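(* Let $g$ be a Riemannian metric on a surface that is $C^2$ near a point $x$, with Gaussian curvature $K$. Then, as $r\downarrow0$: (Perimeter gauge) $$L_g\big(\partial B_g(x,r)\big)=2\pi r\Big(1-\tfrac{K(x)}{6}r^2+o(r^2)\Big),$$ and with $r_{c,\mathrm{per}}:=L_g(\partial B_g(x,r))/(2\pi)$, $$\delta r_{\mathrm{per}}:=r-r_{c,\mathrm{per}}=\tfrac{K(x)}{6}r^3+o(r^3).$$ (Area gauge) $$\operatorname{Area}_g\big(B_g(x,r)\big)=\pi r^2\Big(1-\tfrac{K(x)}{12}r^2+o(r^2)\Big),$$ and with $r_{c,\mathrm{area}}:=\sqrt{\operatorname{Area}_g(B_g(x,r))/\pi}$, $$\delta r_{\mathrm{area}}:=r-r_{c,\mathrm{area}}=\tfrac{K(x)}{24}r^3+o(r^3).$$ In a conformal chart in which $g=e^{2u}g_0$ with $g_0$ the Euclidean metric, these become $$\delta r_{\mathrm{per}}=-\tfrac{e^{-2u(x)}}{6}\,\Delta u(x)\,r^3+o(r^3),\qquad \delta r_{\mathrm{area}}=-\tfrac{e^{-2u(x)}}{24}\,\Delta u(x)\,r^3+o(r^3).$$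
   Context: $B_g(x,r)$ is the geodesic ball (disk) of radius $r$ about $x$, $L_g$ is $g$-length, $\operatorname{Area}_g$ is $g$-area, and $\Delta$ is the Euclidean Laplacian in the conformal chart. *)

theory Defs
  imports "HOL-Analysis.Analysis"
begin

section \<open>Calculus in coordinates\<close>

text \<open>The \<open>i\<close>-th partial derivative; it is only used on (Frechet) differentiable functions.\<close>

definition partial :: "2 \<Rightarrow> (real^2 \<Rightarrow> 'b::real_normed_vector) \<Rightarrow> real^2 \<Rightarrow> 'b" where
  "partial i f q = frechet_derivative f (at q) (axis i 1)"

text \<open>Class \<open>C\<^sup>k\<close>, meant for open \<open>W\<close>.\<close>

primrec Ck_on :: "nat \<Rightarrow> (real^2 \<Rightarrow> 'b::real_normed_vector) \<Rightarrow> (real^2) set \<Rightarrow> bool" where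
  "Ck_on 0 f W \<longleftrightarrow> continuous_on W f"
| "Ck_on (Suc k) f W \<longleftrightarrow>
     (\<forall>q\<in>W. f differentiable (at q)) \<and> (\<forall>i. Ck_on k (partial i f) W)"

definition laplacian :: "(real^2 \<Rightarrow> real) \<Rightarrow> real^2 \<Rightarrow> real" where
  "laplacian u q = (\<Sum>i\<in>UNIV. partial i (partial i u) q)"


section \<open>Smooth surfaces\<close>

type_synonym 'a chart = "'a set \<times> ('a \<Rightarrow> real^2)"

abbreviation dom_of :: "'a chart \<Rightarrow> 'a set" where "dom_of c \<equiv> fst c"
abbreviation coord :: "'a chart \<Rightarrow> 'a \<Rightarrow> real^2" where "coord c \<equiv> snd c"
abbreviation param :: "'a chart \<Rightarrow> real^2 \<Rightarrow> 'a" where "param c \<equiv> inv_into (fst c) (snd c)"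

definition is_chart :: "'a::topological_space chart \<Rightarrow> bool" where
  "is_chart c \<longleftrightarrow> open (dom_of c) \<and> open (coord c ` dom_of c) \<and>
     homeomorphism (dom_of c) (coord c ` dom_of c) (coord c) (param c)"

text \<open>The surface is the union of the chart domains. It need not be connected, nor the whole type,
  and the atlas need not be maximal.\<close>

definition carrier :: "'a chart set \<Rightarrow> 'a set" where
  "carrier A = (\<Union>c\<in>A. dom_of c)"

definition smooth_surface :: "'a::{t2_space, second_countable_topology} chart set \<Rightarrow> bool" where
  "smooth_surface A \<longleftrightarrow> (\<forall>c\<in>A. is_chart c) \<and>
     (\<forall>c\<in>A. \<forall>d\<in>A. \<forall>k. Ck_on k (coord d \<circ> param c) (coord c ` (dom_of c \<inter> dom_of d)))"


section \<open>Riemannian metrics\<close>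

text \<open>A metric is given by its matrices of components: \<open>G c p\<close> is the Gram matrix at the point
  \<open>p\<close> of the surface of the coordinate frame of the chart \<open>c\<close>. Values for \<open>p\<close> outside the domain
  of \<open>c\<close> are irrelevant.\<close>

type_synonym 'a metric = "'a chart \<Rightarrow> 'a \<Rightarrow> real^2^2"

definition transition_jacobian :: "'a chart \<Rightarrow> 'a chart \<Rightarrow> 'a \<Rightarrow> real^2^2" where
  "transition_jacobian c d p = matrix (frechet_derivative (coord d \<circ> param c) (at (coord c p)))"

definition riemannian_metric :: "'a::topological_space chart set \<Rightarrow> 'a metric \<Rightarrow> bool" where
  "riemannian_metric A G \<longleftrightarrow>
     (\<forall>c\<in>A. continuous_on (dom_of c) (G c) \<and>
        (\<forall>p\<in>dom_of c. transpose (G c p) = G c p \<and> (\<forall>v. v \<noteq> 0 \<longrightarrow> v \<bullet> (G c p *v v) > 0))) \<and>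
     (\<forall>c\<in>A. \<forall>d\<in>A. \<forall>p\<in>dom_of c \<inter> dom_of d.
        G c p = transpose (transition_jacobian c d p) ** G d p ** transition_jacobian c d p)"

definition C2_near :: "'a::topological_space chart set \<Rightarrow> 'a metric \<Rightarrow> 'a \<Rightarrow> bool" where
  "C2_near A G x \<longleftrightarrow> (\<exists>V. open V \<and> x \<in> V \<and>
     (\<forall>c\<in>A. Ck_on 2 (G c \<circ> param c) (coord c ` (dom_of c \<inter> V))))"


section \<open>Gaussian curvature\<close>

text \<open>For a metric with components \<open>h\<close> on an open subset of the plane:
  \<open>christoffel h k i j\<close> is \<open>\<Gamma>\<^sup>k\<^sub>i\<^sub>j\<close>, and \<open>riemann h l i j k\<close> is the \<open>l\<close>-th component of
  \<open>R(\<partial>\<^sub>i, \<partial>\<^sub>j)\<partial>\<^sub>k = \<nabla>\<^sub>i\<nabla>\<^sub>j\<partial>\<^sub>k - \<nabla>\<^sub>j\<nabla>\<^sub>i\<partial>\<^sub>k\<close>. The curvature is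
  \<open>\<langle>R(\<partial>\<^sub>1, \<partial>\<^sub>2)\<partial>\<^sub>2, \<partial>\<^sub>1\<rangle> / det h\<close>, so that round spheres have positive curvature.\<close>

definition christoffel :: "(real^2 \<Rightarrow> real^2^2) \<Rightarrow> 2 \<Rightarrow> 2 \<Rightarrow> 2 \<Rightarrow> real^2 \<Rightarrow> real" where
  "christoffel h k i j q = (\<Sum>l\<in>UNIV. matrix_inv (h q) $ k $ l *
     (partial i (\<lambda>q. h q $ j $ l) q + partial j (\<lambda>q. h q $ i $ l) q
      - partial l (\<lambda>q. h q $ i $ j) q)) / 2"

definition riemann :: "(real^2 \<Rightarrow> real^2^2) \<Rightarrow> 2 \<Rightarrow> 2 \<Rightarrow> 2 \<Rightarrow> 2 \<Rightarrow> real^2 \<Rightarrow> real" where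
  "riemann h l i j k q =
     partial i (christoffel h l j k) q - partial j (christoffel h l i k) q
     + (\<Sum>m\<in>UNIV. christoffel h m j k q * christoffel h l i m q
                  - christoffel h m i k q * christoffel h l j m q)"

definition coord_curvature :: "(real^2 \<Rightarrow> real^2^2) \<Rightarrow> real^2 \<Rightarrow> real" where
  "coord_curvature h q = (\<Sum>l\<in>UNIV. h q $ 1 $ l * riemann h l 1 2 2 q) / det (h q)"

text \<open>The curvature at \<open>x\<close> does not depend on the chart \<open>c\<close> around \<open>x\<close> in which it is computed.\<close>

definition gauss_curvature :: "'a metric \<Rightarrow> 'a chart \<Rightarrow> 'a \<Rightarrow> real" where
  "gauss_curvature G c x = coord_curvature (G c \<circ> param c) (coord c x)"


section \<open>Length, distance and balls\<close>

text \<open>Piecewise \<open>C\<^sup>1\<close> paths in the surface, parametrised by \<open>[0, 1]\<close>.\<close>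

definition pw_C1_path :: "'a::topological_space chart set \<Rightarrow> (real \<Rightarrow> 'a) \<Rightarrow> bool" where
  "pw_C1_path A \<gamma> \<longleftrightarrow> path \<gamma> \<and> path_image \<gamma> \<subseteq> carrier A \<and>
     (\<forall>c\<in>A. \<forall>a b. 0 \<le> a \<and> a < b \<and> b \<le> 1 \<and> \<gamma> ` {a..b} \<subseteq> dom_of c \<longrightarrow>
        (coord c \<circ> \<gamma>) piecewise_C1_differentiable_on {a..b})"

text \<open>The \<open>g\<close>-norm of the velocity does not depend on the choice of the chart: this is the
  transformation law in \<open>riemannian_metric\<close>.\<close>

definition speed :: "'a::topological_space chart set \<Rightarrow> 'a metric \<Rightarrow> (real \<Rightarrow> 'a) \<Rightarrow> real \<Rightarrow> real" where
  "speed A G \<gamma> t =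
     (let c = (SOME c. c \<in> A \<and> \<gamma> t \<in> dom_of c);
          v = vector_derivative (coord c \<circ> \<gamma>) (at t)
      in sqrt (v \<bullet> (G c (\<gamma> t) *v v)))"

definition path_length :: "'a::topological_space chart set \<Rightarrow> 'a metric \<Rightarrow> (real \<Rightarrow> 'a) \<Rightarrow> ennreal" where
  "path_length A G \<gamma> = (\<integral>\<^sup>+t\<in>{0..1}. ennreal (speed A G \<gamma> t) \<partial>lborel)"

text \<open>The distance is infinite between points in different components.\<close>

definition geodesic_dist :: "'a::topological_space chart set \<Rightarrow> 'a metric \<Rightarrow> 'a \<Rightarrow> 'a \<Rightarrow> ennreal" where
  "geodesic_dist A G x y =
     (INF \<gamma>\<in>{\<gamma>. pw_C1_path A \<gamma> \<and> pathstart \<gamma> = x \<and> pathfinish \<gamma> = y}. path_length A G \<gamma>)"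

definition geodesic_ball :: "'a::topological_space chart set \<Rightarrow> 'a metric \<Rightarrow> 'a \<Rightarrow> real \<Rightarrow> 'a set" where
  "geodesic_ball A G x r = {y \<in> carrier A. geodesic_dist A G x y < ennreal r}"

text \<open>The topological boundary of the ball within the surface (which is open in the ambient type).\<close>

definition geodesic_sphere :: "'a::topological_space chart set \<Rightarrow> 'a metric \<Rightarrow> 'a \<Rightarrow> real \<Rightarrow> 'a set" where
  "geodesic_sphere A G x r = carrier A \<inter> frontier (geodesic_ball A G x r)"

text \<open>The length of a set that is a simple closed curve is the common length of its piecewise
  \<open>C\<^sup>1\<close> parametrisations that are injective up to the endpoints.\<close>

definition closed_curve_length :: "'a::topological_space chart set \<Rightarrow> 'a metric \<Rightarrow> 'a set \<Rightarrow> ennreal" where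
  "closed_curve_length A G C =
     (THE l. \<exists>\<gamma>. pw_C1_path A \<gamma> \<and> simple_path \<gamma> \<and> pathfinish \<gamma> = pathstart \<gamma> \<and>
                  path_image \<gamma> = C \<and> path_length A G \<gamma> = l)"

definition perimeter :: "'a::topological_space chart set \<Rightarrow> 'a metric \<Rightarrow> 'a \<Rightarrow> real \<Rightarrow> real" where
  "perimeter A G x r = enn2real (closed_curve_length A G (geodesic_sphere A G x r))"


section \<open>Area\<close>

text \<open>The area of a Borel set inside the domain of a single chart.\<close>

definition chart_area :: "'a metric \<Rightarrow> 'a chart \<Rightarrow> 'a set \<Rightarrow> ennreal" where
  "chart_area G c E = (\<integral>\<^sup>+q\<in>coord c ` E. ennreal (sqrt (det (G c (param c q)))) \<partial>lborel)"

text \<open>The Riemannian measure of a Borel set: cut it into finitely many disjoint Borel pieces, each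
  inside a chart; the supremum takes care of sets that only countably many charts can exhaust.\<close>

definition area :: "'a::topological_space chart set \<Rightarrow> 'a metric \<Rightarrow> 'a set \<Rightarrow> ennreal" where
  "area A G B =
     (SUP P\<in>{P. finite P \<and> disjoint_family_on snd P \<and>
               (\<forall>(c, E)\<in>P. c \<in> A \<and> E \<in> sets borel \<and> E \<subseteq> B \<inter> dom_of c)}.
        \<Sum>(c, E)\<in>P. chart_area G c E)"

definition ball_area :: "'a::topological_space chart set \<Rightarrow> 'a metric \<Rightarrow> 'a \<Rightarrow> real \<Rightarrow> real" where
  "ball_area A G x r = enn2real (area A G (geodesic_ball A G x r))"


section \<open>Gauge radii\<close>

definition radius_per :: "'a::topological_space chart set \<Rightarrow> 'a metric \<Rightarrow> 'a \<Rightarrow> real \<Rightarrow> real" where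
  "radius_per A G x r = perimeter A G x r / (2 * pi)"

definition radius_area :: "'a::topological_space chart set \<Rightarrow> 'a metric \<Rightarrow> 'a \<Rightarrow> real \<Rightarrow> real" where
  "radius_area A G x r = sqrt (ball_area A G x r / pi)"

definition delta_per :: "'a::topological_space chart set \<Rightarrow> 'a metric \<Rightarrow> 'a \<Rightarrow> real \<Rightarrow> real" where
  "delta_per A G x r = r - radius_per A G x r"

definition delta_area :: "'a::topological_space chart set \<Rightarrow> 'a metric \<Rightarrow> 'a \<Rightarrow> real \<Rightarrow> real" where
  "delta_area A G x r = r - radius_area A G x r"

text \<open>In the chart \<open>d\<close> the metric is \<open>e\<^sup>2\<^sup>u\<close> times the Euclidean one; \<open>u\<close> is a function of the
  coordinates.\<close>

definition conformal_chart :: "'a metric \<Rightarrow> 'a chart \<Rightarrow> (real^2 \<Rightarrow> real) \<Rightarrow> bool" where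
  "conformal_chart G d u \<longleftrightarrow> (\<forall>p\<in>dom_of d. G d p = mat (exp (2 * u (coord d p))))"

end

theory Submission
  imports Defs "HOL-Analysis.Analysis" "HOL-Library.Landau_Symbols"
begin

text \<open>After a cubic change of coordinates the metric near \<open>x\<close> is \<open>\<bar>v\<bar>\<^sup>2 - K/3 (z \<times> v)\<^sup>2\<close> up to an error
  \<open>o(\<bar>z\<bar>\<^sup>2) \<bar>v\<bar>\<^sup>2\<close>, and it is only \<open>C\<^sup>1\<^sup>,\<^sup>1\<close>, so geodesics are avoided altogether. The squared distance \<open>F\<close> from \<open>x\<close> is the
  infimum of the energies of paths. Energy is almost midpoint convex along families of paths with the same
  parametrisation, hence so is \<open>F\<close>; translating the paths linearly bounds the second differences of \<open>F\<close> from
  above. So \<open>F\<close> is \<open>C\<^sup>1\<^sup>,\<^sup>1\<close>. Comparison with rays gives \<open>F(z) = \<bar>z\<bar>\<^sup>2 + o(\<bar>z\<bar>\<^sup>4)\<close>, and convexity turns this into an estimate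
  for the gradient. The geodesic circles are therefore \<open>C\<^sup>1\<close> polar graphs close to round circles, and length and
  area are read off from the normal form of the metric.\<close>

text \<open>The exponential map of a C^2 metric is only C^1, so in geodesic polar coordinates the
  metric may lose the derivatives from which the expansion is read off; a polynomial change of
  coordinates loses none. Energy is quadratic in the velocity. For two paths from the origin with
  half-difference \<open>d\<close>, averaging gains the integral of |d'|^2, whereas the variation of
  the metric costs at most \<open>M * (4 * r1\<^sup>2 + 8 * r1)\<close> times the square of the
  integral of |d'|, because \<open>d\<close> starts at 0. A small \<open>r1\<close> lets the gain
  absorb the cost, and \<open>F\<close> is midpoint convex with no error left. Curvature is
  invisible in \<open>F\<close> up to fourth order: along rays z \<times> v = 0, and on other paths
  it weighs only the tangential velocity. It enters through the tangential speed of the level curve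
  and through the determinant. The squared speed of the curve of polar radius R(\<theta>) is R'^2 +
  R^2 - K/3 R^4 up to o(r^4), so R^2 = r^2 + o(r^4) and R' = o(r^2) are exactly what the perimeter
  requires; a bound on \<open>F\<close> alone would not control R', and convexity does.\<close>

section \<open>Bilinear forms of 2x2 matrices, and integrals with finitely many exceptional
  points\<close>

definition qf :: "real^2^2 \<Rightarrow> real^2 \<Rightarrow> real^2 \<Rightarrow> real" where
  "qf m v w = v \<bullet> (m *v w)"

lemma qf_eq: "qf m v w = m$1$1 * v$1 * w$1 + m$1$2 * v$1 * w$2 + m$2$1 * v$2 * w$1 + m$2$2 * v$2 * w$2"
  by (simp add: qf_def inner_vec_def sum_2 matrix_vector_mult_def algebra_simps)

lemma qf_simps:
  "qf m (u + v) w = qf m u w + qf m v w" "qf m w (u + v) = qf m w u + qf m w v"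
  "qf m (u - v) w = qf m u w - qf m v w" "qf m w (u - v) = qf m w u - qf m w v"
  "qf m (c *\<^sub>R v) w = c * qf m v w" "qf m v (c *\<^sub>R w) = c * qf m v w"
  by (simp_all add: qf_eq algebra_simps)

lemma qf_0 [simp]: "qf m 0 w = 0" "qf m v 0 = 0"
  by (simp_all add: qf_eq)

lemma continuous_on_qf [continuous_intros]:
  assumes "continuous_on S m" "continuous_on S v" "continuous_on S w"
  shows "continuous_on S (\<lambda>t. qf (m t) (v t) (w t))"
  unfolding qf_eq by (intro continuous_intros assms)

text \<open>Velocities are continuous and bounded only off a finite set of corners. On the Borel set
  that remains a continuous function is measurable, and the removed points are negligible.\<close>

lemma integrable_bounded_cont:
  fixes f :: "real \<Rightarrow> 'b::euclidean_space"
  assumes "finite S" "continuous_on ({a..b} - S) f" "\<And>t. t \<in> {a..b} - S \<Longrightarrow> norm (f t) \<le> B"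
  shows "f integrable_on {a..b}"
proof -
  have m: "{a..b} - S \<in> sets borel" using assms(1) by (intro sets.Diff) (auto simp: finite_imp_closed)
  then have m': "{a..b} - S \<in> sets lebesgue" by simp
  have "f integrable_on ({a..b} - S)"
  proof (rule measurable_bounded_by_integrable_imp_integrable[OF _ _ _ m'])
    show "f \<in> borel_measurable (lebesgue_on ({a..b} - S))"
      by (rule continuous_imp_measurable_on_sets_lebesgue[OF assms(2) m'])
    have "{a..b} - S \<in> lmeasurable"
      using m' by (meson bounded_closed_interval bounded_diff bounded_set_imp_lmeasurable)
    then show "(\<lambda>_. B) integrable_on ({a..b} - S)"
      by (intro integrable_on_const) 
  qed (use assms(3) in auto)
  then show ?thesis
    by (rule integrable_spike_set) (use assms(1) in \<open>auto intro!: negligible_subset[OF negligible_finite]\<close>)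
qed

text \<open>At the corners the velocity is arbitrary and the inequality may fail; replacing
  \<open>g\<close> by \<open>f\<close> there changes no integral.\<close>

lemma integral_le_finite:
  fixes f :: "real \<Rightarrow> real"
  assumes "finite S" "f integrable_on {a..b}" "g integrable_on {a..b}"
    and "\<And>t. t \<in> {a..b} - S \<Longrightarrow> f t \<le> g t"
  shows "integral {a..b} f \<le> integral {a..b} g"
proof -
  define g' where "g' = (\<lambda>t. if t \<in> S then f t else g t)"
  have "(g' has_integral integral {a..b} g) {a..b}"
    by (rule has_integral_spike_finite[OF assms(1) _ integrable_integral[OF assms(3)]]) (auto simp: g'_def)
  then show ?thesis
    by (rule has_integral_le[OF integrable_integral[OF assms(2)]]) (use assms(4) in \<open>auto simp: g'_def\<close>)
qed

text \<open>Cauchy-Schwarz on an interval of length 1, in the form that the variance, the integral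
  of (f - I)^2 with I the mean of \<open>f\<close>, is nonnegative.\<close>

lemma integral_sq_ge:
  fixes f :: "real \<Rightarrow> real"
  assumes "f integrable_on {0..1}" "(\<lambda>t. (f t)\<^sup>2) integrable_on {0..1}"
  shows "(integral {0..1} f)\<^sup>2 \<le> integral {0..1} (\<lambda>t. (f t)\<^sup>2)"
proof -
  define I where "I = integral {0..1} f"
  have "0 \<le> integral {0..1} (\<lambda>t. (f t)\<^sup>2 - 2 * I * f t + I\<^sup>2)"
  proof (rule integral_nonneg)
    show "(\<lambda>t. (f t)\<^sup>2 - 2 * I * f t + I\<^sup>2) integrable_on {0..1}"
      using assms by (intro integrable_add integrable_diff integrable_on_cmult_left[of f "{0..1}" "2*I", simplified]) auto
    show "0 \<le> (f x)\<^sup>2 - 2 * I * f x + I\<^sup>2" for x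
      using zero_le_power2[of "f x - I"] by (simp add: power2_diff algebra_simps)
  qed
  moreover have "((\<lambda>t. (f t)\<^sup>2 - 2 * I * f t + I\<^sup>2) has_integral (integral {0..1} (\<lambda>t. (f t)\<^sup>2) - 2 * I * I + I\<^sup>2)) {0..1}"
    using has_integral_const_real[of "I\<^sup>2" 0 1] assms
    by (intro has_integral_add has_integral_diff has_integral_mult_right) (auto simp: I_def)
  then have "integral {0..1} (\<lambda>t. (f t)\<^sup>2 - 2 * I * f t + I\<^sup>2) = integral {0..1} (\<lambda>t. (f t)\<^sup>2) - 2 * I * I + I\<^sup>2"
    by (rule integral_unique)
  ultimately show ?thesis by (simp add: I_def power2_eq_square)
qed

section \<open>Paths from the origin with bounded velocity\<close>

text \<open>The velocity is carried along as a separate function, arbitrary at the points of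
  \<open>S\<close>, so that linear combinations of paths are again such pairs. The bound
  \<open>B\<close> is what makes energies integrable.\<close>

definition adm :: "real set \<Rightarrow> (real \<Rightarrow> real^2) \<Rightarrow> (real \<Rightarrow> real^2) \<Rightarrow> real \<Rightarrow> bool" where
  "adm S p w B \<longleftrightarrow> finite S \<and> continuous_on {0..1} p \<and> p 0 = 0 \<and> continuous_on ({0..1} - S) w \<and>
     (\<forall>t\<in>{0..1} - S. (p has_vector_derivative w t) (at t) \<and> norm (w t) \<le> B)"

lemma adm_integral:
  assumes "adm S p w B" "0 \<le> t" "t \<le> 1"
  shows "(w has_integral p t) {0..t}"
proof -
  have "(w has_integral (p t - p 0)) {0..t}"
    by (rule fundamental_theorem_of_calculus_interior_strong[where S=S])
       (use assms in \<open>auto simp: adm_def intro: continuous_on_subset\<close>)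
  then show ?thesis using assms by (simp add: adm_def)
qed

lemma adm_norm_integrable:
  assumes "adm S p w B"
  shows "(\<lambda>t. norm (w t)) integrable_on {0..1}"
  using assms by (intro integrable_bounded_cont[where S=S and B=B] continuous_intros) (auto simp: adm_def)

text \<open>Applied to the half-difference of two paths, this bounds its size by the very quantity
  whose square is gained when energies are averaged.\<close>

lemma adm_bound_integral:
  assumes "adm S p w B" "0 \<le> t" "t \<le> 1"
  shows "norm (p t) \<le> integral {0..1} (\<lambda>t. norm (w t))"
proof -
  have i: "(\<lambda>t. norm (w t)) integrable_on {0..t}"
    by (rule integrable_on_subinterval[OF adm_norm_integrable[OF assms(1)]]) (use assms in auto)
  have "norm (p t) = norm (integral {0..t} w)" using adm_integral[OF assms] by (simp add: integral_unique)
  also have "\<dots> \<le> integral {0..t} (\<lambda>t. norm (w t))"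
    by (rule integral_norm_bound_integral) (use adm_integral[OF assms] i in auto)
  also have "\<dots> \<le> integral {0..1} (\<lambda>t. norm (w t))"
    by (rule integral_subset_le) (use assms adm_norm_integrable[OF assms(1)] i in auto)
  finally show ?thesis .
qed

lemma adm_bound:
  assumes "adm S p w B" "0 \<le> t" "t \<le> 1" "0 \<le> B"
  shows "norm (p t) \<le> B * t"
proof -
  have 1: "(w has_integral p t) {0..t}" by (rule adm_integral[OF assms(1-3)])
  define w' where "w' = (\<lambda>s. if s \<in> S then 0 else w s)"
  have "(w' has_integral p t) {0..t}"
    by (rule has_integral_spike_finite[OF _ _ 1, of S]) (use assms in \<open>auto simp: adm_def w'_def\<close>)
  then have "norm (p t) \<le> B * measure lborel {0..t}"
    using has_integral_bound_real[of B "{}" w' "p t" 0 t] assms by (auto simp: adm_def w'_def)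
  then show ?thesis using assms by simp
qed

lemma adm_comb:
  assumes "adm S p w B" "adm T q v C"
  shows "adm (S \<union> T) (\<lambda>t. a *\<^sub>R p t + b *\<^sub>R q t) (\<lambda>t. a *\<^sub>R w t + b *\<^sub>R v t) (\<bar>a\<bar> * B + \<bar>b\<bar> * C)"
proof -
  have "norm (a *\<^sub>R w t + b *\<^sub>R v t) \<le> \<bar>a\<bar> * B + \<bar>b\<bar> * C" if "t \<in> {0..1} - (S \<union> T)" for t
  proof -
    have "norm (a *\<^sub>R w t + b *\<^sub>R v t) \<le> \<bar>a\<bar> * norm (w t) + \<bar>b\<bar> * norm (v t)"
      by (metis norm_triangle_ineq norm_scaleR)
    also have "\<dots> \<le> \<bar>a\<bar> * B + \<bar>b\<bar> * C"
      using assms that by (intro add_mono mult_left_mono) (auto simp: adm_def)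
    finally show ?thesis .
  qed
  then show ?thesis using assms
    unfolding adm_def
    by (auto intro!: continuous_intros has_vector_derivative_add bounded_linear.has_vector_derivative[OF bounded_linear_scaleR_right]
             intro: continuous_on_subset)
qed

lemma adm_line: "adm {} (\<lambda>t. t *\<^sub>R k) (\<lambda>t. k) (norm k)"
  unfolding adm_def by (auto intro!: continuous_intros derivative_eq_intros)

section \<open>Metrics on a disc, and second differences of the energy density\<close>

definition cross2 :: "real^2 \<Rightarrow> real^2 \<Rightarrow> real" where
  "cross2 q v = q$1 * v$2 - q$2 * v$1"

lemma inner_cross2: "(q \<bullet> v)\<^sup>2 + (cross2 q v)\<^sup>2 = (norm q)\<^sup>2 * (norm v)\<^sup>2"
  unfolding power2_norm_eq_inner by (simp add: inner_vec_def sum_2 cross2_def power2_eq_square algebra_simps)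

text \<open>Uniform ellipticity together with C^{1,1} bounds in difference form: \<open>lip\<close>
  controls first differences of the metric and \<open>sd\<close> second differences, both by the
  same constant \<open>M\<close>.\<close>

locale metric_disc =
  fixes h :: "real^2 \<Rightarrow> real^2^2" and r0 M :: real
  assumes r0: "0 < r0" and M: "0 \<le> M"
    and sym: "q \<in> ball 0 r0 \<Longrightarrow> qf (h q) v w = qf (h q) w v"
    and cont: "continuous_on (ball 0 r0) h"
    and lower: "q \<in> ball 0 r0 \<Longrightarrow> (norm v)\<^sup>2 / 2 \<le> qf (h q) v v"
    and upper: "q \<in> ball 0 r0 \<Longrightarrow> qf (h q) v v \<le> 2 * (norm v)\<^sup>2"
    and lip: "q \<in> ball 0 r0 \<Longrightarrow> q' \<in> ball 0 r0 \<Longrightarrow>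
       \<bar>qf (h q) v w - qf (h q') v w\<bar> \<le> M * norm (q - q') * norm v * norm w"
    and sd: "q \<in> ball 0 r0 \<Longrightarrow> q + p \<in> ball 0 r0 \<Longrightarrow> q - p \<in> ball 0 r0 \<Longrightarrow>
       \<bar>qf (h (q + p)) v v + qf (h (q - p)) v v - 2 * qf (h q) v v\<bar> \<le> M * (norm p)\<^sup>2 * (norm v)\<^sup>2"
begin

definition energy :: "(real \<Rightarrow> real^2) \<Rightarrow> (real \<Rightarrow> real^2) \<Rightarrow> real" where
  "energy p w = integral {0..1} (\<lambda>t. qf (h (p t)) (w t) (w t))"

lemma energy_integrable:
  assumes "adm S p w B" "p ` {0..1} \<subseteq> ball 0 r0"
  shows "(\<lambda>t. qf (h (p t)) (w t) (w t)) integrable_on {0..1}"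
proof (rule integrable_bounded_cont[where S=S and B="2 * B\<^sup>2"])
  have c: "continuous_on ({0..1} - S) p" "continuous_on ({0..1} - S) w"
    using assms(1) by (auto simp: adm_def intro: continuous_on_subset)
  have "continuous_on ({0..1} - S) (\<lambda>t. h (p t))"
    by (rule continuous_on_compose2[OF cont c(1)]) (use assms(2) in auto)
  then show "continuous_on ({0..1} - S) (\<lambda>t. qf (h (p t)) (w t) (w t))"
    by (intro continuous_intros c)
  fix t assume t: "t \<in> {0..1} - S"
  then have p: "p t \<in> ball 0 r0" using assms(2) by blast
  have "(norm (w t))\<^sup>2 \<le> B\<^sup>2" using assms(1) t by (auto simp: adm_def intro!: power_mono)
  then show "norm (qf (h (p t)) (w t) (w t)) \<le> 2 * B\<^sup>2"
    using upper[OF p, of "w t"] lower[OF p, of "w t"] zero_le_power2[of "norm (w t)"] by simp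
qed (use assms in \<open>auto simp: adm_def\<close>)

text \<open>Here \<open>p\<close> is a displacement and \<open>w\<close> its velocity. After
  expansion the part quadratic in \<open>v\<close> is a second difference of the metric, the mixed
  part sees a first difference over the distance 2|p|, and the part quadratic in \<open>w\<close> is
  at least |w|^2 by ellipticity; this last term is the convexity gain.\<close>

lemma second_diff_lower:
  assumes "q \<in> ball 0 r0" "q + p \<in> ball 0 r0" "q - p \<in> ball 0 r0" "norm v \<le> \<beta>"
  shows "qf (h (q + p)) (v + w) (v + w) + qf (h (q - p)) (v - w) (v - w)
     \<ge> 2 * qf (h q) v v + (norm w)\<^sup>2 - M * \<beta>\<^sup>2 * (norm p)\<^sup>2 - 4 * M * \<beta> * norm p * norm w"
proof -
  have b: "0 \<le> \<beta>" using assms(4) norm_ge_zero order_trans by blast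
  have "qf (h (q + p)) (v + w) (v + w) + qf (h (q - p)) (v - w) (v - w) =
     (qf (h (q + p)) v v + qf (h (q - p)) v v) + 2 * (qf (h (q + p)) v w - qf (h (q - p)) v w)
     + (qf (h (q + p)) w w + qf (h (q - p)) w w)"
    using sym[OF assms(2), of v w] sym[OF assms(3), of v w] by (simp add: qf_simps)
  moreover have "qf (h (q + p)) v v + qf (h (q - p)) v v \<ge> 2 * qf (h q) v v - M * \<beta>\<^sup>2 * (norm p)\<^sup>2"
  proof -
    have "M * (norm p)\<^sup>2 * (norm v)\<^sup>2 \<le> M * (norm p)\<^sup>2 * \<beta>\<^sup>2"
      using assms(4) M by (intro mult_left_mono power_mono) auto
    then show ?thesis using sd[OF assms(1-3), of v] by (simp add: algebra_simps abs_le_iff)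
  qed
  moreover have "\<bar>qf (h (q + p)) v w - qf (h (q - p)) v w\<bar> \<le> 2 * M * \<beta> * norm p * norm w"
  proof -
    have "\<bar>qf (h (q + p)) v w - qf (h (q - p)) v w\<bar> \<le> M * norm (q + p - (q - p)) * norm v * norm w"
      by (rule lip[OF assms(2,3)])
    also have "q + p - (q - p) = 2 *\<^sub>R p" by (simp add: scaleR_2)
    also have "norm (2 *\<^sub>R p) = 2 * norm p" by simp
    also have "M * (2 * norm p) * norm v * norm w \<le> M * (2 * norm p) * \<beta> * norm w"
      using assms(4) M by (intro mult_right_mono mult_left_mono) auto
    finally show ?thesis by (simp add: algebra_simps)
  qed
  moreover have "qf (h (q + p)) w w + qf (h (q - p)) w w \<ge> (norm w)\<^sup>2"
    using lower[OF assms(2), of w] lower[OF assms(3), of w] by simp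
  ultimately show ?thesis unfolding abs_le_iff by argo
qed

text \<open>The same expansion read from above; ellipticity now lets the part quadratic in
  \<open>w\<close> cost up to 4|w|^2.\<close>

lemma second_diff_upper:
  assumes "q \<in> ball 0 r0" "q + p \<in> ball 0 r0" "q - p \<in> ball 0 r0" "norm v \<le> \<beta>"
  shows "qf (h (q + p)) (v + w) (v + w) + qf (h (q - p)) (v - w) (v - w)
     \<le> 2 * qf (h q) v v + 4 * (norm w)\<^sup>2 + M * \<beta>\<^sup>2 * (norm p)\<^sup>2 + 4 * M * \<beta> * norm p * norm w"
proof -
  have b: "0 \<le> \<beta>" using assms(4) norm_ge_zero order_trans by blast
  have "qf (h (q + p)) (v + w) (v + w) + qf (h (q - p)) (v - w) (v - w) =
     (qf (h (q + p)) v v + qf (h (q - p)) v v) + 2 * (qf (h (q + p)) v w - qf (h (q - p)) v w)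
     + (qf (h (q + p)) w w + qf (h (q - p)) w w)"
    using sym[OF assms(2), of v w] sym[OF assms(3), of v w] by (simp add: qf_simps)
  moreover have "qf (h (q + p)) v v + qf (h (q - p)) v v \<le> 2 * qf (h q) v v + M * \<beta>\<^sup>2 * (norm p)\<^sup>2"
  proof -
    have "M * (norm p)\<^sup>2 * (norm v)\<^sup>2 \<le> M * (norm p)\<^sup>2 * \<beta>\<^sup>2"
      using assms(4) M by (intro mult_left_mono power_mono) auto
    then show ?thesis using sd[OF assms(1-3), of v] by (simp add: algebra_simps abs_le_iff)
  qed
  moreover have "\<bar>qf (h (q + p)) v w - qf (h (q - p)) v w\<bar> \<le> 2 * M * \<beta> * norm p * norm w"
  proof -
    have "\<bar>qf (h (q + p)) v w - qf (h (q - p)) v w\<bar> \<le> M * norm (q + p - (q - p)) * norm v * norm w"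
      by (rule lip[OF assms(2,3)])
    also have "q + p - (q - p) = 2 *\<^sub>R p" by (simp add: scaleR_2)
    also have "norm (2 *\<^sub>R p) = 2 * norm p" by simp
    also have "M * (2 * norm p) * norm v * norm w \<le> M * (2 * norm p) * \<beta> * norm w"
      using assms(4) M by (intro mult_right_mono mult_left_mono) auto
    finally show ?thesis by (simp add: algebra_simps)
  qed
  moreover have "qf (h (q + p)) w w + qf (h (q - p)) w w \<le> 4 * (norm w)\<^sup>2"
    using upper[OF assms(2), of w] upper[OF assms(3), of w] by simp
  ultimately show ?thesis unfolding abs_le_iff by argo
qed

end

section \<open>The squared distance: midpoint convexity and semiconcavity\<close>

text \<open>The second-order expansion of a metric in normal coordinates with curvature
  \<open>K\<close> at the origin, required for the quadratic form only.\<close>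

locale metric_normal = metric_disc +
  fixes K :: real
  assumes normal: "\<And>\<epsilon>. 0 < \<epsilon> \<Longrightarrow> \<exists>\<delta>>0. \<forall>q v. norm q < \<delta> \<longrightarrow>
     \<bar>qf (h q) v v - ((norm v)\<^sup>2 - K / 3 * (cross2 q v)\<^sup>2)\<bar> \<le> \<epsilon> * (norm q)\<^sup>2 * (norm v)\<^sup>2"

text \<open>An axiomatic squared distance: it lies below the energy of every path in the disc and is
  almost attained by paths whose squared speed is bounded at every instant, not just on average. The
  instantaneous bound is what confines such paths to a small disc. The condition on \<open>M\<close>
  and \<open>r1\<close> is consumed in \<open>F_midpoint\<close>.\<close>

locale dist_sq = metric_normal +
  fixes F :: "real^2 \<Rightarrow> real" and r1 :: real
  assumes r1: "0 < r1" "4 * r1 \<le> r0" "M * (4 * r1\<^sup>2 + 8 * r1) \<le> 1"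
    and F_nonneg: "0 \<le> F z"
    and F_le: "adm S p w B \<Longrightarrow> p ` {0..1} \<subseteq> ball 0 r0 \<Longrightarrow> norm (p 1) < r1 \<Longrightarrow> F (p 1) \<le> energy p w"
    and F_approx: "norm z < r1 \<Longrightarrow> 0 < \<epsilon> \<Longrightarrow> \<exists>S p w B. adm S p w B \<and> p ` {0..1} \<subseteq> ball 0 r0 \<and> p 1 = z \<and>
        (\<forall>t\<in>{0..1} - S. qf (h (p t)) (w t) (w t) \<le> F z + \<epsilon>)"
begin

lemma F_upper: 
  assumes "norm z < r1"
  shows "F z \<le> 2 * (norm z)\<^sup>2"
proof -
  have im: "(\<lambda>t. t *\<^sub>R z) ` {0..1} \<subseteq> ball 0 r0"
  proof safe
    fix t :: real assume "t \<in> {0..1}"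
    then have "norm (t *\<^sub>R z) \<le> norm z" by (simp add: mult_left_le_one_le)
    then show "t *\<^sub>R z \<in> ball 0 r0" using assms r1 by simp
  qed
  have "F (1 *\<^sub>R z) \<le> energy (\<lambda>t. t *\<^sub>R z) (\<lambda>t. z)"
    by (rule F_le[OF adm_line im]) (use assms in auto)
  also have "\<dots> \<le> integral {0..1} (\<lambda>t::real. 2 * (norm z)\<^sup>2)"
    unfolding energy_def
    by (rule integral_le[OF energy_integrable[OF adm_line im]]) (use im upper in blast)+
  finally show ?thesis by simp
qed

lemma F_0: "F 0 = 0"
  using F_upper[of 0] F_nonneg[of 0] r1 by simp

text \<open>Sharpens \<open>F_approx\<close>. If the squared speed is at most 2 r1^2, ellipticity
  bounds the velocity by 2 r1, so a path starting at 0 cannot leave the disc of radius 2 r1. This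
  velocity bound does not depend on \<open>z\<close> and fixes the constants of the next two
  lemmas.\<close>

lemma near_min:
  assumes z: "norm z < r1" and "0 < \<epsilon>"
  obtains S p w where "adm S p w (2 * r1)" "p ` {0..1} \<subseteq> cball 0 (2 * r1)" "p 1 = z"
    "energy p w \<le> F z + \<epsilon>" "\<forall>t\<in>{0..1} - S. qf (h (p t)) (w t) (w t) \<le> F z + \<epsilon>"
    "\<forall>t\<in>{0..1} - S. (norm (w t))\<^sup>2 \<le> 2 * (F z + \<epsilon>)"
proof -
  \<comment> \<open>By \<open>F_upper\<close>, F z is at most 2|z|^2; the second entry keeps F z + e
    below 2 r1^2.\<close>
  define e where "e = min \<epsilon> (2 * r1\<^sup>2 - 2 * (norm z)\<^sup>2)"
  have "(norm z)\<^sup>2 < r1\<^sup>2" using z by (intro power_strict_mono) auto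
  then have e: "0 < e" "e \<le> \<epsilon>" "F z + e \<le> 2 * r1\<^sup>2" using F_upper[OF z] assms by (auto simp: e_def)
  obtain S p w B where p: "adm S p w B" "p ` {0..1} \<subseteq> ball 0 r0" "p 1 = z"
      "\<forall>t\<in>{0..1} - S. qf (h (p t)) (w t) (w t) \<le> F z + e"
    using F_approx[OF z e(1)] by blast
  have w: "(norm (w t))\<^sup>2 \<le> 2 * (F z + e)" if "t \<in> {0..1} - S" for t
  proof -
    have "p t \<in> ball 0 r0" using p(2) that by blast
    then have "(norm (w t))\<^sup>2 / 2 \<le> qf (h (p t)) (w t) (w t)" by (rule lower)
    also have "\<dots> \<le> F z + e" using p(4) that by blast
    finally show ?thesis by simp
  qed
  have w2: "norm (w t) \<le> 2 * r1" if "t \<in> {0..1} - S" for t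
  proof -
    have "(norm (w t))\<^sup>2 \<le> (2 * r1)\<^sup>2" using w[OF that] e(3) by (simp add: power_mult_distrib)
    then show ?thesis by (rule power2_le_imp_le) (use r1 in simp)
  qed
  have a: "adm S p w (2 * r1)" using p(1) w2 by (auto simp: adm_def)
  have "p ` {0..1} \<subseteq> cball 0 (2 * r1)"
  proof safe
    fix t :: real assume "t \<in> {0..1}"
    then have "norm (p t) \<le> 2 * r1 * t" using adm_bound[OF a] r1 by auto
    also have "\<dots> \<le> 2 * r1 * 1" using r1 \<open>t \<in> {0..1}\<close> by (intro mult_left_mono) auto
    finally show "p t \<in> cball 0 (2 * r1)" by simp
  qed
  moreover have "energy p w \<le> F z + e"
  proof -
    have "energy p w \<le> integral {0..1} (\<lambda>t::real. F z + e)" unfolding energy_def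
      by (rule integral_le_finite[OF _ energy_integrable[OF a p(2)]]) (use a p(4) in \<open>auto simp: adm_def\<close>)
    then show ?thesis by simp
  qed
  moreover have "\<forall>t\<in>{0..1} - S. qf (h (p t)) (w t) (w t) \<le> F z + \<epsilon>"
  proof
    fix t assume "t \<in> {0..1} - S"
    from bspec[OF p(4) this] e(2) show "qf (h (p t)) (w t) (w t) \<le> F z + \<epsilon>" by linarith
  qed
  moreover have "\<forall>t\<in>{0..1} - S. (norm (w t))\<^sup>2 \<le> 2 * (F z + \<epsilon>)"
  proof
    fix t assume "t \<in> {0..1} - S"
    from w[OF this] show "(norm (w t))\<^sup>2 \<le> 2 * (F z + \<epsilon>)" by (rule order_trans) (use e(2) in simp)
  qed
  ultimately show ?thesis by (intro that[OF a _ p(3)]) (use e(2) in linarith)+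
qed


text \<open>The average of two near-minimisers is a path to \<open>z\<close>, so its energy bounds
  \<open>F z\<close>. By \<open>second_diff_lower\<close> twice that energy is at most the sum of
  the two energies, minus the integral of |dw|^2, plus metric errors. Since \<open>d\<close> starts
  at 0, the errors are controlled by the square of I, the integral of |dw|, and I^2 is at most the
  integral of |dw|^2.\<close>

lemma F_midpoint:
  assumes z: "norm (z + k) < r1" "norm (z - k) < r1"
  shows "2 * F z \<le> F (z + k) + F (z - k)"
proof (rule field_le_epsilon)
  fix e :: real assume "0 < e"
  then have e: "0 < e / 2" by simp
  obtain S p w where p: "adm S p w (2 * r1)" "p ` {0..1} \<subseteq> cball 0 (2 * r1)" "p 1 = z + k"
      "energy p w \<le> F (z + k) + e / 2" by (rule near_min[OF z(1) e])
  obtain T q v where q: "adm T q v (2 * r1)" "q ` {0..1} \<subseteq> cball 0 (2 * r1)" "q 1 = z - k"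
      "energy q v \<le> F (z - k) + e / 2" by (rule near_min[OF z(2) e])
  define m where "m = (\<lambda>t. (1/2) *\<^sub>R p t + (1/2) *\<^sub>R q t)"
  define mw where "mw = (\<lambda>t. (1/2) *\<^sub>R w t + (1/2) *\<^sub>R v t)"
  define d where "d = (\<lambda>t. (1/2) *\<^sub>R p t + (-1/2) *\<^sub>R q t)"
  define dw where "dw = (\<lambda>t. (1/2) *\<^sub>R w t + (-1/2) *\<^sub>R v t)"
  have am: "adm (S \<union> T) m mw (2 * r1)" 
    using adm_comb[OF p(1) q(1), of "1/2" "1/2"] by (simp add: m_def mw_def)
  have ad: "adm (S \<union> T) d dw (2 * r1)" 
    using adm_comb[OF p(1) q(1), of "1/2" "-1/2"] by (simp add: d_def dw_def)
  have half: "(1/2) *\<^sub>R a + (1/2) *\<^sub>R a = a" for a :: "real^2"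
    by (metis field_sum_of_halves scaleR_add_left scaleR_one)
  have eqs: "p t = m t + d t" "q t = m t - d t" "w t = mw t + dw t" "v t = mw t - dw t" for t
    unfolding m_def d_def mw_def dw_def by (simp_all add: half)
  have mb: "m ` {0..1} \<subseteq> cball 0 (2 * r1)"
  proof safe
    fix t :: real assume t: "t \<in> {0..1}"
    have "norm (m t) \<le> 2 * r1 * t" using adm_bound[OF am] r1 t by auto
    also have "\<dots> \<le> 2 * r1 * 1" using r1 t by (intro mult_left_mono) auto
    finally show "m t \<in> cball 0 (2 * r1)" by simp
  qed
  have sub: "cball 0 (2 * r1) \<subseteq> (ball 0 r0 :: (real^2) set)" using r1 by auto
  have m1: "m 1 = z" unfolding m_def p(3) q(3) by (simp add: algebra_simps half)
  have zr: "norm (m 1) < r1"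
  proof -
    have "norm z = norm ((1/2) *\<^sub>R (z + k) + (1/2) *\<^sub>R (z - k))" by (simp add: algebra_simps half)
    also have "\<dots> \<le> (1/2) * norm (z + k) + (1/2) * norm (z - k)"
      by (rule order_trans[OF norm_triangle_ineq]) simp
    finally show ?thesis using z m1 by simp
  qed
  define I where "I = integral {0..1} (\<lambda>t. norm (dw t))"
  have dint: "(\<lambda>t. norm (dw t)) integrable_on {0..1}" by (rule adm_norm_integrable[OF ad])
  have dint2: "(\<lambda>t. (norm (dw t))\<^sup>2) integrable_on {0..1}"
  proof (rule integrable_bounded_cont[where S="S \<union> T" and B="(2 * r1)\<^sup>2"])
    fix t assume "t \<in> {0..1} - (S \<union> T)"
    then have "norm (dw t) \<le> 2 * r1" using ad by (auto simp: adm_def)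
    then have "(norm (dw t))\<^sup>2 \<le> (2 * r1)\<^sup>2" by (rule power_mono) simp
    then show "norm ((norm (dw t))\<^sup>2) \<le> (2 * r1)\<^sup>2" by simp
  qed (use ad in \<open>auto simp: adm_def intro!: continuous_intros\<close>)
  have I0: "0 \<le> I" unfolding I_def by (rule integral_nonneg[OF dint]) simp
  have db: "norm (d t) \<le> I" if "t \<in> {0..1}" for t
    unfolding I_def by (rule adm_bound_integral[OF ad]) (use that in auto)
  have pi: "(\<lambda>t. qf (h (p t)) (w t) (w t)) integrable_on {0..1}"
    by (rule energy_integrable[OF p(1)]) (use p(2) sub in blast)
  have qi: "(\<lambda>t. qf (h (q t)) (v t) (v t)) integrable_on {0..1}"
    by (rule energy_integrable[OF q(1)]) (use q(2) sub in blast)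
  have mi: "(\<lambda>t. qf (h (m t)) (mw t) (mw t)) integrable_on {0..1}"
    by (rule energy_integrable[OF am]) (use mb sub in blast)
  let ?R = "\<lambda>t. 2 * qf (h (m t)) (mw t) (mw t) + (norm (dw t))\<^sup>2 - M * (2 * r1)\<^sup>2 * I\<^sup>2 - 4 * M * (2 * r1) * I * norm (dw t)"
  have cst: "((\<lambda>t::real. C) has_integral C) {0..1}" for C :: real
    using has_integral_const_real[of C 0 1] by simp
  have Rint: "(?R has_integral (2 * energy m mw + integral {0..1} (\<lambda>t. (norm (dw t))\<^sup>2) - M * (2 * r1)\<^sup>2 * I\<^sup>2 - 4 * M * (2 * r1) * I * I)) {0..1}"
    using integrable_integral[OF mi] integrable_integral[OF dint] integrable_integral[OF dint2]
    by (intro has_integral_add has_integral_diff has_integral_mult_right cst) (simp_all only: I_def energy_def)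
  have "integral {0..1} ?R \<le> integral {0..1} (\<lambda>t. qf (h (p t)) (w t) (w t) + qf (h (q t)) (v t) (v t))"
  proof (rule integral_le_finite[where S="S \<union> T"])
    show "(\<lambda>t. qf (h (p t)) (w t) (w t) + qf (h (q t)) (v t) (v t)) integrable_on {0..1}"
      by (rule integrable_add[OF pi qi])
    show "?R integrable_on {0..1}" using Rint by blast
    fix t assume t: "t \<in> {0..1} - (S \<union> T)"
    have b: "m t \<in> ball 0 r0" "m t + d t \<in> ball 0 r0" "m t - d t \<in> ball 0 r0"
      using mb p(2) q(2) sub t unfolding eqs[symmetric] by blast+
    have nv: "norm (mw t) \<le> 2 * r1" using am t by (auto simp: adm_def)
    have "M * (2 * r1)\<^sup>2 * (norm (d t))\<^sup>2 \<le> M * (2 * r1)\<^sup>2 * I\<^sup>2"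
      using db[of t] t M by (intro mult_left_mono power_mono) auto
    moreover have "4 * M * (2 * r1) * norm (d t) * norm (dw t) \<le> 4 * M * (2 * r1) * I * norm (dw t)"
      using db[of t] t M r1 by (intro mult_left_mono mult_right_mono) auto
    moreover note second_diff_lower[OF b nv, of "dw t"]
    ultimately show "?R t \<le> qf (h (p t)) (w t) (w t) + qf (h (q t)) (v t) (v t)"
      unfolding eqs by linarith
  qed (use am in \<open>auto simp: adm_def\<close>)
  also have "\<dots> = energy p w + energy q v" unfolding energy_def by (rule integral_add[OF pi qi])
  finally have A: "2 * energy m mw + integral {0..1} (\<lambda>t. (norm (dw t))\<^sup>2) - M * (2 * r1)\<^sup>2 * I\<^sup>2 - 4 * M * (2 * r1) * I * I
     \<le> energy p w + energy q v" using Rint by (simp add: integral_unique)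
  have B: "I\<^sup>2 \<le> integral {0..1} (\<lambda>t. (norm (dw t))\<^sup>2)"
    unfolding I_def by (rule integral_sq_ge[OF dint dint2])
  \<comment> \<open>The smallness of \<open>r1\<close> is spent here: with velocities bounded by 2
    r1 the two error terms add up to M (4 r1^2 + 8 r1) I^2.\<close>
  have C: "M * (2 * r1)\<^sup>2 * I\<^sup>2 + 4 * M * (2 * r1) * I * I \<le> I\<^sup>2"
  proof -
    have "M * (2 * r1)\<^sup>2 * I\<^sup>2 + 4 * M * (2 * r1) * I * I = (M * (4 * r1\<^sup>2 + 8 * r1)) * I\<^sup>2"
      by (simp add: power2_eq_square algebra_simps)
    also have "\<dots> \<le> 1 * I\<^sup>2" using r1(3) by (rule mult_right_mono) simp
    finally show ?thesis by simp
  qed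
  have "F (m 1) \<le> energy m mw" by (rule F_le[OF am _ zr]) (use mb sub in blast)
  with A B C p(4) q(4) m1 show "2 * F z \<le> F (z + k) + F (z - k) + e" by simp
qed

definition Csc :: real where "Csc = 4 + M * (2 * r1)\<^sup>2 + 4 * M * (2 * r1)"

lemma Csc: "4 \<le> Csc" using M r1 by (simp add: Csc_def)

text \<open>Shift a near-minimiser for \<open>z\<close> by t k and by -t k. The shifted paths still
  start at 0, they end at z + k and z - k, and their velocities change by the constants k and -k.
  \<open>second_diff_upper\<close> with the velocity bound 2 r1 and displacement at most |k| yields
  \<open>Csc\<close>.\<close>

lemma F_semiconcave:
  assumes z: "norm z < r1" "norm (z + k) < r1" "norm (z - k) < r1"
  shows "F (z + k) + F (z - k) \<le> 2 * F z + Csc * (norm k)\<^sup>2"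
proof (rule field_le_epsilon)
  fix e :: real assume "0 < e"
  then have e: "0 < e / 2" by simp
  obtain S p w where p: "adm S p w (2 * r1)" "p ` {0..1} \<subseteq> cball 0 (2 * r1)" "p 1 = z"
      "energy p w \<le> F z + e / 2" by (rule near_min[OF z(1) e])
  \<comment> \<open>Keeps the shifted paths within 3 r1 of the origin, inside the disc.\<close>
  have kr: "norm k < r1"
  proof -
    have "2 *\<^sub>R k = (z + k) - (z - k)" by (simp add: scaleR_2)
    then have "2 * norm k = norm ((z + k) - (z - k))" by (metis norm_scaleR abs_numeral)
    also have "\<dots> \<le> norm (z + k) + norm (z - k)" by (rule norm_triangle_ineq4)
    finally show ?thesis using z by simp
  qed
  define p1 where "p1 = (\<lambda>t. p t + t *\<^sub>R k)"
  define p2 where "p2 = (\<lambda>t. p t - t *\<^sub>R k)"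
  have a1: "adm S p1 (\<lambda>t. w t + k) (2 * r1 + norm k)"
    using adm_comb[OF p(1) adm_line[of k], of 1 1] by (simp add: p1_def)
  have a2: "adm S p2 (\<lambda>t. w t - k) (2 * r1 + norm k)"
    using adm_comb[OF p(1) adm_line[of k], of 1 "-1"] by (simp add: p2_def)
  have tk: "norm (t *\<^sub>R k) \<le> norm k" if "t \<in> {0..1}" for t
    using that by (simp add: mult_left_le_one_le)
  have im: "p t \<in> ball 0 r0" "p t + t *\<^sub>R k \<in> ball 0 r0" "p t - t *\<^sub>R k \<in> ball 0 r0" if "t \<in> {0..1}" for t
  proof -
    have "norm (p t) \<le> 2 * r1" using p(2) that by (auto simp: subset_iff)
    with tk[OF that] norm_triangle_ineq[of "p t" "t *\<^sub>R k"] norm_triangle_ineq4[of "p t" "t *\<^sub>R k"] kr r1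
    show "p t \<in> ball 0 r0" "p t + t *\<^sub>R k \<in> ball 0 r0" "p t - t *\<^sub>R k \<in> ball 0 r0" by auto
  qed
  have im1: "p1 ` {0..1} \<subseteq> ball 0 r0" and im2: "p2 ` {0..1} \<subseteq> ball 0 r0" and im0: "p ` {0..1} \<subseteq> ball 0 r0"
    unfolding p1_def p2_def using im by blast+
  have "energy p1 (\<lambda>t. w t + k) + energy p2 (\<lambda>t. w t - k)
     = integral {0..1} (\<lambda>t. qf (h (p1 t)) (w t + k) (w t + k) + qf (h (p2 t)) (w t - k) (w t - k))"
    unfolding energy_def
    by (rule integral_add[symmetric]) (rule energy_integrable[OF a1 im1] energy_integrable[OF a2 im2])+
  also have "\<dots> \<le> integral {0..1} (\<lambda>t. 2 * qf (h (p t)) (w t) (w t) + Csc * (norm k)\<^sup>2)"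
  proof (rule integral_le_finite[where S=S])
    show "(\<lambda>t. qf (h (p1 t)) (w t + k) (w t + k) + qf (h (p2 t)) (w t - k) (w t - k)) integrable_on {0..1}"
      by (intro integrable_add energy_integrable[OF a1 im1] energy_integrable[OF a2 im2])
    show "(\<lambda>t. 2 * qf (h (p t)) (w t) (w t) + Csc * (norm k)\<^sup>2) integrable_on {0..1}"
      using energy_integrable[OF p(1) im0] by (intro integrable_add integrable_on_mult_right) auto
    fix t assume t: "t \<in> {0..1} - S"
    have nv: "norm (w t) \<le> 2 * r1" using p(1) t by (auto simp: adm_def)
    have t': "norm (t *\<^sub>R k) \<le> norm k" using tk t by blast
    have "M * (2 * r1)\<^sup>2 * (norm (t *\<^sub>R k))\<^sup>2 \<le> M * (2 * r1)\<^sup>2 * (norm k)\<^sup>2"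
      using t' M by (intro mult_left_mono power_mono) auto
    moreover have "4 * M * (2 * r1) * norm (t *\<^sub>R k) * norm k \<le> 4 * M * (2 * r1) * norm k * norm k"
      using t' M r1 by (intro mult_left_mono mult_right_mono) auto
    moreover have "2 * qf (h (p t)) (w t) (w t) + Csc * (norm k)\<^sup>2 = 2 * qf (h (p t)) (w t) (w t) + 4 * (norm k)\<^sup>2
        + M * (2 * r1)\<^sup>2 * (norm k)\<^sup>2 + 4 * M * (2 * r1) * norm k * norm k"
      by (simp add: Csc_def power2_eq_square algebra_simps)
    moreover have "t \<in> {0..1}" using t by simp
    note second_diff_upper[OF im[OF this] nv, of k]
    ultimately show "qf (h (p1 t)) (w t + k) (w t + k) + qf (h (p2 t)) (w t - k) (w t - k) \<le> 2 * qf (h (p t)) (w t) (w t) + Csc * (norm k)\<^sup>2"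
      unfolding p1_def p2_def by linarith
  qed (use p in \<open>auto simp: adm_def\<close>)
  also have "\<dots> = 2 * energy p w + Csc * (norm k)\<^sup>2"
    using has_integral_add[OF has_integral_mult_right[OF integrable_integral[OF energy_integrable[OF p(1) im0]], of 2]
      has_integral_const_real[of "Csc * (norm k)\<^sup>2" 0 1]]
    by (simp add: energy_def integral_unique)
  finally have "energy p1 (\<lambda>t. w t + k) + energy p2 (\<lambda>t. w t - k) \<le> 2 * energy p w + Csc * (norm k)\<^sup>2" .
  moreover have "F (p1 1) \<le> energy p1 (\<lambda>t. w t + k)" "F (p2 1) \<le> energy p2 (\<lambda>t. w t - k)"
    by (rule F_le[OF a1 im1] F_le[OF a2 im2]; use z p(3) in \<open>simp add: p1_def p2_def\<close>)+
  moreover have "p1 1 = z + k" "p2 1 = z - k" using p(3) by (simp_all add: p1_def p2_def)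
  ultimately show "F (z + k) + F (z - k) \<le> 2 * F z + Csc * (norm k)\<^sup>2 + e" using p(4) by simp
qed

end

section \<open>Fourth-order comparison with |z|^2, and the gradient of the squared distance\<close>

lemma nondecreasing_finite:
  fixes f :: "real \<Rightarrow> real"
  assumes "finite S" "a \<le> b" "continuous_on {a..b} f"
    and "\<And>t. t \<in> {a..b} - S \<Longrightarrow> (f has_vector_derivative f' t) (at t)"
    and "\<And>t. t \<in> {a..b} - S \<Longrightarrow> 0 \<le> f' t"
  shows "f a \<le> f b"
proof -
  have i: "(f' has_integral (f b - f a)) {a..b}"
    by (rule fundamental_theorem_of_calculus_strong[OF assms(1,2,4,3)])
  have "integral {a..b} (\<lambda>t. 0::real) \<le> integral {a..b} f'"
    by (rule integral_le_finite[OF assms(1)]) (use i assms(5) in auto)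
  then show ?thesis using i by (simp add: integral_unique)
qed

lemma DERIV_sqrt_add:
  fixes f :: "real \<Rightarrow> real"
  assumes "(f has_real_derivative 2 * d) (at t)" "0 < f t + c"
  shows "((\<lambda>t. sqrt (f t + c)) has_real_derivative d / sqrt (f t + c)) (at t)"
proof -
  have "((\<lambda>t. f t + c) has_real_derivative 2 * d + 0) (at t)"
    by (rule DERIV_add[OF assms(1) DERIV_const])
  from DERIV_chain2[where f=sqrt and g="\<lambda>t. f t + c" and x=t, OF DERIV_real_sqrt[OF assms(2)] this]
  have "((\<lambda>t. sqrt (f t + c)) has_real_derivative inverse (sqrt (f t + c)) / 2 * (2 * d + 0)) (at t)" .
  then show ?thesis by (rule DERIV_cong) (use assms(2) in \<open>simp add: field_simps\<close>)
qed

text \<open>Subtracting x f(1) leaves an additive function that vanishes at 1/m, hence has period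
  1/m. Being bounded on one period it is bounded on the whole line, and multiples n x of a point
  where it did not vanish would contradict this.\<close>

lemma additive_bounded_imp_linear:
  fixes f :: "real \<Rightarrow> real"
  assumes add: "\<And>x y. f (x + y) = f x + f y"
    and "0 < d" and bd: "\<And>x. 0 \<le> x \<Longrightarrow> x \<le> d \<Longrightarrow> \<bar>f x\<bar> \<le> C"
  shows "f x = x * f 1"
proof -
  define g where "g = (\<lambda>x. f x - x * f 1)"
  have ga: "g (x + y) = g x + g y" for x y by (simp add: g_def add algebra_simps)
  have g0: "g 0 = 0" using ga[of 0 0] by simp
  have gn: "g (real n * x) = real n * g x" for n x
    by (induction n) (simp_all add: g0 ga algebra_simps)
  have gm: "g (- x) = - g x" for x using ga[of x "-x"] g0 by simp
  have gi: "g (of_int n * x) = of_int n * g x" for n x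
    by (cases n rule: int_cases2) (use gn[of _ x] gm in simp_all)
  obtain m :: nat where m: "0 < m" "1 / real m < d"
    using reals_Archimedean[OF assms(2)] by (metis inverse_eq_divide zero_less_Suc)
  have "real m * g (1 / real m) = 0" using gn[of m "1 / real m"] m by (simp add: g_def)
  then have g1: "g (1 / real m) = 0" using m by simp
  have bound: "\<bar>g x\<bar> \<le> C + d * \<bar>f 1\<bar>" for x
  proof -
    define n where "n = \<lfloor>x * m\<rfloor>"
    define y where "y = x - of_int n * (1 / m)"
    have "real_of_int n \<le> x * m" "x * m < real_of_int n + 1" unfolding n_def by linarith+
    moreover have "y = (x * m - of_int n) / m" using m by (simp add: y_def field_simps)
    ultimately have y: "0 \<le> y" "y \<le> 1 / m" using m by (simp_all add: divide_right_mono)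
    have "g x = g (of_int n * (1 / m) + y)" by (simp add: y_def)
    also have "\<dots> = g y" by (simp only: ga gi g1)
    finally have "\<bar>g x\<bar> \<le> \<bar>f y\<bar> + \<bar>y * f 1\<bar>" by (simp add: g_def)
    also have "\<bar>f y\<bar> \<le> C" using y m by (intro bd) auto
    also have "\<bar>y * f 1\<bar> \<le> d * \<bar>f 1\<bar>" using y m by (auto simp: abs_mult intro!: mult_right_mono)
    finally show ?thesis by simp
  qed
  have "g x = 0"
  proof (rule ccontr)
    assume "g x \<noteq> 0"
    then obtain n :: nat where "C + d * \<bar>f 1\<bar> < n * \<bar>g x\<bar>"
      using ex_less_of_nat_mult[of "\<bar>g x\<bar>"] by auto
    also have "\<dots> = \<bar>g (real n * x)\<bar>" by (simp add: gn abs_mult)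
    finally show False using bound[of "real n * x"] by simp
  qed
  then show ?thesis by (simp add: g_def)
qed

context dist_sq
begin

text \<open>Upper bound: the cross product, and with it the curvature term, vanishes along the ray.
  Lower bound: curvature affects only the tangential part of the velocity, whose coefficient stays
  nonnegative near 0; so the radial speed of a near-minimiser is at most \<open>s\<close>, and
  reaching \<open>z\<close> in unit time forces |z| \<le> s.\<close>

lemma F_sandwich:
  assumes "0 < \<epsilon>"
  shows "\<exists>\<delta>>0. \<delta> \<le> r1 \<and> (\<forall>z. norm z < \<delta> \<longrightarrow> \<bar>F z - (norm z)\<^sup>2\<bar> \<le> \<epsilon> * (norm z) ^ 4)"
proof -
  \<comment> \<open>Near-minimisers will satisfy |p| \<le> 3|z|, so errors in |p|^2 cost a factor
    9.\<close>
  define \<eta> where "\<eta> = \<epsilon> / 9"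
  have \<eta>: "0 < \<eta>" using assms by (simp add: \<eta>_def)
  obtain d0 where d0: "0 < d0" "\<And>q v. norm q < d0 \<Longrightarrow>
     \<bar>qf (h q) v v - ((norm v)\<^sup>2 - K / 3 * (cross2 q v)\<^sup>2)\<bar> \<le> \<eta> * (norm q)\<^sup>2 * (norm v)\<^sup>2"
    using normal[OF \<eta>] by blast
  \<comment> \<open>For |p| < d1 the coefficient \<open>1 - \<eta> * ?n - K / 3 * ?n\<close> of the
    tangential part, computed below, is nonnegative.\<close>
  define d1 where "d1 = min d0 (1 / sqrt (\<eta> + \<bar>K\<bar> / 3))"
  have "0 < \<eta> + \<bar>K\<bar> / 3" using \<eta> by (simp add: add_pos_nonneg)
  then have d1: "0 < d1" "d1 \<le> d0" using d0 by (auto simp: d1_def)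
  have d1': "x\<^sup>2 * (\<eta> + \<bar>K\<bar> / 3) \<le> 1" if "\<bar>x\<bar> < d1" for x
  proof -
    have "\<bar>x\<bar> * sqrt (\<eta> + \<bar>K\<bar> / 3) \<le> 1"
      using that \<open>0 < \<eta> + \<bar>K\<bar> / 3\<close> by (auto simp: d1_def field_simps)
    then have "(\<bar>x\<bar> * sqrt (\<eta> + \<bar>K\<bar> / 3))\<^sup>2 \<le> 1" 
      using \<open>0 < \<eta> + \<bar>K\<bar> / 3\<close> by (simp add: power_le_one)
    then show ?thesis using \<open>0 < \<eta> + \<bar>K\<bar> / 3\<close> by (simp add: power_mult_distrib)
  qed
  define \<delta> where "\<delta> = min r1 (d1 / 3)"
  have \<delta>: "0 < \<delta>" "\<delta> \<le> r1" "3 * \<delta> \<le> d1" using r1 d1 by (auto simp: \<delta>_def)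
  have up: "F z \<le> (norm z)\<^sup>2 + \<epsilon> * (norm z) ^ 4" if z: "norm z < \<delta>" for z
  proof -
    have le: "norm (t *\<^sub>R z) \<le> norm z" if "t \<in> {0..1}" for t using that by (simp add: mult_left_le_one_le)
    have im: "(\<lambda>t. t *\<^sub>R z) ` {0..1} \<subseteq> ball 0 r0" using le z \<delta> r1 by (auto simp: image_subset_iff) fastforce
    have "F (1 *\<^sub>R z) \<le> energy (\<lambda>t. t *\<^sub>R z) (\<lambda>t. z)"
      by (rule F_le[OF adm_line im]) (use z \<delta> in auto)
    also have "\<dots> \<le> integral {0..1} (\<lambda>t::real. (norm z)\<^sup>2 + \<eta> * (norm z) ^ 4)"
      unfolding energy_def
    proof (rule integral_le[OF energy_integrable[OF adm_line im]])
      fix t :: real assume t: "t \<in> {0..1}"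
      have "norm (t *\<^sub>R z) < d0" using le[OF t] z \<delta> d1 by linarith
      from d0(2)[OF this, of z] have "qf (h (t *\<^sub>R z)) z z \<le> (norm z)\<^sup>2 + \<eta> * (norm (t *\<^sub>R z))\<^sup>2 * (norm z)\<^sup>2"
        by (simp add: cross2_def abs_le_iff)
      also have "\<eta> * (norm (t *\<^sub>R z))\<^sup>2 * (norm z)\<^sup>2 \<le> \<eta> * (norm z)\<^sup>2 * (norm z)\<^sup>2"
        using le[OF t] \<eta> by (intro mult_right_mono mult_left_mono power_mono) auto
      finally show "qf (h (t *\<^sub>R z)) z z \<le> (norm z)\<^sup>2 + \<eta> * (norm z) ^ 4"
        by (simp add: power4_eq_xxxx power2_eq_square mult.assoc)
    qed auto
    also have "\<dots> \<le> (norm z)\<^sup>2 + \<epsilon> * (norm z) ^ 4" using assms by (simp add: \<eta>_def)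
    finally show ?thesis by simp
  qed
  have low: "(norm z)\<^sup>2 - \<epsilon> * (norm z) ^ 4 \<le> F z" if z: "norm z < \<delta>" for z
  proof (cases "z = 0")
    case True then show ?thesis by (simp add: F_0)
  next
    case False
    \<comment> \<open>A lower bound for the coefficient 1 - \<eta> |p|^2 of the radial part, given
      |p| \<le> 3|z|.\<close>
    define c where "c = 1 - 9 * \<eta> * (norm z)\<^sup>2"
    have c: "0 < c"
    proof -
      have "(3 * norm z)\<^sup>2 * \<eta> < d1\<^sup>2 * (\<eta> + \<bar>K\<bar> / 3)"
        using z \<delta> d1 \<eta> by (intro mult_less_le_imp_less power_strict_mono) auto
      also have "\<dots> \<le> 1"
        using \<open>0 < \<eta> + \<bar>K\<bar> / 3\<close> d1 
          power_mono[of d1 "1 / sqrt (\<eta> + \<bar>K\<bar> / 3)" 2] by (simp add: d1_def power_divide field_simps)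
      finally show ?thesis by (simp add: c_def power_mult_distrib algebra_simps)
    qed
    have "c * (norm z)\<^sup>2 \<le> F z"
    proof (rule field_le_epsilon)
      fix e0 :: real assume "0 < e0"
      \<comment> \<open>With F z \<le> 2|z|^2 this cap gives |w|^2 \<le> 5|z|^2, within the bound
        3|z| for the velocity.\<close>
      define e where "e = min e0 ((norm z)\<^sup>2 / 2)"
      have e: "0 < e" "e \<le> e0" "e \<le> (norm z)\<^sup>2 / 2" using \<open>0 < e0\<close> False by (auto simp: e_def)
      have zr: "norm z < r1" using z \<delta> by linarith
      obtain S p w where p: "adm S p w (2 * r1)" "p ` {0..1} \<subseteq> cball 0 (2 * r1)" "p 1 = z"
        "energy p w \<le> F z + e" "\<forall>t\<in>{0..1} - S. qf (h (p t)) (w t) (w t) \<le> F z + e"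
        "\<forall>t\<in>{0..1} - S. (norm (w t))\<^sup>2 \<le> 2 * (F z + e)"
        by (rule near_min[OF zr e(1)])
      have w: "norm (w t) \<le> 3 * norm z" if "t \<in> {0..1} - S" for t
      proof -
        have "(norm (w t))\<^sup>2 \<le> 2 * (F z + e)" by (rule bspec[OF p(6) that])
        also have "\<dots> \<le> (3 * norm z)\<^sup>2" using F_upper[of z] z \<delta> e by (simp add: power_mult_distrib)
        finally show ?thesis by (rule power2_le_imp_le) simp
      qed
      have a: "adm S p w (3 * norm z)" using p(1) w by (auto simp: adm_def)
      have pb: "norm (p t) \<le> 3 * norm z" if "t \<in> {0..1}" for t
      proof -
        have "norm (p t) \<le> 3 * norm z * t" using adm_bound[OF a] that by auto
        also have "\<dots> \<le> 3 * norm z * 1" using that by (intro mult_left_mono) auto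
        finally show ?thesis by simp
      qed
      define s where "s = sqrt ((F z + e) / c)"
      have s0: "0 \<le> s" "s\<^sup>2 = (F z + e) / c" using F_nonneg[of z] e c by (auto simp: s_def)
      have key: "p t \<bullet> w t \<le> norm (p t) * s" if t: "t \<in> {0..1} - S" for t
      proof -
        let ?a = "p t \<bullet> w t" and ?b = "cross2 (p t) (w t)" and ?n = "(norm (p t))\<^sup>2"
        have pt: "norm (p t) \<le> 3 * norm z" using pb t by auto
        then have n3: "norm (p t) < d1" using z \<delta> by linarith
        have n9: "?n \<le> 9 * (norm z)\<^sup>2" using power_mono[OF pt, of 2] by (simp add: power_mult_distrib)
        \<comment> \<open>Lagrange's identity splits |p|^2 |w|^2 into a radial square
          \<open>?a\<close> and a tangential square \<open>?b\<close>; the curvature term contains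
          \<open>?b\<close> alone.\<close>
        have i: "?a\<^sup>2 + ?b\<^sup>2 = ?n * (norm (w t))\<^sup>2" by (rule inner_cross2)
        have "(norm (w t))\<^sup>2 - K / 3 * ?b\<^sup>2 - \<eta> * ?n * (norm (w t))\<^sup>2 \<le> F z + e"
          using d0(2)[of "p t" "w t"] n3 d1 bspec[OF p(5) t] by (simp add: abs_le_iff)
        then have "?n * ((norm (w t))\<^sup>2 - K / 3 * ?b\<^sup>2 - \<eta> * ?n * (norm (w t))\<^sup>2) \<le> ?n * (F z + e)"
          by (intro mult_left_mono) auto
        also have "?n * ((norm (w t))\<^sup>2 - K / 3 * ?b\<^sup>2 - \<eta> * ?n * (norm (w t))\<^sup>2)
           = ?n * (norm (w t))\<^sup>2 - K / 3 * ?n * ?b\<^sup>2 - \<eta> * ?n * (?n * (norm (w t))\<^sup>2)" by (simp add: algebra_simps)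
        also have "\<dots> = ?a\<^sup>2 * (1 - \<eta> * ?n) + ?b\<^sup>2 * (1 - \<eta> * ?n - K / 3 * ?n)" 
          unfolding i[symmetric] by (simp add: algebra_simps)
        finally have A: "?a\<^sup>2 * (1 - \<eta> * ?n) + ?b\<^sup>2 * (1 - \<eta> * ?n - K / 3 * ?n) \<le> ?n * (F z + e)" .
        have "?n * (\<eta> + \<bar>K\<bar> / 3) \<le> 1" using d1'[of "norm (p t)"] n3 by simp
        moreover have "K / 3 * ?n \<le> \<bar>K\<bar> / 3 * ?n" by (intro mult_right_mono) auto
        ultimately have "0 \<le> 1 - \<eta> * ?n - K / 3 * ?n" by (simp add: algebra_simps)
        then have B: "0 \<le> ?b\<^sup>2 * (1 - \<eta> * ?n - K / 3 * ?n)" by simp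
        have "?a\<^sup>2 * c \<le> ?a\<^sup>2 * (1 - \<eta> * ?n)"
          using n9 \<eta> by (intro mult_left_mono) (auto simp: c_def)
        with A B have "?a\<^sup>2 * c \<le> ?n * (F z + e)" by linarith
        then have "?a\<^sup>2 \<le> (norm (p t) * s)\<^sup>2" using c by (simp add: power_mult_distrib s0 field_simps)
        then show ?thesis using s0 by (meson abs_le_square_iff abs_le_D1 abs_of_nonneg mult_nonneg_nonneg norm_ge_zero order_trans power2_le_imp_le)
      qed
      have "norm z \<le> s"
      proof (rule field_le_epsilon)
        fix u :: real assume u: "0 < u"
        \<comment> \<open>A smooth substitute for |p|, which need not be differentiable where the
          path meets the origin; the auxiliary \<open>u\<close> is arbitrarily small.\<close>
        define G where "G = (\<lambda>t. sqrt (p t \<bullet> p t + u\<^sup>2))"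
        have pos: "0 < p t \<bullet> p t + u\<^sup>2" for t using u by (simp add: add_nonneg_pos)
        have "0 * s - G 0 \<le> 1 * s - G 1"
        proof (rule nondecreasing_finite[where S=S and f="\<lambda>t. t * s - G t" and f'="\<lambda>t. s - (p t \<bullet> w t) / G t"])
          show "continuous_on {0..1} (\<lambda>t. t * s - G t)"
            using p(1) unfolding G_def by (intro continuous_intros) (auto simp: adm_def)
          fix t assume t: "t \<in> {0..1} - S"
          then have pd: "(p has_vector_derivative w t) (at t)" using p(1) by (auto simp: adm_def)
          have "((\<lambda>t. p t \<bullet> p t) has_vector_derivative (p t \<bullet> w t + w t \<bullet> p t)) (at t)"
            by (rule bounded_bilinear.has_vector_derivative[OF bounded_bilinear_inner pd pd])
          then have "((\<lambda>t. p t \<bullet> p t) has_real_derivative 2 * (p t \<bullet> w t)) (at t)"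
            by (simp add: has_real_derivative_iff_has_vector_derivative inner_commute)
          from DERIV_sqrt_add[OF this pos]
          have Gd: "(G has_real_derivative (p t \<bullet> w t) / G t) (at t)" unfolding G_def .
          have "((\<lambda>t. t * s) has_real_derivative s) (at t)" by (auto intro!: derivative_eq_intros)
          from DERIV_diff[OF this Gd]
          show "((\<lambda>t. t * s - G t) has_vector_derivative s - (p t \<bullet> w t) / G t) (at t)"
            unfolding has_real_derivative_iff_has_vector_derivative .
          have "norm (p t) \<le> G t" unfolding G_def norm_eq_sqrt_inner by simp
          then have "norm (p t) * s \<le> G t * s" using s0 by (intro mult_right_mono) auto
          with key[OF t] have "p t \<bullet> w t \<le> G t * s" by linarith
          moreover have "0 < G t" using pos[of t] by (simp add: G_def)
          ultimately show "0 \<le> s - (p t \<bullet> w t) / G t" by (simp add: field_simps)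
        qed (use p(1) in \<open>auto simp: adm_def\<close>)
        moreover have "G 0 = u" using p(1) u by (simp add: G_def adm_def)
        moreover have "norm z \<le> G 1" unfolding G_def norm_eq_sqrt_inner p(3) by simp
        ultimately show "norm z \<le> s + u" by simp
      qed
      then have "(norm z)\<^sup>2 \<le> s\<^sup>2" by (intro power_mono) auto
      then show "c * (norm z)\<^sup>2 \<le> F z + e0" using c e unfolding s0 by (simp add: field_simps)
    qed
    then show ?thesis by (simp add: c_def \<eta>_def power4_eq_xxxx power2_eq_square algebra_simps)
  qed
  show ?thesis
    using \<delta> up low by (intro exI[of _ \<delta>]) (force simp: abs_le_iff)
qed

text \<open>Midpoint convexity makes the dyadic difference quotients at \<open>z\<close> decrease,
  so they have a limit D k that is subadditive in k and at most F(z + k) - F z. Semiconcavity gives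
  D k + D (-k) \<le> 0. Together these make D odd and additive, and local boundedness makes it
  linear; its coefficients form the gradient.\<close>

lemma F_gradient:
  assumes z: "norm z < r1 / 2"
  shows "\<exists>g. (\<forall>y. norm y < r1 \<longrightarrow> F z + g \<bullet> (y - z) \<le> F y) \<and>
             (\<forall>k. norm k < r1 / 2 \<longrightarrow> F (z + k) \<le> F z + g \<bullet> k + Csc * (norm k)\<^sup>2)"
proof -
  define a where "a = (\<lambda>(n::nat) (k::real^2). 2^n * (F (z + (1/2^n) *\<^sub>R k) - F z))"
  define D where "D = (\<lambda>k. lim (\<lambda>n. a n k))"
  have sc: "norm ((1/2^n) *\<^sub>R k) \<le> norm k" for n and k :: "real^2"
    by (simp add: divide_le_eq mult_le_cancel_left1)
  have small: "\<forall>\<^sub>F n in sequentially. norm ((1/2^n) *\<^sub>R k) < r1 / 2" for k :: "real^2"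
  proof -
    have "(\<lambda>n. (1/2^n) *\<^sub>R k) \<longlonglongrightarrow> 0 *\<^sub>R k"
      by (intro tendsto_intros) (use LIMSEQ_inverse_realpow_zero[of 2] in \<open>simp add: inverse_eq_divide\<close>)
    then have "(\<lambda>n. (1/2^n) *\<^sub>R k) \<longlonglongrightarrow> 0" by simp
    then have "(\<lambda>n. norm ((1/2^n) *\<^sub>R k)) \<longlonglongrightarrow> 0" by (rule tendsto_norm_zero)
    then show ?thesis by (rule order_tendstoD) (use r1 in auto)
  qed
  have seg: "norm (z + s *\<^sub>R k) < r1" if "norm (z + k) < r1" "0 \<le> s" "s \<le> 1" for s k
  proof -
    have "z + s *\<^sub>R k = (1 - s) *\<^sub>R z + s *\<^sub>R (z + k)" by (simp add: algebra_simps)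
    moreover have "(1 - s) *\<^sub>R z + s *\<^sub>R (z + k) \<in> ball 0 r1"
      by (rule convexD[OF convex_ball]) (use that z r1 in auto)
    ultimately show ?thesis by simp
  qed
  have dec1: "a (Suc n) k \<le> a n k" if "norm (z + (1/2^n) *\<^sub>R k) < r1" for n k
  proof -
    let ?u = "(1/2^Suc n) *\<^sub>R k"
    have u2: "?u + ?u = (1/2^n) *\<^sub>R k" by (simp flip: scaleR_add_left)
    have "2 * F (z + ?u) \<le> F (z + ?u + ?u) + F (z + ?u - ?u)"
    proof (rule F_midpoint)
      show "norm (z + ?u + ?u) < r1" unfolding add.assoc u2 by (rule that)
      show "norm (z + ?u - ?u) < r1" using z r1 by simp
    qed
    then have "2 * F (z + ?u) \<le> F (z + (1/2^n) *\<^sub>R k) + F z" unfolding add.assoc u2 by simp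
    then have "2^n * (2 * F (z + ?u)) \<le> 2^n * (F (z + (1/2^n) *\<^sub>R k) + F z)" by (intro mult_left_mono) auto
    then show ?thesis by (simp add: a_def algebra_simps)
  qed
  have conv: "convergent (\<lambda>n. a n k)" for k
  proof -
    obtain N where N: "\<And>n. N \<le> n \<Longrightarrow> norm ((1/2^n) *\<^sub>R k) < r1 / 2"
      using small[of k] unfolding eventually_sequentially by blast
    have inr: "norm (z + (1/2^n) *\<^sub>R k) < r1" "norm (z - (1/2^n) *\<^sub>R k) < r1" if "N \<le> n" for n
      using N[OF that] z norm_triangle_ineq[of z "(1/2^n) *\<^sub>R k"] norm_triangle_ineq4[of z "(1/2^n) *\<^sub>R k"] by linarith+
    have inr': "norm (z + (1/2^n) *\<^sub>R (- k)) < r1" if "N \<le> n" for n using inr(2)[OF that] by simp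
    have dk: "decseq (\<lambda>n. a (n + N) k)" "decseq (\<lambda>n. a (n + N) (- k))"
      using dec1[OF inr(1)] dec1[OF inr'] by (auto intro!: decseq_SucI)
    \<comment> \<open>By midpoint convexity at \<open>z\<close> a quotient is at least minus the one
      in the opposite direction, and the latter decreases too.\<close>
    have lb: "- a N (- k) \<le> a (n + N) k" for n
    proof -
      have "2 * F z \<le> F (z + (1/2^(n+N)) *\<^sub>R k) + F (z - (1/2^(n+N)) *\<^sub>R k)"
        by (rule F_midpoint; rule inr; simp)
      then have "2^(n+N) * (2 * F z) \<le> 2^(n+N) * (F (z + (1/2^(n+N)) *\<^sub>R k) + F (z - (1/2^(n+N)) *\<^sub>R k))"
        by (intro mult_left_mono) auto
      then have "0 \<le> a (n + N) k + a (n + N) (- k)" by (simp add: a_def algebra_simps)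
      moreover have "a (n + N) (- k) \<le> a (0 + N) (- k)" using dk(2) by (rule decseqD) simp
      ultimately show ?thesis by simp
    qed
    from decseq_convergent[OF dk(1), of "- a N (- k)"] lb obtain L where "(\<lambda>n. a (n + N) k) \<longlonglongrightarrow> L" by blast
    then have "(\<lambda>n. a n k) \<longlonglongrightarrow> L" by (simp add: LIMSEQ_offset)
    then show ?thesis by (rule convergentI)
  qed
  have lim: "(\<lambda>n. a n k) \<longlonglongrightarrow> D k" for k
    using conv[of k] unfolding D_def convergent_LIMSEQ_iff .
  have D_le: "D k \<le> F (z + k) - F z" if k: "norm (z + k) < r1" for k
  proof -
    have "decseq (\<lambda>n. a n k)"
      by (intro decseq_SucI dec1 seg[OF k]) auto
    from decseq_ge[OF this lim, of 0] show ?thesis by (simp add: a_def)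
  qed
  \<comment> \<open>The point z + (k + l)/2^(n+1) is the midpoint of z + k/2^n and z + l/2^n; hence
    the shift in the index.\<close>
  have D_sub: "D (k + l) \<le> D k + D l" for k l
  proof (rule tendsto_le[OF _ tendsto_add[OF lim[of k] lim[of l]] LIMSEQ_Suc[OF lim[of "k + l"]]])
    show "\<forall>\<^sub>F n in sequentially. a (Suc n) (k + l) \<le> a n k + a n l"
      using small[of k] small[of l]
    proof eventually_elim
      case (elim n)
      let ?c = "(1/2^Suc n) :: real"
      have c2: "?c + ?c = 1/2^n" by simp
      have e1: "z + ?c *\<^sub>R (k + l) + ?c *\<^sub>R (k - l) = z + (?c + ?c) *\<^sub>R k"
        by (simp only: scaleR_add_left scaleR_add_right scaleR_diff_right) simp
      have e2: "z + ?c *\<^sub>R (k + l) - ?c *\<^sub>R (k - l) = z + (?c + ?c) *\<^sub>R l"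
        by (simp only: scaleR_add_left scaleR_add_right scaleR_diff_right) simp
      have "2 * F (z + ?c *\<^sub>R (k + l)) \<le> F (z + ?c *\<^sub>R (k + l) + ?c *\<^sub>R (k - l)) + F (z + ?c *\<^sub>R (k + l) - ?c *\<^sub>R (k - l))"
        by (rule F_midpoint; unfold e1 e2 c2)
           (use elim z norm_triangle_ineq[of z "(1/2^n) *\<^sub>R k"] norm_triangle_ineq[of z "(1/2^n) *\<^sub>R l"] in linarith)+
      then have "2 * F (z + ?c *\<^sub>R (k + l)) \<le> F (z + (1/2^n) *\<^sub>R k) + F (z + (1/2^n) *\<^sub>R l)"
        unfolding e1 e2 c2 .
      then have "2^n * (2 * F (z + ?c *\<^sub>R (k + l))) \<le> 2^n * (F (z + (1/2^n) *\<^sub>R k) + F (z + (1/2^n) *\<^sub>R l))"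
        by (intro mult_left_mono) auto
      then show ?case by (simp add: a_def algebra_simps)
    qed
  qed simp
  \<comment> \<open>At scale 2^(-n) semiconcavity bounds the sum of opposite quotients by Csc |k|^2
    / 2^n.\<close>
  have D_opp: "D k + D (- k) \<le> 0" for k
  proof (rule tendsto_le[OF _ _ tendsto_add[OF lim[of k] lim[of "- k"]]])
    have "(\<lambda>n. Csc * (norm k)\<^sup>2 * (1/2^n)) \<longlonglongrightarrow> Csc * (norm k)\<^sup>2 * 0"
      by (intro tendsto_intros) (use LIMSEQ_inverse_realpow_zero[of 2] in \<open>simp add: inverse_eq_divide\<close>)
    then show "(\<lambda>n. Csc * (norm k)\<^sup>2 * (1/2^n)) \<longlonglongrightarrow> 0" by simp
    show "\<forall>\<^sub>F n in sequentially. a n k + a n (- k) \<le> Csc * (norm k)\<^sup>2 * (1/2^n)"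
      using small[of k]
    proof eventually_elim
      case (elim n)
      let ?u = "(1/2^n) *\<^sub>R k"
      have "F (z + ?u) + F (z - ?u) \<le> 2 * F z + Csc * (norm ?u)\<^sup>2"
        by (rule F_semiconcave)
           (use elim z r1 norm_triangle_ineq[of z ?u] norm_triangle_ineq4[of z ?u] in linarith)+
      then have "2^n * (F (z + ?u) + F (z - ?u)) \<le> 2^n * (2 * F z + Csc * (norm ?u)\<^sup>2)"
        by (intro mult_left_mono) auto
      then show ?case by (simp add: a_def algebra_simps power_divide power2_eq_square)
    qed
  qed simp
  have D0: "D 0 = 0"
  proof -
    have "a n 0 = 0" for n by (simp add: a_def)
    then show ?thesis using lim[of 0] by (simp add: LIMSEQ_const_iff)
  qed
  have D_neg: "D (- k) = - D k" for k
    using D_sub[of k "- k"] D_opp[of k] D0 by simp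
  have D_add: "D (k + l) = D k + D l" for k l
    using D_sub[of k l] D_sub[of "k + l" "- l"] D_neg[of l] by simp
  have D_bd: "\<bar>D k\<bar> \<le> 2 * r1\<^sup>2" if "norm k < r1 / 2" for k
  proof -
    have i: "norm (z + k) < r1" "norm (z + - k) < r1"
      using z that norm_triangle_ineq[of z k] norm_triangle_ineq4[of z k] by auto
    have "D j \<le> 2 * r1\<^sup>2" if "norm (z + j) < r1" for j
    proof -
      have "(norm (z + j))\<^sup>2 \<le> r1\<^sup>2" using that by (intro power_mono) auto
      then show ?thesis using D_le[OF that] F_nonneg[of z] F_upper[OF that] by simp
    qed
    from this[OF i(1)] this[OF i(2)] show ?thesis using D_neg[of k] by simp
  qed
  have D_scale: "D (s *\<^sub>R e) = s * D e" if "norm e = 1" for s e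
  proof -
    have "(\<lambda>s. D (s *\<^sub>R e)) s = s * (\<lambda>s. D (s *\<^sub>R e)) 1"
    proof (rule additive_bounded_imp_linear[where d="r1/4" and C="2 * r1\<^sup>2"])
      show "\<bar>D (x *\<^sub>R e)\<bar> \<le> 2 * r1\<^sup>2" if "0 \<le> x" "x \<le> r1 / 4" for x
        by (rule D_bd) (use that \<open>norm e = 1\<close> r1 in simp)
    qed (use r1 in \<open>auto simp: scaleR_add_left D_add\<close>)
    then show ?thesis by simp
  qed
  define g where "g = (\<chi> i. D (axis i 1))"
  have Dg: "D k = g \<bullet> k" for k
  proof -
    have "k = (k$1) *\<^sub>R axis 1 1 + (k$2) *\<^sub>R axis 2 1"
      by (simp add: vec_eq_iff forall_2 axis_def)
    then have "D k = k$1 * D (axis 1 1) + k$2 * D (axis 2 1)"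
      by (metis D_add D_scale norm_axis_1)
    then show ?thesis by (simp add: g_def inner_vec_def sum_2 mult.commute)
  qed
  have "F z + g \<bullet> (y - z) \<le> F y" if "norm y < r1" for y
    using D_le[of "y - z"] that by (simp add: Dg)
  moreover have "F (z + k) \<le> F z + g \<bullet> k + Csc * (norm k)\<^sup>2" if k: "norm k < r1 / 2" for k
  proof -
    have i: "norm (z + k) < r1" "norm (z - k) < r1"
      using z that norm_triangle_ineq[of z k] norm_triangle_ineq4[of z k] by auto
    have "F (z + k) + F (z - k) \<le> 2 * F z + Csc * (norm k)\<^sup>2"
      by (rule F_semiconcave) (use z r1 i in auto)
    moreover have "g \<bullet> (- k) \<le> F (z + - k) - F z" unfolding Dg[symmetric] by (rule D_le) (use i in simp)
    ultimately show ?thesis by simp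
  qed
  ultimately show ?thesis by blast
qed

end

section \<open>Polar coordinates in the plane\<close>

definition polar :: "real \<Rightarrow> real^2" where "polar \<theta> = (\<chi> i. if i = 1 then cos \<theta> else sin \<theta>)"
definition polar' :: "real \<Rightarrow> real^2" where "polar' \<theta> = (\<chi> i. if i = 1 then - sin \<theta> else cos \<theta>)"

lemma polar_nth [simp]: "polar \<theta> $ 1 = cos \<theta>" "polar \<theta> $ 2 = sin \<theta>" "polar' \<theta> $ 1 = - sin \<theta>" "polar' \<theta> $ 2 = cos \<theta>"
  by (simp_all add: polar_def polar'_def)

lemma norm_polar [simp]: "norm (polar \<theta>) = 1" "norm (polar' \<theta>) = 1"
  by (simp_all add: norm_eq_sqrt_inner inner_vec_def sum_2 flip: power2_eq_square)

lemma norm_vec2: "(norm (v::real^2))\<^sup>2 = (v$1)\<^sup>2 + (v$2)\<^sup>2"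
  unfolding power2_norm_eq_inner by (simp add: inner_vec_def sum_2 power2_eq_square)

lemma norm_polar_decomp: "(norm v)\<^sup>2 = (v \<bullet> polar \<theta>)\<^sup>2 + (v \<bullet> polar' \<theta>)\<^sup>2"
proof -
  have "(v \<bullet> polar \<theta>)\<^sup>2 + (v \<bullet> polar' \<theta>)\<^sup>2 = ((v$1)\<^sup>2 + (v$2)\<^sup>2) * ((sin \<theta>)\<^sup>2 + (cos \<theta>)\<^sup>2)"
    by (simp only: inner_vec_def sum_2 polar_nth inner_real_def) algebra
  then show ?thesis by (simp add: norm_vec2)
qed

lemma polar_eq: "polar \<theta> = cos \<theta> *\<^sub>R axis 1 1 + sin \<theta> *\<^sub>R axis 2 1"
  and polar'_eq: "polar' \<theta> = (- sin \<theta>) *\<^sub>R axis 1 1 + cos \<theta> *\<^sub>R axis 2 1"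
  by (simp_all add: vec_eq_iff forall_2 axis_def)

lemma polar_deriv: "(polar has_vector_derivative polar' \<theta>) (at \<theta>)"
proof -
  have eq: "polar = (\<lambda>\<theta>. cos \<theta> *\<^sub>R axis 1 1 + sin \<theta> *\<^sub>R axis 2 1)"
    by (rule ext) (simp add: vec_eq_iff forall_2 axis_def)
  have "((\<lambda>\<theta>. cos \<theta> *\<^sub>R axis 1 1 + sin \<theta> *\<^sub>R axis 2 1 :: real^2) has_vector_derivative
      (cos \<theta> *\<^sub>R 0 + (- sin \<theta>) *\<^sub>R axis 1 1) + (sin \<theta> *\<^sub>R 0 + cos \<theta> *\<^sub>R axis 2 1)) (at \<theta>)"
    by (intro derivative_intros has_vector_derivative_scaleR DERIV_cos DERIV_sin)
  moreover have "(cos \<theta> *\<^sub>R 0 + (- sin \<theta>) *\<^sub>R axis 1 1) + (sin \<theta> *\<^sub>R 0 + cos \<theta> *\<^sub>R axis 2 1) = polar' \<theta>"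
    by (simp add: vec_eq_iff forall_2 axis_def)
  ultimately show ?thesis unfolding eq by simp
qed

lemma continuous_polar [continuous_intros]: "continuous_on S f \<Longrightarrow> continuous_on S (\<lambda>x. polar (f x))"
  for f :: "real \<Rightarrow> real"
  unfolding polar_eq by (intro continuous_on_add continuous_on_scaleR continuous_on_const continuous_on_cos continuous_on_sin)

lemma continuous_polar' [continuous_intros]: "continuous_on S f \<Longrightarrow> continuous_on S (\<lambda>x. polar' (f x))"
  for f :: "real \<Rightarrow> real"
  unfolding polar'_eq by (intro continuous_on_add continuous_on_scaleR continuous_on_minus continuous_on_const continuous_on_cos continuous_on_sin)

lemma polar_periodic: "polar (\<theta> + 2 * pi) = polar \<theta>" "polar' (\<theta> + 2 * pi) = polar' \<theta>"
  by (simp_all add: vec_eq_iff forall_2)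

lemma polar_coords: "\<exists>\<theta>. z = norm z *\<^sub>R polar \<theta>"
proof (cases "z = 0")
  case False
  then have "(z$1 / norm z)\<^sup>2 + (z$2 / norm z)\<^sup>2 = 1"
    by (simp add: power_divide flip: add_divide_distrib norm_vec2)
  then obtain \<theta> where "z$1 / norm z = cos \<theta>" "z$2 / norm z = sin \<theta>"
    using sincos_total_2pi by metis
  then have "z$1 = norm z * cos \<theta>" "z$2 = norm z * sin \<theta>" using False by (simp_all add: field_simps)
  then have "z = norm z *\<^sub>R polar \<theta>" by (simp only: vec_eq_iff forall_2 vector_scaleR_component polar_nth real_scaleR_def simp_thms)
  then show ?thesis ..
qed simp

lemma polar_eq_iff: "polar a = polar b \<longleftrightarrow> (\<exists>n::int. a = b + 2 * pi * n)"
proof -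
  have "polar a = polar b \<longleftrightarrow> cos a = cos b \<and> sin a = sin b" by (simp add: vec_eq_iff forall_2)
  also have "\<dots> \<longleftrightarrow> (\<exists>n::int. a = b + 2 * pi * n)" 
    using sin_cos_eq_iff[of a b] by blast
  finally show ?thesis .
qed

text \<open>Rationalising, the error is y^2/4 divided by (1 + y/2) + sqrt (1 + y), a number of size
  at least 1/4.\<close>

lemma sqrt_expand:
  fixes y :: real
  assumes "\<bar>y\<bar> \<le> 1 / 2"
  shows "\<bar>sqrt (1 + y) - (1 + y / 2)\<bar> \<le> y\<^sup>2"
proof -
  have y: "- (1 / 2) \<le> y" "y \<le> 1 / 2" using assms by (simp_all add: abs_le_iff)
  have p0: "0 \<le> sqrt (1 + y)" using y by simp
  then have p: "0 \<le> sqrt (1 + y)" "0 < 1 + y / 2 + sqrt (1 + y)" using y by linarith+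
  have "((1 + y / 2) - sqrt (1 + y)) * ((1 + y / 2) + sqrt (1 + y)) = (1 + y / 2)\<^sup>2 - (sqrt (1 + y))\<^sup>2"
    by (simp add: power2_eq_square algebra_simps)
  also have "\<dots> = y\<^sup>2 / 4" using assms by (simp add: power2_eq_square algebra_simps abs_le_iff)
  finally have eq: "(1 + y / 2) - sqrt (1 + y) = y\<^sup>2 / 4 / ((1 + y / 2) + sqrt (1 + y))"
    using p by (simp add: field_simps)
  have "y\<^sup>2 / 4 / ((1 + y / 2) + sqrt (1 + y)) \<le> y\<^sup>2 / 4 / (1 / 4)"
  proof (rule divide_left_mono)
    show "1 / 4 \<le> (1 + y / 2) + sqrt (1 + y)" using y p0 by linarith
  qed (use p in auto)
  moreover have "0 \<le> y\<^sup>2 / 4 / ((1 + y / 2) + sqrt (1 + y))" using p by simp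
  ultimately show ?thesis using eq by (simp add: abs_le_iff)
qed

section \<open>Level curves of the squared distance as polar graphs\<close>

context dist_sq
begin

text \<open>The two clauses, a supporting plane from convexity and a quadratic upper bound from
  semiconcavity, are recorded as inequalities because the estimates below use them at points a
  definite distance away.\<close>

definition grad :: "real^2 \<Rightarrow> real^2" where
  "grad z = (SOME g. (\<forall>y. norm y < r1 \<longrightarrow> F z + g \<bullet> (y - z) \<le> F y) \<and>
             (\<forall>k. norm k < r1 / 2 \<longrightarrow> F (z + k) \<le> F z + g \<bullet> k + Csc * (norm k)\<^sup>2))"

lemma grad:
  assumes "norm z < r1 / 2"
  shows "norm y < r1 \<Longrightarrow> F z + grad z \<bullet> (y - z) \<le> F y"
    and "norm k < r1 / 2 \<Longrightarrow> F (z + k) \<le> F z + grad z \<bullet> k + Csc * (norm k)\<^sup>2"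
  using someI_ex[OF F_gradient[OF assms]] unfolding grad_def by blast+

text \<open>Let k point along the gradient difference with |k| = |y - z|. The upper bound from
  \<open>z\<close> at y + k is compared with the supporting plane from \<open>z\<close> at
  \<open>y\<close> followed by the one from \<open>y\<close> at y + k; the affine parts leave |grad
  y - grad z| |k| \<le> Csc (2|k|)^2.\<close>

lemma grad_lip:
  assumes "norm z < r1 / 8" "norm y < r1 / 8"
  shows "norm (grad y - grad z) \<le> 4 * Csc * norm (y - z)"
proof (cases "grad y = grad z")
  case True
  then show ?thesis using Csc by simp
next
  case False
  define s where "s = norm (y - z)"
  have s: "s < r1 / 4" using norm_triangle_ineq4[of y z] assms by (simp add: s_def)
  define d where "d = grad y - grad z"
  define k where "k = (s / norm d) *\<^sub>R d"
  have d: "d \<noteq> 0" using False by (simp add: d_def)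
  have nk: "norm k = s" using d by (simp add: k_def s_def)
  have dk: "d \<bullet> k = s * norm d" using d by (simp add: k_def power2_norm_eq_inner[symmetric] power2_eq_square)
  have yk: "norm (y + k) < r1" using norm_triangle_ineq[of y k] nk s assms r1(1) by linarith
  have n2: "norm (y - z + k) \<le> 2 * s" using norm_triangle_ineq[of "y - z" k] nk by (simp add: s_def)
  have z2: "norm z < r1 / 2" "norm y < r1 / 2" "norm y < r1" using assms r1 by linarith+
  have "F y + grad y \<bullet> (y + k - y) \<le> F (y + k)" by (rule grad(1)[OF z2(2) yk])
  moreover have "F z + grad z \<bullet> (y - z) \<le> F y" by (rule grad(1)[OF z2(1,3)])
  moreover have "F (z + (y - z + k)) \<le> F z + grad z \<bullet> (y - z + k) + Csc * (norm (y - z + k))\<^sup>2"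
    by (rule grad(2)[OF z2(1)]) (use n2 s in linarith)
  moreover have "Csc * (norm (y - z + k))\<^sup>2 \<le> Csc * (2 * s)\<^sup>2"
    using n2 Csc by (intro mult_left_mono power_mono) auto
  ultimately have "grad y \<bullet> k - grad z \<bullet> k \<le> Csc * (2 * s)\<^sup>2"
    by (simp add: inner_add_right inner_diff_right)
  then have "s * norm d \<le> s * (4 * Csc * s)" using dk by (simp add: d_def inner_diff_left power2_eq_square mult_ac)
  moreover have "0 < s" unfolding s_def using False by auto
  ultimately show ?thesis by (simp add: d_def s_def)
qed

lemma grad_cont: "continuous_on (ball 0 (r1 / 8)) grad"
  unfolding continuous_on_iff
proof safe
  fix z :: "real^2" and e :: real assume z: "z \<in> ball 0 (r1 / 8)" and e: "0 < e"
  have "dist (grad y) (grad z) < e" if "y \<in> ball 0 (r1 / 8)" "dist y z < e / (4 * Csc)" for y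
  proof -
    have "norm (grad y - grad z) \<le> 4 * Csc * norm (y - z)" by (rule grad_lip) (use z that in auto)
    also have "\<dots> < e" using that(2) Csc by (simp add: dist_norm field_simps)
    finally show ?thesis by (simp add: dist_norm)
  qed
  then show "\<exists>d>0. \<forall>y\<in>ball 0 (r1 / 8). dist y z < d \<longrightarrow> dist (grad y) (grad z) < e"
    using e Csc by (intro exI[of _ "e / (4 * Csc)"]) auto
qed

lemma F_deriv:
  assumes z: "norm z < r1 / 2"
  shows "(F has_derivative (\<lambda>k. grad z \<bullet> k)) (at z)"
  unfolding has_derivative_at
proof safe
  show "bounded_linear ((\<bullet>) (grad z))" by (rule bounded_linear_inner_right)
  show "(\<lambda>k. norm (F (z + k) - F z - grad z \<bullet> k) / norm k) \<midarrow>0\<rightarrow> 0"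
  proof (rule tendsto_sandwich[where f="\<lambda>_. 0" and h="\<lambda>k. Csc * norm k"])
    have "\<forall>\<^sub>F k in at 0. norm (k::real^2) < r1 / 2"
      using r1 by (auto simp: eventually_at intro!: exI[of _ "r1/2"])
    then show "\<forall>\<^sub>F k in at 0. norm (F (z + k) - F z - grad z \<bullet> k) / norm k \<le> Csc * norm k"
    proof eventually_elim
      case (elim k)
      have "norm (z + k) < r1" using norm_triangle_ineq[of z k] z elim by linarith
      from grad(1)[OF z this] grad(2)[OF z elim]
      have "norm (F (z + k) - F z - grad z \<bullet> k) \<le> Csc * (norm k)\<^sup>2" by simp
      then show ?case by (cases "k = 0") (simp_all add: field_simps power2_eq_square)
    qed
    show "(\<lambda>k::real^2. Csc * norm k) \<midarrow>0\<rightarrow> 0"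
      by (auto intro!: tendsto_eq_intros)
  qed (auto intro!: always_eventually)
qed

lemma F_cont: "continuous_on (ball 0 (r1 / 2)) F"
  by (intro continuous_at_imp_continuous_on ballI has_derivative_continuous[OF F_deriv]) auto

text \<open>A near-minimiser moves with velocity at most sqrt (2 (F z + e)) and reaches
  \<open>z\<close> in unit time.\<close>

lemma F_lower:
  assumes z: "norm z < r1"
  shows "(norm z)\<^sup>2 / 2 \<le> F z"
proof (rule field_le_epsilon)
  fix e :: real assume e: "0 < e"
  obtain S p w where p: "adm S p w (2 * r1)" "p ` {0..1} \<subseteq> cball 0 (2 * r1)" "p 1 = z"
    "energy p w \<le> F z + e" "\<forall>t\<in>{0..1} - S. qf (h (p t)) (w t) (w t) \<le> F z + e"
    "\<forall>t\<in>{0..1} - S. (norm (w t))\<^sup>2 \<le> 2 * (F z + e)"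
    by (rule near_min[OF z e])
  have "adm S p w (sqrt (2 * (F z + e)))"
    using p(1,6) unfolding adm_def by (auto simp: real_le_rsqrt)
  from adm_bound[OF this, of 1] have "norm z \<le> sqrt (2 * (F z + e))"
    using p(3) F_nonneg[of z] e by simp
  then have "(norm z)\<^sup>2 \<le> (sqrt (2 * (F z + e)))\<^sup>2" by (intro power_mono) auto
  then show "(norm z)\<^sup>2 / 2 \<le> F z + e" using F_nonneg[of z] e by simp
qed

lemma F_pos: "norm z < r1 \<Longrightarrow> z \<noteq> 0 \<Longrightarrow> 0 < F z"
  using F_lower[of z] by (rule less_le_trans[rotated]) auto

text \<open>The supporting plane at \<open>z\<close>, evaluated at the origin, lies below F 0 = 0 <
  F z.\<close>

lemma grad_radial:
  assumes "norm z < r1 / 2" "z \<noteq> 0"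
  shows "0 < grad z \<bullet> z"
proof -
  have "F z + grad z \<bullet> (0 - z) \<le> F 0" by (rule grad(1)) (use assms r1 in auto)
  moreover have "0 < F z" using F_pos[of z] assms r1 by auto
  ultimately show ?thesis by (simp add: F_0)
qed

text \<open>The supporting plane at the inner point increases along the ray by
  \<open>grad_radial\<close>, and \<open>F\<close> lies above it.\<close>

lemma F_radial_mono:
  assumes z: "norm z < r1 / 2" "z \<noteq> 0" and c: "0 \<le> c" "c < 1"
  shows "F (c *\<^sub>R z) < F z"
proof (cases "c = 0")
  case True
  then show ?thesis using F_pos[of z] z r1 by (simp add: F_0)
next
  case False
  have le: "norm (c *\<^sub>R z) \<le> norm z" using c by (simp add: mult_left_le_one_le)
  have "0 < grad (c *\<^sub>R z) \<bullet> (c *\<^sub>R z)"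
    by (rule grad_radial[OF order_le_less_trans[OF le z(1)]]) (use z(2) False in simp)
  then have "0 < grad (c *\<^sub>R z) \<bullet> z" using c False by (simp add: zero_less_mult_iff)
  moreover have "F (c *\<^sub>R z) + grad (c *\<^sub>R z) \<bullet> (z - c *\<^sub>R z) \<le> F z"
    by (rule grad(1)[OF order_le_less_trans[OF le z(1)]]) (use z r1 in linarith)
  moreover have "grad (c *\<^sub>R z) \<bullet> (z - c *\<^sub>R z) = (1 - c) * (grad (c *\<^sub>R z) \<bullet> z)"
    by (simp add: inner_diff_right algebra_simps)
  ultimately show ?thesis using c by (smt (verit) mult_pos_pos)
qed

lemma F_radial_mono':
  assumes "0 \<le> s" "s < t" "t < r1 / 2"
  shows "F (s *\<^sub>R polar \<theta>) < F (t *\<^sub>R polar \<theta>)"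
proof -
  have "t *\<^sub>R polar \<theta> \<noteq> 0" using assms norm_polar(1)[of \<theta>] by (metis less_irrefl norm_zero not_less scaleR_eq_0_iff zero_neq_one)
  then have "F ((s / t) *\<^sub>R (t *\<^sub>R polar \<theta>)) < F (t *\<^sub>R polar \<theta>)"
    by (intro F_radial_mono) (use assms in auto)
  then show ?thesis using assms by simp
qed

definition rad :: "real \<Rightarrow> real \<Rightarrow> real" where
  "rad r \<theta> = (THE s. 0 < s \<and> s < r1 / 8 \<and> F (s *\<^sub>R polar \<theta>) = r\<^sup>2)"

lemma rad_ex1:
  assumes r: "0 < r" "r < r1 / 16"
  shows "\<exists>!s. 0 < s \<and> s < r1 / 8 \<and> F (s *\<^sub>R polar \<theta>) = r\<^sup>2"
proof -
  \<comment> \<open>At this radius \<open>F\<close> is at least b^2/2 = 9 r^2/8, above the level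
    r^2, while b is still below r1/8.\<close>
  define b where "b = 3 * r / 2"
  have b: "0 < b" "b < r1 / 8" using r by (auto simp: b_def)
  have "r\<^sup>2 < b\<^sup>2 / 2" using r by (simp add: b_def power2_eq_square)
  also have "\<dots> \<le> F (b *\<^sub>R polar \<theta>)" using F_lower[of "b *\<^sub>R polar \<theta>"] b r1 by simp
  finally have ub: "r\<^sup>2 < F (b *\<^sub>R polar \<theta>)" .
  have "\<exists>s\<ge>0. s \<le> b \<and> F (s *\<^sub>R polar \<theta>) = r\<^sup>2"
  proof (rule IVT')
    show "F (0 *\<^sub>R polar \<theta>) \<le> r\<^sup>2" by (simp add: F_0)
    show "continuous_on {0..b} (\<lambda>s. F (s *\<^sub>R polar \<theta>))"
      by (rule continuous_on_compose2[OF F_cont]) (use b in \<open>auto intro!: continuous_intros\<close>)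
  qed (use ub b in auto)
  then obtain s where s: "0 \<le> s" "s \<le> b" "F (s *\<^sub>R polar \<theta>) = r\<^sup>2" by blast
  have "s \<noteq> 0" using s(3) r by (auto simp: F_0)
  then have "0 < s \<and> s < r1 / 8 \<and> F (s *\<^sub>R polar \<theta>) = r\<^sup>2" using s b by auto
  moreover have "t = s" if "0 < t" "t < r1 / 8" "F (t *\<^sub>R polar \<theta>) = r\<^sup>2" for t
    using F_radial_mono'[of s t \<theta>] F_radial_mono'[of t s \<theta>] that s b r1
    by (cases s t rule: linorder_cases) auto
  ultimately show ?thesis by blast
qed

lemma rad:
  assumes r: "0 < r" "r < r1 / 16"
  shows "0 < rad r \<theta>" "rad r \<theta> < r1 / 8" "F (rad r \<theta> *\<^sub>R polar \<theta>) = r\<^sup>2" "(rad r \<theta>)\<^sup>2 \<le> 2 * r\<^sup>2"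
proof -
  show 1: "0 < rad r \<theta>" "rad r \<theta> < r1 / 8" "F (rad r \<theta> *\<^sub>R polar \<theta>) = r\<^sup>2"
    using theI'[OF rad_ex1[OF r, of \<theta>]] unfolding rad_def by auto
  show "(rad r \<theta>)\<^sup>2 \<le> 2 * r\<^sup>2" using F_lower[of "rad r \<theta> *\<^sub>R polar \<theta>"] 1 r1 by simp
qed

lemma rad_unique:
  assumes "0 < r" "r < r1 / 16" "0 < s" "s < r1 / 8" "F (s *\<^sub>R polar \<theta>) = r\<^sup>2"
  shows "rad r \<theta> = s"
  unfolding rad_def by (rule the1_equality[OF rad_ex1[OF assms(1,2)]]) (use assms in simp)

lemma rad_periodic: "rad r (\<theta> + 2 * pi) = rad r \<theta>"
  by (simp add: rad_def polar_periodic)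

lemma level_set:
  assumes r: "0 < r" "r < r1 / 16"
  shows "{z. norm z < r1 \<and> F z = r\<^sup>2} = range (\<lambda>\<theta>. rad r \<theta> *\<^sub>R polar \<theta>)"
proof safe
  fix z assume z: "norm z < r1" "F z = r\<^sup>2"
  obtain \<theta> where \<theta>: "z = norm z *\<^sub>R polar \<theta>" using polar_coords by blast
  have "(norm z)\<^sup>2 \<le> 2 * r\<^sup>2" using F_lower[OF z(1)] z(2) by simp
  also have "\<dots> < (2 * r)\<^sup>2" using r by simp
  finally have "norm z < 2 * r" by (rule power2_less_imp_less) (use r in simp)
  moreover have "z \<noteq> 0" using z r by (auto simp: F_0)
  ultimately have "rad r \<theta> = norm z" by (intro rad_unique) (use r z \<theta>[symmetric] in auto)
  then show "z \<in> range (\<lambda>\<theta>. rad r \<theta> *\<^sub>R polar \<theta>)" using \<theta> by (intro range_eqI[of _ _ \<theta>]) simp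
next
  fix \<theta>
  show "norm (rad r \<theta> *\<^sub>R polar \<theta>) < r1" "F (rad r \<theta> *\<^sub>R polar \<theta>) = r\<^sup>2"
    using rad[OF r, of \<theta>] r1 by auto
qed

text \<open>On the circles of radius R - e and R + e the function \<open>F\<close> stays below and
  above r^2 for nearby angles, and radial monotonicity traps \<open>rad r t\<close> between
  them.\<close>

lemma rad_cont:
  assumes r: "0 < r" "r < r1 / 16"
  shows "isCont (rad r) \<theta>"
  unfolding isCont_def tendsto_iff
proof safe
  fix e0 :: real assume "0 < e0"
  let ?R = "rad r \<theta>"
  define e where "e = min e0 (min ?R (r1/8 - ?R)) / 2"
  have e: "0 < e" "e < e0" "e < ?R" "?R + e < r1 / 8" using \<open>0 < e0\<close> rad[OF r, of \<theta>] by (auto simp: e_def min_def)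
  have c: "((\<lambda>t. F (s *\<^sub>R polar t)) \<longlongrightarrow> F (s *\<^sub>R polar \<theta>)) (nhds \<theta>)" if "\<bar>s\<bar> < r1 / 2" for s
  proof -
    have "continuous_on UNIV (\<lambda>t. F (s *\<^sub>R polar t))"
      by (rule continuous_on_compose2[OF F_cont]) (use that in \<open>auto intro!: continuous_intros\<close>)
    then have "isCont (\<lambda>t. F (s *\<^sub>R polar t)) \<theta>" by (simp add: continuous_on_eq_continuous_at)
    then show ?thesis using tendsto_at_iff_tendsto_nhds[of "\<lambda>t. F (s *\<^sub>R polar t)" \<theta>] unfolding isCont_def by simp
  qed
  have ab: "\<bar>?R - e\<bar> < r1 / 2" "\<bar>?R + e\<bar> < r1 / 2" using e rad[OF r, of \<theta>] r1 by auto
  have lo: "F ((?R - e) *\<^sub>R polar \<theta>) < r\<^sup>2" and hi: "r\<^sup>2 < F ((?R + e) *\<^sub>R polar \<theta>)"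
    using F_radial_mono'[of "?R - e" ?R \<theta>] F_radial_mono'[of ?R "?R + e" \<theta>] rad[OF r, of \<theta>] e r1 by auto
  have "\<forall>\<^sub>F t in nhds \<theta>. F ((?R - e) *\<^sub>R polar t) < r\<^sup>2"
    by (rule order_tendstoD(2)[OF c[OF ab(1)] lo])
  moreover have "\<forall>\<^sub>F t in nhds \<theta>. r\<^sup>2 < F ((?R + e) *\<^sub>R polar t)"
    by (rule order_tendstoD(1)[OF c[OF ab(2)] hi])
  ultimately have "\<forall>\<^sub>F t in nhds \<theta>. dist (rad r t) ?R < e0"
  proof eventually_elim
    case (elim t)
    have "?R - e < rad r t"
    proof (rule ccontr)
      assume "\<not> ?R - e < rad r t"
      then have "r\<^sup>2 \<le> F ((?R - e) *\<^sub>R polar t)"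
        using F_radial_mono'[of "rad r t" "?R - e" t] rad[OF r, of t] rad[OF r, of \<theta>] e r1
        by (cases "?R - e = rad r t") auto
      then show False using elim by simp
    qed
    moreover have "rad r t < ?R + e"
    proof (rule ccontr)
      assume "\<not> rad r t < ?R + e"
      then have "F ((?R + e) *\<^sub>R polar t) \<le> r\<^sup>2"
        using F_radial_mono'[of "?R + e" "rad r t" t] rad[OF r, of t] rad[OF r, of \<theta>] e r1
        by (cases "?R + e = rad r t") auto
      then show False using elim by simp
    qed
    ultimately show ?case using e by (simp add: dist_real_def)
  qed
  then show "\<forall>\<^sub>F t in at \<theta>. dist (rad r t) ?R < e0"
    unfolding eventually_at_filter by (rule eventually_mono) simp
qed

text \<open>The slope found by differentiating F(R(\<theta>) polar \<theta>) = r^2 in \<theta> and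
  solving for R'.\<close>

definition rad' :: "real \<Rightarrow> real \<Rightarrow> real" where
  "rad' r \<theta> = - rad r \<theta> * (grad (rad r \<theta> *\<^sub>R polar \<theta>) \<bullet> polar' \<theta>) / (grad (rad r \<theta> *\<^sub>R polar \<theta>) \<bullet> polar \<theta>)"

lemma grad_polar_pos:
  assumes r: "0 < r" "r < r1 / 16"
  shows "0 < grad (rad r \<theta> *\<^sub>R polar \<theta>) \<bullet> polar \<theta>"
proof -
  have "polar \<theta> \<noteq> 0" using norm_polar(1)[of \<theta>] by (metis norm_zero zero_neq_one)
  then have "0 < grad (rad r \<theta> *\<^sub>R polar \<theta>) \<bullet> (rad r \<theta> *\<^sub>R polar \<theta>)"
    by (intro grad_radial) (use rad[OF r, of \<theta>] r1 in auto)
  then show ?thesis using rad(1)[OF r, of \<theta>] by (simp add: zero_less_mult_iff)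
qed

lemma rad'_cont:
  assumes r: "0 < r" "r < r1 / 16"
  shows "continuous_on UNIV (rad' r)"
proof -
  have c: "continuous_on UNIV (rad r)" using rad_cont[OF r] by (simp add: continuous_at_imp_continuous_on)
  have "continuous_on UNIV (\<lambda>\<theta>. grad (rad r \<theta> *\<^sub>R polar \<theta>))"
    by (rule continuous_on_compose2[OF grad_cont]) (use rad[OF r] c in \<open>auto intro!: continuous_intros simp: abs_of_pos\<close>)
  moreover have "grad (rad r \<theta> *\<^sub>R polar \<theta>) \<bullet> polar \<theta> \<noteq> 0" for \<theta> using grad_polar_pos[OF r, of \<theta>] by simp
  ultimately show ?thesis unfolding rad'_def by (intro continuous_intros c) auto
qed

text \<open>Implicit differentiation: by the gradient inequality the difference quotient of \<open>F\<close> along a ray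
  lies between the radial derivatives at the two end points.\<close>

lemma rad_deriv:
  assumes r: "0 < r" "r < r1 / 16"
  shows "(rad r has_real_derivative rad' r \<theta>) (at \<theta>)"
proof -
  let ?R = "rad r \<theta>" and ?z = "rad r \<theta> *\<^sub>R polar \<theta>"
  define A where "A = (\<lambda>t. grad (?R *\<^sub>R polar t) \<bullet> polar t)"
  define B where "B = (\<lambda>t. grad (rad r t *\<^sub>R polar t) \<bullet> polar t)"
  define N where "N = (\<lambda>t. r\<^sup>2 - F (?R *\<^sub>R polar t))"
  \<comment> \<open>The secant slope of \<open>F\<close> on the ray at angle \<open>t\<close>
    between the radii R and \<open>rad r t\<close>, completed by the radial derivative where they
    coincide. In either order of the two radii it lies between \<open>A t\<close> and
    \<open>B t\<close>.\<close>
  define q where "q = (\<lambda>t. if rad r t = ?R then A t else N t / (rad r t - ?R))"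
  have c: "continuous_on UNIV (rad r)" using rad_cont[OF r] by (simp add: continuous_at_imp_continuous_on)
  have "continuous_on UNIV A" unfolding A_def
    by (intro continuous_intros continuous_on_compose2[OF grad_cont])
       (use rad[OF r, of \<theta>] in \<open>auto intro!: continuous_intros\<close>)
  then have At: "(A \<longlongrightarrow> A \<theta>) (at \<theta>)" by (simp add: continuous_on_eq_continuous_at isCont_def)
  have "continuous_on UNIV B" unfolding B_def
    by (intro continuous_intros continuous_on_compose2[OF grad_cont])
       (use rad[OF r] c in \<open>auto intro!: continuous_intros simp: abs_of_pos\<close>)
  then have Bt: "(B \<longlongrightarrow> A \<theta>) (at \<theta>)" by (simp add: continuous_on_eq_continuous_at isCont_def A_def B_def)
  have pos: "0 < A \<theta>" using grad_polar_pos[OF r, of \<theta>] by (simp add: A_def)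
  have AB: "A t * (rad r t - ?R) \<le> N t" "N t \<le> B t * (rad r t - ?R)" for t
  proof -
    have b: "norm (?R *\<^sub>R polar t) < r1 / 2" "norm (rad r t *\<^sub>R polar t) < r1 / 2"
        "norm (?R *\<^sub>R polar t) < r1" "norm (rad r t *\<^sub>R polar t) < r1"
      using rad[OF r, of t] rad[OF r, of \<theta>] r1 by auto
    have "F (?R *\<^sub>R polar t) + grad (?R *\<^sub>R polar t) \<bullet> (rad r t *\<^sub>R polar t - ?R *\<^sub>R polar t) \<le> F (rad r t *\<^sub>R polar t)"
      by (rule grad(1)[OF b(1,4)])
    then show "A t * (rad r t - ?R) \<le> N t"
      using rad(3)[OF r, of t] by (simp add: A_def N_def algebra_simps inner_diff_right)
    have "F (rad r t *\<^sub>R polar t) + grad (rad r t *\<^sub>R polar t) \<bullet> (?R *\<^sub>R polar t - rad r t *\<^sub>R polar t) \<le> F (?R *\<^sub>R polar t)"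
      by (rule grad(1)[OF b(2,3)])
    then show "N t \<le> B t * (rad r t - ?R)"
      using rad(3)[OF r, of t] by (simp add: B_def N_def algebra_simps inner_diff_right)
  qed
  have qt: "(q \<longlongrightarrow> A \<theta>) (at \<theta>)"
  proof (rule tendsto_sandwich[where f="\<lambda>t. min (A t) (B t)" and h="\<lambda>t. max (A t) (B t)"])
    show "((\<lambda>t. min (A t) (B t)) \<longlongrightarrow> A \<theta>) (at \<theta>)" using tendsto_min[OF At Bt] by simp
    show "((\<lambda>t. max (A t) (B t)) \<longlongrightarrow> A \<theta>) (at \<theta>)" using tendsto_max[OF At Bt] by simp
    have "min (A t) (B t) \<le> q t \<and> q t \<le> max (A t) (B t)" for t
    proof (cases "rad r t" "?R" rule: linorder_cases)
      case less
      then have "N t / (rad r t - ?R) \<le> A t" "B t \<le> N t / (rad r t - ?R)"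
        using AB[of t] by (auto simp: neg_divide_le_eq neg_le_divide_eq)
      then show ?thesis using less by (simp add: q_def min_le_iff_disj le_max_iff_disj)
    next
      case equal
      then show ?thesis by (simp add: q_def)
    next
      case greater
      then have "N t / (rad r t - ?R) \<le> B t" "A t \<le> N t / (rad r t - ?R)"
        using AB[of t] by (auto simp: pos_divide_le_eq pos_le_divide_eq)
      then show ?thesis using greater by (simp add: q_def min_le_iff_disj le_max_iff_disj)
    qed
    then show "\<forall>\<^sub>F t in at \<theta>. min (A t) (B t) \<le> q t" "\<forall>\<^sub>F t in at \<theta>. q t \<le> max (A t) (B t)"
      by (auto intro!: always_eventually)
  qed
  have "((\<lambda>t. F (?R *\<^sub>R polar t)) has_derivative (\<lambda>k. grad ?z \<bullet> (?R *\<^sub>R (k *\<^sub>R polar' \<theta>)))) (at \<theta>)"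
  proof (rule has_derivative_compose[where f="\<lambda>t. ?R *\<^sub>R polar t" and g=F])
    show "((\<lambda>t. ?R *\<^sub>R polar t) has_derivative (\<lambda>k. ?R *\<^sub>R (k *\<^sub>R polar' \<theta>))) (at \<theta>)"
      by (rule has_derivative_scaleR_right) (use polar_deriv[of \<theta>] in \<open>simp add: has_vector_derivative_def\<close>)
    show "(F has_derivative (\<bullet>) (grad ?z)) (at ?z)"
      by (rule F_deriv) (use rad[OF r, of \<theta>] r1 in auto)
  qed
  then have "((\<lambda>t. F (?R *\<^sub>R polar t)) has_real_derivative ?R * (grad ?z \<bullet> polar' \<theta>)) (at \<theta>)"
    unfolding has_field_derivative_def by (rule has_derivative_eq_rhs) (simp add: fun_eq_iff mult_ac)
  from DERIV_diff[OF DERIV_const[of "r\<^sup>2"] this]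
  have "((\<lambda>t. (N t - N \<theta>) / (t - \<theta>)) \<longlongrightarrow> - (?R * (grad ?z \<bullet> polar' \<theta>))) (at \<theta>)"
    unfolding N_def[symmetric] has_field_derivative_iff by (simp add: N_def)
  moreover have "N \<theta> = 0" using rad(3)[OF r, of \<theta>] by (simp add: N_def)
  ultimately have "((\<lambda>t. N t / (t - \<theta>) / q t) \<longlongrightarrow> - (?R * (grad ?z \<bullet> polar' \<theta>)) / A \<theta>) (at \<theta>)"
    using qt pos by (intro tendsto_divide) auto
  moreover have "\<forall>\<^sub>F t in at \<theta>. N t / (t - \<theta>) / q t = (rad r t - ?R) / (t - \<theta>)"
    using order_tendstoD(1)[OF qt pos]
  proof eventually_elim
    case (elim t)
    have "N t = q t * (rad r t - ?R)"
      using rad(3)[OF r, of t] by (auto simp: q_def N_def)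
    then show ?case using elim by simp
  qed
  ultimately have "((\<lambda>t. (rad r t - ?R) / (t - \<theta>)) \<longlongrightarrow> - (?R * (grad ?z \<bullet> polar' \<theta>)) / A \<theta>) (at \<theta>)"
    by (rule Lim_transform_eventually)
  then show ?thesis unfolding has_field_derivative_iff by (simp add: rad'_def A_def)
qed

definition lspeed :: "real \<Rightarrow> real \<Rightarrow> real" where
  "lspeed r \<theta> = (let v = rad' r \<theta> *\<^sub>R polar \<theta> + rad r \<theta> *\<^sub>R polar' \<theta>
     in sqrt (qf (h (rad r \<theta> *\<^sub>R polar \<theta>)) v v))"

text \<open>A supporting line of the convex set \<open>F \<le> r\<^sup>2\<close> misses the inner of the two discs between which
  the level curve lies; this bounds the slope \<open>rad'\<close>.\<close>

lemma rad_close: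
  assumes "0 < \<epsilon>"
  shows "\<exists>r3>0. r3 \<le> r1 / 16 \<and> (\<forall>r \<theta>. 0 < r \<longrightarrow> r < r3 \<longrightarrow>
     \<bar>(rad r \<theta>)\<^sup>2 - r\<^sup>2\<bar> \<le> \<epsilon> * r ^ 4 \<and> (rad' r \<theta>)\<^sup>2 \<le> \<epsilon> * r ^ 4)"
proof -
  \<comment> \<open>The bound for the slope at the end loses the factor 2 * 10.\<close>
  define \<eta> where "\<eta> = \<epsilon> / 20"
  have \<eta>: "0 < \<eta>" "4 * \<eta> \<le> \<epsilon>" "20 * \<eta> = \<epsilon>" using assms by (auto simp: \<eta>_def)
  obtain \<delta> where \<delta>: "0 < \<delta>" "\<And>z. norm z < \<delta> \<Longrightarrow> \<bar>F z - (norm z)\<^sup>2\<bar> \<le> \<eta> * (norm z) ^ 4"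
    using F_sandwich[OF \<eta>(1)] by blast
  define r3 where "r3 = min (r1 / 16) (min (\<delta> / 2) (1 / sqrt (2 * \<eta>)))"
  have r3: "0 < r3" "r3 \<le> r1 / 16" "2 * r3 \<le> \<delta>" using r1 \<delta> \<eta> by (auto simp: r3_def)
  have "\<bar>(rad r \<theta>)\<^sup>2 - r\<^sup>2\<bar> \<le> \<epsilon> * r ^ 4 \<and> (rad' r \<theta>)\<^sup>2 \<le> \<epsilon> * r ^ 4" if r: "0 < r" "r < r3" for r \<theta>
  proof -
    have r': "r < r1 / 16" using r r3 by simp
    note R = rad[OF r(1) r', of \<theta>]
    let ?R = "rad r \<theta>"
    have e2: "\<eta> * r\<^sup>2 \<le> 1 / 2"
    proof -
      have "r\<^sup>2 \<le> (1 / sqrt (2 * \<eta>))\<^sup>2" using r by (intro power_mono) (auto simp: r3_def)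
      then show ?thesis using \<eta> by (simp add: power_divide field_simps)
    qed
    have r4: "(r\<^sup>2)\<^sup>2 = r ^ 4" "(?R\<^sup>2)\<^sup>2 = ?R ^ 4" by simp_all
    have "?R\<^sup>2 < (2 * r)\<^sup>2" by (rule le_less_trans[OF R(4)]) (use r in \<open>simp add: power_mult_distrib\<close>)
    then have "?R < 2 * r" by (rule power2_less_imp_less) (use r in simp)
    then have "\<bar>r\<^sup>2 - ?R\<^sup>2\<bar> \<le> \<eta> * ?R ^ 4" using \<delta>(2)[of "?R *\<^sub>R polar \<theta>"] R r r3 by simp
    moreover have "\<eta> * ?R ^ 4 \<le> 4 * \<eta> * r ^ 4"
    proof -
      have "(?R\<^sup>2)\<^sup>2 \<le> (2 * r\<^sup>2)\<^sup>2" using R(4) by (intro power_mono) auto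
      then have "?R ^ 4 \<le> 4 * r ^ 4" by (simp add: power_mult_distrib)
      then show ?thesis using \<eta> by simp
    qed
    ultimately have A: "\<bar>?R\<^sup>2 - r\<^sup>2\<bar> \<le> 4 * \<eta> * r ^ 4" by linarith
    let ?z = "?R *\<^sub>R polar \<theta>"
    let ?g = "grad ?z"
    let ?a = "?g \<bullet> polar \<theta>" and ?b = "?g \<bullet> polar' \<theta>"
    have pos: "0 < ?a" by (rule grad_polar_pos[OF r(1) r'])
    then have g0: "?g \<noteq> 0" by auto
    \<comment> \<open>This radius satisfies s^2 + \<eta> r^4 = r^2, so the disc of radius s lies in
      the sublevel set; \<open>y\<close> is its point farthest in the direction of the
      gradient.\<close>
    define s where "s = r * sqrt (1 - \<eta> * r\<^sup>2)"
    have s2: "s\<^sup>2 = r\<^sup>2 * (1 - \<eta> * r\<^sup>2)" using e2 by (simp add: s_def power_mult_distrib)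
    have s0: "0 < s" using r e2 by (simp add: s_def)
    have "s\<^sup>2 \<le> r\<^sup>2 * 1" unfolding s2 using \<eta> by (intro mult_left_mono) auto
    then have sr: "s\<^sup>2 \<le> r\<^sup>2" by simp
    then have sr': "s \<le> r" by (rule power2_le_imp_le) (use r in simp)
    define y where "y = (s / norm ?g) *\<^sub>R ?g"
    have ny: "norm y = s" using g0 s0 by (simp add: y_def)
    have "F y \<le> s\<^sup>2 + \<eta> * s ^ 4" using \<delta>(2)[of y] ny sr' r r3 by (simp add: abs_le_iff)
    also have "\<dots> \<le> s\<^sup>2 + \<eta> * r ^ 4" using power_mono[OF sr', of 4] s0 \<eta> by simp
    also have "\<dots> = r\<^sup>2" unfolding s2 by (simp add: power4_eq_xxxx power2_eq_square algebra_simps)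
    finally have Fy: "F y \<le> r\<^sup>2" .
    have "F ?z + ?g \<bullet> (y - ?z) \<le> F y"
      by (rule grad(1)) (use R r1 ny sr' r r' in auto)
    then have "?g \<bullet> y \<le> ?g \<bullet> ?z" using Fy R(3) by (simp add: inner_diff_right)
    moreover have "?g \<bullet> y = s * norm ?g" using g0 by (simp add: y_def power2_norm_eq_inner[symmetric] power2_eq_square)
    \<comment> \<open>Since |g|^2 = a^2 + b^2 and R is close to s, this inequality forces the
      angular component b to be small compared with the radial one.\<close>
    ultimately have "s * norm ?g \<le> ?R * ?a" by simp
    then have "(s * norm ?g)\<^sup>2 \<le> (?R * ?a)\<^sup>2" using s0 by (intro power_mono) auto
    then have "s\<^sup>2 * (?a\<^sup>2 + ?b\<^sup>2) \<le> ?R\<^sup>2 * ?a\<^sup>2" by (simp add: power_mult_distrib norm_polar_decomp[of ?g \<theta>])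
    then have B: "s\<^sup>2 * ?b\<^sup>2 \<le> (?R\<^sup>2 - s\<^sup>2) * ?a\<^sup>2" by (simp add: algebra_simps)
    have "?R\<^sup>2 - s\<^sup>2 \<le> 5 * \<eta> * r ^ 4"
      using A unfolding s2 by (simp add: abs_le_iff power4_eq_xxxx power2_eq_square algebra_simps)
    then have "(?R\<^sup>2 - s\<^sup>2) * ?a\<^sup>2 \<le> 5 * \<eta> * r ^ 4 * ?a\<^sup>2" by (rule mult_right_mono) simp
    moreover have "r\<^sup>2 / 2 * ?b\<^sup>2 \<le> s\<^sup>2 * ?b\<^sup>2"
    proof (rule mult_right_mono)
      have "r\<^sup>2 * (1 / 2) \<le> r\<^sup>2 * (1 - \<eta> * r\<^sup>2)" using e2 by (intro mult_left_mono) auto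
      then show "r\<^sup>2 / 2 \<le> s\<^sup>2" unfolding s2 by simp
    qed simp
    ultimately have "r\<^sup>2 / 2 * ?b\<^sup>2 \<le> 5 * \<eta> * r ^ 4 * ?a\<^sup>2" using B by linarith
    also have "\<dots> = r\<^sup>2 / 2 * (10 * \<eta> * r\<^sup>2 * ?a\<^sup>2)" by (simp add: power4_eq_xxxx power2_eq_square)
    finally have b: "?b\<^sup>2 \<le> 10 * \<eta> * r\<^sup>2 * ?a\<^sup>2" by (rule mult_left_le_imp_le) (use r in simp)
    have "(rad' r \<theta>)\<^sup>2 = ?R\<^sup>2 * (?b\<^sup>2 / ?a\<^sup>2)" by (simp add: rad'_def power_mult_distrib power_divide)
    also have "\<dots> \<le> (2 * r\<^sup>2) * (10 * \<eta> * r\<^sup>2)"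
      by (rule mult_mono) (use R(4) b pos in \<open>auto simp: divide_le_eq\<close>)
    also have "\<dots> = \<epsilon> * r ^ 4" using \<eta>(3) by (simp add: power4_eq_xxxx power2_eq_square)
    finally have C: "(rad' r \<theta>)\<^sup>2 \<le> \<epsilon> * r ^ 4" .
    have "4 * \<eta> * r ^ 4 \<le> \<epsilon> * r ^ 4" using \<eta>(2) by (rule mult_right_mono) simp
    then show ?thesis using A C by linarith
  qed
  then show ?thesis using r3 by blast
qed

text \<open>For v = R' polar + R polar' one has |v|^2 = R'^2 + R^2, and the cross product of the
  position with v is exactly R^2. The normal form and \<open>rad_close\<close> then give the squared
  speed r^2 (1 - K/3 r^2 + o(r^2)); the square root halves K/3 to K/6.\<close>

lemma lspeed_approx:
  assumes "0 < \<epsilon>"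
  shows "\<exists>r3>0. r3 \<le> r1 / 16 \<and> (\<forall>r \<theta>. 0 < r \<longrightarrow> r < r3 \<longrightarrow>
     \<bar>lspeed r \<theta> - r * (1 - K / 6 * r\<^sup>2)\<bar> \<le> \<epsilon> * r ^ 3)"
proof -
  define L where "L = \<bar>K\<bar> / 3"
  have L: "0 \<le> L" by (simp add: L_def)
  \<comment> \<open>The factor 10 + 3 L is the total error of the squared speed in units of \<eta>
    r^4, see \<open>X3\<close>; half of \<epsilon> is reserved for the square root.\<close>
  define \<eta> where "\<eta> = min 1 (\<epsilon> / (2 * (10 + 3 * L)))"
  have "(10 + 3 * L) * \<eta> \<le> (10 + 3 * L) * (\<epsilon> / (2 * (10 + 3 * L)))"
    using L by (intro mult_left_mono) (auto simp: \<eta>_def)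
  also have "\<dots> = \<epsilon> / 2" using L by (simp add: field_simps)
  finally have e2: "(10 + 3 * L) * \<eta> \<le> \<epsilon> / 2" .
  have \<eta>: "0 < \<eta>" "\<eta> \<le> 1" "(10 + 3 * L) * \<eta> \<le> \<epsilon> / 2"
    using assms L e2 by (simp_all add: \<eta>_def)
  obtain ra where ra: "0 < ra" "ra \<le> r1 / 16" "\<And>r \<theta>. 0 < r \<Longrightarrow> r < ra \<Longrightarrow> \<bar>(rad r \<theta>)\<^sup>2 - r\<^sup>2\<bar> \<le> \<eta> * r ^ 4"
     "\<And>r \<theta>. 0 < r \<Longrightarrow> r < ra \<Longrightarrow> (rad' r \<theta>)\<^sup>2 \<le> \<eta> * r ^ 4"
    using rad_close[OF \<eta>(1)] by blast
  obtain \<delta> where \<delta>: "0 < \<delta>" "\<And>q v. norm q < \<delta> \<Longrightarrow>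
     \<bar>qf (h q) v v - ((norm v)\<^sup>2 - K / 3 * (cross2 q v)\<^sup>2)\<bar> \<le> \<eta> * (norm q)\<^sup>2 * (norm v)\<^sup>2"
    using normal[OF \<eta>(1)] by blast
  \<comment> \<open>D r^2 will bound the relative deviation y of the squared speed, which keeps y
    within the range of \<open>sqrt_expand\<close> and its square of order r^4.\<close>
  define D where "D = 10 + 4 * L"
  have D: "0 < D" using L by (simp add: D_def)
  define r3 where "r3 = Min {ra, \<delta> / 2, 1, 1 / (2 * D), \<epsilon> / (2 * D\<^sup>2)}"
  have r3: "0 < r3" "r3 \<le> ra" "r3 \<le> \<delta> / 2" "r3 \<le> 1" "r3 \<le> 1 / (2 * D)" "r3 \<le> \<epsilon> / (2 * D\<^sup>2)"
    using ra(1) \<delta>(1) D assms by (auto simp: r3_def)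
  have "\<bar>lspeed r \<theta> - r * (1 - K / 6 * r\<^sup>2)\<bar> \<le> \<epsilon> * r ^ 3" if r: "0 < r" "r < r3" for r \<theta>
  proof -
    have rra: "r < ra" and r16: "r < r1 / 16" using r r3 ra by auto
    note R = rad[OF r(1) r16, of \<theta>]
    let ?R = "rad r \<theta>" and ?R' = "rad' r \<theta>"
    define v where "v = ?R' *\<^sub>R polar \<theta> + ?R *\<^sub>R polar' \<theta>"
    define X where "X = qf (h (?R *\<^sub>R polar \<theta>)) v v"
    have sc: "(cos \<theta>)\<^sup>2 = 1 - (sin \<theta>)\<^sup>2" by (simp add: cos_squared_eq)
    have nv: "(norm v)\<^sup>2 = ?R'\<^sup>2 + ?R\<^sup>2"
      unfolding norm_vec2 by (simp add: v_def power2_sum power2_diff power_mult_distrib sc algebra_simps)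
    have cr: "cross2 (?R *\<^sub>R polar \<theta>) v = ?R\<^sup>2"
    proof -
      have "cross2 (?R *\<^sub>R polar \<theta>) v = ?R\<^sup>2 * ((cos \<theta>)\<^sup>2 + (sin \<theta>)\<^sup>2)"
        unfolding cross2_def v_def
        by (simp only: vector_add_component vector_scaleR_component polar_nth real_scaleR_def) algebra
      then show ?thesis by simp
    qed
    have "?R\<^sup>2 < (2 * r)\<^sup>2" by (rule le_less_trans[OF R(4)]) (use r in \<open>simp add: power_mult_distrib\<close>)
    then have R2: "?R < 2 * r" by (rule power2_less_imp_less) (use r in simp)
    have "\<bar>X - ((norm v)\<^sup>2 - K / 3 * (?R\<^sup>2)\<^sup>2)\<bar> \<le> \<eta> * ?R\<^sup>2 * (norm v)\<^sup>2"
      using \<delta>(2)[of "?R *\<^sub>R polar \<theta>" v] R R2 r r3 unfolding X_def cr by simp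
    then have X1: "\<bar>X - (?R'\<^sup>2 + ?R\<^sup>2 - K / 3 * (?R\<^sup>2)\<^sup>2)\<bar> \<le> \<eta> * ?R\<^sup>2 * (?R'\<^sup>2 + ?R\<^sup>2)" unfolding nv .
    define P where "P = ?R\<^sup>2"
    define Q where "Q = ?R'\<^sup>2"
    define t where "t = r\<^sup>2"
    have t: "0 < t" "t \<le> 1" "r ^ 4 = t\<^sup>2" using r r3 by (auto simp: t_def power_le_one)
    have P: "\<bar>P - t\<bar> \<le> \<eta> * t\<^sup>2" "0 \<le> P" "P \<le> 2 * t" 
      using ra(3)[OF r(1) rra, of \<theta>] R(4) unfolding P_def[symmetric] t(3) t_def[symmetric] by (simp_all add: P_def)
    have Q: "0 \<le> Q" "Q \<le> \<eta> * t\<^sup>2" using ra(4)[OF r(1) rra, of \<theta>] unfolding Q_def[symmetric] t(3) by (simp_all add: Q_def)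
    have t2: "\<eta> * t\<^sup>2 \<le> t" using t \<eta> mult_mono[of \<eta> 1 t 1] by (simp add: power2_eq_square mult_le_cancel_right1 mult.assoc[symmetric])
    have X2: "\<bar>X - (Q + P - K / 3 * P\<^sup>2)\<bar> \<le> 6 * \<eta> * t\<^sup>2"
    proof -
      have "\<eta> * P * (Q + P) \<le> \<eta> * (2 * t) * (3 * t)"
        using P Q t2 \<eta> t by (intro mult_mono mult_left_mono) auto
      then show ?thesis using X1 unfolding P_def[symmetric] Q_def[symmetric] by (simp add: power2_eq_square)
    qed
    have P2: "\<bar>P\<^sup>2 - t\<^sup>2\<bar> \<le> 3 * \<eta> * t\<^sup>2"
    proof -
      have "P\<^sup>2 - t\<^sup>2 = (P - t) * (P + t)" by (simp add: power2_eq_square algebra_simps)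
      then have "\<bar>P\<^sup>2 - t\<^sup>2\<bar> = \<bar>P - t\<bar> * (P + t)" using P t by (simp add: abs_mult)
      also have "\<dots> \<le> (\<eta> * t\<^sup>2) * 3" using P t \<eta> by (intro mult_mono) auto
      finally show ?thesis by simp
    qed
    have KP: "\<bar>K / 3 * P\<^sup>2 - K / 3 * t\<^sup>2\<bar> \<le> L * (3 * \<eta> * t\<^sup>2)"
    proof -
      have "K / 3 * P\<^sup>2 - K / 3 * t\<^sup>2 = K / 3 * (P\<^sup>2 - t\<^sup>2)" by (simp add: algebra_simps)
      then have "\<bar>K / 3 * P\<^sup>2 - K / 3 * t\<^sup>2\<bar> = L * \<bar>P\<^sup>2 - t\<^sup>2\<bar>"
        by (simp only: L_def abs_mult abs_divide abs_numeral)
      also have "\<dots> \<le> L * (3 * \<eta> * t\<^sup>2)" using P2 L by (rule mult_left_mono)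
      finally show ?thesis .
    qed
    have X3: "\<bar>X - (t - K / 3 * t\<^sup>2)\<bar> \<le> (10 + 3 * L) * \<eta> * t\<^sup>2"
    proof -
      have "(10 + 3 * L) * \<eta> * t\<^sup>2 = 10 * (\<eta> * t\<^sup>2) + L * (3 * \<eta> * t\<^sup>2)" by (simp add: algebra_simps)
      moreover have "6 * \<eta> * t\<^sup>2 = 6 * (\<eta> * t\<^sup>2)" "0 \<le> \<eta> * t\<^sup>2" using \<eta> by simp_all
      ultimately show ?thesis using X2 KP P(1) Q by linarith
    qed
    define y where "y = X / t - 1"
    have y1: "\<bar>y + K / 3 * t\<bar> \<le> (10 + 3 * L) * \<eta> * t"
    proof -
      have "y + K / 3 * t = (X - (t - K / 3 * t\<^sup>2)) / t"
        using t by (simp add: y_def field_simps power2_eq_square)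
      then have "\<bar>y + K / 3 * t\<bar> = \<bar>X - (t - K / 3 * t\<^sup>2)\<bar> / t"
        using t(1) by (simp only: abs_divide abs_of_pos)
      also have "\<dots> \<le> (10 + 3 * L) * \<eta> * t\<^sup>2 / t" using X3 t by (intro divide_right_mono) auto
      finally show ?thesis using t by (simp add: power2_eq_square)
    qed
    have y2: "\<bar>y\<bar> \<le> D * t"
    proof -
      have "(10 + 3 * L) * \<eta> * t \<le> (10 + 3 * L) * 1 * t" using \<eta> L t by (intro mult_right_mono mult_left_mono) auto
      moreover have "\<bar>K / 3 * t\<bar> = L * t" using t by (simp add: L_def abs_mult)
      moreover have "D * t = (10 + 3 * L) * 1 * t + L * t" by (simp add: D_def algebra_simps)
      ultimately show ?thesis using y1 by linarith
    qed
    have tr: "t \<le> r" using r r3 by (simp add: t_def power2_eq_square mult_le_cancel_right1)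
    have Dt: "D * t \<le> 1 / 2"
    proof -
      have "D * t \<le> D * (1 / (2 * D))" using tr r r3 D by (intro mult_left_mono) auto
      then show ?thesis using D by simp
    qed
    have s: "\<bar>sqrt (1 + y) - (1 + y / 2)\<bar> \<le> y\<^sup>2" by (rule sqrt_expand) (use y2 Dt in linarith)
    have y3: "y\<^sup>2 \<le> \<epsilon> / 2 * t"
    proof -
      have "y\<^sup>2 \<le> (D * t)\<^sup>2" using power_mono[OF y2, of 2] by simp
      also have "\<dots> = (D\<^sup>2 * t) * t" by (simp add: power2_eq_square)
      also have "\<dots> \<le> (D\<^sup>2 * (\<epsilon> / (2 * D\<^sup>2))) * t" using tr r r3 t by (intro mult_right_mono mult_left_mono) auto
      finally show ?thesis using D by simp
    qed
    have s2: "\<bar>sqrt (1 + y) - (1 - K / 6 * t)\<bar> \<le> \<epsilon> * t"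
    proof -
      have "(10 + 3 * L) * \<eta> * t \<le> \<epsilon> / 2 * t" using \<eta>(3) t by (intro mult_right_mono) auto
      then show ?thesis using s y3 y1 by argo
    qed
    have "X = t * (1 + y)" using t by (simp add: y_def field_simps)
    then have "X = r\<^sup>2 * (1 + y)" by (simp only: t_def)
    then have "lspeed r \<theta> = r * sqrt (1 + y)"
      unfolding lspeed_def Let_def v_def[symmetric] X_def[symmetric] using r by (simp add: real_sqrt_mult)
    then have "\<bar>lspeed r \<theta> - r * (1 - K / 6 * r\<^sup>2)\<bar> = r * \<bar>sqrt (1 + y) - (1 - K / 6 * t)\<bar>"
      using r by (simp only: t_def abs_mult abs_of_pos right_diff_distrib[symmetric])
    also have "\<dots> \<le> r * (\<epsilon> * t)" using s2 r by (intro mult_left_mono) auto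
    finally show ?thesis by (simp add: t_def power2_eq_square power3_eq_cube mult_ac)
  qed
  then show ?thesis using r3 ra by (meson order_trans)
qed

lemma rad_cont_on:
  assumes r: "0 < r" "r < r1 / 16"
  shows "continuous_on UNIV (rad r)"
  using rad_cont[OF r] by (simp add: continuous_at_imp_continuous_on)

lemma lspeed_cont:
  assumes r: "0 < r" "r < r1 / 16"
  shows "continuous_on UNIV (lspeed r)"
proof -
  have "norm (rad r \<theta> *\<^sub>R polar \<theta>) < r0" for \<theta> using rad(1,2)[OF r, of \<theta>] r1 by simp
  then have "continuous_on UNIV (\<lambda>\<theta>. h (rad r \<theta> *\<^sub>R polar \<theta>))"
    by (intro continuous_on_compose2[OF cont] continuous_intros rad_cont_on[OF r]) auto
  then show ?thesis unfolding lspeed_def Let_def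
    by (intro continuous_intros rad_cont_on[OF r] rad'_cont[OF r])
qed

lemma lspeed_periodic: "lspeed r (\<theta> + 2 * pi) = lspeed r \<theta>"
  by (simp add: lspeed_def rad'_def rad_periodic polar_periodic)

lemma integral_lspeed:
  assumes "0 < \<epsilon>"
  shows "\<exists>r3>0. r3 \<le> r1 / 16 \<and> (\<forall>r. 0 < r \<longrightarrow> r < r3 \<longrightarrow>
     \<bar>integral {0..2 * pi} (lspeed r) - 2 * pi * r * (1 - K / 6 * r\<^sup>2)\<bar> \<le> \<epsilon> * r ^ 3)"
proof -
  have e: "0 < \<epsilon> / (2 * pi)" using assms by simp
  obtain r3 where r3: "0 < r3" "r3 \<le> r1 / 16" "\<And>r \<theta>. 0 < r \<Longrightarrow> r < r3 \<Longrightarrow>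
     \<bar>lspeed r \<theta> - r * (1 - K / 6 * r\<^sup>2)\<bar> \<le> \<epsilon> / (2 * pi) * r ^ 3"
    using lspeed_approx[OF e] by blast
  have "\<bar>integral {0..2 * pi} (lspeed r) - 2 * pi * r * (1 - K / 6 * r\<^sup>2)\<bar> \<le> \<epsilon> * r ^ 3" if r: "0 < r" "r < r3" for r
  proof -
    have c: "continuous_on {0..2*pi} (lspeed r)"
      by (rule continuous_on_subset[OF lspeed_cont[OF r(1)]]) (use r r3 in auto)
    have i: "lspeed r integrable_on {0..2*pi}" by (rule integrable_continuous_real[OF c])
    have "((\<lambda>\<theta>. lspeed r \<theta> - r * (1 - K / 6 * r\<^sup>2)) has_integral
       (integral {0..2 * pi} (lspeed r) - 2 * pi * (r * (1 - K / 6 * r\<^sup>2)))) {0..2*pi}"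
      using has_integral_diff[OF integrable_integral[OF i] has_integral_const_real[of "r * (1 - K / 6 * r\<^sup>2)" 0 "2*pi"]] by simp
    from has_integral_bound_real[OF _ finite.emptyI this, of "\<epsilon> / (2 * pi) * r ^ 3"]
    have "norm (integral {0..2 * pi} (lspeed r) - 2 * pi * (r * (1 - K / 6 * r\<^sup>2))) \<le> \<epsilon> / (2 * pi) * r ^ 3 * measure lborel {0..2*pi}"
      using r3(3)[OF r] r assms by simp
    then show ?thesis by (simp add: mult.assoc)
  qed
  then show ?thesis using r3 by blast
qed

end

section \<open>Lengths of piecewise C^1 paths in the disc\<close>

lemma qf_pullback: "qf (transpose J ** m ** J) v w = qf m (J *v v) (J *v w)"
  by (simp add: qf_def transpose_def inner_vec_def sum_2 matrix_vector_mult_def matrix_matrix_mult_def algebra_simps)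

lemma has_vector_derivative_eventually:
  assumes "(f has_vector_derivative f') (at t)" "\<forall>\<^sub>F s in nhds t. f s = g s"
  shows "(g has_vector_derivative f') (at t)"
  using has_vector_derivative_cong_ev[of UNIV f g t f'] assms eventually_nhds_x_imp_x[OF assms(2)]
  by simp

lemma finite_AE_lborel: "finite S \<Longrightarrow> AE t in lborel. (t::real) \<notin> S"
  by (rule AE_I'[of S]) (auto simp: finite_imp_null_set_lborel)

text \<open>\<open>path_length\<close> is a nonnegative integral that may be infinite, and the
  velocity of a piecewise C^1 path may be unbounded near a corner. A finite length takes the place
  of a velocity bound as the source of integrability.\<close>

lemma nn_integral_imp_integrable_on:
  fixes f :: "real \<Rightarrow> real"
  assumes "finite S" "continuous_on ({a..b} - S) f" "\<And>t. t \<in> {a..b} - S \<Longrightarrow> 0 \<le> f t"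
    and fin: "(\<integral>\<^sup>+t\<in>{a..b}. ennreal (f t) \<partial>lborel) < \<infinity>"
  shows "f integrable_on {a..b}" "(\<integral>\<^sup>+t\<in>{a..b}. ennreal (f t) \<partial>lborel) = ennreal (integral {a..b} f)"
proof -
  define f' where "f' = (\<lambda>t. if t \<in> {a..b} - S then f t else 0)"
  have m: "{a..b} - S \<in> sets borel" using assms(1) by (intro sets.Diff) (auto simp: finite_imp_closed)
  have f'm: "f' \<in> borel_measurable borel"
    unfolding f'_def by (rule borel_measurable_continuous_on_if[OF m assms(2)]) auto
  have eq: "(\<integral>\<^sup>+t. ennreal (f' t) \<partial>lborel) = (\<integral>\<^sup>+t\<in>{a..b}. ennreal (f t) \<partial>lborel)"
    by (rule nn_integral_cong_AE, use finite_AE_lborel[OF assms(1)] in eventually_elim) (auto simp: f'_def)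
  have f'0: "0 \<le> f' t" for t using assms(3) by (simp add: f'_def)
  obtain r where r: "0 \<le> r" "(\<integral>\<^sup>+t. ennreal (f' t) \<partial>lborel) = ennreal r"
    using fin eq by (cases "\<integral>\<^sup>+t. ennreal (f' t) \<partial>lborel") auto
  have "(f' has_integral r) UNIV"
    by (rule nn_integral_has_integral) (use f'm f'0 r in auto)
  then have "((\<lambda>t. if t \<in> {a..b} then f' t else 0) has_integral r) UNIV"
    by (rule has_integral_eq[rotated]) (auto simp: f'_def)
  then have "(f' has_integral r) {a..b}" by (simp only: has_integral_restrict_UNIV)
  then have "(f has_integral r) {a..b}"
    by (rule has_integral_spike_finite[OF assms(1), rotated]) (auto simp: f'_def)
  then show "f integrable_on {a..b}" "(\<integral>\<^sup>+t\<in>{a..b}. ennreal (f t) \<partial>lborel) = ennreal (integral {a..b} f)"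
    using eq r by (auto simp: integral_unique)
qed

lemma nn_integral_eq_integral_finite:
  fixes f :: "real \<Rightarrow> real"
  assumes "finite S" "f integrable_on {a..b}" "\<And>t. t \<in> {a..b} - S \<Longrightarrow> 0 \<le> f t"
  shows "(\<integral>\<^sup>+t\<in>{a..b}. ennreal (f t) \<partial>lborel) = ennreal (integral {a..b} f)"
proof -
  define f' where "f' = (\<lambda>t. if t \<in> S then 0 else f t)"
  have "(f' has_integral integral {a..b} f) {a..b}"
    by (rule has_integral_spike_finite[OF assms(1) _ integrable_integral[OF assms(2)]]) (auto simp: f'_def)
  from nn_integral_has_integral_lebesgue'[OF _ this] assms(3)
  have "(\<integral>\<^sup>+t. ennreal (f' t) * indicator {a..b} t \<partial>lborel) = ennreal (integral {a..b} f)" by (auto simp: f'_def)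
  moreover have "(\<integral>\<^sup>+t. ennreal (f' t) * indicator {a..b} t \<partial>lborel) = (\<integral>\<^sup>+t\<in>{a..b}. ennreal (f t) \<partial>lborel)"
    by (rule nn_integral_cong_AE, use finite_AE_lborel[OF assms(1)] in eventually_elim) (auto simp: f'_def)
  ultimately show ?thesis by simp
qed

text \<open>What a path of the surface becomes in coordinates: it differs from \<open>adm\<close> in
  having neither a prescribed starting point nor a bound on the velocity.\<close>

definition pwC1 :: "real \<Rightarrow> real \<Rightarrow> real set \<Rightarrow> (real \<Rightarrow> real^2) \<Rightarrow> (real \<Rightarrow> real^2) \<Rightarrow> bool" where
  "pwC1 a b S z w \<longleftrightarrow> finite S \<and> continuous_on {a..b} z \<and> continuous_on ({a..b} - S) w \<and>
     (\<forall>t\<in>{a..b} - S. (z has_vector_derivative w t) (at t))"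

context metric_disc
begin

lemma speed_cont:
  assumes "pwC1 a b S z w" "z ` {a..b} \<subseteq> ball 0 r0"
  shows "continuous_on ({a..b} - S) (\<lambda>t. sqrt (qf (h (z t)) (w t) (w t)))"
proof -
  have c: "continuous_on ({a..b} - S) z" "continuous_on ({a..b} - S) w"
    using assms(1) by (auto simp: pwC1_def intro: continuous_on_subset)
  have "continuous_on ({a..b} - S) (\<lambda>t. h (z t))"
    by (rule continuous_on_compose2[OF cont c(1)]) (use assms(2) in auto)
  then show ?thesis by (intro continuous_intros c)
qed

lemma speed_lower:
  assumes "q \<in> ball 0 r0"
  shows "norm v \<le> sqrt 2 * sqrt (qf (h q) v v)"
proof -
  have "(norm v)\<^sup>2 \<le> 2 * qf (h q) v v" using lower[OF assms, of v] by simp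
  then have "sqrt ((norm v)\<^sup>2) \<le> sqrt (2 * qf (h q) v v)" by (rule real_sqrt_le_mono)
  then show ?thesis by (simp add: real_sqrt_mult)
qed

lemma qf_nonneg: "q \<in> ball 0 r0 \<Longrightarrow> 0 \<le> qf (h q) v v"
  using lower[of q v] zero_le_power2[of "norm v"] by linarith

text \<open>Ellipticity bounds the Euclidean velocity by sqrt 2 times the speed; integrating it
  compares displacement with length. A path of infinite length is a separate, trivial case.\<close>

lemma length_lower_bound:
  assumes z: "pwC1 a b S z w" "z ` {a..b} \<subseteq> ball 0 r0" and "a \<le> b"
  shows "ennreal (norm (z b - z a) / sqrt 2) \<le> (\<integral>\<^sup>+t\<in>{a..b}. ennreal (sqrt (qf (h (z t)) (w t) (w t))) \<partial>lborel)"
proof (cases "(\<integral>\<^sup>+t\<in>{a..b}. ennreal (sqrt (qf (h (z t)) (w t) (w t))) \<partial>lborel) < \<infinity>")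
  case True
  let ?f = "\<lambda>t. sqrt (qf (h (z t)) (w t) (w t))"
  have fS: "finite S" using z(1) by (simp add: pwC1_def)
  have inb: "z t \<in> ball 0 r0" if "t \<in> {a..b}" for t using z(2) that by blast
  have nn: "0 \<le> ?f t" if "t \<in> {a..b} - S" for t using inb[of t] qf_nonneg that by simp
  note I = nn_integral_imp_integrable_on[OF fS speed_cont[OF z] nn True]
  have wi: "(w has_integral (z b - z a)) {a..b}"
    by (rule fundamental_theorem_of_calculus_strong[OF fS \<open>a \<le> b\<close>]) (use z(1) in \<open>auto simp: pwC1_def\<close>)
  define w' where "w' = (\<lambda>t. if t \<in> S then 0 else w t)"
  define f' where "f' = (\<lambda>t. if t \<in> S then 0 else sqrt 2 * ?f t)"
  have w'i: "(w' has_integral (z b - z a)) {a..b}"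
    by (rule has_integral_spike_finite[OF fS _ wi]) (auto simp: w'_def)
  have f'i: "(f' has_integral (sqrt 2 * integral {a..b} ?f)) {a..b}"
    by (rule has_integral_spike_finite[OF fS _ has_integral_mult_right[OF integrable_integral[OF I(1)]]]) (auto simp: f'_def)
  have "norm (integral {a..b} w') \<le> integral {a..b} f'"
  proof (rule integral_norm_bound_integral)
    fix t assume "t \<in> {a..b}"
    then show "norm (w' t) \<le> f' t" using speed_lower[OF inb, of t "w t"] by (simp add: w'_def f'_def)
  qed (use w'i f'i in auto)
  then have "norm (z b - z a) \<le> sqrt 2 * integral {a..b} ?f" using w'i f'i by (simp add: integral_unique)
  then have "norm (z b - z a) / sqrt 2 \<le> integral {a..b} ?f" by (simp add: field_simps)
  then have "ennreal (norm (z b - z a) / sqrt 2) \<le> ennreal (integral {a..b} ?f)" by (rule ennreal_leI)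
  also have "\<dots> = (\<integral>\<^sup>+t\<in>{a..b}. ennreal (?f t) \<partial>lborel)" using I(2) by simp
  finally show ?thesis .
next
  case False
  then have "(\<integral>\<^sup>+t\<in>{a..b}. ennreal (sqrt (qf (h (z t)) (w t) (w t))) \<partial>lborel) = top"
    by (simp add: less_top[symmetric])
  then show ?thesis by (metis top_greatest)
qed

text \<open>Parametrisation by arc length, perturbed by \<open>\<epsilon> t\<close> so that the new parameter is strictly
  increasing where the velocity vanishes.\<close>

lemma reparametrise:
  assumes z: "pwC1 0 1 S z w" "z ` {0..1} \<subseteq> ball 0 r0" "z 0 = 0" and "{0, 1} \<subseteq> S" and \<epsilon>: "0 < \<epsilon>"
    and i: "(\<lambda>t. sqrt (qf (h (z t)) (w t) (w t))) integrable_on {0..1}"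
    and L: "integral {0..1} (\<lambda>t. sqrt (qf (h (z t)) (w t) (w t))) = L"
  shows "\<exists>T p v B. adm T p v B \<and> p ` {0..1} \<subseteq> ball 0 r0 \<and> p 1 = z 1 \<and>
      (\<forall>t\<in>{0..1} - T. qf (h (p t)) (v t) (v t) \<le> (L + \<epsilon>)\<^sup>2)"
proof -
  let ?f = "\<lambda>t. sqrt (qf (h (z t)) (w t) (w t))"
  have fS: "finite S" using z(1) by (simp add: pwC1_def)
  have inb: "z t \<in> ball 0 r0" if "t \<in> {0..1}" for t using z(2) that by blast
  have nn: "0 \<le> ?f t" if "t \<in> {0..1}" for t using qf_nonneg[OF inb[OF that]] by simp
  have isub: "?f integrable_on {a..b}" if "0 \<le> a" "b \<le> 1" for a b
    by (rule integrable_on_subinterval[OF i]) (use that in auto)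
  define len where "len = L + \<epsilon>"
  define s where "s = (\<lambda>t. integral {0..t} ?f + \<epsilon> * t)"
  have s_mono: "s t < s u" if "0 \<le> t" "t < u" "u \<le> 1" for t u
  proof -
    have "integral {0..t} ?f \<le> integral {0..u} ?f"
      by (rule integral_subset_le) (use that isub nn in auto)
    then show ?thesis using that \<epsilon> by (simp add: s_def add_le_less_mono)
  qed
  have s_le: "s t \<le> s u" if "0 \<le> t" "t \<le> u" "u \<le> 1" for t u
    using s_mono[of t u] that by (cases "t = u") auto
  have s01: "s 0 = 0" "s 1 = len" using L by (auto simp: s_def len_def)
  have L0: "0 \<le> L" unfolding L[symmetric] by (rule integral_nonneg[OF i]) (use nn in auto)
  have len0: "0 < len" using L0 \<epsilon> by (simp add: len_def)
  have s_cont: "continuous_on {0..1} s" unfolding s_def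
    by (intro continuous_intros indefinite_integral_continuous_1 i)
  have s_inj: "inj_on s {0..1}"
    by (rule inj_onI) (metis atLeastAtMost_iff less_irrefl linorder_neqE_linordered_idom s_mono)
  have s_im: "s ` {0..1} = {0..len}"
  proof
    show "s ` {0..1} \<subseteq> {0..len}" using s_le[of 0] s_le[of _ 1] s01 by auto
    show "{0..len} \<subseteq> s ` {0..1}"
    proof
      fix y assume "y \<in> {0..len}"
      then have "\<exists>t\<ge>0. t \<le> 1 \<and> s t = y" using s01 s_cont by (intro IVT') auto
      then show "y \<in> s ` {0..1}" by auto
    qed
  qed
  define \<sigma> where "\<sigma> = inv_into {0..1} s"
  have \<sigma>s: "\<sigma> (s t) = t" if "t \<in> {0..1}" for t using s_inj that by (simp add: \<sigma>_def)
  have s\<sigma>: "s (\<sigma> y) = y" "\<sigma> y \<in> {0..1}" if "y \<in> {0..len}" for y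
    unfolding \<sigma>_def using that by (metis s_im f_inv_into_f, metis s_im inv_into_into)
  have \<sigma>_cont: "continuous_on {0..len} \<sigma>"
    using continuous_on_inv[OF s_cont compact_Icc, of \<sigma>] \<sigma>s s_im by simp
  have sd: "(s has_real_derivative (?f t + \<epsilon>)) (at t)" if t: "t \<in> {0..1} - S" for t
  proof -
    \<comment> \<open>The end points were put into \<open>S\<close>, so the remaining times are
      interior and the indefinite integral has a two-sided derivative there.\<close>
    have t01: "0 < t" "t < 1" using t assms(4) by (auto simp: order_less_le)
    define Op where "Op = {0<..<1} - S"
    have "open Op" unfolding Op_def by (intro open_Diff) (auto simp: fS finite_imp_closed)
    have tO: "t \<in> Op" using t t01 by (simp add: Op_def)
    have OS: "{0..1} - S = Op" using assms(4) by (auto simp: Op_def order_less_le)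
    have "continuous (at t within ({0..1} - S)) ?f"
      using speed_cont[OF z(1,2)] t by (simp add: continuous_on_eq_continuous_within)
    from integral_has_vector_derivative_continuous_at[OF i t fS this]
    have "((\<lambda>u. integral {0..u} ?f) has_vector_derivative ?f t) (at t within Op)" unfolding OS .
    then have "((\<lambda>u. integral {0..u} ?f) has_real_derivative ?f t) (at t)"
      using at_within_open[OF tO \<open>open Op\<close>] by (simp add: has_real_derivative_iff_has_vector_derivative)
    from DERIV_add[OF this DERIV_cmult[OF DERIV_ident, of \<epsilon>]] show ?thesis unfolding s_def by simp
  qed
  define T where "T = (\<lambda>t. s t / len) ` (S \<inter> {0..1})"
  define p where "p = (\<lambda>\<tau>. z (\<sigma> (len * \<tau>)))"
  \<comment> \<open>Chain rule: the inverse of \<open>s\<close> has derivative 1/(f + \<epsilon>),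
    and rescaling the parameter to the unit interval contributes \<open>len\<close>.\<close>
  define v where "v = (\<lambda>\<tau>. (len / (?f (\<sigma> (len * \<tau>)) + \<epsilon>)) *\<^sub>R w (\<sigma> (len * \<tau>)))"
  have lt: "len * \<tau> \<in> {0..len}" if "\<tau> \<in> {0..1}" for \<tau> using that len0 by (simp add: mult_left_le)
  have \<sigma>in: "\<sigma> (len * \<tau>) \<in> {0..1} - S" if \<tau>: "\<tau> \<in> {0..1} - T" for \<tau>
  proof -
    have a: "\<sigma> (len * \<tau>) \<in> {0..1}" "s (\<sigma> (len * \<tau>)) = len * \<tau>" using s\<sigma>[OF lt] \<tau> by auto
    have "\<sigma> (len * \<tau>) \<notin> S"
    proof
      assume "\<sigma> (len * \<tau>) \<in> S"
      then have "s (\<sigma> (len * \<tau>)) / len \<in> T" using a unfolding T_def by blast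
      then show False using a len0 \<tau> by simp
    qed
    then show ?thesis using a by simp
  qed
  have lin: "continuous_on X (\<lambda>\<tau>. len * \<tau>)" for X by (intro continuous_intros)
  have c\<sigma>: "continuous_on {0..1} (\<lambda>\<tau>. \<sigma> (len * \<tau>))"
    by (rule continuous_on_compose2[OF \<sigma>_cont lin]) (use lt in auto)
  have c\<sigma>T: "continuous_on ({0..1} - T) (\<lambda>\<tau>. \<sigma> (len * \<tau>))"
    by (rule continuous_on_subset[OF c\<sigma>]) auto
  have pc: "continuous_on {0..1} p" unfolding p_def
  proof (rule continuous_on_compose2[OF _ c\<sigma>])
    show "continuous_on {0..1} z" using z(1) by (simp add: pwC1_def)
  qed (use s\<sigma>(2)[OF lt] in auto)
  have fpos: "0 < ?f t + \<epsilon>" if "t \<in> {0..1} - S" for t 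
    using add_nonneg_pos[OF nn[of t] \<epsilon>] that by simp
  have vc: "continuous_on ({0..1} - T) v"
  proof -
    have 1: "continuous_on ({0..1} - T) (\<lambda>\<tau>. ?f (\<sigma> (len * \<tau>)))"
      by (rule continuous_on_compose2[OF speed_cont[OF z(1,2)] c\<sigma>T]) (use \<sigma>in in auto)
    have "continuous_on ({0..1} - S) w" using z(1) by (simp add: pwC1_def)
    then have 2: "continuous_on ({0..1} - T) (\<lambda>\<tau>. w (\<sigma> (len * \<tau>)))"
      by (rule continuous_on_compose2[OF _ c\<sigma>T]) (use \<sigma>in in auto)
    have 3: "?f (\<sigma> (len * \<tau>)) + \<epsilon> \<noteq> 0" if "\<tau> \<in> {0..1} - T" for \<tau>
      using fpos[OF \<sigma>in[OF that]] by (rule less_imp_neq[THEN not_sym])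
    show ?thesis unfolding v_def
      by (intro continuous_on_scaleR continuous_on_divide continuous_on_add continuous_on_const ballI 1 2 3)
  qed
  have pd: "(p has_vector_derivative v \<tau>) (at \<tau>)" if \<tau>: "\<tau> \<in> {0..1} - T" for \<tau>
  proof -
    let ?t = "\<sigma> (len * \<tau>)"
    have t: "?t \<in> {0..1} - S" by (rule \<sigma>in[OF \<tau>])
    have t01: "0 < ?t" "?t < 1" using t assms(4) by (auto simp: order_less_le)
    have st: "s ?t = len * \<tau>" using s\<sigma>(1)[OF lt] \<tau> by simp
    have y: "0 < len * \<tau>" "len * \<tau> < len" using s_mono[of 0 ?t] s_mono[of ?t 1] t01 s01 st by auto
    have "isCont \<sigma> (len * \<tau>)"
      by (rule continuous_on_interior[OF \<sigma>_cont]) (use y in simp)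
    then have "(\<sigma> has_real_derivative inverse (?f ?t + \<epsilon>)) (at (len * \<tau>))"
      by (intro DERIV_inverse_function[where f=s and a=0 and b=len])
         (use sd[OF t] fpos[OF t] y s\<sigma>(1) in auto)
    from DERIV_chain2[OF this DERIV_cmult[OF DERIV_ident]]
    have "((\<lambda>\<tau>. \<sigma> (len * \<tau>)) has_real_derivative len / (?f ?t + \<epsilon>)) (at \<tau>)" by (simp add: divide_inverse mult.commute)
    moreover have "(z has_vector_derivative w ?t) (at ?t)" using z(1) t by (simp add: pwC1_def)
    ultimately have "((z \<circ> (\<lambda>\<tau>. \<sigma> (len * \<tau>))) has_vector_derivative (len / (?f ?t + \<epsilon>)) *\<^sub>R w ?t) (at \<tau>)"
      by (intro vector_diff_chain_at) (simp_all add: has_real_derivative_iff_has_vector_derivative)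
    then show ?thesis by (simp add: p_def v_def o_def)
  qed
  have pin: "p \<tau> \<in> ball 0 r0" if "\<tau> \<in> {0..1}" for \<tau> unfolding p_def by (rule inb[OF s\<sigma>(2)[OF lt[OF that]]])
  have vq: "qf (h (p \<tau>)) (v \<tau>) (v \<tau>) \<le> len\<^sup>2" if \<tau>: "\<tau> \<in> {0..1} - T" for \<tau>
  proof -
    let ?t = "\<sigma> (len * \<tau>)"
    have t: "?t \<in> {0..1} - S" by (rule \<sigma>in[OF \<tau>])
    have "qf (h (p \<tau>)) (v \<tau>) (v \<tau>) = len\<^sup>2 * ((?f ?t)\<^sup>2 / (?f ?t + \<epsilon>)\<^sup>2)"
      using qf_nonneg[OF inb, of ?t "w ?t"] t
      by (simp add: p_def v_def qf_simps power_divide power2_eq_square[of "len"] power2_eq_square[of "_ + \<epsilon>"])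
    also have "\<dots> \<le> len\<^sup>2 * 1"
    proof (rule mult_left_mono)
      have "(?f ?t)\<^sup>2 \<le> (?f ?t + \<epsilon>)\<^sup>2" using nn[of ?t] t \<epsilon> by (intro power_mono) auto
      then show "(?f ?t)\<^sup>2 / (?f ?t + \<epsilon>)\<^sup>2 \<le> 1" using fpos[OF t] by (simp add: divide_le_eq)
    qed simp
    finally show ?thesis by simp
  qed
  have vB: "norm (v \<tau>) \<le> sqrt 2 * len" if \<tau>: "\<tau> \<in> {0..1} - T" for \<tau>
  proof -
    have "norm (v \<tau>) \<le> sqrt 2 * sqrt (qf (h (p \<tau>)) (v \<tau>) (v \<tau>))" using speed_lower[OF pin] \<tau> by blast
    also have "\<dots> \<le> sqrt 2 * sqrt (len\<^sup>2)" using vq[OF \<tau>] by (intro mult_left_mono real_sqrt_le_mono) auto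
    finally show ?thesis using len0 by simp
  qed
  have p01: "p 0 = 0" "p 1 = z 1" using \<sigma>s[of 0] \<sigma>s[of 1] s01 z(3) by (auto simp: p_def)
  have "adm T p v (sqrt 2 * len)" unfolding adm_def
    using pc vc pd vB p01 fS by (auto simp: T_def)
  then show ?thesis using pin vq p01 unfolding len_def by blast
qed

end

section \<open>From the disc to the surface\<close>

text \<open>Cramer's formula for the inverse matrix applied to a vector, written out so that
  continuity in the matrix is immediate.\<close>

definition inv2 :: "real^2^2 \<Rightarrow> real^2 \<Rightarrow> real^2" where
  "inv2 m v = (1 / det m) *\<^sub>R ((m$2$2 * v$1 - m$1$2 * v$2) *\<^sub>R axis 1 1 + (m$1$1 * v$2 - m$2$1 * v$1) *\<^sub>R axis 2 1)"

lemma inv2_left: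
  assumes "det m \<noteq> 0"
  shows "inv2 m (m *v v) = v"
proof -
  have "m$2$2 * (m *v v)$1 - m$1$2 * (m *v v)$2 = det m * v$1" "m$1$1 * (m *v v)$2 - m$2$1 * (m *v v)$1 = det m * v$2"
    by (simp_all add: matrix_vector_mult_def sum_2 det_2 algebra_simps)
  then show ?thesis using assms by (simp add: inv2_def vec_eq_iff forall_2 axis_def)
qed

lemma linear_inv2: "linear (inv2 m)"
  by (rule linearI) (simp_all add: inv2_def algebra_simps)

lemma continuous_on_inv2 [continuous_intros]:
  assumes "continuous_on S m" "continuous_on S v" "\<And>t. t \<in> S \<Longrightarrow> det (m t) \<noteq> 0"
  shows "continuous_on S (\<lambda>t. inv2 (m t) (v t))"
  using assms(3) unfolding inv2_def det_2 by (intro continuous_intros assms(1,2)) auto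

text \<open>\<open>\<pi>\<close> parametrises the neighbourhood \<open>U\<close> of \<open>x\<close>
  by the disc, \<open>\<zeta>\<close> is its inverse, and \<open>J d\<close> is the Jacobian matrix
  of \<open>\<pi>\<close> seen in the chart \<open>d\<close>. Every chart of the atlas occurs, since
  \<open>speed\<close> uses an unspecified chart and \<open>area\<close> cuts along arbitrary
  ones.\<close>

locale surface_chart = metric_disc h r0 M for h r0 M +
  fixes A :: "'a::{t2_space, second_countable_topology} chart set" and G :: "'a metric" and x :: 'a
    and c :: "'a chart" and U :: "'a set" and \<zeta> :: "'a \<Rightarrow> real^2" and \<pi> :: "real^2 \<Rightarrow> 'a"
    and J :: "'a chart \<Rightarrow> real^2 \<Rightarrow> real^2^2"
  assumes is_chart: "d \<in> A \<Longrightarrow> is_chart d"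
    and c: "c \<in> A" "U \<subseteq> dom_of c" "open U"
    and hom: "homeomorphism U (ball 0 r0) \<zeta> \<pi>"
    and pi0: "\<pi> 0 = x"
    and J: "d \<in> A \<Longrightarrow> z \<in> ball 0 r0 \<Longrightarrow> \<pi> z \<in> dom_of d \<Longrightarrow>
      ((coord d \<circ> \<pi>) has_derivative (\<lambda>v. J d z *v v)) (at z)"
    and J_cont: "d \<in> A \<Longrightarrow> continuous_on {z \<in> ball 0 r0. \<pi> z \<in> dom_of d} (J d)"
    and metric: "d \<in> A \<Longrightarrow> z \<in> ball 0 r0 \<Longrightarrow> \<pi> z \<in> dom_of d \<Longrightarrow>
      h z = transpose (J d z) ** G d (\<pi> z) ** J d z"
begin

lemma pi_cont: "continuous_on (ball 0 r0) \<pi>" and zeta_cont: "continuous_on U \<zeta>"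
  and pi_im: "\<pi> ` ball 0 r0 = U" and zeta_im: "\<zeta> ` U = ball 0 r0"
  using hom by (auto simp: homeomorphism_def)

lemma zp [simp]: "z \<in> ball 0 r0 \<Longrightarrow> \<zeta> (\<pi> z) = z" and pz [simp]: "p \<in> U \<Longrightarrow> \<pi> (\<zeta> p) = p"
  using hom by (auto simp: homeomorphism_def)

lemma pi_in: "z \<in> ball 0 r0 \<Longrightarrow> \<pi> z \<in> U" and zeta_in: "p \<in> U \<Longrightarrow> \<zeta> p \<in> ball 0 r0"
  using pi_im zeta_im by blast+

lemma U_carrier: "U \<subseteq> carrier A" using c by (auto simp: carrier_def)

lemma pi_open: "open S \<Longrightarrow> S \<subseteq> ball 0 r0 \<Longrightarrow> open (\<pi> ` S)"
proof -
  assume S: "open S" "S \<subseteq> ball 0 r0"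
  have "\<pi> ` S = U \<inter> \<zeta> -` S" using S pi_in zeta_in by (force simp: image_iff)
  then show ?thesis using continuous_open_preimage[OF zeta_cont c(3) S(1)] by simp
qed

text \<open>A vector in the kernel would have length 0 for \<open>h\<close>, against
  \<open>lower\<close>.\<close>

lemma J_inj:
  assumes "d \<in> A" "z \<in> ball 0 r0" "\<pi> z \<in> dom_of d"
  shows "det (J d z) \<noteq> 0"
proof -
  have "v = 0" if "J d z *v v = 0" for v
  proof -
    have "qf (h z) v v = 0" unfolding metric[OF assms] qf_pullback using that by simp
    then have "(norm v)\<^sup>2 / 2 \<le> 0" using lower[OF assms(2), of v] by simp
    then show ?thesis by simp
  qed
  then have "invertible (J d z)" 
    using matrix_left_invertible_ker[of "J d z"] invertible_left_inverse by blast
  then show ?thesis by (simp add: invertible_det_nz)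
qed

text \<open>A continuous inverse of a map with invertible derivative is differentiable. This is what
  carries the velocity of a path, known in the chart \<open>c\<close>, into the disc.\<close>

lemma chart_deriv:
  assumes p: "p \<in> U"
  shows "((\<zeta> \<circ> param c) has_derivative inv2 (J c (\<zeta> p))) (at (coord c p))"
proof (rule has_derivative_inverse_basic[where f="coord c \<circ> \<pi>" and T="coord c ` U"])
  have hc: "homeomorphism (dom_of c) (coord c ` dom_of c) (coord c) (param c)" and oc: "open (coord c ` dom_of c)"
    using is_chart[OF c(1)] by (auto simp: is_chart_def)
  have pc: "p \<in> dom_of c" using p c by auto
  have inv: "param c (coord c q) = q" if "q \<in> U" for q
    using hc that c(2) by (auto simp: homeomorphism_def)
  show "((coord c \<circ> \<pi>) has_derivative (\<lambda>v. J c (\<zeta> p) *v v)) (at ((\<zeta> \<circ> param c) (coord c p)))"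
    using J[OF c(1) zeta_in[OF p]] p pc inv by simp
  show "bounded_linear (inv2 (J c (\<zeta> p)))" by (simp add: linear_inv2 linear_conv_bounded_linear[symmetric])
  show "inv2 (J c (\<zeta> p)) \<circ> (\<lambda>v. J c (\<zeta> p) *v v) = id"
    using inv2_left[OF J_inj[OF c(1) zeta_in[OF p]]] p pc by (simp add: fun_eq_iff)
  have co: "openin (top_of_set (coord c ` dom_of c)) (coord c ` U)"
    by (rule homeomorphism_imp_open_map[OF hc open_subset[OF c(2,3)]])
  then show "open (coord c ` U)" using oc openin_open_trans by blast
  have "continuous_on (coord c ` U) (\<zeta> \<circ> param c)"
  proof (rule continuous_on_compose)
    show "continuous_on (coord c ` U) (param c)"
      by (rule continuous_on_subset[of "coord c ` dom_of c"]) (use hc c(2) in \<open>auto simp: homeomorphism_def\<close>)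
    show "continuous_on (param c ` coord c ` U) \<zeta>"
      by (rule continuous_on_subset[OF zeta_cont]) (use inv in auto)
  qed
  then show "continuous (at (coord c p)) (\<zeta> \<circ> param c)"
    using continuous_on_eq_continuous_at[OF \<open>open (coord c ` U)\<close>] p by blast
  show "coord c p \<in> coord c ` U" using p by simp
  show "(coord c \<circ> \<pi>) ((\<zeta> \<circ> param c) z) = z" if "z \<in> coord c ` U" for z using that inv by auto
qed

lemma path_eventually_in:
  assumes "path \<gamma>" "0 < t" "t < 1" "\<gamma> t \<in> S" "open S"
  shows "\<forall>\<^sub>F s in nhds t. \<gamma> s \<in> S"
proof -
  have "continuous_on {0<..<1} \<gamma>" using assms(1) by (auto simp: path_def intro: continuous_on_subset)
  then have "open ({0<..<1} \<inter> \<gamma> -` S)" using assms(5) by (intro continuous_open_preimage) auto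
  then show ?thesis unfolding eventually_nhds using assms by (intro exI[of _ "{0<..<1} \<inter> \<gamma> -` S"]) auto
qed

text \<open>The chart inside \<open>speed\<close> is chosen by SOME; as the law
  \<open>metric\<close> holds for every chart, the choice drops out.\<close>

lemma speed_chart:
  assumes t: "\<forall>\<^sub>F s in nhds t. \<gamma> s \<in> U" and w: "((\<zeta> \<circ> \<gamma>) has_vector_derivative w) (at t)"
  shows "speed A G \<gamma> t = sqrt (qf (h (\<zeta> (\<gamma> t))) w w)"
proof -
  have tU: "\<gamma> t \<in> U" using eventually_nhds_x_imp_x[OF t] .
  define d where "d = (SOME d. d \<in> A \<and> \<gamma> t \<in> dom_of d)"
  have "c \<in> A \<and> \<gamma> t \<in> dom_of c" using tU c by auto
  then have d: "d \<in> A" "\<gamma> t \<in> dom_of d" unfolding d_def by (metis (mono_tags, lifting) someI_ex)+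
  let ?z = "\<zeta> (\<gamma> t)"
  have z: "?z \<in> ball 0 r0" "\<pi> ?z \<in> dom_of d" using zeta_in[OF tU] d tU by auto
  have "((coord d \<circ> \<pi>) \<circ> (\<zeta> \<circ> \<gamma>) has_vector_derivative J d ?z *v w) (at t)"
    using vector_derivative_diff_chain_within[OF w, of "coord d \<circ> \<pi>" "\<lambda>v. J d ?z *v v"] J[OF d(1) z]
    by (auto simp: has_derivative_at_withinI)
  then have "((coord d \<circ> \<gamma>) has_vector_derivative J d ?z *v w) (at t)"
    by (rule has_vector_derivative_eventually) (use t in \<open>auto elim: eventually_mono\<close>)
  then have "vector_derivative (coord d \<circ> \<gamma>) (at t) = J d ?z *v w" by (rule vector_derivative_at)
  then show ?thesis
    unfolding speed_def d_def[symmetric] Let_def metric[OF d(1) z] qf_pullback using tU by (simp add: qf_def)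
qed

text \<open>The path lies in the domain of \<open>c\<close>, so its coordinates there are piecewise
  C^1, and \<open>chart_deriv\<close> turns their derivative into a velocity in the disc. The end
  points join the exceptional set so that only interior times remain.\<close>

lemma path_out:
  assumes \<gamma>: "pw_C1_path A \<gamma>" and ab: "0 \<le> a" "a < b" "b \<le> 1" and im: "\<gamma> ` {a..b} \<subseteq> U"
  obtains S w where "pwC1 a b S (\<zeta> \<circ> \<gamma>) w" "{a, b} \<subseteq> S"
    "\<And>t. t \<in> {a..b} - S \<Longrightarrow> speed A G \<gamma> t = sqrt (qf (h (\<zeta> (\<gamma> t))) (w t) (w t))"
proof -
  have "(coord c \<circ> \<gamma>) piecewise_C1_differentiable_on {a..b}"
    using \<gamma> c im ab unfolding pw_C1_path_def by (meson order_trans)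
  then obtain T D where T: "finite T" "\<And>t. t \<in> {a..b} - T \<Longrightarrow> ((coord c \<circ> \<gamma>) has_vector_derivative D t) (at t)"
      "continuous_on ({a..b} - T) D"
    unfolding piecewise_C1_differentiable_on_def C1_differentiable_on_def by blast
  define S where "S = T \<union> {a, b}"
  define w where "w = (\<lambda>t. inv2 (J c (\<zeta> (\<gamma> t))) (D t))"
  have path: "path \<gamma>" using \<gamma> by (simp add: pw_C1_path_def)
  have gc: "continuous_on {a..b} \<gamma>" using path ab by (auto simp: path_def intro: continuous_on_subset)
  have zc: "continuous_on {a..b} (\<zeta> \<circ> \<gamma>)"
    by (rule continuous_on_compose[OF gc continuous_on_subset[OF zeta_cont im]])
  have gU: "\<gamma> t \<in> U" if "t \<in> {a..b}" for t using im that by blast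
  have ev: "\<forall>\<^sub>F s in nhds t. \<gamma> s \<in> U" if "t \<in> {a..b} - S" for t
    by (rule path_eventually_in[OF path]) (use that ab gU c(3) in \<open>auto simp: S_def order_less_le\<close>)
  have zd: "((\<zeta> \<circ> \<gamma>) has_vector_derivative w t) (at t)" if t: "t \<in> {a..b} - S" for t
  proof -
    have tU: "\<gamma> t \<in> U" using gU t by blast
    have Tt: "((coord c \<circ> \<gamma>) has_vector_derivative D t) (at t)" using T(2) t by (simp add: S_def)
    have "((\<zeta> \<circ> param c) \<circ> (coord c \<circ> \<gamma>) has_vector_derivative w t) (at t)"
      using vector_derivative_diff_chain_within[OF Tt, of "\<zeta> \<circ> param c" "inv2 (J c (\<zeta> (\<gamma> t)))"] chart_deriv[OF tU]
      by (simp add: has_derivative_at_withinI w_def)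
    moreover have "param c (coord c q) = q" if "q \<in> U" for q
      using is_chart[OF c(1)] c(2) that by (auto simp: is_chart_def homeomorphism_def)
    ultimately show ?thesis
      by (rule_tac has_vector_derivative_eventually) (use ev[OF t] in \<open>auto elim: eventually_mono\<close>)
  qed
  have "continuous_on ({a..b} - S) w" unfolding w_def
  proof (rule continuous_on_inv2)
    have "continuous_on ({a..b} - S) (\<zeta> \<circ> \<gamma>)" by (rule continuous_on_subset[OF zc]) auto
    then have "continuous_on ({a..b} - S) (\<lambda>t. \<zeta> (\<gamma> t))" by (simp add: o_def)
    then show "continuous_on ({a..b} - S) (\<lambda>t. J c (\<zeta> (\<gamma> t)))"
      by (rule continuous_on_compose2[OF J_cont[OF c(1)]]) (use gU zeta_in c(2) in auto)
    show "continuous_on ({a..b} - S) D" by (rule continuous_on_subset[OF T(3)]) (auto simp: S_def)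
    show "det (J c (\<zeta> (\<gamma> t))) \<noteq> 0" if "t \<in> {a..b} - S" for t
      by (rule J_inj[OF c(1)]) (use that gU zeta_in c(2) in auto)
  qed
  then have "pwC1 a b S (\<zeta> \<circ> \<gamma>) w" using T(1) zc zd by (simp add: pwC1_def S_def)
  then show thesis using that[of S w] speed_chart[OF ev zd] by (simp add: S_def)
qed

text \<open>The converse transfer. Piecewise differentiability must be checked in every chart that
  the path meets, and the Jacobian matrices \<open>J d\<close> supply the derivative there.\<close>

lemma path_in:
  assumes p: "pwC1 0 1 S p w" "p ` {0..1} \<subseteq> ball 0 r0"
  shows "pw_C1_path A (\<pi> \<circ> p)"
    and "path_length A G (\<pi> \<circ> p) = (\<integral>\<^sup>+t\<in>{0..1}. ennreal (sqrt (qf (h (p t)) (w t) (w t))) \<partial>lborel)"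
proof -
  have pc: "continuous_on {0..1} p" using p(1) by (simp add: pwC1_def)
  have fS: "finite S" using p(1) by (simp add: pwC1_def)
  have pin: "p t \<in> ball 0 r0" if "t \<in> {0..1}" for t using p(2) that by blast
  have cont: "continuous_on {0..1} (\<pi> \<circ> p)"
    by (rule continuous_on_compose[OF pc continuous_on_subset[OF pi_cont p(2)]])
  have im: "(\<pi> \<circ> p) ` {0..1} \<subseteq> U" using pin pi_in by auto
  have D: "((coord d \<circ> (\<pi> \<circ> p)) has_vector_derivative J d (p t) *v w t) (at t)"
    if "d \<in> A" "t \<in> {0..1} - S" "\<pi> (p t) \<in> dom_of d" for d t
  proof -
    have pt: "(p has_vector_derivative w t) (at t)" using p(1) that by (simp add: pwC1_def)
    have "((coord d \<circ> \<pi>) has_derivative (\<lambda>v. J d (p t) *v v)) (at (p t))"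
      by (rule J) (use that pin in auto)
    then show ?thesis
      using vector_derivative_diff_chain_within[OF pt, of "coord d \<circ> \<pi>" "\<lambda>v. J d (p t) *v v"]
      by (simp add: has_derivative_at_withinI comp_assoc)
  qed
  show "pw_C1_path A (\<pi> \<circ> p)" unfolding pw_C1_path_def
  proof (intro conjI ballI allI impI)
    show "path (\<pi> \<circ> p)" using cont by (simp add: path_def)
    show "path_image (\<pi> \<circ> p) \<subseteq> carrier A" using im U_carrier by (auto simp: path_image_def)
    fix d a b assume d: "d \<in> A" and ab: "0 \<le> a \<and> a < b \<and> b \<le> 1 \<and> (\<pi> \<circ> p) ` {a..b} \<subseteq> dom_of d"
    have sub: "{a..b} \<subseteq> {0..1}" using ab by auto
    have dm: "\<pi> (p t) \<in> dom_of d" if "t \<in> {a..b}" for t using ab that by auto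
    have "continuous_on {a..b} (coord d \<circ> (\<pi> \<circ> p))"
    proof (rule continuous_on_compose)
      show "continuous_on {a..b} (\<pi> \<circ> p)" by (rule continuous_on_subset[OF cont sub])
      show "continuous_on ((\<pi> \<circ> p) ` {a..b}) (coord d)"
        by (rule continuous_on_subset[of "dom_of d"]) (use is_chart[OF d] ab in \<open>auto simp: is_chart_def homeomorphism_def\<close>)
    qed
    moreover have "(coord d \<circ> (\<pi> \<circ> p)) C1_differentiable_on ({a..b} - S)"
      unfolding C1_differentiable_on_def
    proof (intro exI[of _ "\<lambda>t. J d (p t) *v w t"] conjI ballI)
      fix t assume "t \<in> {a..b} - S"
      then show "((coord d \<circ> (\<pi> \<circ> p)) has_vector_derivative J d (p t) *v w t) (at t)"
        using D[OF d, of t] dm sub by blast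
    next
      have c1: "continuous_on ({a..b} - S) p" by (rule continuous_on_subset[OF pc]) (use sub in auto)
      have c2: "continuous_on ({a..b} - S) (\<lambda>t. J d (p t))"
        by (rule continuous_on_compose2[OF J_cont[OF d] c1]) (use pin sub dm in auto)
      have c3: "continuous_on ({a..b} - S) w"
        by (rule continuous_on_subset[of "{0..1} - S"]) (use p(1) sub in \<open>auto simp: pwC1_def\<close>)
      have "continuous_on ({a..b} - S) (\<lambda>t. (\<chi> i. \<Sum>j\<in>UNIV. J d (p t) $ i $ j * w t $ j))"
        by (intro continuous_intros c2 c3)
      then show "continuous_on ({a..b} - S) (\<lambda>t. J d (p t) *v w t)" by (simp add: matrix_vector_mult_def)
    qed
    ultimately show "(coord d \<circ> (\<pi> \<circ> p)) piecewise_C1_differentiable_on {a..b}"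
      unfolding piecewise_C1_differentiable_on_def using fS by blast
  qed
  then have path: "path (\<pi> \<circ> p)" by (simp add: pw_C1_path_def)
  show "path_length A G (\<pi> \<circ> p) = (\<integral>\<^sup>+t\<in>{0..1}. ennreal (sqrt (qf (h (p t)) (w t) (w t))) \<partial>lborel)"
    unfolding path_length_def
  proof (rule nn_integral_cong_AE)
    have "AE t in lborel. t \<notin> S \<union> {0, 1::real}" using fS by (intro finite_AE_lborel) simp
    then show "AE t in lborel. ennreal (speed A G (\<pi> \<circ> p) t) * indicator {0..1} t
        = ennreal (sqrt (qf (h (p t)) (w t) (w t))) * indicator {0..1} t"
  proof eventually_elim
    fix t assume t: "t \<notin> S \<union> {0, 1}"
    show "ennreal (speed A G (\<pi> \<circ> p) t) * indicator {0..1} t = ennreal (sqrt (qf (h (p t)) (w t) (w t))) * indicator {0..1} t"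
    proof (cases "t \<in> {0..1}")
      case True
      then have t': "0 < t" "t < 1" "t \<in> {0..1} - S" using t by auto
      have ev: "\<forall>\<^sub>F s in nhds t. (\<pi> \<circ> p) s \<in> U"
        by (rule path_eventually_in[OF path t'(1,2) _ c(3)]) (use im True in auto)
      have "\<forall>\<^sub>F s in nhds t. s \<in> {0<..<1}" using t' by (intro eventually_nhds_in_open) auto
      then have "\<forall>\<^sub>F s in nhds t. p s = (\<zeta> \<circ> (\<pi> \<circ> p)) s"
        by eventually_elim (use pin in auto)
      moreover have "(p has_vector_derivative w t) (at t)" using p(1) t' by (simp add: pwC1_def)
      ultimately have "((\<zeta> \<circ> (\<pi> \<circ> p)) has_vector_derivative w t) (at t)"
        by (rule_tac has_vector_derivative_eventually)
      from speed_chart[OF ev this] show ?thesis using pin True by simp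
    qed simp
  qed
  qed
qed

end

section \<open>Geodesic distance, balls and spheres in the coordinates of the disc\<close>

context surface_chart
begin

lemma path_length_ge:
  assumes \<gamma>: "pw_C1_path A \<gamma>" and ab: "0 \<le> a" "a < b" "b \<le> 1" and im: "\<gamma> ` {a..b} \<subseteq> U"
  shows "ennreal (norm (\<zeta> (\<gamma> b) - \<zeta> (\<gamma> a)) / sqrt 2) \<le> path_length A G \<gamma>"
proof -
  obtain S w where S: "pwC1 a b S (\<zeta> \<circ> \<gamma>) w" "{a, b} \<subseteq> S"
    "\<And>t. t \<in> {a..b} - S \<Longrightarrow> speed A G \<gamma> t = sqrt (qf (h (\<zeta> (\<gamma> t))) (w t) (w t))"
    by (rule path_out[OF assms]) blast
  have fS: "finite S" using S(1) by (simp add: pwC1_def)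
  have im': "(\<zeta> \<circ> \<gamma>) ` {a..b} \<subseteq> ball 0 r0"
  proof
    fix y assume "y \<in> (\<zeta> \<circ> \<gamma>) ` {a..b}"
    then obtain t where "t \<in> {a..b}" "y = \<zeta> (\<gamma> t)" by auto
    then show "y \<in> ball 0 r0" using im zeta_in by blast
  qed
  have "ennreal (norm ((\<zeta> \<circ> \<gamma>) b - (\<zeta> \<circ> \<gamma>) a) / sqrt 2)
      \<le> (\<integral>\<^sup>+t\<in>{a..b}. ennreal (sqrt (qf (h ((\<zeta> \<circ> \<gamma>) t)) (w t) (w t))) \<partial>lborel)"
    by (rule length_lower_bound[OF S(1) im']) (use ab in auto)
  also have "\<dots> \<le> path_length A G \<gamma>" unfolding path_length_def
  proof (rule nn_integral_mono_AE, use finite_AE_lborel[OF fS] in eventually_elim)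
    fix t assume "t \<notin> S"
    then show "ennreal (sqrt (qf (h ((\<zeta> \<circ> \<gamma>) t)) (w t) (w t))) * indicator {a..b} t
        \<le> ennreal (speed A G \<gamma> t) * indicator {0..1} t"
      using S(3)[of t] ab by (auto simp: indicator_def)
  qed
  finally show ?thesis by simp
qed

text \<open>Until the first time \<open>b\<close> outside the open disc the path stays in the closed
  one, and at time \<open>b\<close> its coordinate has norm exactly \<open>s\<close>; so the
  displacement is \<open>s\<close> and \<open>path_length_ge\<close> applies.\<close>

lemma exit_length:
  assumes \<gamma>: "pw_C1_path A \<gamma>" "\<gamma> 0 = x" and s: "0 < s" "s < r0" and t0: "t0 \<in> {0..1}" "\<gamma> t0 \<notin> \<pi> ` ball 0 s"
  shows "ennreal (s / sqrt 2) \<le> path_length A G \<gamma>"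
proof -
  have gc: "continuous_on {0..1} \<gamma>" using \<gamma>(1) by (simp add: pw_C1_path_def path_def)
  have ob: "open (\<pi> ` ball 0 s)" by (rule pi_open) (use s in auto)
  define N where "N = {0..1} \<inter> \<gamma> -` (- \<pi> ` ball 0 s)"
  have "closed N" unfolding N_def by (intro continuous_closed_preimage gc) (use ob in auto)
  then have "compact N" unfolding N_def by (simp add: compact_eq_bounded_closed bounded_Int)
  moreover have "N \<noteq> {}" using t0 by (auto simp: N_def)
  ultimately obtain b where bN: "b \<in> N" "\<forall>t\<in>N. b \<le> t" using compact_attains_inf[of N] by metis
  then have b: "b \<in> N" "\<And>t. t \<in> N \<Longrightarrow> b \<le> t" by auto
  have "x \<in> \<pi> ` ball 0 s" using s pi0 by (intro image_eqI[of _ _ 0]) auto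
  then have b0: "0 < b" "b \<le> 1" using b(1) \<gamma>(2) by (auto simp: N_def order_less_le)
  have cc: "\<pi> ` cball 0 s \<subseteq> U" using s pi_in by auto
  \<comment> \<open>The space is Hausdorff, so the compact image is closed and the path still lies
    in it at the limiting time \<open>b\<close>.\<close>
  have "compact (\<pi> ` cball 0 s)"
    by (rule compact_continuous_image[OF continuous_on_subset[OF pi_cont]]) (use s in auto)
  then have cl: "closed (\<pi> ` cball 0 s)" by (rule compact_imp_closed)
  have lt: "\<gamma> t \<in> \<pi> ` cball 0 s" if "t \<in> {0..<b}" for t
    using b(2)[of t] that b0 by (fastforce simp: N_def)
  have "\<gamma> ` closure {0..<b} \<subseteq> \<pi> ` cball 0 s"
    by (rule image_closure_subset) (use lt cl b0 in \<open>auto intro: continuous_on_subset[OF gc]\<close>)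
  then have im: "\<gamma> ` {0..b} \<subseteq> \<pi> ` cball 0 s" using b0 by simp
  have "\<gamma> b \<in> \<pi> ` cball 0 s" by (rule subsetD[OF im]) (use b0 in simp)
  then obtain z where z: "z \<in> cball 0 s" "\<gamma> b = \<pi> z" by blast
  have "z \<notin> ball 0 s" using b(1) z by (auto simp: N_def)
  then have nz: "norm z = s" using z by simp
  have "ennreal (norm (\<zeta> (\<gamma> b) - \<zeta> (\<gamma> 0)) / sqrt 2) \<le> path_length A G \<gamma>"
    by (rule path_length_ge[OF \<gamma>(1)]) (use b0 im cc in auto)
  moreover have "\<zeta> (\<gamma> b) = z" "\<zeta> (\<gamma> 0) = 0" using z nz s \<gamma>(2) zp[of 0] r0 by (auto simp: pi0)
  ultimately show ?thesis using nz by simp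
qed

lemma adm_pwC1: "adm S p w B \<Longrightarrow> pwC1 0 1 S p w"
  by (auto simp: adm_def pwC1_def)

lemma adm_dist_le:
  assumes p: "adm S p w B" "p ` {0..1} \<subseteq> ball 0 r0"
  shows "(\<lambda>t. sqrt (qf (h (p t)) (w t) (w t))) integrable_on {0..1}"
    "geodesic_dist A G x (\<pi> (p 1)) \<le> ennreal (integral {0..1} (\<lambda>t. sqrt (qf (h (p t)) (w t) (w t))))"
proof -
  let ?f = "\<lambda>t. sqrt (qf (h (p t)) (w t) (w t))"
  have fS: "finite S" using p(1) by (simp add: adm_def)
  have inb: "p t \<in> ball 0 r0" if "t \<in> {0..1}" for t using p(2) that by blast
  have nn: "0 \<le> ?f t" if "t \<in> {0..1} - S" for t using qf_nonneg inb that by simp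
  show i: "?f integrable_on {0..1}"
  proof (rule integrable_bounded_cont[OF fS speed_cont[OF adm_pwC1[OF p(1)] p(2)]])
    fix t assume t: "t \<in> {0..1} - S"
    have "qf (h (p t)) (w t) (w t) \<le> 2 * (norm (w t))\<^sup>2" using upper inb t by simp
    also have "\<dots> \<le> 2 * B\<^sup>2" using p(1) t by (auto simp: adm_def intro!: power_mono)
    finally show "norm (?f t) \<le> sqrt (2 * B\<^sup>2)" using nn[OF t] by simp
  qed
  have "geodesic_dist A G x (\<pi> (p 1)) \<le> path_length A G (\<pi> \<circ> p)"
    unfolding geodesic_dist_def
    by (rule INF_lower) (use path_in(1)[OF adm_pwC1[OF p(1)] p(2)] p(1) pi0 in \<open>auto simp: pathstart_def pathfinish_def adm_def\<close>)
  also have "\<dots> = ennreal (integral {0..1} ?f)"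
    unfolding path_in(2)[OF adm_pwC1[OF p(1)] p(2)] by (rule nn_integral_eq_integral_finite[OF fS i nn])
  finally show "geodesic_dist A G x (\<pi> (p 1)) \<le> ennreal (integral {0..1} ?f)" .
qed

lemma dist_line:
  assumes "norm z < r0"
  shows "geodesic_dist A G x (\<pi> z) \<le> ennreal (sqrt 2 * norm z)"
proof -
  have inb: "t *\<^sub>R z \<in> ball 0 r0" if "t \<in> {0..1}" for t
  proof -
    have "norm (t *\<^sub>R z) \<le> norm z" using that by (simp add: mult_left_le_one_le)
    then show ?thesis using assms by simp
  qed
  then have im: "(\<lambda>t. t *\<^sub>R z) ` {0..1} \<subseteq> ball 0 r0" by blast
  note d = adm_dist_le[OF adm_line im]
  have "integral {0..1} (\<lambda>t. sqrt (qf (h (t *\<^sub>R z)) z z)) \<le> integral {0..1} (\<lambda>t::real. sqrt 2 * norm z)"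
  proof (rule integral_le[OF d(1)])
    fix t :: real assume "t \<in> {0..1}"
    then have "sqrt (qf (h (t *\<^sub>R z)) z z) \<le> sqrt (2 * (norm z)\<^sup>2)" using upper inb by (intro real_sqrt_le_mono) simp
    then show "sqrt (qf (h (t *\<^sub>R z)) z z) \<le> sqrt 2 * norm z" by (simp add: real_sqrt_mult)
  qed auto
  then have "ennreal (integral {0..1} (\<lambda>t. sqrt (qf (h (t *\<^sub>R z)) z z))) \<le> ennreal (sqrt 2 * norm z)"
    by (intro ennreal_leI) simp
  then show ?thesis using d(2) by (simp add: order_trans)
qed

definition Fd :: "real^2 \<Rightarrow> real" where "Fd z = (enn2real (geodesic_dist A G x (\<pi> z)))\<^sup>2"

end

locale surface_normal = surface_chart h r0 M A G x c U \<zeta> \<pi> J + metric_normal h r0 M K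
  for h r0 M and A :: "'a::{t2_space, second_countable_topology} chart set" and G x c U \<zeta> \<pi> J K +
  fixes r1 :: real
  assumes r1_pos: "0 < r1" and r1_le: "8 * r1 \<le> r0" and r1_M: "M * (4 * r1\<^sup>2 + 8 * r1) \<le> 1"
begin

text \<open>The squared length of a path parametrised by the unit interval is at most its energy, by
  Cauchy-Schwarz.\<close>

lemma Fd_le:
  assumes p: "adm S p w B" "p ` {0..1} \<subseteq> ball 0 r0"
  shows "Fd (p 1) \<le> energy p w"
proof -
  let ?f = "\<lambda>t. sqrt (qf (h (p t)) (w t) (w t))"
  have inb: "p t \<in> ball 0 r0" if "t \<in> {0..1}" for t using p(2) that by blast
  have sq: "(?f t)\<^sup>2 = qf (h (p t)) (w t) (w t)" if "t \<in> {0..1}" for t using qf_nonneg[OF inb[OF that]] by simp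
  note d = adm_dist_le[OF p]
  have I0: "0 \<le> integral {0..1} ?f" by (rule integral_nonneg[OF d(1)]) (use qf_nonneg inb in auto)
  have "enn2real (geodesic_dist A G x (\<pi> (p 1))) \<le> integral {0..1} ?f"
    using enn2real_mono[OF d(2)] I0 by simp
  then have "Fd (p 1) \<le> (integral {0..1} ?f)\<^sup>2" unfolding Fd_def by (intro power_mono) auto
  also have "\<dots> \<le> integral {0..1} (\<lambda>t. (?f t)\<^sup>2)"
  proof (rule integral_sq_ge[OF d(1)])
    show "(\<lambda>t. (?f t)\<^sup>2) integrable_on {0..1}"
      by (rule integrable_eq[OF energy_integrable[OF p]]) (use sq in auto)
  qed
  also have "\<dots> = energy p w" unfolding energy_def by (rule integral_cong) (use sq in auto)
  finally show ?thesis .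
qed

text \<open>The distance is an infimum over all paths of the surface. A nearly shortest one has
  length below 2 r1, too short to leave the disc of radius 4 r1, so it can be read in the disc.
  \<open>reparametrise\<close> then turns its length into a bound on the squared speed at every
  instant off a finite set.\<close>

lemma Fd_approx:
  assumes z: "norm z < r1" and \<epsilon>: "0 < \<epsilon>"
  shows "\<exists>S p w B. adm S p w B \<and> p ` {0..1} \<subseteq> ball 0 r0 \<and> p 1 = z \<and>
        (\<forall>t\<in>{0..1} - S. qf (h (p t)) (w t) (w t) \<le> Fd z + \<epsilon>)"
proof -
  define D where "D = enn2real (geodesic_dist A G x (\<pi> z))"
  have zr: "norm z < r0" using z r1_le r1_pos by linarith
  have fin: "geodesic_dist A G x (\<pi> z) = ennreal D"
    unfolding D_def using dist_line[OF zr] by (metis ennreal_enn2real ennreal_less_top order_le_less_trans)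
  have D0: "0 \<le> D" by (simp add: D_def)
  have "ennreal D \<le> ennreal (sqrt 2 * norm z)" using dist_line[OF zr] fin by simp
  then have Dz: "D \<le> sqrt 2 * norm z" by (subst (asm) ennreal_le_iff) auto
  have s2: "sqrt 2 < 2" "0 < sqrt 2" "sqrt 2 * sqrt 2 = 2" by (auto simp: real_less_lsqrt real_sqrt_less_iff intro: real_sqrt_unique)
  have "sqrt 2 * norm z \<le> 2 * norm z" using s2 by (intro mult_right_mono) auto
  then have D2: "D < 2 * r1" using Dz z by linarith
  \<comment> \<open>Spent twice, once on the choice of the path and once on its reparametrisation;
    the second entry keeps the length below 2 r1.\<close>
  define \<eta> where "\<eta> = min (sqrt (D\<^sup>2 + \<epsilon>) - D) (2 * r1 - D) / 2"
  have "D < sqrt (D\<^sup>2 + \<epsilon>)" using \<epsilon> D0 by (intro real_less_rsqrt) auto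
  then have \<eta>: "0 < \<eta>" "D + 2 * \<eta> \<le> sqrt (D\<^sup>2 + \<epsilon>)" "D + \<eta> < 2 * r1" 
    using D2 by (auto simp: \<eta>_def min_def field_simps)
  have "geodesic_dist A G x (\<pi> z) < ennreal (D + \<eta>)" unfolding fin using \<eta> D0 by (simp add: ennreal_less_iff)
  then obtain \<gamma> where \<gamma>: "pw_C1_path A \<gamma>" "\<gamma> 0 = x" "\<gamma> 1 = \<pi> z" "path_length A G \<gamma> < ennreal (D + \<eta>)"
    unfolding geodesic_dist_def INF_less_iff by (auto simp: pathstart_def pathfinish_def)
  have im: "\<gamma> t \<in> \<pi> ` ball 0 (4 * r1)" if "t \<in> {0..1}" for t
  proof (rule ccontr)
    assume n: "\<gamma> t \<notin> \<pi> ` ball 0 (4 * r1)"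
    have "ennreal (4 * r1 / sqrt 2) \<le> path_length A G \<gamma>"
      by (rule exit_length[OF \<gamma>(1,2) _ _ that n]) (use r1_pos r1_le in auto)
    then have "ennreal (4 * r1 / sqrt 2) < ennreal (D + \<eta>)" using \<gamma>(4) by (rule order_le_less_trans)
    then have "4 * r1 / sqrt 2 < D + \<eta>" by (subst (asm) ennreal_less_iff) (use r1_pos in auto)
    moreover have "4 * r1 / sqrt 2 = 2 * r1 * sqrt 2" using s2 by (simp add: field_simps)
    moreover have "2 * r1 * 1 \<le> 2 * r1 * sqrt 2" using r1_pos by (intro mult_left_mono) auto
    ultimately show False using \<eta>(3) by linarith
  qed
  have imU: "\<gamma> ` {0..1} \<subseteq> U"
  proof safe
    fix t :: real assume "t \<in> {0..1}"
    then show "\<gamma> t \<in> U" using im[of t] pi_in r1_le r1_pos by fastforce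
  qed
  obtain S w where S: "pwC1 0 1 S (\<zeta> \<circ> \<gamma>) w" "{0, 1} \<subseteq> S"
    "\<And>t. t \<in> {0..1} - S \<Longrightarrow> speed A G \<gamma> t = sqrt (qf (h (\<zeta> (\<gamma> t))) (w t) (w t))"
    by (rule path_out[OF \<gamma>(1) _ _ _ imU]) auto
  have fS: "finite S" using S(1) by (simp add: pwC1_def)
  have imz: "(\<zeta> \<circ> \<gamma>) ` {0..1} \<subseteq> ball 0 r0"
  proof
    fix y assume "y \<in> (\<zeta> \<circ> \<gamma>) ` {0..1}"
    then obtain t where "t \<in> {0..1}" "y = \<zeta> (\<gamma> t)" by auto
    then show "y \<in> ball 0 r0" using imU zeta_in by blast
  qed
  let ?f = "\<lambda>t. sqrt (qf (h ((\<zeta> \<circ> \<gamma>) t)) (w t) (w t))"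
  have nn: "0 \<le> ?f t" if "t \<in> {0..1} - S" for t using qf_nonneg imz that by (simp add: image_subset_iff)
  have pl: "(\<integral>\<^sup>+t\<in>{0..1}. ennreal (?f t) \<partial>lborel) = path_length A G \<gamma>" unfolding path_length_def
    by (rule nn_integral_cong_AE, use finite_AE_lborel[OF fS] in eventually_elim) (use S(3) in \<open>auto simp: indicator_def\<close>)
  have "(\<integral>\<^sup>+t\<in>{0..1}. ennreal (?f t) \<partial>lborel) < \<infinity>" unfolding pl using \<gamma>(4) by (simp add: order_less_trans[OF _ ennreal_less_top])
  note I = nn_integral_imp_integrable_on[OF fS speed_cont[OF S(1) imz] nn this]
  have "ennreal (integral {0..1} ?f) < ennreal (D + \<eta>)" using I(2) pl \<gamma>(4) by simp
  then have L: "integral {0..1} ?f < D + \<eta>"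
    by (subst (asm) ennreal_less_iff) (rule integral_nonneg[OF I(1)], use qf_nonneg imz in \<open>auto simp: image_subset_iff\<close>)
  have z0: "(\<zeta> \<circ> \<gamma>) 0 = 0" "(\<zeta> \<circ> \<gamma>) 1 = z" using \<gamma>(2,3) zp[of 0] zp[of z] zr r0 by (auto simp: pi0)
  obtain T p v B where p: "adm T p v B" "p ` {0..1} \<subseteq> ball 0 r0" "p 1 = z"
      "\<forall>t\<in>{0..1} - T. qf (h (p t)) (v t) (v t) \<le> (integral {0..1} ?f + \<eta>)\<^sup>2"
    using reparametrise[OF S(1) imz z0(1) S(2) \<eta>(1) I(1) refl] z0(2) by auto
  have L0: "0 \<le> integral {0..1} ?f" by (rule integral_nonneg[OF I(1)]) (use qf_nonneg imz in \<open>auto simp: image_subset_iff\<close>)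
  have "(integral {0..1} ?f + \<eta>)\<^sup>2 \<le> (sqrt (D\<^sup>2 + \<epsilon>))\<^sup>2" using L L0 \<eta> by (intro power_mono) auto
  also have "\<dots> = Fd z + \<epsilon>" using \<epsilon> by (simp add: Fd_def D_def)
  finally have bd: "(integral {0..1} ?f + \<eta>)\<^sup>2 \<le> Fd z + \<epsilon>" .
  have "\<forall>t\<in>{0..1} - T. qf (h (p t)) (v t) (v t) \<le> Fd z + \<epsilon>"
    using p(4) order_trans[OF _ bd] by blast
  then show ?thesis using p(1,2,3) by blast
qed

sublocale dist_sq h r0 M K Fd r1
proof
  show "0 < r1" "4 * r1 \<le> r0" "M * (4 * r1\<^sup>2 + 8 * r1) \<le> 1" using r1_pos r1_le r1_M by auto
  show "0 \<le> Fd z" for z by (simp add: Fd_def)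
qed (use Fd_le Fd_approx in blast)+

text \<open>Leaving the disc of radius 2 r costs a length of at least 2 r / sqrt 2 > r, so a path
  shorter than r ends inside it and the ball can be described by \<open>Fd\<close> alone.\<close>

lemma geodesic_ball_eq:
  assumes r: "0 < r" "r < r1 / 16"
  shows "geodesic_ball A G x r = \<pi> ` {z. norm z < r1 \<and> Fd z < r\<^sup>2}"
proof safe
  fix y assume "y \<in> geodesic_ball A G x r"
  then have d: "geodesic_dist A G x y < ennreal r" by (simp add: geodesic_ball_def)
  then obtain \<gamma> where \<gamma>: "pw_C1_path A \<gamma>" "\<gamma> 0 = x" "\<gamma> 1 = y" "path_length A G \<gamma> < ennreal r"
    unfolding geodesic_dist_def INF_less_iff by (auto simp: pathstart_def pathfinish_def)
  have "\<gamma> 1 \<in> \<pi> ` ball 0 (2 * r)"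
  proof (rule ccontr)
    assume n: "\<gamma> 1 \<notin> \<pi> ` ball 0 (2 * r)"
    have "ennreal (2 * r / sqrt 2) \<le> path_length A G \<gamma>"
      by (rule exit_length[OF \<gamma>(1,2) _ _ _ n]) (use r r1_le in auto)
    then have "ennreal (2 * r / sqrt 2) < ennreal r" using \<gamma>(4) by (rule order_le_less_trans)
    then have "2 * r / sqrt 2 < r" by (subst (asm) ennreal_less_iff) (use r in auto)
    then have "2 * r < r * sqrt 2" by (simp add: field_simps)
    also have "\<dots> \<le> r * 2" using r by (intro mult_left_mono) (auto intro: real_le_lsqrt)
    finally show False by simp
  qed
  then obtain z where z: "norm z < 2 * r" "y = \<pi> z" using \<gamma>(3) by auto
  have "enn2real (geodesic_dist A G x y) < r"
    using d r by (metis enn2real_ennreal enn2real_less_iff ennreal_less_top less_eq_real_def order_less_trans)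
  then have "Fd z < r\<^sup>2" unfolding Fd_def z(2)[symmetric] by (intro power_strict_mono) auto
  then show "y \<in> \<pi> ` {z. norm z < r1 \<and> Fd z < r\<^sup>2}" using z r by auto
next
  fix z assume z: "norm z < r1" "Fd z < r\<^sup>2"
  have zr: "norm z < r0" using z r1_le r1_pos by linarith
  have f: "geodesic_dist A G x (\<pi> z) < top"
    using dist_line[OF zr] ennreal_less_top by (rule order_le_less_trans)
  have "enn2real (geodesic_dist A G x (\<pi> z)) < r"
    using z(2) r by (intro power2_less_imp_less[of _ r]) (auto simp: Fd_def)
  then have "geodesic_dist A G x (\<pi> z) < ennreal r"
    using f r by (metis ennreal_enn2real ennreal_less_iff enn2real_nonneg)
  moreover have "\<pi> z \<in> carrier A" using pi_in[of z] zr U_carrier by auto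
  ultimately show "\<pi> z \<in> geodesic_ball A G x r" by (simp add: geodesic_ball_def)
qed

text \<open>The frontier of an open set is its closure without the set. The compact sublevel set
  \<open>W\<close> has a closed image, and moving inwards along rays shows that points of level r^2
  are limits of points of lower level, so \<open>W\<close> is the closure in coordinates.\<close>

lemma geodesic_sphere_eq:
  assumes r: "0 < r" "r < r1 / 16"
  shows "geodesic_sphere A G x r = \<pi> ` {z. norm z < r1 \<and> Fd z = r\<^sup>2}"
proof -
  define \<Omega> where "\<Omega> = {z. norm z < r1 \<and> Fd z < r\<^sup>2}"
  define W where "W = {z \<in> cball 0 (2 * r). Fd z \<le> r\<^sup>2}"
  have nb: "norm z < 2 * r" if "norm z < r1" "Fd z \<le> r\<^sup>2" for z
  proof -
    have "(norm z)\<^sup>2 \<le> 2 * r\<^sup>2" using F_lower[OF that(1)] that(2) by simp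
    also have "\<dots> < (2 * r)\<^sup>2" using r by (simp add: power_mult_distrib)
    finally show ?thesis by (rule power2_less_imp_less) (use r in simp)
  qed
  have Fc: "continuous_on (cball 0 (2 * r)) Fd" by (rule continuous_on_subset[OF F_cont]) (use r in auto)
  have \<Omega>eq: "\<Omega> = ball 0 (2 * r) \<inter> Fd -` {..<r\<^sup>2}" using nb r by (auto simp: \<Omega>_def)
  have "open \<Omega>" unfolding \<Omega>eq
    by (rule continuous_open_preimage[OF continuous_on_subset[OF Fc]]) auto
  have \<Omega>in: "\<Omega> \<subseteq> ball 0 r0" using r1_le r1_pos by (auto simp: \<Omega>_def)
  have oB: "open (\<pi> ` \<Omega>)" by (rule pi_open[OF \<open>open \<Omega>\<close> \<Omega>in])
  have "closed W"
  proof -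
    have "W = cball 0 (2 * r) \<inter> Fd -` {..r\<^sup>2}" by (auto simp: W_def)
    then show ?thesis using continuous_closed_preimage[OF Fc closed_cball closed_atMost] by simp
  qed
  moreover have "bounded W" by (rule bounded_subset[OF bounded_cball[of 0 "2 * r"]]) (auto simp: W_def)
  ultimately have "compact W" by (simp add: compact_eq_bounded_closed)
  moreover have Win: "W \<subseteq> ball 0 r0" using r r1_le by (auto simp: W_def)
  ultimately have "compact (\<pi> ` W)" by (intro compact_continuous_image continuous_on_subset[OF pi_cont])
  then have cW: "closed (\<pi> ` W)" by (rule compact_imp_closed)
  have \<Omega>W: "\<Omega> \<subseteq> W" using nb by (force simp: \<Omega>_def W_def)
  have Wcl: "W \<subseteq> closure \<Omega>"
  proof
    fix z assume z: "z \<in> W"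
    show "z \<in> closure \<Omega>"
    proof (cases "Fd z < r\<^sup>2")
      case True
      then have "z \<in> \<Omega>" using z r by (auto simp: W_def \<Omega>_def)
      then show ?thesis using closure_subset by blast
    next
      case False
      then have F: "Fd z = r\<^sup>2" using z by (simp add: W_def)
      then have z0: "z \<noteq> 0" using F_0 r by auto
      have nz: "norm z < r1 / 2" "norm z < r1" using z r by (auto simp: W_def)
      show ?thesis unfolding closure_approachable
      proof safe
        fix e :: real assume e: "0 < e"
        \<comment> \<open>Contracting z by the factor 1 - t moves it by less than e and strictly
          lowers \<open>Fd\<close>.\<close>
        define t where "t = min (1/2) (e / (2 * norm z))"
        have t: "0 < t" "t < 1" "t * norm z < e" using e z0 by (auto simp: t_def min_def field_simps)
        have "Fd ((1 - t) *\<^sub>R z) < Fd z" by (rule F_radial_mono[OF nz(1) z0]) (use t in auto)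
        moreover have "norm ((1 - t) *\<^sub>R z) \<le> norm z" using t by (simp add: mult_left_le_one_le)
        ultimately have "(1 - t) *\<^sub>R z \<in> \<Omega>" using F nz by (simp add: \<Omega>_def)
        moreover have "dist ((1 - t) *\<^sub>R z) z = t * norm z" using t by (simp add: dist_norm algebra_simps)
        ultimately show "\<exists>y\<in>\<Omega>. dist y z < e" using t by (intro bexI[of _ "(1 - t) *\<^sub>R z"]) auto
      qed
    qed
  qed
  have "closure (\<pi> ` \<Omega>) = \<pi> ` W"
  proof
    show "closure (\<pi> ` \<Omega>) \<subseteq> \<pi> ` W" by (rule closure_minimal) (use \<Omega>W cW in auto)
    have "closure \<Omega> \<subseteq> cball 0 (2 * r)" by (rule closure_minimal) (auto simp: \<Omega>eq)
    then have "continuous_on (closure \<Omega>) \<pi>" by (intro continuous_on_subset[OF pi_cont]) (use r r1_le in auto)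
    then have "\<pi> ` closure \<Omega> \<subseteq> closure (\<pi> ` \<Omega>)" by (rule image_closure_subset) (auto simp: closure_subset)
    then show "\<pi> ` W \<subseteq> closure (\<pi> ` \<Omega>)" using Wcl by blast
  qed
  then have "frontier (\<pi> ` \<Omega>) = \<pi> ` W - \<pi> ` \<Omega>" using oB by (simp add: frontier_def interior_open)
  also have "\<dots> = \<pi> ` (W - \<Omega>)"
  proof -
    have "inj_on \<pi> (ball 0 r0)" by (rule inj_on_inverseI[of _ \<zeta>]) simp
    then show ?thesis using inj_on_image_set_diff[of \<pi> "ball 0 r0" W \<Omega>] Win \<Omega>in by auto
  qed
  also have "W - \<Omega> = {z. norm z < r1 \<and> Fd z = r\<^sup>2}" using nb r by (force simp: W_def \<Omega>_def)
  finally have fr: "frontier (\<pi> ` \<Omega>) = \<pi> ` {z. norm z < r1 \<and> Fd z = r\<^sup>2}" .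
  moreover have "\<pi> ` {z. norm z < r1 \<and> Fd z = r\<^sup>2} \<subseteq> carrier A"
    using pi_in U_carrier r1_le r1_pos by fastforce
  ultimately show ?thesis unfolding geodesic_sphere_def geodesic_ball_eq[OF r] \<Omega>_def[symmetric] by blast
qed

end

section \<open>Perimeter: all simple parametrisations of a geodesic circle have the same
  length\<close>

text \<open>One antiderivative for a whole symmetric interval, so that it can be composed with an
  angle that starts anywhere and runs in either direction.\<close>

lemma antiderivative_continuous_real:
  fixes f :: "real \<Rightarrow> real"
  assumes "continuous_on UNIV f"
  shows "\<exists>H. (\<forall>u\<in>{-R<..<R}. (H has_real_derivative f u) (at u)) \<and>
     (\<forall>a b. -R < a \<longrightarrow> a \<le> b \<longrightarrow> b < R \<longrightarrow> integral {a..b} f = H b - H a)"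
proof (intro exI conjI ballI allI impI)
  fix u assume u: "u \<in> {-R<..<R}"
  have "((\<lambda>u. integral {-R..u} f) has_vector_derivative f u) (at u within {-R..R})"
    by (rule integral_has_vector_derivative) (use u assms in \<open>auto intro: continuous_on_subset\<close>)
  then have "((\<lambda>u. integral {-R..u} f) has_vector_derivative f u) (at u within {-R<..<R})"
    by (rule has_vector_derivative_within_subset) auto
  then show "((\<lambda>u. integral {-R..u} f) has_real_derivative f u) (at u)"
    using at_within_open[OF u] by (simp add: has_real_derivative_iff_has_vector_derivative)
next
  fix a b assume ab: "-R < a" "a \<le> b" "b < R"
  have "f integrable_on {-R..b}"
    by (rule integrable_continuous_real) (use assms in \<open>auto intro: continuous_on_subset\<close>)
  from Henstock_Kurzweil_Integration.integral_combine[OF _ _ this, of a] ab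
  show "integral {a..b} f = integral {-R..b} f - integral {-R..a} f" by simp
qed

text \<open>For an antiderivative H of a p-periodic function, H(u + p) - H(u) has derivative
  0.\<close>

lemma integral_periodic:
  fixes f :: "real \<Rightarrow> real"
  assumes f: "continuous_on UNIV f" "\<And>u. f (u + p) = f u" and p: "0 < p"
  shows "integral {a..a + p} f = integral {0..p} f"
proof -
  define R where "R = \<bar>a\<bar> + p + 1"
  obtain H where H: "\<And>u. u \<in> {-R<..<R} \<Longrightarrow> (H has_real_derivative f u) (at u)"
     "\<And>a b. -R < a \<Longrightarrow> a \<le> b \<Longrightarrow> b < R \<Longrightarrow> integral {a..b} f = H b - H a"
    using antiderivative_continuous_real[OF f(1), of R] by blast
  define P where "P = (\<lambda>u. H (u + p) - H u)"
  define I where "I = {- \<bar>a\<bar> - 1 / 2<..<\<bar>a\<bar> + 1 / 2}"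
  have "(P has_real_derivative 0) (at u within I)" if "u \<in> I" for u
  proof -
    have 1: "u + p \<in> {-R<..<R}" "u \<in> {-R<..<R}" using that p by (auto simp: I_def R_def)
    have "((\<lambda>u. H (u + p)) has_real_derivative f (u + p)) (at u)"
      using DERIV_shift[of H "f (u + p)" u p] H(1)[OF 1(1)] by simp
    from DERIV_diff[OF this H(1)[OF 1(2)]] show ?thesis unfolding P_def
      by (simp add: f(2) has_field_derivative_at_within)
  qed
  then obtain k where k: "\<And>u. u \<in> I \<Longrightarrow> P u = k"
    using has_field_derivative_zero_constant[of I P] by (auto simp: I_def)
  have "a \<in> I" "0 \<in> I" unfolding I_def greaterThanLessThan_iff
    using abs_ge_self[of a] abs_ge_minus_self[of a] by linarith+
  then have "P a = P 0" using k[of a] k[of 0] by simp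
  moreover have "integral {a..a + p} f = P a" "integral {0..0 + p} f = P 0" unfolding P_def
    by (rule H(2); use p in \<open>auto simp: R_def\<close>)+
  ultimately show ?thesis by simp
qed

lemma strict_monotone_of_inj:
  fixes \<theta> :: "real \<Rightarrow> real"
  assumes c: "continuous_on {0..1} \<theta>" and i: "inj_on \<theta> {0..1}" and lt: "\<theta> 0 < \<theta> 1"
    and st: "0 \<le> s" "s < t" "t \<le> 1"
  shows "\<theta> s < \<theta> t"
proof -
  have 1: "\<theta> 0 < \<theta> u \<and> \<theta> u < \<theta> 1" if "0 < u" "u < 1" for u
    using continuous_inj_imp_mono[OF that c i] lt by auto
  consider "s = 0" "t = 1" | "s = 0" "t < 1" | "0 < s" "t = 1" | "0 < s" "t < 1" using st by linarith
  then show ?thesis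
  proof cases
    case 4
    have "continuous_on {s..1} \<theta>" "inj_on \<theta> {s..1}"
      using c i st by (auto intro: continuous_on_subset inj_on_subset)
    from continuous_inj_imp_mono[OF st(2) 4(2) this] show ?thesis using 1[of s] 4 st by auto
  qed (use 1 lt st in auto)
qed

context surface_normal
begin

lemma level_curve_pwC1:
  assumes r: "0 < r" "r < r1 / 16"
  shows "pwC1 0 1 {} (\<lambda>t. rad r (2 * pi * t) *\<^sub>R polar (2 * pi * t))
     (\<lambda>t. (2 * pi) *\<^sub>R (rad' r (2 * pi * t) *\<^sub>R polar (2 * pi * t) + rad r (2 * pi * t) *\<^sub>R polar' (2 * pi * t)))"
proof -
  have Zd: "((\<lambda>\<theta>. rad r \<theta> *\<^sub>R polar \<theta>) has_vector_derivative (rad' r \<theta> *\<^sub>R polar \<theta> + rad r \<theta> *\<^sub>R polar' \<theta>)) (at \<theta>)" for \<theta>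
    using has_vector_derivative_scaleR[OF rad_deriv[OF r, of \<theta>] polar_deriv[of \<theta>]] by (simp add: add.commute)
  have l: "((\<lambda>t. 2 * pi * t) has_vector_derivative (2 * pi)) (at t)" for t
    using DERIV_cmult[OF DERIV_ident, of "2 * pi" t UNIV] by (simp add: has_real_derivative_iff_has_vector_derivative)
  have d: "((\<lambda>t. rad r (2 * pi * t) *\<^sub>R polar (2 * pi * t)) has_vector_derivative
      (2 * pi) *\<^sub>R (rad' r (2 * pi * t) *\<^sub>R polar (2 * pi * t) + rad r (2 * pi * t) *\<^sub>R polar' (2 * pi * t))) (at t)" for t
    using vector_diff_chain_at[OF l[of t] Zd[of "2 * pi * t"]] by (simp add: o_def)
  have cl: "continuous_on S (\<lambda>t. 2 * pi * t)" for S :: "real set" by (intro continuous_intros)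
  have c1: "continuous_on S (\<lambda>t. rad r (2 * pi * t))" for S
    by (rule continuous_on_compose2[OF rad_cont_on[OF r] cl]) auto
  have c2: "continuous_on S (\<lambda>t. rad' r (2 * pi * t))" for S
    by (rule continuous_on_compose2[OF rad'_cont[OF r] cl]) auto
  show ?thesis unfolding pwC1_def using d
    by (auto intro!: continuous_on_scaleR continuous_on_add continuous_on_const continuous_polar continuous_polar' cl c1 c2)
qed

lemma pi_inj: "inj_on \<pi> (ball 0 r0)"
  by (rule inj_on_inverseI[of _ \<zeta>]) simp

text \<open>The polar graph is itself an admissible parametrisation: taking norms shows that equal
  points have equal radii, hence equal angles up to multiples of 2 pi.\<close>

lemma sphere_param:
  assumes r: "0 < r" "r < r1 / 16"
  defines "\<gamma> \<equiv> \<pi> \<circ> (\<lambda>t. rad r (2 * pi * t) *\<^sub>R polar (2 * pi * t))"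
  shows "pw_C1_path A \<gamma> \<and> simple_path \<gamma> \<and> pathfinish \<gamma> = pathstart \<gamma> \<and> path_image \<gamma> = geodesic_sphere A G x r"
proof -
  let ?p = "\<lambda>t. rad r (2 * pi * t) *\<^sub>R polar (2 * pi * t)"
  have nb: "rad r \<theta> *\<^sub>R polar \<theta> \<in> ball 0 r0" for \<theta>
    using rad[OF r, of \<theta>] r1_le r1_pos by simp
  have im: "?p ` {0..1} \<subseteq> ball 0 r0" using nb by blast
  have pw: "pw_C1_path A \<gamma>" unfolding \<gamma>_def by (rule path_in(1)[OF level_curve_pwC1[OF r] im])
  have inj: "s = t \<or> s = 0 \<and> t = 1 \<or> s = 1 \<and> t = 0" if st: "s \<in> {0..1}" "t \<in> {0..1}" "\<gamma> s = \<gamma> t" for s t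
  proof -
    have "?p s = ?p t" using st(3) inj_onD[OF pi_inj _ nb nb, of "2 * pi * s" "2 * pi * t"] by (simp add: \<gamma>_def)
    moreover from arg_cong[OF this, of norm] have "rad r (2 * pi * s) = rad r (2 * pi * t)"
      using rad(1)[OF r] by (simp add: abs_of_pos)
    ultimately have "polar (2 * pi * s) = polar (2 * pi * t)" using rad(1)[OF r, of "2 * pi * t"] by simp
    then obtain n :: int where "2 * pi * s = 2 * pi * t + 2 * pi * n" using polar_eq_iff by blast
    then have n: "s = t + n" by (metis distrib_left mult_left_cancel pi_neq_zero mult_eq_0_iff zero_neq_numeral)
    then have "-1 \<le> real_of_int n" "real_of_int n \<le> 1" using st by auto
    then have "n = -1 \<or> n = 0 \<or> n = 1" by linarith
    then show ?thesis using n st by auto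
  qed
  have sp: "simple_path \<gamma>"
    unfolding simple_path_def loop_free_def using pw inj by (auto simp: pw_C1_path_def)
  have loop: "pathfinish \<gamma> = pathstart \<gamma>"
    using rad_periodic[of r 0] polar_periodic(1)[of 0] by (simp add: pathfinish_def pathstart_def \<gamma>_def)
  have "?p ` {0..1} = range (\<lambda>\<theta>. rad r \<theta> *\<^sub>R polar \<theta>)"
  proof
    show "range (\<lambda>\<theta>. rad r \<theta> *\<^sub>R polar \<theta>) \<subseteq> ?p ` {0..1}"
    proof safe
      fix \<theta>
      define n where "n = \<lfloor>\<theta> / (2 * pi)\<rfloor>"
      define t where "t = \<theta> / (2 * pi) - n"
      have t: "t \<in> {0..1}" by (auto simp: t_def n_def) linarith
      have th: "2 * pi * t = \<theta> + 2 * pi * of_int (- n)" by (simp add: t_def field_simps)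
      then have "polar (2 * pi * t) = polar \<theta>" using polar_eq_iff by blast
      moreover then have "rad r (2 * pi * t) = rad r \<theta>" unfolding rad_def by simp
      ultimately show "rad r \<theta> *\<^sub>R polar \<theta> \<in> ?p ` {0..1}" using t by (intro image_eqI[of _ _ t]) auto
    qed
  qed auto
  then have "path_image \<gamma> = geodesic_sphere A G x r"
    unfolding geodesic_sphere_eq[OF r] level_set[OF r] path_image_def \<gamma>_def image_comp[symmetric] by simp
  then show ?thesis using pw sp loop by simp
qed

text \<open>Any competing parametrisation has an angle that lifts continuously to
  \<open>\<theta>\<close>. Simplicity of the path makes the lift injective, hence monotone, and the
  closed path turns exactly once. The length becomes the integral of
  \<open>lspeed r (\<theta> t)\<close> times the absolute value of \<open>\<theta>' t\<close>, a
  substitution in the integral of \<open>lspeed r\<close> over one period.\<close>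

lemma sphere_length:
  assumes r: "0 < r" "r < r1 / 16"
    and \<gamma>: "pw_C1_path A \<gamma>" "simple_path \<gamma>" "pathfinish \<gamma> = pathstart \<gamma>" "path_image \<gamma> = geodesic_sphere A G x r"
  shows "path_length A G \<gamma> = ennreal (integral {0..2 * pi} (lspeed r))"
proof -
  define z where "z = \<zeta> \<circ> \<gamma>"
  have nb: "z \<in> ball 0 r0" if "norm z < r1" for z :: "real^2" using that r1_le r1_pos by simp
  have zt: "norm (z t) < r1" "Fd (z t) = r\<^sup>2" "\<gamma> t = \<pi> (z t)" if "t \<in> {0..1}" for t
  proof -
    have "\<gamma> t \<in> \<pi> ` {z. norm z < r1 \<and> Fd z = r\<^sup>2}"
      using \<gamma>(4) that unfolding geodesic_sphere_eq[OF r] path_image_def by blast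
    then show "norm (z t) < r1" "Fd (z t) = r\<^sup>2" "\<gamma> t = \<pi> (z t)" using nb by (auto simp: z_def)
  qed
  have imU: "\<gamma> ` {0..1} \<subseteq> U" using zt nb pi_in by fastforce
  obtain S w where S: "pwC1 0 1 S z w" "{0, 1} \<subseteq> S"
    "\<And>t. t \<in> {0..1} - S \<Longrightarrow> speed A G \<gamma> t = sqrt (qf (h (\<zeta> (\<gamma> t))) (w t) (w t))"
    unfolding z_def by (rule path_out[OF \<gamma>(1) _ _ _ imU]) auto
  have fS: "finite S" and zc: "continuous_on {0..1} z" using S(1) by (auto simp: pwC1_def)
  define f where "f = (\<lambda>t. Complex (z t $ 1) (z t $ 2))"
  have fc: "continuous_on {0..1} f" unfolding f_def
    by (intro continuous_on_Complex continuous_on_component zc)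
  have z0: "z t \<noteq> 0" if "t \<in> {0..1}" for t using zt(2)[OF that] F_0 r by auto
  have f0: "f t \<noteq> 0" if "t \<in> {0..1}" for t using z0[OF that] by (auto simp: f_def complex_eq_iff vec_eq_iff forall_2)
  \<comment> \<open>A continuous function without zeros on an interval has a continuous logarithm;
    its imaginary part is the lifted angle.\<close>
  obtain g where g: "continuous_on {0..1} g" "\<And>t. t \<in> {0..1} \<Longrightarrow> f t = exp (g t)"
    using continuous_logarithm_on_contractible[OF fc convex_imp_contractible[OF convex_real_interval(5)] f0] by blast
  define \<theta> where "\<theta> = (\<lambda>t. Im (g t))"
  have \<theta>c: "continuous_on {0..1} \<theta>" unfolding \<theta>_def by (intro continuous_intros g)
  have zp: "z t = rad r (\<theta> t) *\<^sub>R polar (\<theta> t)" if t: "t \<in> {0..1}" for t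
  proof -
    have 1: "z t = exp (Re (g t)) *\<^sub>R polar (\<theta> t)"
      using g(2)[OF t] by (simp add: f_def \<theta>_def vec_eq_iff forall_2 complex_eq_iff Re_exp Im_exp)
    have "(norm (z t))\<^sup>2 \<le> 2 * r\<^sup>2" using F_lower[OF zt(1)[OF t]] zt(2)[OF t] by simp
    also have "\<dots> < (2 * r)\<^sup>2" using r by (simp add: power_mult_distrib)
    finally have "norm (z t) < 2 * r" by (rule power2_less_imp_less) (use r in simp)
    then have "exp (Re (g t)) < r1 / 8" unfolding 1 using r by simp
    then have "rad r (\<theta> t) = exp (Re (g t))"
      by (intro rad_unique[OF r]) (use zt(2)[OF t] in \<open>simp_all add: 1\<close>)
    then show ?thesis using 1 by simp
  qed
  have loop: "\<gamma> 1 = \<gamma> 0" using \<gamma>(3) by (simp add: pathfinish_def pathstart_def)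
  have per: "rad r (a + 2 * pi * of_int n) *\<^sub>R polar (a + 2 * pi * of_int n) = rad r a *\<^sub>R polar a" for a and n :: int
  proof -
    have "polar (a + 2 * pi * of_int n) = polar a" using polar_eq_iff by blast
    then show ?thesis by (simp add: rad_def)
  qed
  have inj: "s = t \<or> s = 0 \<and> t = 1 \<or> s = 1 \<and> t = 0"
    if st: "s \<in> {0..1}" "t \<in> {0..1}" "\<theta> s = \<theta> t + 2 * pi * of_int n" for s t and n :: int
  proof -
    have "z s = z t" using zp st per by metis
    then have "\<gamma> s = \<gamma> t" using zt(3) st by metis
    then show ?thesis using \<gamma>(2) st unfolding simple_path_def loop_free_def by auto
  qed
  \<comment> \<open>If the angle came back to its initial value, it would take the mean of \<theta>
    0 and \<theta> (1/2) once in each half of the interval, against simplicity.\<close>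
  have ne: "\<theta> 0 \<noteq> \<theta> 1"
  proof
    assume eq: "\<theta> 0 = \<theta> 1"
    have half: "\<theta> (1/2) \<noteq> \<theta> 0" using inj[of "1/2" 0 0] by auto
    define m where "m = (\<theta> 0 + \<theta> (1/2)) / 2"
    have c1: "continuous_on {0..1/2} \<theta>" and c2: "continuous_on {1/2..1} \<theta>" by (auto intro: continuous_on_subset[OF \<theta>c])
    have "\<exists>s\<ge>0. s \<le> 1/2 \<and> \<theta> s = m"
      using IVT'[of \<theta> 0 m "1/2"] IVT2'[of \<theta> "1/2" m 0] c1 by (cases "\<theta> 0 < \<theta> (1/2)") (auto simp: m_def)
    then obtain s where s: "0 \<le> s" "s \<le> 1/2" "\<theta> s = m" by blast
    have "\<exists>t\<ge>1/2. t \<le> 1 \<and> \<theta> t = m"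
      using IVT'[of \<theta> "1/2" m 1] IVT2'[of \<theta> 1 m "1/2"] c2 eq by (cases "\<theta> 0 < \<theta> (1/2)") (auto simp: m_def)
    then obtain t where t: "1/2 \<le> t" "t \<le> 1" "\<theta> t = m" by blast
    have "s \<noteq> t"
    proof
      assume "s = t"
      then have "s = 1/2" using s t by linarith
      with s(3) have "\<theta> (1/2) = m" by (simp only:)
      then show False using half by (simp add: m_def field_simps)
    qed
    moreover have "s \<noteq> 0" using s half by (auto simp: m_def)
    ultimately show False using inj[of s t 0] s t by auto
  qed
  have injo: "inj_on \<theta> {0..1}"
  proof (rule inj_onI)
    fix s t assume "s \<in> {0..1}" "t \<in> {0..1}" "\<theta> s = \<theta> t"
    then show "s = t" using inj[of s t 0] ne by auto
  qed
  have "z 1 = z 0" using loop by (simp add: z_def)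
  then have "rad r (\<theta> 1) *\<^sub>R polar (\<theta> 1) = rad r (\<theta> 0) *\<^sub>R polar (\<theta> 0)" using zp[of 0] zp[of 1] by simp
  moreover from arg_cong[OF this, of norm] have "rad r (\<theta> 1) = rad r (\<theta> 0)"
    using rad(1)[OF r] by (simp add: abs_of_pos)
  ultimately have "polar (\<theta> 1) = polar (\<theta> 0)" using rad(1)[OF r, of "\<theta> 0"] by simp
  then obtain n :: int where n: "\<theta> 1 = \<theta> 0 + 2 * pi * n" using polar_eq_iff by blast
  \<comment> \<open>The orientation: \<sigma> \<theta> increases for either sense of
    traversal.\<close>
  define \<sigma> :: real where "\<sigma> = (if \<theta> 0 < \<theta> 1 then 1 else -1)"
  have \<sigma>: "\<sigma> * \<sigma> = 1" "\<bar>\<sigma>\<bar> = 1" by (auto simp: \<sigma>_def)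
  have mono: "\<sigma> * \<theta> s < \<sigma> * \<theta> t" if "0 \<le> s" "s < t" "t \<le> 1" for s t
  proof (rule strict_monotone_of_inj[OF _ _ _ that])
    show "continuous_on {0..1} (\<lambda>t. \<sigma> * \<theta> t)" by (intro continuous_intros \<theta>c)
    show "inj_on (\<lambda>t. \<sigma> * \<theta> t) {0..1}"
    proof (rule inj_onI)
      fix s t assume st: "s \<in> {0..1}" "t \<in> {0..1}" "\<sigma> * \<theta> s = \<sigma> * \<theta> t"
      then have "\<theta> s = \<theta> t" by (simp add: \<sigma>_def split: if_splits)
      then show "s = t" using inj_onD[OF injo] st by blast
    qed
    show "\<sigma> * \<theta> 0 < \<sigma> * \<theta> 1" using ne by (auto simp: \<sigma>_def)
  qed
  \<comment> \<open>With two or more turns the lift would pass \<theta> 0 + 2 pi \<sigma> at an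
    interior time, and the path would meet its starting point there.\<close>
  have one_turn: "\<sigma> * \<theta> 1 = \<sigma> * \<theta> 0 + 2 * pi"
  proof -
    have "\<sigma> * \<theta> 0 < \<sigma> * \<theta> 1" by (rule mono) auto
    then have "0 < 2 * pi * (\<sigma> * n)" using n by (simp add: algebra_simps)
    then have "0 < \<sigma> * n" by (simp add: zero_less_mult_iff)
    moreover have "\<sigma> * n = of_int (if \<theta> 0 < \<theta> 1 then n else - n)" by (simp add: \<sigma>_def)
    ultimately obtain m :: int where m: "\<sigma> * n = of_int m" "0 < m" by (metis of_int_0_less_iff)
    have "m = 1"
    proof (rule ccontr)
      assume "m \<noteq> 1"
      then have "2 \<le> real_of_int m" using m(2) by linarith
      then have "2 * pi * 2 \<le> 2 * pi * (\<sigma> * n)" unfolding m(1) by (intro mult_left_mono) auto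
      then have "\<sigma> * \<theta> 0 + 2 * pi < \<sigma> * \<theta> 1" using n pi_gt_zero by (simp add: algebra_simps)
      then have "\<exists>t\<ge>0. t \<le> 1 \<and> \<sigma> * \<theta> t = \<sigma> * \<theta> 0 + 2 * pi"
        by (intro IVT') (auto intro!: continuous_intros \<theta>c)
      then obtain t where t: "0 \<le> t" "t \<le> 1" "\<sigma> * \<theta> t = \<sigma> * \<theta> 0 + 2 * pi" by blast
      have "\<theta> t = \<theta> 0 + 2 * pi * of_int (if \<theta> 0 < \<theta> 1 then 1 else -1)"
        using t(3) by (simp add: \<sigma>_def split: if_splits)
      from inj[OF _ _ this] t have "t = 0 \<or> t = 1" by auto
      then show False using t(3) \<open>\<sigma> * \<theta> 0 + 2 * pi < \<sigma> * \<theta> 1\<close> by auto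
    qed
    then show ?thesis using m n by (simp add: algebra_simps)
  qed
  define \<theta>' where "\<theta>' = deriv \<theta>"
  have \<theta>d: "(\<theta> has_real_derivative \<theta>' t) (at t)" if t: "t \<in> {0..1} - S" for t
  proof -
    have t01: "0 < t" "t < 1" using t S(2) by (auto simp: order_less_le)
    \<comment> \<open>The lift is so far only continuous. Near \<open>t\<close> the tangent of
      \<theta> s - \<theta> t is this quotient of differentiable functions, so arctan exhibits
      \<theta> as differentiable.\<close>
    define u where "u = (\<lambda>s. (z s \<bullet> polar' (\<theta> t)) / (z s \<bullet> polar (\<theta> t)))"
    have zd: "(z has_vector_derivative w t) (at t)" using S(1) t by (simp add: pwC1_def)
    have in1: "((\<lambda>s. z s \<bullet> v) has_real_derivative w t \<bullet> v) (at t)" for v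
      using bounded_linear.has_vector_derivative[OF bounded_linear_inner_left zd, of v]
      by (simp add: has_real_derivative_iff_has_vector_derivative)
    have pp: "polar a \<bullet> polar b = cos (a - b)" "polar a \<bullet> polar' b = sin (a - b)" for a b
      by (simp_all add: inner_vec_def sum_2 cos_diff sin_diff algebra_simps)
    have tt: "t \<in> {0..1}" using t by simp
    have "z t \<bullet> polar (\<theta> t) \<noteq> 0" using zp[OF tt] rad(1)[OF r, of "\<theta> t"] by (simp add: pp)
    then have "\<exists>D. (u has_real_derivative D) (at t)" unfolding u_def
      using DERIV_divide[OF in1 in1] by blast
    then obtain D where D: "(u has_real_derivative D) (at t)" by blast
    have ad: "((\<lambda>s. \<theta> t + arctan (u s)) has_real_derivative (0 + inverse (1 + (u t)\<^sup>2) * D)) (at t)"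
      by (intro DERIV_add DERIV_const DERIV_chain2[OF DERIV_arctan D])
    have "isCont \<theta> t" by (rule continuous_on_interior[OF \<theta>c]) (use t01 in simp)
    then have "(\<theta> \<longlongrightarrow> \<theta> t) (nhds t)" using tendsto_at_iff_tendsto_nhds[of \<theta> t] by (simp add: isCont_def)
    then have e1: "\<forall>\<^sub>F s in nhds t. dist (\<theta> s) (\<theta> t) < pi / 2" by (rule tendstoD) simp
    have e2: "\<forall>\<^sub>F s in nhds t. s \<in> {0<..<1}" using t01 by (intro eventually_nhds_in_open) auto
    have ev: "\<forall>\<^sub>F s in nhds t. \<theta> t + arctan (u s) = \<theta> s"
      using e1 e2
    proof eventually_elim
      case (elim s)
      have "u s = tan (\<theta> s - \<theta> t)"
        unfolding u_def tan_def using zp[of s] rad(1)[OF r, of "\<theta> s"] elim(2) by (simp add: pp)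
      moreover have "- (pi / 2) < \<theta> s - \<theta> t" "\<theta> s - \<theta> t < pi / 2"
        using elim(1) unfolding dist_real_def abs_less_iff by linarith+
      ultimately show ?case using arctan_tan by simp
    qed
    have "\<exists>D. (\<theta> has_real_derivative D) (at t)"
      using has_vector_derivative_eventually[OF ad[unfolded has_real_derivative_iff_has_vector_derivative] ev]
      unfolding has_real_derivative_iff_has_vector_derivative by blast
    then show ?thesis unfolding \<theta>'_def by (metis DERIV_imp_deriv)
  qed
  define R where "R = \<bar>\<theta> 0\<bar> + \<bar>\<theta> 1\<bar> + 1"
  have \<theta>R: "\<theta> t \<in> {-R<..<R}" if t: "t \<in> {0..1}" for t
  proof -
    have "\<sigma> * \<theta> 0 \<le> \<sigma> * \<theta> t" "\<sigma> * \<theta> t \<le> \<sigma> * \<theta> 1"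
      using mono[of 0 t] mono[of t 1] t by (cases "t = 0"; cases "t = 1"; force)+
    then show ?thesis by (auto simp: R_def \<sigma>_def split: if_splits)
  qed
  obtain H where H: "\<And>u. u \<in> {-R<..<R} \<Longrightarrow> (H has_real_derivative lspeed r u) (at u)"
     "\<And>a b. -R < a \<Longrightarrow> a \<le> b \<Longrightarrow> b < R \<Longrightarrow> integral {a..b} (lspeed r) = H b - H a"
    using antiderivative_continuous_real[OF lspeed_cont[OF r], of R] by blast
  have Hc: "continuous_on {-R<..<R} H" using H(1) by (intro continuous_at_imp_continuous_on ballI DERIV_isCont) blast
  let ?q = "\<lambda>t. \<sigma> * (lspeed r (\<theta> t) * \<theta>' t)"
  have "(?q has_integral (\<sigma> * H (\<theta> 1) - \<sigma> * H (\<theta> 0))) {0..1}"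
  proof (rule fundamental_theorem_of_calculus_strong[OF fS])
    fix t assume t: "t \<in> {0..1} - S"
    then have "((\<lambda>t. H (\<theta> t)) has_real_derivative lspeed r (\<theta> t) * \<theta>' t) (at t)"
      by (intro DERIV_chain2[OF H(1)[OF \<theta>R] \<theta>d]) auto
    then show "((\<lambda>t. \<sigma> * H (\<theta> t)) has_vector_derivative ?q t) (at t)"
      unfolding has_real_derivative_iff_has_vector_derivative[symmetric] by (rule DERIV_cmult)
  next
    show "continuous_on {0..1} (\<lambda>t. \<sigma> * H (\<theta> t))"
      by (intro continuous_on_mult_left continuous_on_compose2[OF Hc \<theta>c]) (use \<theta>R in auto)
  qed simp
  moreover have "\<sigma> * H (\<theta> 1) - \<sigma> * H (\<theta> 0) = integral {0..2 * pi} (lspeed r)"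
  proof (cases "\<theta> 0 < \<theta> 1")
    case True
    then have "\<theta> 1 = \<theta> 0 + 2 * pi" using one_turn by (simp add: \<sigma>_def)
    then show ?thesis using True H(2)[of "\<theta> 0" "\<theta> 1"] \<theta>R[of 0] \<theta>R[of 1]
        integral_periodic[OF lspeed_cont[OF r] lspeed_periodic, of "\<theta> 0"] by (simp add: \<sigma>_def)
  next
    case False
    then have "\<theta> 0 = \<theta> 1 + 2 * pi" using one_turn by (simp add: \<sigma>_def)
    then show ?thesis using False H(2)[of "\<theta> 1" "\<theta> 0"] \<theta>R[of 0] \<theta>R[of 1]
        integral_periodic[OF lspeed_cont[OF r] lspeed_periodic, of "\<theta> 1"] by (simp add: \<sigma>_def)
  qed
  ultimately have qi: "(?q has_integral integral {0..2 * pi} (lspeed r)) {0..1}" by simp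
  \<comment> \<open>Differentiating z = R(\<theta>) polar \<theta> and comparing with the velocity
    \<open>w\<close> shows that \<open>w\<close> is \<theta>' times the velocity of the polar graph;
    monotonicity makes \<sigma> \<theta>' nonnegative.\<close>
  have pt: "sqrt (qf (h (\<zeta> (\<gamma> t))) (w t) (w t)) = ?q t" "0 \<le> ?q t" if t: "t \<in> {0..1} - S" for t
  proof -
    have t01: "0 < t" "t < 1" using t S(2) by (auto simp: order_less_le)
    let ?v = "rad' r (\<theta> t) *\<^sub>R polar (\<theta> t) + rad r (\<theta> t) *\<^sub>R polar' (\<theta> t)"
    have Zd: "((\<lambda>\<theta>. rad r \<theta> *\<^sub>R polar \<theta>) has_vector_derivative ?v) (at (\<theta> t))"
      using has_vector_derivative_scaleR[OF rad_deriv[OF r, of "\<theta> t"] polar_deriv[of "\<theta> t"]] by (simp add: add.commute)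
    have "((\<lambda>s. rad r (\<theta> s) *\<^sub>R polar (\<theta> s)) has_vector_derivative \<theta>' t *\<^sub>R ?v) (at t)"
      using vector_diff_chain_at[OF \<theta>d[OF t, unfolded has_real_derivative_iff_has_vector_derivative] Zd] by (simp add: o_def)
    moreover have "\<forall>\<^sub>F s in nhds t. s \<in> {0<..<1}" using t01 by (intro eventually_nhds_in_open) auto
    then have "\<forall>\<^sub>F s in nhds t. rad r (\<theta> s) *\<^sub>R polar (\<theta> s) = z s" by eventually_elim (use zp in auto)
    ultimately have "(z has_vector_derivative \<theta>' t *\<^sub>R ?v) (at t)" by (rule has_vector_derivative_eventually)
    moreover have "(z has_vector_derivative w t) (at t)" using S(1) t by (simp add: pwC1_def)
    ultimately have w: "w t = \<theta>' t *\<^sub>R ?v" by (rule vector_derivative_unique_at[rotated])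
    have "0 \<le> \<sigma> * \<theta>' t"
    proof (rule mono_on_imp_deriv_nonneg[of "{0..1}" "\<lambda>t. \<sigma> * \<theta> t"])
      show "mono_on {0..1} (\<lambda>t. \<sigma> * \<theta> t)"
      proof (rule mono_onI)
        fix a b :: real assume "a \<in> {0..1}" "b \<in> {0..1}" "a \<le> b"
        then show "\<sigma> * \<theta> a \<le> \<sigma> * \<theta> b" using mono[of a b] by (cases "a = b") auto
      qed
      show "((\<lambda>t. \<sigma> * \<theta> t) has_real_derivative \<sigma> * \<theta>' t) (at t)" by (rule DERIV_cmult[OF \<theta>d[OF t]])
      show "t \<in> interior {0..1}" using t01 by simp
    qed
    then have \<sigma>\<theta>: "\<bar>\<theta>' t\<bar> = \<sigma> * \<theta>' t" by (cases "\<theta> 0 < \<theta> 1") (simp_all add: \<sigma>_def)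
    have zt': "\<zeta> (\<gamma> t) = rad r (\<theta> t) *\<^sub>R polar (\<theta> t)" using zp[of t] t by (simp add: z_def)
    have "qf (h (\<zeta> (\<gamma> t))) (w t) (w t) = (\<theta>' t)\<^sup>2 * qf (h (rad r (\<theta> t) *\<^sub>R polar (\<theta> t))) ?v ?v"
      unfolding w zt' by (simp only: qf_simps(5,6) power2_eq_square mult.assoc)
    then have "sqrt (qf (h (\<zeta> (\<gamma> t))) (w t) (w t)) = \<bar>\<theta>' t\<bar> * lspeed r (\<theta> t)"
      by (simp add: real_sqrt_mult lspeed_def Let_def)
    then show eq: "sqrt (qf (h (\<zeta> (\<gamma> t))) (w t) (w t)) = ?q t" by (simp add: \<sigma>\<theta> mult_ac)
    have "0 \<le> sqrt (qf (h (\<zeta> (\<gamma> t))) (w t) (w t))"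
      using qf_nonneg[OF nb[OF zt(1)[of t]]] t by (simp add: z_def)
    then show "0 \<le> ?q t" unfolding eq .
  qed
  have "path_length A G \<gamma> = (\<integral>\<^sup>+t\<in>{0..1}. ennreal (?q t) \<partial>lborel)" unfolding path_length_def
    by (rule nn_integral_cong_AE, use finite_AE_lborel[OF fS] in eventually_elim) (use S(3) pt(1) in \<open>auto simp: indicator_def\<close>)
  also have "\<dots> = ennreal (integral {0..1} ?q)"
    by (rule nn_integral_eq_integral_finite[OF fS]) (use qi pt(2) in auto)
  also have "integral {0..1} ?q = integral {0..2 * pi} (lspeed r)" using qi by (rule integral_unique)
  finally show ?thesis .
qed

text \<open>\<open>sphere_param\<close> provides a parametrisation and \<open>sphere_length\<close>
  a single possible length, so the definite description in \<open>closed_curve_length\<close>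
  denotes it.\<close>

lemma perimeter_eq:
  assumes r: "0 < r" "r < r1 / 16"
  shows "perimeter A G x r = integral {0..2 * pi} (lspeed r)"
proof -
  have "closed_curve_length A G (geodesic_sphere A G x r) = ennreal (integral {0..2 * pi} (lspeed r))"
    unfolding closed_curve_length_def
  proof (rule the_equality)
    show "\<exists>\<gamma>. pw_C1_path A \<gamma> \<and> simple_path \<gamma> \<and> pathfinish \<gamma> = pathstart \<gamma> \<and>
        path_image \<gamma> = geodesic_sphere A G x r \<and> path_length A G \<gamma> = ennreal (integral {0..2 * pi} (lspeed r))"
      using sphere_param[OF r] sphere_length[OF r] by blast
  qed (use sphere_length[OF r] in blast)
  moreover have "0 \<le> lspeed r \<theta>" for \<theta> unfolding lspeed_def Let_def
    using qf_nonneg rad[OF r, of \<theta>] r1_le r1_pos by simp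
  then have "0 \<le> integral {0..2 * pi} (lspeed r)"
    by (intro integral_nonneg integrable_continuous_real continuous_on_subset[OF lspeed_cont[OF r]]) auto
  ultimately show ?thesis by (simp add: perimeter_def)
qed

end

section \<open>Area of geodesic balls\<close>

lemma det_pullback: "sqrt (det (transpose J ** m ** J)) = \<bar>det J\<bar> * sqrt (det (m :: real^2^2))"
proof -
  have "det (transpose J ** m ** J) = (det J * det J) * det m" by (simp add: det_mul det_transpose mult_ac)
  then show ?thesis by (simp add: real_sqrt_mult)
qed

text \<open>The formula is applied to absolutely integrable functions with values in
  \<open>real^1\<close>. Integrability is supplied on the side of \<open>g\<close> and transported
  to \<open>f\<close>; both integrals are then read as nonnegative ones.\<close>

lemma nn_integral_change_of_variables:
  fixes \<tau> :: "real^2 \<Rightarrow> real^2" and f g :: "real^2 \<Rightarrow> real"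
  assumes S: "S \<in> sets borel" and g: "set_integrable lborel S g"
    and der: "\<And>z. z \<in> S \<Longrightarrow> (\<tau> has_derivative (\<lambda>v. D z *v v)) (at z)" and inj: "inj_on \<tau> S"
    and fg: "\<And>z. z \<in> S \<Longrightarrow> g z = \<bar>det (D z)\<bar> * f (\<tau> z)" and f0: "\<And>z. z \<in> S \<Longrightarrow> 0 \<le> f (\<tau> z)"
  shows "(\<integral>\<^sup>+q\<in>\<tau> ` S. ennreal (f q) \<partial>lborel) = (\<integral>\<^sup>+z\<in>S. ennreal (g z) \<partial>lborel)"
proof -
  have Sl: "S \<in> sets lebesgue" using S by simp
  have ga: "g absolutely_integrable_on S"
    using g S unfolding set_integrable_def by (simp add: integrable_completion borel_measurable_integrable)
  define b where "b = integral S g"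
  have "((\<lambda>z. \<bar>det (matrix (\<lambda>v. D z *v v))\<bar> *\<^sub>R (vec (f (\<tau> z)) :: real^1)) absolutely_integrable_on S \<and>
     integral S (\<lambda>z. \<bar>det (matrix (\<lambda>v. D z *v v))\<bar> *\<^sub>R (vec (f (\<tau> z)) :: real^1)) = vec b)
    \<longleftrightarrow> ((\<lambda>q. vec (f q) :: real^1) absolutely_integrable_on \<tau> ` S \<and> integral (\<tau> ` S) (\<lambda>q. vec (f q) :: real^1) = vec b)"
    by (rule has_absolute_integral_change_of_variables[OF Sl _ inj, of "\<lambda>z v. D z *v v" "\<lambda>q. vec (f q)" "vec b"])
       (use der in \<open>auto intro: has_derivative_at_withinI\<close>)
  moreover have eq: "\<bar>det (matrix (\<lambda>v. D z *v v))\<bar> *\<^sub>R (vec (f (\<tau> z)) :: real^1) = vec (g z)" if "z \<in> S" for z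
    using fg[OF that] by (simp add: matrix_of_matrix_vector_mul vec_eq_iff)
  have vg: "(\<lambda>z. vec (g z) :: real^1) absolutely_integrable_on S" "integral S (\<lambda>z. vec (g z) :: real^1) = vec b"
    using ga set_lebesgue_integral_eq_integral(1)[OF ga] unfolding absolutely_integrable_on_1_iff integral_on_1_eq b_def
    by (simp_all add: o_def)
  have "(\<lambda>z. \<bar>det (matrix (\<lambda>v. D z *v v))\<bar> *\<^sub>R (vec (f (\<tau> z)) :: real^1)) absolutely_integrable_on S"
    by (rule iffD2[OF set_integrable_cong[OF refl refl eq] vg(1)])
  moreover have "integral S (\<lambda>z. \<bar>det (matrix (\<lambda>v. D z *v v))\<bar> *\<^sub>R (vec (f (\<tau> z)) :: real^1)) = vec b"
    unfolding vg(2)[symmetric] by (rule Henstock_Kurzweil_Integration.integral_cong) (rule eq)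
  ultimately have "(\<lambda>q. vec (f q) :: real^1) absolutely_integrable_on \<tau> ` S" "integral (\<tau> ` S) (\<lambda>q. vec (f q) :: real^1) = vec b"
    by blast+
  then have "f absolutely_integrable_on \<tau> ` S" "integral (\<tau> ` S) f = b"
    unfolding absolutely_integrable_on_1_iff integral_on_1_eq by (simp_all add: o_def vec_eq_iff)
  then have "(f has_integral b) (\<tau> ` S)" using set_lebesgue_integral_eq_integral(1) by (auto simp: has_integral_iff)
  from nn_integral_has_integral_lebesgue'[OF _ this] f0
  have 1: "(\<integral>\<^sup>+q\<in>\<tau> ` S. ennreal (f q) \<partial>lborel) = ennreal b" by auto
  have "(g has_integral b) S" using set_lebesgue_integral_eq_integral(1)[OF ga] by (simp add: b_def has_integral_iff)
  from nn_integral_has_integral_lebesgue'[OF _ this] fg f0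
  have 2: "(\<integral>\<^sup>+z\<in>S. ennreal (g z) \<partial>lborel) = ennreal b" by auto
  show ?thesis using 1 2 by simp
qed

context metric_disc
begin

text \<open>The form at the vector (m22, -m12) equals m22 times the determinant, and m22 is
  positive. For the upper bound both diagonal entries are at most 2.\<close>

lemma det_nonneg: 
  assumes q: "q \<in> ball 0 r0"
  shows "0 \<le> det (h q)" "det (h q) \<le> 4"
proof -
  let ?m = "h q"
  have s: "?m$1$2 = ?m$2$1" using sym[OF q, of "axis 1 1" "axis 2 1"] by (simp add: qf_eq axis_def)
  have a: "qf ?m (axis 1 1) (axis 1 1) = ?m$1$1" "qf ?m (axis 2 1) (axis 2 1) = ?m$2$2" by (simp_all add: qf_eq axis_def)
  have p1: "1 / 2 \<le> ?m$1$1" "?m$1$1 \<le> 2" using lower[OF q, of "axis 1 1"] upper[OF q, of "axis 1 1"] by (simp_all add: a)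
  have p2: "1 / 2 \<le> ?m$2$2" "?m$2$2 \<le> 2" using lower[OF q, of "axis 2 1"] upper[OF q, of "axis 2 1"] by (simp_all add: a)
  have "0 \<le> qf ?m (\<chi> i. if i = 1 then ?m$2$2 else - ?m$1$2) (\<chi> i. if i = 1 then ?m$2$2 else - ?m$1$2)"
    by (rule qf_nonneg[OF q])
  also have "\<dots> = ?m$2$2 * det ?m" using s by (simp add: qf_eq det_2 algebra_simps)
  finally show "0 \<le> det ?m" using p2 by (simp add: zero_le_mult_iff)
  have "?m$1$1 * ?m$2$2 \<le> 2 * 2" using p1 p2 by (intro mult_mono) auto
  moreover have "0 \<le> ?m$2$1 * ?m$2$1" by simp
  moreover have "det ?m = ?m$1$1 * ?m$2$2 - ?m$2$1 * ?m$2$1" by (simp add: det_2 s)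
  ultimately show "det ?m \<le> 4" by linarith
qed

text \<open>The area density of \<open>h\<close>, extended by 0 so as to be measurable and
  integrable on the whole plane.\<close>

definition dens :: "real^2 \<Rightarrow> real" where "dens z = (if z \<in> ball 0 r0 then sqrt (det (h z)) else 0)"

lemma dens_nonneg: "0 \<le> dens z" using det_nonneg by (simp add: dens_def)

lemma dens_measurable [measurable]: "dens \<in> borel_measurable borel"
  unfolding dens_def det_2
  by (rule borel_measurable_continuous_on_if) (auto intro!: continuous_intros cont)

lemma dens_integrable: "integrable lborel dens"
proof (rule Bochner_Integration.integrable_bound[of _ "\<lambda>z. indicator (ball 0 r0) z * 2"])
  show "integrable lborel (\<lambda>z::real^2. indicator (ball 0 r0) z * (2::real))"
    by (intro integrable_mult_left integrable_real_indicator emeasure_bounded_finite bounded_ball) simp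
  show "AE z in lborel. norm (dens z) \<le> norm (indicator (ball 0 r0) z * (2::real))"
  proof (rule AE_I2)
    fix z
    have "z \<in> ball 0 r0 \<Longrightarrow> sqrt (det (h z)) \<le> sqrt 4" using det_nonneg by (intro real_sqrt_le_mono) auto
    then show "norm (dens z) \<le> norm (indicator (ball 0 r0) z * (2::real))" using dens_nonneg[of z] by (simp add: dens_def)
  qed
qed simp

end

context surface_chart
begin

lemma zeta_borel:
  assumes "E \<in> sets borel" "E \<subseteq> U"
  shows "\<zeta> ` E \<in> sets borel"
proof -
  have "\<pi> \<in> borel_measurable (restrict_space borel (ball 0 r0))"
    by (rule borel_measurable_continuous_on_restrict[OF pi_cont])
  from measurable_sets[OF this assms(1)]
  have "\<pi> -` E \<inter> ball 0 r0 \<in> sets (restrict_space borel (ball 0 r0))" by (simp add: space_restrict_space)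
  then have "\<pi> -` E \<inter> ball 0 r0 \<in> sets borel" by (subst (asm) sets_restrict_space_iff) auto
  moreover have "\<zeta> ` E = \<pi> -` E \<inter> ball 0 r0"
  proof
    show "\<zeta> ` E \<subseteq> \<pi> -` E \<inter> ball 0 r0" using assms(2) zeta_in by auto
    show "\<pi> -` E \<inter> ball 0 r0 \<subseteq> \<zeta> ` E" by (force simp: image_iff)
  qed
  ultimately show ?thesis by simp
qed

text \<open>The square root of the determinant of the metric picks up the factor |det J| under
  pullback, which is the Jacobian of the change of variables; so every chart yields the same density
  in the disc.\<close>

lemma chart_area_eq:
  assumes d: "d \<in> A" and E: "E \<in> sets borel" "E \<subseteq> U \<inter> dom_of d"
  shows "chart_area G d E = (\<integral>\<^sup>+z\<in>\<zeta> ` E. ennreal (dens z) \<partial>lborel)"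
proof -
  have hd: "homeomorphism (dom_of d) (coord d ` dom_of d) (coord d) (param d)"
    using is_chart[OF d] by (simp add: is_chart_def)
  then have pd: "param d (coord d p) = p" if "p \<in> dom_of d" for p using that by (auto simp: homeomorphism_def)
  have zE: "z \<in> ball 0 r0" "\<pi> z \<in> dom_of d" "\<pi> z \<in> E" if z: "z \<in> \<zeta> ` E" for z
  proof -
    obtain p where p: "p \<in> E" "z = \<zeta> p" using z by blast
    then have "p \<in> U" "p \<in> dom_of d" using E(2) by auto
    then show "z \<in> ball 0 r0" "\<pi> z \<in> dom_of d" "\<pi> z \<in> E" using p zeta_in pz by simp_all
  qed
  have "coord d (\<pi> (\<zeta> p)) = coord d p" if "p \<in> E" for p using pz[of p] that E(2) by auto
  then have "coord d ` E = (coord d \<circ> \<pi>) ` \<zeta> ` E" unfolding image_comp by (intro image_cong) auto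
  moreover have "(\<integral>\<^sup>+q\<in>(coord d \<circ> \<pi>) ` \<zeta> ` E. ennreal (sqrt (det (G d (param d q)))) \<partial>lborel)
      = (\<integral>\<^sup>+z\<in>\<zeta> ` E. ennreal (dens z) \<partial>lborel)"
  proof (rule nn_integral_change_of_variables[where D="J d"])
    show zb: "\<zeta> ` E \<in> sets borel" by (rule zeta_borel) (use E in auto)
    show "set_integrable lborel (\<zeta> ` E) dens"
      unfolding set_integrable_def using integrable_mult_indicator[OF _ dens_integrable, of "\<zeta> ` E"] zb by simp
    show "((coord d \<circ> \<pi>) has_derivative (\<lambda>v. J d z *v v)) (at z)" if "z \<in> \<zeta> ` E" for z
      by (rule J[OF d]) (use zE that in auto)
    show "inj_on (coord d \<circ> \<pi>) (\<zeta> ` E)"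
    proof (rule inj_onI)
      fix y z assume a: "y \<in> \<zeta> ` E" "z \<in> \<zeta> ` E" "(coord d \<circ> \<pi>) y = (coord d \<circ> \<pi>) z"
      then have "param d (coord d (\<pi> y)) = param d (coord d (\<pi> z))" by simp
      then have "\<pi> y = \<pi> z" using pd zE a by simp
      then have "\<zeta> (\<pi> y) = \<zeta> (\<pi> z)" by simp
      then show "y = z" using zE a by simp
    qed
    fix z assume z: "z \<in> \<zeta> ` E"
    show eq: "dens z = \<bar>det (J d z)\<bar> * sqrt (det (G d (param d ((coord d \<circ> \<pi>) z))))"
      using zE[OF z] pd by (simp add: dens_def metric[OF d zE(1,2)[OF z]] det_pullback)
    have "0 \<le> \<bar>det (J d z)\<bar> * sqrt (det (G d (param d ((coord d \<circ> \<pi>) z))))" unfolding eq[symmetric] by (rule dens_nonneg)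
    moreover have "0 < \<bar>det (J d z)\<bar>" using J_inj[OF d zE(1,2)[OF z]] by simp
    ultimately show "0 \<le> sqrt (det (G d (param d ((coord d \<circ> \<pi>) z))))" by (simp only: zero_le_mult_iff) linarith
  qed
  ultimately show ?thesis by (simp add: chart_area_def)
qed

text \<open>A single piece in the chart \<open>c\<close> already attains the integral. Conversely,
  disjoint pieces have disjoint images in \<Omega>, so no finite family exceeds it.\<close>

lemma area_eq:
  assumes \<Omega>: "open \<Omega>" "\<Omega> \<subseteq> ball 0 r0"
  shows "area A G (\<pi> ` \<Omega>) = (\<integral>\<^sup>+z\<in>\<Omega>. ennreal (dens z) \<partial>lborel)"
proof (rule antisym)
  have oU: "open (\<pi> ` \<Omega>)" by (rule pi_open[OF \<Omega>])
  have sU: "\<pi> ` \<Omega> \<subseteq> U" using \<Omega>(2) pi_in by auto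
  have zi: "\<zeta> ` \<pi> ` \<Omega> = \<Omega>" using \<Omega>(2) by (force simp: image_iff)
  show "(\<integral>\<^sup>+z\<in>\<Omega>. ennreal (dens z) \<partial>lborel) \<le> area A G (\<pi> ` \<Omega>)"
    unfolding area_def
  proof (rule SUP_upper2[of "{(c, \<pi> ` \<Omega>)}"])
    show "{(c, \<pi> ` \<Omega>)} \<in> {P. finite P \<and> disjoint_family_on snd P \<and>
        (\<forall>(ca, E)\<in>P. ca \<in> A \<and> E \<in> sets borel \<and> E \<subseteq> \<pi> ` \<Omega> \<inter> dom_of ca)}"
      using c oU sU by (auto simp: disjoint_family_on_def)
    have "chart_area G c (\<pi> ` \<Omega>) = (\<integral>\<^sup>+z\<in>\<zeta> ` \<pi> ` \<Omega>. ennreal (dens z) \<partial>lborel)"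
      by (rule chart_area_eq) (use c oU sU in auto)
    then show "(\<integral>\<^sup>+z\<in>\<Omega>. ennreal (dens z) \<partial>lborel) \<le> (\<Sum>(ca, E)\<in>{(c, \<pi> ` \<Omega>)}. chart_area G ca E)"
      by (simp add: zi)
  qed
  show "area A G (\<pi> ` \<Omega>) \<le> (\<integral>\<^sup>+z\<in>\<Omega>. ennreal (dens z) \<partial>lborel)"
    unfolding area_def
  proof (rule SUP_least)
    fix P assume "P \<in> {P. finite P \<and> disjoint_family_on snd P \<and>
        (\<forall>(ca, E)\<in>P. ca \<in> A \<and> E \<in> sets borel \<and> E \<subseteq> \<pi> ` \<Omega> \<inter> dom_of ca)}"
    then have P: "finite P" "disjoint_family_on snd P"
      "\<And>p. p \<in> P \<Longrightarrow> fst p \<in> A" "\<And>p. p \<in> P \<Longrightarrow> snd p \<in> sets borel" "\<And>p. p \<in> P \<Longrightarrow> snd p \<subseteq> \<pi> ` \<Omega> \<inter> dom_of (fst p)"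
      by (auto simp: case_prod_beta)
    have "(\<Sum>(ca, E)\<in>P. chart_area G ca E) = (\<Sum>p\<in>P. \<integral>\<^sup>+z. ennreal (dens z) * indicator (\<zeta> ` snd p) z \<partial>lborel)"
      unfolding case_prod_beta by (rule sum.cong[OF refl], rule chart_area_eq) (use P(3-5) sU in blast)+
    also have "\<dots> = (\<integral>\<^sup>+z. (\<Sum>p\<in>P. ennreal (dens z) * indicator (\<zeta> ` snd p) z) \<partial>lborel)"
    proof (rule nn_integral_sum[symmetric])
      fix p assume p: "p \<in> P"
      have "\<zeta> ` snd p \<in> sets borel" by (rule zeta_borel) (use P(4,5)[OF p] sU in blast)+
      then show "(\<lambda>z. ennreal (dens z) * indicator (\<zeta> ` snd p) z) \<in> borel_measurable lborel" by measurable
    qed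
    also have "\<dots> \<le> (\<integral>\<^sup>+z\<in>\<Omega>. ennreal (dens z) \<partial>lborel)"
    proof (rule nn_integral_mono)
      fix z
      show "(\<Sum>p\<in>P. ennreal (dens z) * indicator (\<zeta> ` snd p) z) \<le> ennreal (dens z) * indicator \<Omega> z"
      \<comment> \<open>By disjointness at most one summand is nonzero at \<open>z\<close>.\<close>
      proof (cases "\<exists>p\<in>P. z \<in> \<zeta> ` snd p")
        case True
        then obtain p where p: "p \<in> P" "z \<in> \<zeta> ` snd p" by blast
        then have z\<Omega>: "z \<in> \<Omega>" and zp: "\<pi> z \<in> snd p" using P(5)[OF p(1)] zi sU by force+
        have "z \<notin> \<zeta> ` snd p'" if p': "p' \<in> P" "p' \<noteq> p" for p'
        proof
          assume "z \<in> \<zeta> ` snd p'"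
          then have "\<pi> z \<in> snd p'" using P(5)[OF p'(1)] sU by force
          then show False using P(2) p p' zp unfolding disjoint_family_on_def by blast
        qed
        then have "(\<Sum>p\<in>P. ennreal (dens z) * indicator (\<zeta> ` snd p) z) = (\<Sum>p'\<in>{p}. ennreal (dens z) * indicator (\<zeta> ` snd p') z)"
          using P(1) p by (intro sum.mono_neutral_right) auto
        then show ?thesis using p z\<Omega> by simp
      qed auto
    qed
    finally show "(\<Sum>(ca, E)\<in>P. chart_area G ca E) \<le> (\<integral>\<^sup>+z\<in>\<Omega>. ennreal (dens z) \<partial>lborel)" .
  qed
qed

end

lemma ball_measure: "0 \<le> R \<Longrightarrow> measure lborel (ball 0 R :: (real^2) set) = pi * R\<^sup>2"
  using content_ball[of R "0::real^2"] by (simp add: unit_ball_vol_2)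

lemma set_integrable_ball_norm2: "set_integrable lborel (ball 0 R) (\<lambda>z::real^2. (norm z)\<^sup>2)"
proof (rule set_integrable_subset)
  show "set_integrable lborel (cball 0 R) (\<lambda>z::real^2. (norm z)\<^sup>2)"
    unfolding set_integrable_def by (rule borel_integrable_compact) (auto intro!: continuous_intros)
qed auto

lemma set_integral_const_lborel:
  assumes "S \<in> sets borel" "bounded (S :: (real^2) set)"
  shows "set_integrable lborel S (\<lambda>z. k::real)" "(LINT z:S|lborel. k) = k * measure lborel S"
proof -
  have f: "emeasure lborel S < \<infinity>" using emeasure_bounded_finite[OF assms(2)] .
  show "set_integrable lborel S (\<lambda>z. k)"
    unfolding set_integrable_def using f assms(1) by (intro integrable_scaleR_left) simp
  show "(LINT z:S|lborel. k) = k * measure lborel S"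
    unfolding set_lebesgue_integral_def using f assms(1) by simp
qed

text \<open>The second moment of a disc: the increments of both sides over an annulus differ by a
  quadratic quantity in the increment of \<open>R\<^sup>2\<close>.\<close>

lemma integral_ball_norm2:
  assumes "0 \<le> R"
  shows "(LINT z:ball 0 R|lborel. (norm (z::real^2))\<^sup>2) = pi * R ^ 4 / 2"
proof -
  \<comment> \<open>The parameter is t = R^2, in which the area of the disc is linear, so that an
    annulus has area pi (t - s).\<close>
  define I where "I = (\<lambda>t. (LINT z:ball 0 (sqrt t)|lborel. (norm (z::real^2))\<^sup>2) - pi * t\<^sup>2 / 2)"
  have inc: "\<bar>I t - I s\<bar> \<le> pi * (t - s)\<^sup>2" if st: "0 \<le> s" "s \<le> t" for s t
  proof -
    let ?B = "ball 0 (sqrt s) :: (real^2) set" and ?C = "ball 0 (sqrt t) :: (real^2) set"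
    have BC: "?B \<subseteq> ?C" using st by (auto simp: order_less_le_trans)
    let ?A = "?C - ?B"
    have mA: "measure lborel ?A = pi * t - pi * s"
      using st BC emeasure_bounded_finite[OF bounded_ball, of 0 "sqrt t"]
      by (subst measure_Diff) (auto simp: ball_measure less_top[symmetric])
    have Ab: "?A \<in> sets borel" "bounded ?A" using bounded_subset[OF bounded_ball] by auto
    have iA: "set_integrable lborel ?A (\<lambda>z::real^2. (norm z)\<^sup>2)"
      by (rule set_integrable_subset[OF set_integrable_ball_norm2[of "sqrt t"]]) auto
    have "?C = ?B \<union> ?A" using BC by auto
    then have "(LINT z:?C|lborel. (norm z)\<^sup>2) = (LINT z:?B|lborel. (norm z)\<^sup>2) + (LINT z:?A|lborel. (norm z)\<^sup>2)"
      using set_integral_Un[of ?B ?A lborel "\<lambda>z. (norm z)\<^sup>2"] set_integrable_ball_norm2 iA by auto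
    moreover have "s * (pi * t - pi * s) \<le> (LINT z:?A|lborel. (norm z)\<^sup>2)"
      unfolding mA[symmetric] set_integral_const_lborel(2)[OF Ab, symmetric]
    proof (rule set_integral_mono[OF set_integral_const_lborel(1)[OF Ab] iA])
      fix z assume "z \<in> ?A"
      then have "(sqrt s)\<^sup>2 \<le> (norm z)\<^sup>2" using st by (intro power_mono) auto
      then show "s \<le> (norm z)\<^sup>2" using st by simp
    qed
    moreover have "(LINT z:?A|lborel. (norm z)\<^sup>2) \<le> t * (pi * t - pi * s)"
      unfolding mA[symmetric] set_integral_const_lborel(2)[OF Ab, symmetric]
    proof (rule set_integral_mono[OF iA set_integral_const_lborel(1)[OF Ab]])
      fix z assume "z \<in> ?A"
      then have "(norm z)\<^sup>2 \<le> (sqrt t)\<^sup>2" using st by (intro power_mono) auto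
      then show "(norm z)\<^sup>2 \<le> t" using st by simp
    qed
    moreover have "pi * t\<^sup>2 / 2 - pi * s\<^sup>2 / 2 = s * (pi * t - pi * s) + pi * (t - s)\<^sup>2 / 2"
      "pi * t\<^sup>2 / 2 - pi * s\<^sup>2 / 2 = t * (pi * t - pi * s) - pi * (t - s)\<^sup>2 / 2"
      by (simp_all add: power2_eq_square field_simps)
    moreover have "0 \<le> pi * (t - s)\<^sup>2" by simp
    ultimately show ?thesis unfolding I_def abs_le_iff by argo
  qed
  have "\<exists>k. \<forall>t\<in>{0..}. I t = k"
  proof (rule has_derivative_zero_constant)
    fix t :: real assume t: "t \<in> {0..}"
    show "(I has_derivative (\<lambda>h. 0)) (at t within {0..})"
      unfolding has_derivative_within
    proof (intro conjI)
      have "((\<lambda>y. pi * norm (y - t)) \<longlongrightarrow> pi * norm (t - t)) (at t within {0..})" by (intro tendsto_intros)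
      then have l: "((\<lambda>y. pi * norm (y - t)) \<longlongrightarrow> 0) (at t within {0..})" by simp
      show "((\<lambda>y. (1 / norm (y - t)) *\<^sub>R (I y - (I t + 0))) \<longlongrightarrow> 0) (at t within {0..})"
      proof (rule Lim_null_comparison[OF _ l])
        have "norm ((1 / norm (y - t)) *\<^sub>R (I y - (I t + 0))) \<le> pi * norm (y - t)" if "y \<in> {0..}" for y
        proof -
          have "\<bar>I y - I t\<bar> \<le> pi * (y - t)\<^sup>2"
            using inc[of y t] inc[of t y] t that by (cases "y \<le> t") (auto simp: abs_minus_commute power2_commute)
          then show ?thesis by (cases "y = t") (auto simp: divide_le_eq power2_eq_square abs_mult_self_eq mult.assoc)
        qed
        then show "\<forall>\<^sub>F y in at t within {0..}. norm ((1 / norm (y - t)) *\<^sub>R (I y - (I t + 0))) \<le> pi * norm (y - t)"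
          by (auto simp: eventually_at_filter)
      qed
    qed simp
  qed simp
  then have "I (R\<^sup>2) = I 0" by auto
  moreover have "I 0 = 0" by (simp add: I_def set_lebesgue_integral_def)
  ultimately show ?thesis using assms by (simp add: I_def)
qed

context metric_normal
begin

text \<open>Testing the normal form at e1, e2 and e1 + e2 isolates the three entries of the metric.
  Products of their deviations from the identity are of fourth order, so the determinant is 1 - K/3
  |z|^2 + o(|z|^2), and the root halves K/3.\<close>

lemma dens_approx:
  assumes "0 < \<epsilon>"
  shows "\<exists>\<delta>>0. \<forall>z. norm z < \<delta> \<longrightarrow> \<bar>dens z - (1 - K / 6 * (norm z)\<^sup>2)\<bar> \<le> \<epsilon> * (norm z)\<^sup>2"
proof -
  define L where "L = \<bar>K\<bar> / 3"
  have L: "0 \<le> L" by (simp add: L_def)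
  define \<eta> where "\<eta> = min 1 (\<epsilon> / 2)"
  have \<eta>: "0 < \<eta>" "\<eta> \<le> 1" "\<eta> \<le> \<epsilon> / 2" using assms by (auto simp: \<eta>_def)
  obtain d where d: "0 < d" "\<And>q v. norm q < d \<Longrightarrow>
     \<bar>qf (h q) v v - ((norm v)\<^sup>2 - K / 3 * (cross2 q v)\<^sup>2)\<bar> \<le> \<eta> * (norm q)\<^sup>2 * (norm v)\<^sup>2"
    using normal[OF \<eta>(1)] by blast
  define D where "D = L + 2 + 2 * (L + 2)\<^sup>2"
  have D: "0 < D" using L by (simp add: D_def add_pos_nonneg)
  define N where "N = (L + 2)\<^sup>2 + D\<^sup>2"
  have N: "0 < N" using D by (simp add: N_def add_nonneg_pos)
  define \<delta> where "\<delta> = Min {d, r0, 1, 1 / (2 * D), \<epsilon> / (2 * N)}"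
  have \<delta>: "0 < \<delta>" "\<delta> \<le> d" "\<delta> \<le> r0" "\<delta> \<le> 1" "\<delta> \<le> 1 / (2 * D)" "\<delta> \<le> \<epsilon> / (2 * N)"
    using d r0 D N assms by (auto simp: \<delta>_def)
  have "\<bar>dens z - (1 - K / 6 * (norm z)\<^sup>2)\<bar> \<le> \<epsilon> * (norm z)\<^sup>2" if z: "norm z < \<delta>" for z
  proof -
    define t where "t = (norm z)\<^sup>2"
    have t: "t = (z$1)\<^sup>2 + (z$2)\<^sup>2" by (simp add: t_def norm_vec2)
    have t0: "0 \<le> t" by (simp add: t_def)
    have "norm z * norm z \<le> norm z * 1" using z \<delta> by (intro mult_left_mono) auto
    then have tz: "t \<le> norm z" by (simp add: t_def power2_eq_square)
    have t1: "t \<le> 1" "t \<le> 1 / (2 * D)" "t \<le> \<epsilon> / (2 * N)" using tz z \<delta> by linarith+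
    have zd: "norm z < d" and zb: "z \<in> ball 0 r0" using z \<delta> by auto
    let ?m = "h z"
    have s: "?m$1$2 = ?m$2$1" using sym[OF zb, of "axis 1 1" "axis 2 1"] by (simp add: qf_eq axis_def)
    have q: "qf ?m (axis 1 1) (axis 1 1) = ?m$1$1" "qf ?m (axis 2 1) (axis 2 1) = ?m$2$2"
      "qf ?m (axis 1 1 + axis 2 1) (axis 1 1 + axis 2 1) = ?m$1$1 + 2 * ?m$1$2 + ?m$2$2"
      by (simp_all add: qf_eq axis_def s)
    have c: "cross2 z (axis 1 1) = - z$2" "cross2 z (axis 2 1) = z$1" "cross2 z (axis 1 1 + axis 2 1) = z$1 - z$2"
      by (simp_all add: cross2_def axis_def)
    have n: "(norm (axis 1 1 + axis 2 1 :: real^2))\<^sup>2 = 2" unfolding norm_vec2 by (simp add: axis_def)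
    define e1 where "e1 = ?m$1$1 - 1 + K / 3 * (z$2)\<^sup>2"
    define e2 where "e2 = ?m$2$2 - 1 + K / 3 * (z$1)\<^sup>2"
    define e4 where "e4 = ?m$1$2 - K / 3 * (z$1 * z$2)"
    have e1: "\<bar>e1\<bar> \<le> \<eta> * t" using d(2)[OF zd, of "axis 1 1"] by (simp add: q c e1_def t_def)
    have e2: "\<bar>e2\<bar> \<le> \<eta> * t" using d(2)[OF zd, of "axis 2 1"] by (simp add: q c e2_def t_def)
    \<comment> \<open>Polarisation: the vector e1 + e2 brings in the off-diagonal entry, once the
      errors of the diagonal entries are known.\<close>
    have "\<bar>?m$1$1 + 2 * ?m$1$2 + ?m$2$2 - (2 - K / 3 * (z$1 - z$2)\<^sup>2)\<bar> \<le> \<eta> * t * 2"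
      using d(2)[OF zd, of "axis 1 1 + axis 2 1"] unfolding q c n t_def .
    moreover have "?m$1$1 + 2 * ?m$1$2 + ?m$2$2 - (2 - K / 3 * (z$1 - z$2)\<^sup>2) = e1 + e2 + 2 * e4"
      by (simp add: e1_def e2_def e4_def power2_diff algebra_simps)
    ultimately have e4: "\<bar>e4\<bar> \<le> 2 * (\<eta> * t)" using e1 e2 by linarith
    have z1: "(z$2)\<^sup>2 \<le> t" "(z$1)\<^sup>2 \<le> t" by (simp_all add: t)
    have z12: "\<bar>z$1 * z$2\<bar> \<le> t"
    proof -
      have "2 * (\<bar>z$1\<bar> * \<bar>z$2\<bar>) \<le> \<bar>z$1\<bar>\<^sup>2 + \<bar>z$2\<bar>\<^sup>2"
        using zero_le_power2[of "\<bar>z$1\<bar> - \<bar>z$2\<bar>"] by (simp add: power2_diff)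
      moreover have "0 \<le> \<bar>z$1\<bar> * \<bar>z$2\<bar>" by simp
      ultimately have "\<bar>z$1\<bar> * \<bar>z$2\<bar> \<le> \<bar>z$1\<bar>\<^sup>2 + \<bar>z$2\<bar>\<^sup>2" by linarith
      then show ?thesis by (simp add: t abs_mult)
    qed
    have K3: "\<bar>K / 3 * y\<bar> \<le> L * t" if "\<bar>y\<bar> \<le> t" for y
      using that by (simp only: L_def abs_mult abs_divide abs_numeral) (rule mult_left_mono, auto)
    have \<eta>t: "\<eta> * t \<le> 1 * t" using \<eta> t0 by (intro mult_right_mono) auto
    define a where "a = ?m$1$1 - 1"
    define b where "b = ?m$2$2 - 1"
    have a: "\<bar>a\<bar> \<le> (L + 2) * t"
    proof -
      have "a = e1 - K / 3 * (z$2)\<^sup>2" by (simp add: a_def e1_def)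
      then show ?thesis using e1 K3[of "(z$2)\<^sup>2"] z1 \<eta>t t0 by (simp add: algebra_simps)
    qed
    have b: "\<bar>b\<bar> \<le> (L + 2) * t"
    proof -
      have "b = e2 - K / 3 * (z$1)\<^sup>2" by (simp add: b_def e2_def)
      then show ?thesis using e2 K3[of "(z$1)\<^sup>2"] z1 \<eta>t t0 by (simp add: algebra_simps)
    qed
    have m: "\<bar>?m$1$2\<bar> \<le> (L + 2) * t"
    proof -
      have "?m$1$2 = e4 + K / 3 * (z$1 * z$2)" by (simp add: e4_def)
      then show ?thesis using e4 K3[OF z12] \<eta>t t0 by (simp add: algebra_simps)
    qed
    have Lt: "0 \<le> (L + 2) * t" using L t0 by simp
    have ab: "\<bar>a * b\<bar> \<le> (L + 2)\<^sup>2 * t\<^sup>2"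
      using mult_mono[OF a b Lt] by (simp add: abs_mult power2_eq_square mult_ac)
    have mm: "\<bar>?m$1$2 * ?m$1$2\<bar> \<le> (L + 2)\<^sup>2 * t\<^sup>2"
      using mult_mono[OF m m Lt] by (simp add: abs_mult power2_eq_square mult_ac)
    define y where "y = det ?m - 1"
    have y: "y + K / 3 * t = e1 + e2 + a * b - ?m$1$2 * ?m$1$2"
      unfolding y_def det_2 t a_def b_def e1_def e2_def by (simp add: s algebra_simps)
    then have y1: "\<bar>y + K / 3 * t\<bar> \<le> 2 * (\<eta> * t) + 2 * ((L + 2)\<^sup>2 * t\<^sup>2)"
      using e1 e2 ab mm by linarith
    have "t\<^sup>2 \<le> 1 * t" unfolding power2_eq_square using t0 t1 by (intro mult_right_mono) auto
    then have "(L + 2)\<^sup>2 * t\<^sup>2 \<le> (L + 2)\<^sup>2 * t" by (intro mult_left_mono) auto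
    moreover have "D * t = L * t + 2 * t + 2 * ((L + 2)\<^sup>2 * t)" by (simp add: D_def algebra_simps)
    ultimately have y2: "\<bar>y\<bar> \<le> D * t" using y1 K3[of t] \<eta>t t0 by simp
    have "D * t \<le> D * (1 / (2 * D))" using t1 D by (intro mult_left_mono) auto
    then have Dt: "D * t \<le> 1 / 2" using D by simp
    have sq: "\<bar>sqrt (1 + y) - (1 + y / 2)\<bar> \<le> y\<^sup>2" by (rule sqrt_expand) (use y2 Dt in linarith)
    have y3: "y\<^sup>2 \<le> D\<^sup>2 * t\<^sup>2" using power_mono[OF y2, of 2] by (simp add: power_mult_distrib)
    have "N * t \<le> N * (\<epsilon> / (2 * N))" using t1 N by (intro mult_left_mono) auto
    then have "N * t \<le> \<epsilon> / 2" using N by simp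
    then have "N * t * t \<le> \<epsilon> / 2 * t" using t0 by (rule mult_right_mono)
    then have Nt: "(L + 2)\<^sup>2 * t\<^sup>2 + D\<^sup>2 * t\<^sup>2 \<le> \<epsilon> / 2 * t" by (simp add: N_def power2_eq_square algebra_simps)
    have et: "\<eta> * t \<le> \<epsilon> / 2 * t" using \<eta>(3) t0 by (rule mult_right_mono)
    have "sqrt (1 + y) - (1 - K / 6 * t) = (sqrt (1 + y) - (1 + y / 2)) + (y + K / 3 * t) / 2" by (simp add: field_simps)
    also have "\<bar>\<dots>\<bar> \<le> \<bar>sqrt (1 + y) - (1 + y / 2)\<bar> + \<bar>(y + K / 3 * t) / 2\<bar>" by (rule abs_triangle_ineq)
    also have "\<dots> = \<bar>sqrt (1 + y) - (1 + y / 2)\<bar> + \<bar>y + K / 3 * t\<bar> / 2" by (simp only: abs_divide abs_numeral)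
    also have "\<dots> \<le> y\<^sup>2 + (2 * (\<eta> * t) + 2 * ((L + 2)\<^sup>2 * t\<^sup>2)) / 2"
      using sq y1 by (intro add_mono divide_right_mono) auto
    also have "\<dots> = y\<^sup>2 + \<eta> * t + (L + 2)\<^sup>2 * t\<^sup>2" by simp
    also have "\<dots> \<le> D\<^sup>2 * t\<^sup>2 + \<epsilon> / 2 * t + (L + 2)\<^sup>2 * t\<^sup>2" using y3 et by (intro add_mono) auto
    also have "\<dots> \<le> \<epsilon> * t" using Nt by (simp add: algebra_simps)
    finally have "\<bar>sqrt (1 + y) - (1 - K / 6 * t)\<bar> \<le> \<epsilon> * t" .
    moreover have "dens z = sqrt (1 + y)" using zb by (simp add: dens_def y_def)
    ultimately show ?thesis by (simp add: t_def)
  qed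
  then show ?thesis using \<delta>(1) by blast
qed

end

lemma set_integral_disc_quadratic:
  assumes "0 \<le> R"
  shows "set_integrable lborel (ball 0 R) (\<lambda>z::real^2. 1 + k * (norm z)\<^sup>2)"
    "(LINT z:ball 0 R|lborel. 1 + k * (norm (z::real^2))\<^sup>2) = pi * R\<^sup>2 + k * (pi * (R\<^sup>2)\<^sup>2 / 2)"
proof -
  have b: "ball 0 R \<in> sets borel" "bounded (ball 0 R :: (real^2) set)" by auto
  have i: "set_integrable lborel (ball 0 R) (\<lambda>z::real^2. k * (norm z)\<^sup>2)"
    by (rule set_integrable_mult_right) (use set_integrable_ball_norm2 in auto)
  show "set_integrable lborel (ball 0 R) (\<lambda>z::real^2. 1 + k * (norm z)\<^sup>2)"
    by (rule set_integral_add(1)[OF set_integral_const_lborel(1)[OF b] i])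
  show "(LINT z:ball 0 R|lborel. 1 + k * (norm (z::real^2))\<^sup>2) = pi * R\<^sup>2 + k * (pi * (R\<^sup>2)\<^sup>2 / 2)"
    unfolding set_integral_add(2)[OF set_integral_const_lborel(1)[OF b] i] set_integral_const_lborel(2)[OF b]
    using integral_ball_norm2[OF assms] ball_measure[OF assms] by simp
qed

context surface_normal
begin

lemma ball_area_eq:
  assumes r: "0 < r" "r < r1 / 16"
  defines "\<Omega> \<equiv> {z. norm z < r1 \<and> Fd z < r\<^sup>2}"
  shows "open \<Omega>" "bounded \<Omega>" "ball_area A G x r = (LINT z:\<Omega>|lborel. dens z)"
proof -
  have nb: "norm z < 2 * r" if "norm z < r1" "Fd z < r\<^sup>2" for z
  proof -
    have "(norm z)\<^sup>2 \<le> 2 * r\<^sup>2" using F_lower[OF that(1)] that(2) by simp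
    also have "\<dots> < (2 * r)\<^sup>2" using r by (simp add: power_mult_distrib)
    finally show ?thesis by (rule power2_less_imp_less) (use r in simp)
  qed
  have \<Omega>eq: "\<Omega> = ball 0 (2 * r) \<inter> Fd -` {..<r\<^sup>2}" using nb r by (auto simp: \<Omega>_def)
  show o: "open \<Omega>" unfolding \<Omega>eq
    by (rule continuous_open_preimage[OF continuous_on_subset[OF F_cont]]) (use r in auto)
  show "bounded \<Omega>" unfolding \<Omega>eq by (rule bounded_subset[OF bounded_ball]) auto
  have s: "\<Omega> \<subseteq> ball 0 r0" using r1_le r1_pos by (auto simp: \<Omega>_def)
  have i: "integrable lborel (\<lambda>z. indicator \<Omega> z * dens z)"
    using integrable_mult_indicator[OF _ dens_integrable, of \<Omega>] o by simp
  have "area A G (geodesic_ball A G x r) = (\<integral>\<^sup>+z\<in>\<Omega>. ennreal (dens z) \<partial>lborel)"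
    unfolding geodesic_ball_eq[OF r] \<Omega>_def[symmetric] by (rule area_eq[OF o s])
  also have "\<dots> = (\<integral>\<^sup>+z. ennreal (indicator \<Omega> z * dens z) \<partial>lborel)"
    by (rule nn_integral_cong) (auto simp: indicator_def)
  also have "\<dots> = ennreal (\<integral>z. indicator \<Omega> z * dens z \<partial>lborel)"
    by (rule nn_integral_eq_integral[OF i]) (auto simp: dens_nonneg)
  finally show "ball_area A G x r = (LINT z:\<Omega>|lborel. dens z)"
    unfolding ball_area_def set_lebesgue_integral_def
    by (simp add: dens_nonneg Bochner_Integration.integral_nonneg)
qed

text \<open>With s = r^2, the sublevel set lies between discs of squared radius s - \<eta> s^2 and s
  + 4 \<eta> s^2, over which the density is 1 - K/6 |z|^2 up to \<eta> |z|^2. The second moment pi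
  R^4 / 2 of a disc turns K/6 into K/12.\<close>

lemma ball_area_approx:
  assumes "0 < \<epsilon>"
  shows "\<exists>r3>0. \<forall>r. 0 < r \<longrightarrow> r < r3 \<longrightarrow> \<bar>ball_area A G x r - pi * r\<^sup>2 * (1 - K / 12 * r\<^sup>2)\<bar> \<le> \<epsilon> * r ^ 4"
proof -
  define \<eta> where "\<eta> = min 1 (\<epsilon> / (pi * (20 + 2 * \<bar>K\<bar>)))"
  have kp: "0 < pi * (20 + 2 * \<bar>K\<bar>)" by (simp add: add_pos_nonneg)
  have \<eta>: "0 < \<eta>" "\<eta> \<le> 1" "pi * (20 + 2 * \<bar>K\<bar>) * \<eta> \<le> \<epsilon>"
  proof -
    show "0 < \<eta>" "\<eta> \<le> 1" using assms kp by (auto simp: \<eta>_def)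
    have "pi * (20 + 2 * \<bar>K\<bar>) * \<eta> \<le> pi * (20 + 2 * \<bar>K\<bar>) * (\<epsilon> / (pi * (20 + 2 * \<bar>K\<bar>)))"
      using kp by (intro mult_left_mono) (auto simp: \<eta>_def)
    also have "\<dots> = \<epsilon>" using kp by (simp only: times_divide_eq_right nonzero_mult_div_cancel_left less_imp_neq[THEN not_sym] simp_thms)
    finally show "pi * (20 + 2 * \<bar>K\<bar>) * \<eta> \<le> \<epsilon>" .
  qed
  obtain ds where ds: "0 < ds" "ds \<le> r1" "\<And>z. norm z < ds \<Longrightarrow> \<bar>Fd z - (norm z)\<^sup>2\<bar> \<le> \<eta> * (norm z) ^ 4"
    using F_sandwich[OF \<eta>(1)] by blast
  obtain dd where dd: "0 < dd" "\<And>z. norm z < dd \<Longrightarrow> \<bar>dens z - (1 - K / 6 * (norm z)\<^sup>2)\<bar> \<le> \<eta> * (norm z)\<^sup>2"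
    using dens_approx[OF \<eta>(1)] by blast
  define r3 where "r3 = Min {ds / 3, dd / 3, r1 / 16, 1}"
  have r3: "0 < r3" "r3 \<le> ds / 3" "r3 \<le> dd / 3" "r3 \<le> r1 / 16" "r3 \<le> 1" using ds dd r1_pos by (auto simp: r3_def)
  have "\<bar>ball_area A G x r - pi * r\<^sup>2 * (1 - K / 12 * r\<^sup>2)\<bar> \<le> \<epsilon> * r ^ 4" if r: "0 < r" "r < r3" for r
  proof -
    have r': "r < r1 / 16" using r r3 by simp
    define s where "s = r\<^sup>2"
    have s: "0 < s" "s \<le> 1" "r ^ 4 = s\<^sup>2" using r r3 by (auto simp: s_def power_le_one)
    define \<Omega> where "\<Omega> = {z. norm z < r1 \<and> Fd z < r\<^sup>2}"
    note B = ball_area_eq[OF r(1) r', folded \<Omega>_def]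
    have di: "set_integrable lborel X dens" if "X \<in> sets borel" for X
      unfolding set_integrable_def using integrable_mult_indicator[OF _ dens_integrable, of X] that by simp
    have dmono: "(LINT z:X|lborel. dens z) \<le> (LINT z:Y|lborel. dens z)" if "X \<subseteq> Y" "X \<in> sets borel" "Y \<in> sets borel" for X Y
      unfolding set_lebesgue_integral_def
      by (rule integral_mono) (use di[unfolded set_integrable_def] that dens_nonneg in \<open>auto simp: indicator_def\<close>)
    have \<eta>s: "\<eta> * s\<^sup>2 \<le> s"
      using mult_mono[of "\<eta>" 1 "s * s" "1 * s"] \<eta> s by (simp add: power2_eq_square mult_right_mono)
    \<comment> \<open>Evaluates both bounds at once: T is the squared radius of the comparison disc
      and k the error of the density.\<close>
    have est: "\<bar>pi * T + (k - K / 6) * (pi * T\<^sup>2 / 2) - (pi * s - pi * K / 12 * s\<^sup>2)\<bar> \<le> \<epsilon> * s\<^sup>2"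
      if k: "\<bar>k\<bar> \<le> \<eta>" and T: "\<bar>T - s\<bar> \<le> 4 * \<eta> * s\<^sup>2" "0 \<le> T" for T k
    proof -
      have T5: "T \<le> 5 * s" using T \<eta>s by (simp add: abs_le_iff)
      have "T\<^sup>2 - s\<^sup>2 = (T - s) * (T + s)" by (simp add: power2_eq_square algebra_simps)
      then have "\<bar>T\<^sup>2 - s\<^sup>2\<bar> = \<bar>T - s\<bar> * (T + s)" using T s by (simp add: abs_mult)
      also have "\<dots> \<le> 4 * \<eta> * s\<^sup>2 * 6" using T T5 s \<eta> by (intro mult_mono) auto
      finally have T2: "\<bar>T\<^sup>2 - s\<^sup>2\<bar> \<le> 24 * (\<eta> * s\<^sup>2)" by simp
      have T25: "T\<^sup>2 \<le> 25 * s\<^sup>2" using power_mono[OF T5 T(2), of 2] by (simp add: power_mult_distrib)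
      have "\<bar>k * T\<^sup>2\<bar> = \<bar>k\<bar> * T\<^sup>2" by (simp add: abs_mult)
      also have "\<dots> \<le> \<eta> * (25 * s\<^sup>2)" using k T25 \<eta> by (intro mult_mono) auto
      finally have kT: "\<bar>k * T\<^sup>2\<bar> \<le> 25 * (\<eta> * s\<^sup>2)" by simp
      have "\<bar>K * (T\<^sup>2 - s\<^sup>2)\<bar> \<le> \<bar>K\<bar> * (24 * (\<eta> * s\<^sup>2))" unfolding abs_mult using T2 by (intro mult_left_mono) auto
      then have KT: "\<bar>K * (T\<^sup>2 - s\<^sup>2)\<bar> \<le> 24 * (\<bar>K\<bar> * (\<eta> * s\<^sup>2))" by simp
      have eq: "pi * T + (k - K / 6) * (pi * T\<^sup>2 / 2) - (pi * s - pi * K / 12 * s\<^sup>2)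
         = pi * ((T - s) + k * T\<^sup>2 / 2 - K * (T\<^sup>2 - s\<^sup>2) / 12)" by (simp add: field_simps)
      have p0: "0 \<le> \<eta> * s\<^sup>2" using \<eta> by simp
      have kp0: "0 \<le> \<bar>K\<bar> * (\<eta> * s\<^sup>2)" using p0 by simp
      have "\<bar>(T - s) + k * T\<^sup>2 / 2 - K * (T\<^sup>2 - s\<^sup>2) / 12\<bar> \<le> 20 * (\<eta> * s\<^sup>2) + 2 * (\<bar>K\<bar> * (\<eta> * s\<^sup>2))"
        using T(1) kT KT p0 kp0 unfolding abs_le_iff by (simp add: mult.assoc)
      then have "pi * \<bar>(T - s) + k * T\<^sup>2 / 2 - K * (T\<^sup>2 - s\<^sup>2) / 12\<bar> \<le> pi * (20 * (\<eta> * s\<^sup>2) + 2 * (\<bar>K\<bar> * (\<eta> * s\<^sup>2)))"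
        by (rule mult_left_mono) simp
      also have "\<dots> = pi * (20 + 2 * \<bar>K\<bar>) * \<eta> * s\<^sup>2" by (simp add: algebra_simps)
      also have "\<dots> \<le> \<epsilon> * s\<^sup>2" using \<eta>(3) by (rule mult_right_mono) simp
      finally show ?thesis unfolding eq by (simp add: abs_mult)
    qed
    \<comment> \<open>In the sublevel set |z|^2 \<le> 2 s by \<open>F_lower\<close>, so the error
      \<eta> |z|^4 is at most 4 \<eta> s^2.\<close>
    have up: "ball_area A G x r \<le> pi * (s + 4 * \<eta> * s\<^sup>2) + (\<eta> - K / 6) * (pi * (s + 4 * \<eta> * s\<^sup>2)\<^sup>2 / 2)"
    proof -
      define R where "R = sqrt (s + 4 * \<eta> * s\<^sup>2)"
      have R: "0 \<le> R" "R\<^sup>2 = s + 4 * \<eta> * s\<^sup>2" using s \<eta> by (auto simp: R_def)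
      have "R\<^sup>2 < (3 * r)\<^sup>2" unfolding R(2) using \<eta>s s by (simp add: power_mult_distrib s_def[symmetric])
      then have R3: "R < 3 * r" by (rule power2_less_imp_less) (use r in simp)
      have sub: "\<Omega> \<subseteq> ball 0 R"
      proof
        fix z assume "z \<in> \<Omega>"
        then have z: "norm z < r1" "Fd z < s" by (auto simp: \<Omega>_def s_def)
        have z2: "(norm z)\<^sup>2 \<le> 2 * s" using F_lower[OF z(1)] z(2) by simp
        have "(norm z)\<^sup>2 < (3 * r)\<^sup>2" using z2 s by (simp add: power_mult_distrib s_def[symmetric])
        then have "norm z < 3 * r" by (rule power2_less_imp_less) (use r in simp)
        then have "norm z < ds" using r r3 by linarith
        from ds(3)[OF this] have "\<bar>Fd z - (norm z)\<^sup>2\<bar> \<le> \<eta> * ((norm z)\<^sup>2)\<^sup>2" by simp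
        also have "((norm z)\<^sup>2)\<^sup>2 \<le> (2 * s)\<^sup>2" using z2 by (intro power_mono) auto
        then have "\<eta> * ((norm z)\<^sup>2)\<^sup>2 \<le> \<eta> * (2 * s)\<^sup>2" using \<eta>(1) by (intro mult_left_mono) auto
        finally have "(norm z)\<^sup>2 - Fd z \<le> \<eta> * (2 * s)\<^sup>2" unfolding abs_le_iff by linarith
        moreover have "\<eta> * (2 * s)\<^sup>2 = 4 * \<eta> * s\<^sup>2" by (simp add: power_mult_distrib)
        ultimately have "(norm z)\<^sup>2 < R\<^sup>2" unfolding R(2) using z(2) by linarith
        then have "norm z < R" by (rule power2_less_imp_less) (use R in simp)
        then show "z \<in> ball 0 R" by simp
      qed
      have dB: "set_integrable lborel (ball 0 R) dens" by (rule di) simp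
      have "ball_area A G x r \<le> (LINT z:ball 0 R|lborel. dens z)"
        unfolding B(3) by (rule dmono[OF sub]) (use B(1) in auto)
      also have "\<dots> \<le> (LINT z:ball 0 R|lborel. 1 + (\<eta> - K / 6) * (norm (z::real^2))\<^sup>2)"
      proof (rule set_integral_mono)
        show "set_integrable lborel (ball 0 R) dens" by (rule dB)
        show "set_integrable lborel (ball 0 R) (\<lambda>z::real^2. 1 + (\<eta> - K / 6) * (norm z)\<^sup>2)"
          by (rule set_integral_disc_quadratic(1)[OF R(1)])
        fix z :: "real^2" assume "z \<in> ball 0 R"
        then have "norm z < dd" using R3 r r3 by simp
        from dd(2)[OF this] show "dens z \<le> 1 + (\<eta> - K / 6) * (norm z)\<^sup>2" by (simp add: abs_le_iff algebra_simps)
      qed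
      also have "\<dots> = pi * R\<^sup>2 + (\<eta> - K / 6) * (pi * (R\<^sup>2)\<^sup>2 / 2)" by (rule set_integral_disc_quadratic(2)[OF R(1)])
      finally show ?thesis unfolding R(2) .
    qed
    have low: "pi * (s - \<eta> * s\<^sup>2) + (- \<eta> - K / 6) * (pi * (s - \<eta> * s\<^sup>2)\<^sup>2 / 2) \<le> ball_area A G x r"
    proof -
      define R where "R = sqrt (s - \<eta> * s\<^sup>2)"
      have R: "0 \<le> R" "R\<^sup>2 = s - \<eta> * s\<^sup>2" using \<eta>s by (auto simp: R_def)
      have "R\<^sup>2 \<le> r\<^sup>2" unfolding R(2) using \<eta> by (simp add: s_def)
      then have Rr: "R \<le> r" by (rule power2_le_imp_le) (use r in simp)
      have sub: "ball 0 R \<subseteq> \<Omega>"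
      proof
        fix z :: "real^2" assume "z \<in> ball 0 R"
        then have z: "norm z < R" by simp
        have z2: "(norm z)\<^sup>2 < R\<^sup>2" using z by (intro power_strict_mono) auto
        have "norm z < ds" using z Rr r r3 ds(1) by linarith
        from ds(3)[OF this] have "\<bar>Fd z - (norm z)\<^sup>2\<bar> \<le> \<eta> * ((norm z)\<^sup>2)\<^sup>2" by simp
        also have "(norm z)\<^sup>2 \<le> s" using z2 \<open>R\<^sup>2 \<le> r\<^sup>2\<close> by (simp add: s_def)
        then have "\<eta> * ((norm z)\<^sup>2)\<^sup>2 \<le> \<eta> * s\<^sup>2" using \<eta>(1) by (intro mult_left_mono power_mono) auto
        finally have "Fd z - (norm z)\<^sup>2 \<le> \<eta> * s\<^sup>2" unfolding abs_le_iff by linarith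
        then have "Fd z < s" using z2 unfolding R(2) by linarith
        then show "z \<in> \<Omega>" using z Rr r' r1_pos by (auto simp: \<Omega>_def s_def)
      qed
      have dB: "set_integrable lborel (ball 0 R) dens" by (rule di) simp
      have "(LINT z:ball 0 R|lborel. 1 + (- \<eta> - K / 6) * (norm (z::real^2))\<^sup>2) \<le> (LINT z:ball 0 R|lborel. dens z)"
      proof (rule set_integral_mono[OF set_integral_disc_quadratic(1)[OF R(1)] dB])
        fix z :: "real^2" assume "z \<in> ball 0 R"
        then have "norm z < dd" using Rr r r3 dd(1) by simp
        from dd(2)[OF this] show "1 + (- \<eta> - K / 6) * (norm z)\<^sup>2 \<le> dens z" by (simp add: abs_le_iff algebra_simps)
      qed
      also have "\<dots> \<le> ball_area A G x r"
        unfolding B(3) by (rule dmono[OF sub]) (use B(1) in auto)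
      finally show ?thesis unfolding set_integral_disc_quadratic(2)[OF R(1)] R(2) .
    qed
    have "\<bar>pi * (s + 4 * \<eta> * s\<^sup>2) + (\<eta> - K / 6) * (pi * (s + 4 * \<eta> * s\<^sup>2)\<^sup>2 / 2) - (pi * s - pi * K / 12 * s\<^sup>2)\<bar> \<le> \<epsilon> * s\<^sup>2"
      by (rule est) (use \<eta> s in auto)
    moreover have "\<bar>pi * (s - \<eta> * s\<^sup>2) + (- \<eta> - K / 6) * (pi * (s - \<eta> * s\<^sup>2)\<^sup>2 / 2) - (pi * s - pi * K / 12 * s\<^sup>2)\<bar> \<le> \<epsilon> * s\<^sup>2"
      by (rule est) (use \<eta> s \<eta>s in auto)
    ultimately have "\<bar>ball_area A G x r - (pi * s - pi * K / 12 * s\<^sup>2)\<bar> \<le> \<epsilon> * s\<^sup>2"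
      using up low unfolding abs_le_iff by linarith
    moreover have "pi * s - pi * K / 12 * s\<^sup>2 = pi * r\<^sup>2 * (1 - K / 12 * r\<^sup>2)"
      unfolding s_def by (simp add: power2_eq_square algebra_simps)
    ultimately show ?thesis unfolding s(3) by simp
  qed
  then show ?thesis using r3(1) by blast
qed

lemma perimeter_approx:
  assumes "0 < \<epsilon>"
  shows "\<exists>r3>0. \<forall>r. 0 < r \<longrightarrow> r < r3 \<longrightarrow> \<bar>perimeter A G x r - 2 * pi * r * (1 - K / 6 * r\<^sup>2)\<bar> \<le> \<epsilon> * r ^ 3"
proof -
  obtain r3 where r3: "0 < r3" "r3 \<le> r1 / 16" "\<And>r. 0 < r \<Longrightarrow> r < r3 \<Longrightarrow>
     \<bar>integral {0..2 * pi} (lspeed r) - 2 * pi * r * (1 - K / 6 * r\<^sup>2)\<bar> \<le> \<epsilon> * r ^ 3"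
    using integral_lspeed[OF assms] by blast
  have "\<bar>perimeter A G x r - 2 * pi * r * (1 - K / 6 * r\<^sup>2)\<bar> \<le> \<epsilon> * r ^ 3" if "0 < r" "r < r3" for r
    using r3(3)[OF that] perimeter_eq[of r] that r3(2) by simp
  then show ?thesis using r3(1) by blast
qed

end

section \<open>From asymptotic estimates to the gauge radii\<close>

text \<open>Dividing the estimates by 2 pi r and by pi r^2 gives the remainders. The area gauge
  takes a square root, which halves K/12 to K/24 and adds a relative error of order r^4.\<close>

lemma gauge_expansions:
  fixes per ar :: "real \<Rightarrow> real"
  assumes per: "\<And>\<epsilon>. 0 < \<epsilon> \<Longrightarrow> \<exists>r3>0. \<forall>r. 0 < r \<longrightarrow> r < r3 \<longrightarrow> \<bar>per r - 2 * pi * r * (1 - K / 6 * r\<^sup>2)\<bar> \<le> \<epsilon> * r ^ 3"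
    and ar: "\<And>\<epsilon>. 0 < \<epsilon> \<Longrightarrow> \<exists>r3>0. \<forall>r. 0 < r \<longrightarrow> r < r3 \<longrightarrow> \<bar>ar r - pi * r\<^sup>2 * (1 - K / 12 * r\<^sup>2)\<bar> \<le> \<epsilon> * r ^ 4"
  shows "\<exists>\<rho>. \<rho> \<in> o[at_right 0](\<lambda>r. r ^ 2) \<and> (\<forall>\<^sub>F r in at_right 0. per r = 2 * pi * r * (1 - K / 6 * r ^ 2 + \<rho> r))"
    and "(\<lambda>r. r - per r / (2 * pi) - K / 6 * r ^ 3) \<in> o[at_right 0](\<lambda>r. r ^ 3)"
    and "\<exists>\<rho>. \<rho> \<in> o[at_right 0](\<lambda>r. r ^ 2) \<and> (\<forall>\<^sub>F r in at_right 0. ar r = pi * r ^ 2 * (1 - K / 12 * r ^ 2 + \<rho> r))"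
    and "(\<lambda>r. r - sqrt (ar r / pi) - K / 24 * r ^ 3) \<in> o[at_right 0](\<lambda>r. r ^ 3)"
proof -
  have ev: "\<forall>\<^sub>F r in at_right 0. P r" if "\<exists>r3>0. \<forall>r. 0 < r \<longrightarrow> r < r3 \<longrightarrow> P r" for P :: "real \<Rightarrow> bool"
    using that unfolding eventually_at_right_field by auto
  have pos: "\<forall>\<^sub>F r in at_right 0. (0::real) < r" by (rule ev) (auto intro: exI[of _ 1])
  have per': "\<forall>\<^sub>F r in at_right 0. \<bar>per r - 2 * pi * r * (1 - K / 6 * r\<^sup>2)\<bar> \<le> \<epsilon> * r ^ 3" if "0 < \<epsilon>" for \<epsilon>
    by (rule ev[OF per[OF that]])
  have ar': "\<forall>\<^sub>F r in at_right 0. \<bar>ar r - pi * r\<^sup>2 * (1 - K / 12 * r\<^sup>2)\<bar> \<le> \<epsilon> * r ^ 4" if "0 < \<epsilon>" for \<epsilon>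
    by (rule ev[OF ar[OF that]])
  define \<rho>1 where "\<rho>1 = (\<lambda>r. per r / (2 * pi * r) - (1 - K / 6 * r\<^sup>2))"
  define \<rho>2 where "\<rho>2 = (\<lambda>r. ar r / (pi * r\<^sup>2) - (1 - K / 12 * r\<^sup>2))"
  have b1: "\<forall>\<^sub>F r in at_right 0. \<bar>\<rho>1 r\<bar> \<le> \<epsilon> * r\<^sup>2" if e: "0 < \<epsilon>" for \<epsilon>
  proof -
    have p: "0 < 2 * pi * \<epsilon>" using e by simp
    show ?thesis using per'[OF p] pos
  proof eventually_elim
    case (elim r)
    have "\<rho>1 r = (per r - 2 * pi * r * (1 - K / 6 * r\<^sup>2)) / (2 * pi * r)"
      using elim(2) by (simp add: \<rho>1_def diff_divide_distrib)
    then have "\<bar>\<rho>1 r\<bar> = \<bar>per r - 2 * pi * r * (1 - K / 6 * r\<^sup>2)\<bar> / (2 * pi * r)"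
      using elim(2) by (simp add: abs_divide)
    also have "\<dots> \<le> 2 * pi * \<epsilon> * r ^ 3 / (2 * pi * r)" using elim by (intro divide_right_mono) auto
    also have "\<dots> = \<epsilon> * r\<^sup>2" using elim(2) by (simp add: power3_eq_cube power2_eq_square)
    finally show ?case .
  qed
  qed
  have b2: "\<forall>\<^sub>F r in at_right 0. \<bar>\<rho>2 r\<bar> \<le> \<epsilon> * r\<^sup>2" if e: "0 < \<epsilon>" for \<epsilon>
  proof -
    have p: "0 < pi * \<epsilon>" using e by simp
    show ?thesis using ar'[OF p] pos
  proof eventually_elim
    case (elim r)
    have "\<rho>2 r = (ar r - pi * r\<^sup>2 * (1 - K / 12 * r\<^sup>2)) / (pi * r\<^sup>2)"
      using elim(2) by (simp add: \<rho>2_def diff_divide_distrib)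
    then have "\<bar>\<rho>2 r\<bar> = \<bar>ar r - pi * r\<^sup>2 * (1 - K / 12 * r\<^sup>2)\<bar> / (pi * r\<^sup>2)"
      using elim(2) by (simp add: abs_divide)
    also have "\<dots> \<le> pi * \<epsilon> * r ^ 4 / (pi * r\<^sup>2)" using elim by (intro divide_right_mono) auto
    also have "\<dots> = \<epsilon> * r\<^sup>2" using elim(2) by (simp add: power4_eq_xxxx power2_eq_square)
    finally show ?case .
  qed
  qed
  have eq1: "\<forall>\<^sub>F r in at_right 0. per r = 2 * pi * r * (1 - K / 6 * r ^ 2 + \<rho>1 r)"
    using pos by eventually_elim (simp add: \<rho>1_def)
  have eq2: "\<forall>\<^sub>F r in at_right 0. ar r = pi * r ^ 2 * (1 - K / 12 * r ^ 2 + \<rho>2 r)"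
    using pos by eventually_elim (simp add: \<rho>2_def)
  have o1: "\<rho>1 \<in> o[at_right 0](\<lambda>r. r ^ 2)" by (rule landau_o.smallI) (use b1 in simp)
  have o2: "\<rho>2 \<in> o[at_right 0](\<lambda>r. r ^ 2)" by (rule landau_o.smallI) (use b2 in simp)
  show "\<exists>\<rho>. \<rho> \<in> o[at_right 0](\<lambda>r. r ^ 2) \<and> (\<forall>\<^sub>F r in at_right 0. per r = 2 * pi * r * (1 - K / 6 * r ^ 2 + \<rho> r))"
    using o1 eq1 by blast
  show "\<exists>\<rho>. \<rho> \<in> o[at_right 0](\<lambda>r. r ^ 2) \<and> (\<forall>\<^sub>F r in at_right 0. ar r = pi * r ^ 2 * (1 - K / 12 * r ^ 2 + \<rho> r))"
    using o2 eq2 by blast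
  show "(\<lambda>r. r - per r / (2 * pi) - K / 6 * r ^ 3) \<in> o[at_right 0](\<lambda>r. r ^ 3)"
  proof (rule landau_o.smallI)
    fix \<epsilon> :: real assume e: "0 < \<epsilon>"
    show "\<forall>\<^sub>F r in at_right 0. norm (r - per r / (2 * pi) - K / 6 * r ^ 3) \<le> \<epsilon> * norm (r ^ 3)"
      using b1[OF e] eq1 pos
    proof eventually_elim
      case (elim r)
      have "r - per r / (2 * pi) - K / 6 * r ^ 3 = - (r * \<rho>1 r)"
        unfolding elim(2) by (simp add: field_simps power2_eq_square power3_eq_cube)
      then have "norm (r - per r / (2 * pi) - K / 6 * r ^ 3) = r * \<bar>\<rho>1 r\<bar>" using elim(3) by (simp add: abs_mult)
      also have "\<dots> \<le> r * (\<epsilon> * r\<^sup>2)" using elim by (intro mult_left_mono) auto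
      finally show ?case using elim(3) by (simp add: power2_eq_square power3_eq_cube mult_ac)
    qed
  qed
  show "(\<lambda>r. r - sqrt (ar r / pi) - K / 24 * r ^ 3) \<in> o[at_right 0](\<lambda>r. r ^ 3)"
  proof (rule landau_o.smallI)
    fix \<epsilon> :: real assume e: "0 < \<epsilon>"
    define \<eta> where "\<eta> = min 1 \<epsilon>"
    have \<eta>: "0 < \<eta>" "\<eta> \<le> 1" "\<eta> \<le> \<epsilon>" using e by (auto simp: \<eta>_def)
    define D where "D = \<bar>K\<bar> / 12 + 1"
    have D: "1 \<le> D" by (simp add: D_def)
    have sm: "\<forall>\<^sub>F r in at_right 0. r < min 1 (min (1 / (2 * D)) (\<epsilon> / (2 * D\<^sup>2)))"
      by (rule ev) (use e D in \<open>auto intro!: exI[of _ "min 1 (min (1 / (2 * D)) (\<epsilon> / (2 * D\<^sup>2)))"]\<close>)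
    show "\<forall>\<^sub>F r in at_right 0. norm (r - sqrt (ar r / pi) - K / 24 * r ^ 3) \<le> \<epsilon> * norm (r ^ 3)"
      using b2[OF \<eta>(1)] eq2 pos sm
    proof eventually_elim
      case (elim r)
      define s where "s = r\<^sup>2"
      have "r * r \<le> r * 1" using elim by (intro mult_left_mono) auto
      then have s: "0 \<le> s" "s \<le> r" by (auto simp: s_def power2_eq_square)
      define y where "y = \<rho>2 r - K / 12 * s"
      have r2: "\<bar>\<rho>2 r\<bar> \<le> \<eta> * s" using elim(1) by (simp add: s_def)
      have "\<eta> * s \<le> 1 * s" using \<eta> s by (intro mult_right_mono) auto
      moreover have "\<bar>K / 12 * s\<bar> = \<bar>K\<bar> / 12 * s" using s by (simp add: abs_mult)
      ultimately have y: "\<bar>y\<bar> \<le> D * s" using r2 unfolding y_def D_def by (simp add: algebra_simps)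
      have "D * s \<le> D * (1 / (2 * D))" using s elim(4) D by (intro mult_left_mono) auto
      then have Ds: "D * s \<le> 1 / 2" using D by simp
      have sq: "\<bar>sqrt (1 + y) - (1 + y / 2)\<bar> \<le> y\<^sup>2" by (rule sqrt_expand) (use y Ds in linarith)
      have "y\<^sup>2 \<le> D\<^sup>2 * s * s" using power_mono[OF y, of 2] by (simp add: power_mult_distrib power2_eq_square mult_ac)
      also have "\<dots> \<le> D\<^sup>2 * (\<epsilon> / (2 * D\<^sup>2)) * s" using s elim(4) by (intro mult_right_mono mult_left_mono) auto
      finally have y2: "y\<^sup>2 \<le> \<epsilon> / 2 * s" using D by simp
      have es: "\<eta> * s \<le> \<epsilon> * s" using \<eta> s by (intro mult_right_mono) auto
      have "1 - sqrt (1 + y) - K / 24 * s = - (sqrt (1 + y) - (1 + y / 2)) + (- (\<rho>2 r / 2))"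
        by (simp add: y_def field_simps)
      also have "\<bar>\<dots>\<bar> \<le> \<bar>- (sqrt (1 + y) - (1 + y / 2))\<bar> + \<bar>- (\<rho>2 r / 2)\<bar>" by (rule abs_triangle_ineq)
      also have "\<dots> = \<bar>sqrt (1 + y) - (1 + y / 2)\<bar> + \<bar>\<rho>2 r\<bar> / 2" by (simp only: abs_minus_cancel abs_divide abs_numeral)
      also have "\<dots> \<le> y\<^sup>2 + (\<eta> * s) / 2" using sq r2 by (intro add_mono divide_right_mono) auto
      also have "\<dots> \<le> \<epsilon> / 2 * s + (\<epsilon> * s) / 2" using y2 es by (intro add_mono divide_right_mono) auto
      finally have fin: "\<bar>1 - sqrt (1 + y) - K / 24 * s\<bar> \<le> \<epsilon> * s" by simp
      have "ar r / pi = r\<^sup>2 * (1 + y)" unfolding elim(2) by (simp add: y_def s_def)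
      then have "sqrt (ar r / pi) = r * sqrt (1 + y)" using elim(3) by (simp add: real_sqrt_mult)
      then have "r - sqrt (ar r / pi) - K / 24 * r ^ 3 = r * (1 - sqrt (1 + y) - K / 24 * s)"
        by (simp add: s_def power2_eq_square power3_eq_cube algebra_simps)
      then have "norm (r - sqrt (ar r / pi) - K / 24 * r ^ 3) = r * \<bar>1 - sqrt (1 + y) - K / 24 * s\<bar>"
        using elim(3) by (simp add: abs_mult)
      also have "\<dots> \<le> r * (\<epsilon> * s)" using fin elim(3) by (intro mult_left_mono) auto
      finally show ?case using elim(3) by (simp add: s_def power2_eq_square power3_eq_cube mult_ac)
    qed
  qed
qed

section \<open>Second-order jets and C^{1,1} functions at the origin\<close>

text \<open>o(|z|^2) at the origin. The filter \<open>nhds 0\<close>, which unlike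
  \<open>at 0\<close> includes the point, forces e 0 = 0, so a jet also fixes the value at
  0.\<close>

definition small2 :: "(real^2 \<Rightarrow> real) \<Rightarrow> bool" where
  "small2 e \<longleftrightarrow> (\<forall>\<epsilon>>0. \<forall>\<^sub>F z in nhds 0. \<bar>e z\<bar> \<le> \<epsilon> * (norm z)\<^sup>2)"

lemma small2_zero: "small2 (\<lambda>z. 0)"
  by (simp add: small2_def)

lemma small2_add:
  assumes "small2 e" "small2 f"
  shows "small2 (\<lambda>z. e z + f z)"
  unfolding small2_def
proof safe
  fix \<epsilon> :: real assume "0 < \<epsilon>"
  then have h: "0 < \<epsilon> / 2" by simp
  have "\<forall>\<^sub>F z in nhds 0. \<bar>e z\<bar> \<le> \<epsilon> / 2 * (norm z)\<^sup>2" "\<forall>\<^sub>F z in nhds 0. \<bar>f z\<bar> \<le> \<epsilon> / 2 * (norm z)\<^sup>2"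
    using assms h unfolding small2_def by blast+
  then show "\<forall>\<^sub>F z in nhds 0. \<bar>e z + f z\<bar> \<le> \<epsilon> * (norm z)\<^sup>2"
  proof eventually_elim
    case (elim z)
    have "\<epsilon> / 2 * (norm z)\<^sup>2 + \<epsilon> / 2 * (norm z)\<^sup>2 = \<epsilon> * (norm z)\<^sup>2" by simp
    then show ?case using elim by linarith
  qed
qed

lemma small2_mult_tendsto:
  assumes e: "small2 e" and b: "(b \<longlongrightarrow> l) (nhds 0)"
  shows "small2 (\<lambda>z. e z * b z)"
  unfolding small2_def
proof safe
  fix \<epsilon> :: real assume \<epsilon>: "0 < \<epsilon>"
  have p: "0 < \<bar>l\<bar> + 1" by simp
  have "\<forall>\<^sub>F z in nhds 0. \<bar>b z\<bar> < \<bar>l\<bar> + 1" by (rule order_tendstoD(2)[OF tendsto_rabs[OF b]]) simp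
  moreover have "0 < \<epsilon> / (\<bar>l\<bar> + 1)" using \<epsilon> p by simp
  then have "\<forall>\<^sub>F z in nhds 0. \<bar>e z\<bar> \<le> \<epsilon> / (\<bar>l\<bar> + 1) * (norm z)\<^sup>2" using e unfolding small2_def by blast
  ultimately show "\<forall>\<^sub>F z in nhds 0. \<bar>e z * b z\<bar> \<le> \<epsilon> * (norm z)\<^sup>2"
  proof eventually_elim
    case (elim z)
    have "\<bar>e z * b z\<bar> \<le> (\<epsilon> / (\<bar>l\<bar> + 1) * (norm z)\<^sup>2) * (\<bar>l\<bar> + 1)"
      unfolding abs_mult using elim \<epsilon> by (intro mult_mono) auto
    also have "\<dots> = \<epsilon> * (norm z)\<^sup>2" using p by (simp add: field_simps)
    finally show ?case .
  qed
qed

lemma abs_nth_le_norm: "\<bar>(z :: real^2) $ i\<bar> \<le> norm z"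
  using component_le_norm_cart[of z i] by simp

lemma quad_bound: "\<bar>a * (z$1)\<^sup>2 + b * (z$1 * z$2) + c * (z$2)\<^sup>2\<bar> \<le> (\<bar>a\<bar> + \<bar>b\<bar> + \<bar>c\<bar>) * (norm (z :: real^2))\<^sup>2"
proof -
  have n: "\<bar>z$i * z$j\<bar> \<le> (norm z)\<^sup>2" for i j
    unfolding abs_mult power2_eq_square by (intro mult_mono abs_nth_le_norm) auto
  have k: "\<bar>d * (z$i * z$j)\<bar> \<le> \<bar>d\<bar> * (norm z)\<^sup>2" for d i j
    by (subst abs_mult) (rule mult_left_mono[OF n abs_ge_zero])
  note k[of a 1 1] k[of b 1 2] k[of c 2 2]
  then show ?thesis unfolding power2_eq_square[of "z$1"] power2_eq_square[of "z$2"] distrib_right by linarith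
qed

lemma small2_quad:
  assumes b: "(b \<longlongrightarrow> 0) (nhds 0)"
  shows "small2 (\<lambda>z. (q1 * (z$1)\<^sup>2 + q2 * (z$1 * z$2) + q3 * (z$2)\<^sup>2) * b z)"
  unfolding small2_def
proof safe
  fix \<epsilon> :: real assume \<epsilon>: "0 < \<epsilon>"
  define B where "B = \<bar>q1\<bar> + \<bar>q2\<bar> + \<bar>q3\<bar> + 1"
  have B: "0 < B" by (simp add: B_def add_nonneg_pos)
  have "\<forall>\<^sub>F z in nhds 0. \<bar>b z\<bar> < \<epsilon> / B" using tendsto_rabs[OF b] by (rule order_tendstoD(2)) (use \<epsilon> B in simp)
  then show "\<forall>\<^sub>F z in nhds 0. \<bar>(q1 * (z$1)\<^sup>2 + q2 * (z$1 * z$2) + q3 * (z$2)\<^sup>2) * b z\<bar> \<le> \<epsilon> * (norm z)\<^sup>2"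
  proof eventually_elim
    case (elim z)
    have "\<bar>q1 * (z$1)\<^sup>2 + q2 * (z$1 * z$2) + q3 * (z$2)\<^sup>2\<bar> \<le> B * (norm z)\<^sup>2"
      by (rule order_trans[OF quad_bound]) (auto simp: B_def intro!: mult_right_mono)
    then have "\<bar>q1 * (z$1)\<^sup>2 + q2 * (z$1 * z$2) + q3 * (z$2)\<^sup>2\<bar> * \<bar>b z\<bar> \<le> B * (norm z)\<^sup>2 * (\<epsilon> / B)"
      using elim by (intro mult_mono) auto
    also have "B * (norm z)\<^sup>2 * (\<epsilon> / B) = \<epsilon> * (norm z)\<^sup>2" using B by simp
    finally show ?case by (simp only: abs_mult)
  qed
qed

text \<open>\<open>jet f c l1 l2 q1 q2 q3\<close>: the second-order Taylor polynomial of \<open>f\<close> at the origin is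
  \<open>c + l1 x + l2 y + q1 x\<^sup>2 + q2 x y + q3 y\<^sup>2\<close> (in particular \<open>f 0 = c\<close>).\<close>

definition jet :: "(real^2 \<Rightarrow> real) \<Rightarrow> real \<Rightarrow> real \<Rightarrow> real \<Rightarrow> real \<Rightarrow> real \<Rightarrow> real \<Rightarrow> bool" where
  "jet f c l1 l2 q1 q2 q3 \<longleftrightarrow>
     small2 (\<lambda>z. f z - (c + l1 * z$1 + l2 * z$2 + (q1 * (z$1)\<^sup>2 + q2 * (z$1 * z$2) + q3 * (z$2)\<^sup>2)))"

lemma tendsto_nth_0: "((\<lambda>z::real^2. z $ i) \<longlongrightarrow> 0) (nhds 0)"
  using tendsto_vec_nth[OF tendsto_ident_at[of 0 UNIV, unfolded tendsto_at_iff_tendsto_nhds], of i]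
    tendsto_at_iff_tendsto_nhds[of "\<lambda>z::real^2. z $ i" 0] tendsto_vec_nth[OF tendsto_ident_at[of "0::real^2" UNIV], of i]
  by simp

lemma jet_tendsto:
  assumes "jet f c l1 l2 q1 q2 q3"
  shows "(f \<longlongrightarrow> c) (nhds 0)"
proof -
  let ?P = "\<lambda>z::real^2. c + l1 * z$1 + l2 * z$2 + (q1 * (z$1)\<^sup>2 + q2 * (z$1 * z$2) + q3 * (z$2)\<^sup>2)"
  have P: "(?P \<longlongrightarrow> c + l1 * 0 + l2 * 0 + (q1 * 0\<^sup>2 + q2 * (0 * 0) + q3 * 0\<^sup>2)) (nhds 0)"
    by (intro tendsto_intros tendsto_nth_0)
  have n: "((\<lambda>z::real^2. 1 * (norm z)\<^sup>2) \<longlongrightarrow> 0) (nhds 0)"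
    using tendsto_add[OF tendsto_power[OF tendsto_nth_0[of 1], of 2] tendsto_power[OF tendsto_nth_0[of 2], of 2]]
    by (simp add: norm_vec2)
  have "((\<lambda>z. f z - ?P z) \<longlongrightarrow> 0) (nhds 0)"
  proof (rule Lim_null_comparison[OF _ n])
    show "\<forall>\<^sub>F z in nhds 0. norm (f z - ?P z) \<le> 1 * (norm z)\<^sup>2"
      using assms unfolding jet_def small2_def real_norm_def by (auto dest: spec[of _ 1])
  qed
  from tendsto_add[OF this P] show ?thesis by simp
qed

lemma jet_const: "jet (\<lambda>z. c) c 0 0 0 0 0"
  and jet_fst: "jet (\<lambda>z. z$1) 0 1 0 0 0 0"
  and jet_snd: "jet (\<lambda>z. z$2) 0 0 1 0 0 0"
  by (simp_all add: jet_def small2_zero)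

lemma jet_add:
  assumes "jet f c l1 l2 q1 q2 q3" "jet g c' l1' l2' q1' q2' q3'"
  shows "jet (\<lambda>z. f z + g z) (c + c') (l1 + l1') (l2 + l2') (q1 + q1') (q2 + q2') (q3 + q3')"
  using small2_add[OF assms[unfolded jet_def]] unfolding jet_def
  by (rule back_subst[of small2]) (simp add: fun_eq_iff algebra_simps)

lemma jet_mult:
  assumes f: "jet f c l1 l2 q1 q2 q3" and g: "jet g c' l1' l2' q1' q2' q3'"
  shows "jet (\<lambda>z. f z * g z) (c * c') (c * l1' + l1 * c') (c * l2' + l2 * c')
    (c * q1' + l1 * l1' + q1 * c') (c * q2' + l1 * l2' + l2 * l1' + q2 * c') (c * q3' + l2 * l2' + q3 * c')"
proof -
  let ?L = "\<lambda>z::real^2. l1 * z$1 + l2 * z$2" and ?L' = "\<lambda>z::real^2. l1' * z$1 + l2' * z$2"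
  let ?Q = "\<lambda>z::real^2. q1 * (z$1)\<^sup>2 + q2 * (z$1 * z$2) + q3 * (z$2)\<^sup>2"
  let ?Q' = "\<lambda>z::real^2. q1' * (z$1)\<^sup>2 + q2' * (z$1 * z$2) + q3' * (z$2)\<^sup>2"
  let ?ef = "\<lambda>z. f z - (c + l1 * z$1 + l2 * z$2 + ?Q z)" and ?eg = "\<lambda>z. g z - (c' + l1' * z$1 + l2' * z$2 + ?Q' z)"
  have P: "((\<lambda>z::real^2. c + l1 * z$1 + l2 * z$2 + ?Q z) \<longlongrightarrow> c + l1 * 0 + l2 * 0 + (q1 * 0\<^sup>2 + q2 * (0 * 0) + q3 * 0\<^sup>2)) (nhds 0)"
    by (intro tendsto_intros tendsto_nth_0)
  have LQ: "((\<lambda>z. ?L z + ?Q z) \<longlongrightarrow> (l1 * 0 + l2 * 0) + (q1 * 0\<^sup>2 + q2 * (0 * 0) + q3 * 0\<^sup>2)) (nhds 0)"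
    by (intro tendsto_intros tendsto_nth_0)
  have L': "((\<lambda>z. ?L' z) \<longlongrightarrow> l1' * 0 + l2' * 0) (nhds 0)"
    by (intro tendsto_intros tendsto_nth_0)
  \<comment> \<open>The product minus its second-order part: each error times a bounded factor, and
    the terms of degree at least three of the product of the polynomials, each a quadratic form
    times something tending to 0.\<close>
  have "small2 (\<lambda>z. (?ef z * g z + ?eg z * (c + l1 * z$1 + l2 * z$2 + ?Q z)) + (?Q' z * (?L z + ?Q z) + ?Q z * ?L' z))"
    by (intro small2_add small2_mult_tendsto[OF f[unfolded jet_def] jet_tendsto[OF g]]
        small2_mult_tendsto[OF g[unfolded jet_def] P] small2_quad) (use LQ L' in simp_all)
  then show ?thesis unfolding jet_def by (rule back_subst[of small2]) (simp add: fun_eq_iff algebra_simps power2_eq_square)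
qed

lemma jet_cmult: "jet f c l1 l2 q1 q2 q3 \<Longrightarrow> jet (\<lambda>z. k * f z) (k * c) (k * l1) (k * l2) (k * q1) (k * q2) (k * q3)"
  using jet_mult[OF jet_const[of k]] by simp

lemma jet_eq:
  assumes "jet f c l1 l2 q1 q2 q3" "c = c'" "l1 = l1'" "l2 = l2'" "q1 = q1'" "q2 = q2'" "q3 = q3'"
  shows "jet f c' l1' l2' q1' q2' q3'"
  using assms by simp

definition vec2 :: "real \<Rightarrow> real \<Rightarrow> real^2" where "vec2 a b = a *\<^sub>R axis 1 1 + b *\<^sub>R axis 2 1"

lemma vec2_nth [simp]: "vec2 a b $ 1 = a" "vec2 a b $ 2 = b"
  by (simp_all add: vec2_def axis_def)

lemma norm_vec2_le: "norm (vec2 a b) \<le> \<bar>a\<bar> + \<bar>b\<bar>"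
  unfolding vec2_def by (rule order_trans[OF norm_triangle_ineq]) simp

lemma jet_linear_bound:
  assumes "jet f 0 l1 l2 q1 q2 q3"
  shows "\<exists>C>0. \<forall>\<^sub>F z in nhds 0. \<bar>f z\<bar> \<le> C * norm z"
proof -
  define C where "C = \<bar>l1\<bar> + \<bar>l2\<bar> + (\<bar>q1\<bar> + \<bar>q2\<bar> + \<bar>q3\<bar>) + 1"
  have C: "0 < C" by (simp add: C_def add_nonneg_pos)
  have "\<forall>\<^sub>F z in nhds (0::real^2). norm z < 1" by (rule eventually_nhds_metric[THEN iffD2]) (auto intro: exI[of _ 1])
  moreover have "\<forall>\<^sub>F z in nhds 0. \<bar>f z - (0 + l1 * z$1 + l2 * z$2 + (q1 * (z$1)\<^sup>2 + q2 * (z$1 * z$2) + q3 * (z$2)\<^sup>2))\<bar> \<le> 1 * (norm z)\<^sup>2"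
    using assms unfolding jet_def small2_def by (meson zero_less_one)
  ultimately have "\<forall>\<^sub>F z in nhds 0. \<bar>f z\<bar> \<le> C * norm z"
  proof eventually_elim
    case (elim z)
    have n2: "(norm z)\<^sup>2 \<le> norm z" using mult_left_mono[of "norm z" 1 "norm z"] elim(1) by (simp add: power2_eq_square)
    have l: "\<bar>l1 * z$1\<bar> \<le> \<bar>l1\<bar> * norm z" "\<bar>l2 * z$2\<bar> \<le> \<bar>l2\<bar> * norm z"
      unfolding abs_mult by (intro mult_left_mono abs_nth_le_norm; simp)+
    have q: "\<bar>q1 * (z$1)\<^sup>2 + q2 * (z$1 * z$2) + q3 * (z$2)\<^sup>2\<bar> \<le> (\<bar>q1\<bar> + \<bar>q2\<bar> + \<bar>q3\<bar>) * norm z"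
      by (rule order_trans[OF quad_bound]) (use n2 in \<open>auto intro!: mult_left_mono\<close>)
    have "C * norm z = \<bar>l1\<bar> * norm z + \<bar>l2\<bar> * norm z + (\<bar>q1\<bar> + \<bar>q2\<bar> + \<bar>q3\<bar>) * norm z + norm z"
      by (simp only: C_def distrib_right mult_1)
    have tri: "\<bar>x\<bar> \<le> \<bar>x - (0 + a + b + d)\<bar> + \<bar>a\<bar> + \<bar>b\<bar> + \<bar>d\<bar>" for x a b d :: real by linarith
    show ?case unfolding \<open>C * norm z = _\<close>
      by (rule order_trans[OF tri[of _ "l1 * z$1" "l2 * z$2" "q1 * (z$1)\<^sup>2 + q2 * (z$1 * z$2) + q3 * (z$2)\<^sup>2"]])
        (use add_mono[OF add_mono[OF add_mono[OF l] q] order_trans[OF elim(2)[unfolded mult_1] n2]] in \<open>simp only: ac_simps\<close>)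
  qed
  then show ?thesis using C by blast
qed

text \<open>A map whose component jets have no constant term is O(|z|), so substituting it preserves
  o(|z|^2).\<close>

lemma small2_compose:
  assumes e: "small2 e" and p: "jet p1 0 a1 a2 a3 a4 a5" "jet p2 0 b1 b2 b3 b4 b5"
  shows "small2 (\<lambda>z. e (vec2 (p1 z) (p2 z)))"
  unfolding small2_def
proof safe
  fix \<epsilon> :: real assume \<epsilon>: "0 < \<epsilon>"
  obtain C where C: "0 < C" "\<forall>\<^sub>F z in nhds 0. \<bar>p1 z\<bar> \<le> C * norm z" using jet_linear_bound[OF p(1)] by blast
  obtain D where D: "0 < D" "\<forall>\<^sub>F z in nhds 0. \<bar>p2 z\<bar> \<le> D * norm z" using jet_linear_bound[OF p(2)] by blast
  have "0 < \<epsilon> / (C + D)\<^sup>2" using \<epsilon> C D by simp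
  then have "\<forall>\<^sub>F w in nhds 0. \<bar>e w\<bar> \<le> \<epsilon> / (C + D)\<^sup>2 * (norm w)\<^sup>2" using e unfolding small2_def by blast
  moreover have "((\<lambda>z. vec2 (p1 z) (p2 z)) \<longlongrightarrow> vec2 0 0) (nhds 0)"
    unfolding vec2_def by (intro tendsto_intros jet_tendsto[OF p(1)] jet_tendsto[OF p(2)])
  then have "filterlim (\<lambda>z. vec2 (p1 z) (p2 z)) (nhds 0) (nhds 0)" by (simp add: vec2_def)
  ultimately have "\<forall>\<^sub>F z in nhds 0. \<bar>e (vec2 (p1 z) (p2 z))\<bar> \<le> \<epsilon> / (C + D)\<^sup>2 * (norm (vec2 (p1 z) (p2 z)))\<^sup>2"
    by (rule eventually_compose_filterlim)
  then show "\<forall>\<^sub>F z in nhds 0. \<bar>e (vec2 (p1 z) (p2 z))\<bar> \<le> \<epsilon> * (norm z)\<^sup>2"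
    using C(2) D(2)
  proof eventually_elim
    case (elim z)
    have "norm (vec2 (p1 z) (p2 z)) \<le> (C + D) * norm z"
      using norm_vec2_le[of "p1 z" "p2 z"] elim(2,3) by (simp add: distrib_right)
    then have "(norm (vec2 (p1 z) (p2 z)))\<^sup>2 \<le> ((C + D) * norm z)\<^sup>2" by (intro power_mono) auto
    then have "\<epsilon> / (C + D)\<^sup>2 * (norm (vec2 (p1 z) (p2 z)))\<^sup>2 \<le> \<epsilon> / (C + D)\<^sup>2 * ((C + D) * norm z)\<^sup>2"
      using \<epsilon> by (intro mult_left_mono) auto
    also have "\<dots> = \<epsilon> * (norm z)\<^sup>2" using C D by (simp add: power_mult_distrib)
    finally show ?case using elim(1) by linarith
  qed
qed

lemma jet_compose:
  assumes f: "jet f c l1 l2 q1 q2 q3" and p: "jet p1 0 a1 a2 a3 a4 a5" "jet p2 0 b1 b2 b3 b4 b5"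
  shows "jet (\<lambda>z. f (vec2 (p1 z) (p2 z))) c (l1 * a1 + l2 * b1) (l1 * a2 + l2 * b2)
    (l1 * a3 + l2 * b3 + (q1 * a1\<^sup>2 + q2 * (a1 * b1) + q3 * b1\<^sup>2))
    (l1 * a4 + l2 * b4 + (2 * q1 * a1 * a2 + q2 * (a1 * b2 + a2 * b1) + 2 * q3 * b1 * b2))
    (l1 * a5 + l2 * b5 + (q1 * a2\<^sup>2 + q2 * (a2 * b2) + q3 * b2\<^sup>2))"
proof -
  let ?e = "\<lambda>w. f w - (c + l1 * w$1 + l2 * w$2 + (q1 * (w$1)\<^sup>2 + q2 * (w$1 * w$2) + q3 * (w$2)\<^sup>2))"
  let ?P = "\<lambda>z. c + l1 * p1 z + l2 * p2 z + (q1 * (p1 z * p1 z) + q2 * (p1 z * p2 z) + q3 * (p2 z * p2 z))"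
  have e: "small2 (\<lambda>z. ?e (vec2 (p1 z) (p2 z)))" by (rule small2_compose[OF f[unfolded jet_def] p])
  then have "jet (\<lambda>z. ?e (vec2 (p1 z) (p2 z))) 0 0 0 0 0 0" by (simp add: jet_def)
  note jet_add[OF this jet_add[OF jet_add[OF jet_add[OF jet_const[of c] jet_cmult[OF p(1), of l1]] jet_cmult[OF p(2), of l2]]
    jet_add[OF jet_add[OF jet_cmult[OF jet_mult[OF p(1) p(1)], of q1] jet_cmult[OF jet_mult[OF p(1) p(2)], of q2]]
     jet_cmult[OF jet_mult[OF p(2) p(2)], of q3]]]]
  then have "jet (\<lambda>z. ?e (vec2 (p1 z) (p2 z)) + ?P z) c (l1 * a1 + l2 * b1) (l1 * a2 + l2 * b2)
    (l1 * a3 + l2 * b3 + (q1 * a1\<^sup>2 + q2 * (a1 * b1) + q3 * b1\<^sup>2))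
    (l1 * a4 + l2 * b4 + (2 * q1 * a1 * a2 + q2 * (a1 * b2 + a2 * b1) + 2 * q3 * b1 * b2))
    (l1 * a5 + l2 * b5 + (q1 * a2\<^sup>2 + q2 * (a2 * b2) + q3 * b2\<^sup>2))"
    by (rule jet_eq) (simp_all add: power2_eq_square algebra_simps)
  then show ?thesis by (simp add: power2_eq_square)
qed

text \<open>\<open>C\<^sup>1\<^sup>,\<^sup>1\<close> near the origin, in terms of differences.\<close>

definition tame_on :: "real \<Rightarrow> real \<Rightarrow> (real^2 \<Rightarrow> real) \<Rightarrow> bool" where
  "tame_on \<delta> M f \<longleftrightarrow> 0 < \<delta> \<and> 0 \<le> M \<and> (\<forall>z. norm z < \<delta> \<longrightarrow> \<bar>f z\<bar> \<le> M) \<and>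
     (\<forall>z y. norm z < \<delta> \<longrightarrow> norm y < \<delta> \<longrightarrow> \<bar>f y - f z\<bar> \<le> M * norm (y - z)) \<and>
     (\<forall>z p. norm z < \<delta> \<longrightarrow> norm (z + p) < \<delta> \<longrightarrow> norm (z - p) < \<delta> \<longrightarrow>
        \<bar>f (z + p) + f (z - p) - 2 * f z\<bar> \<le> M * (norm p)\<^sup>2)"

definition tame :: "(real^2 \<Rightarrow> real) \<Rightarrow> bool" where "tame f \<longleftrightarrow> (\<exists>\<delta> M. tame_on \<delta> M f)"

lemma tame_on_mono:
  assumes t: "tame_on \<delta> M f" and "0 < \<delta>'" "\<delta>' \<le> \<delta>" "M \<le> M'"
  shows "tame_on \<delta>' M' f"
  unfolding tame_on_def
proof (intro conjI allI impI)
  show "0 < \<delta>'" "0 \<le> M'" using assms by (auto simp: tame_on_def)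
  show "\<bar>f z\<bar> \<le> M'" if "norm z < \<delta>'" for z
    using assms that by (auto simp: tame_on_def intro: order_trans[of _ M])
  show "\<bar>f y - f z\<bar> \<le> M' * norm (y - z)" if "norm z < \<delta>'" "norm y < \<delta>'" for y z
    by (rule order_trans[of _ "M * norm (y - z)"]) (use assms that in \<open>auto simp: tame_on_def intro: mult_right_mono\<close>)
  show "\<bar>f (z + p) + f (z - p) - 2 * f z\<bar> \<le> M' * (norm p)\<^sup>2"
    if "norm z < \<delta>'" "norm (z + p) < \<delta>'" "norm (z - p) < \<delta>'" for z p
    by (rule order_trans[of _ "M * (norm p)\<^sup>2"]) (use assms that in \<open>auto simp: tame_on_def intro: mult_right_mono\<close>)
qed

lemma tame_common:
  assumes "tame f" "tame g"
  obtains \<delta> M where "tame_on \<delta> M f" "tame_on \<delta> M g"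
proof -
  obtain a b c d where "tame_on a b f" "tame_on c d g" using assms unfolding tame_def by blast
  moreover from this have "0 < min a c" by (simp add: tame_on_def)
  ultimately show ?thesis by (intro that[of "min a c" "max b d"]) (erule tame_on_mono; simp)+
qed

lemma tame_const: "tame (\<lambda>z. c)"
  unfolding tame_def tame_on_def by (intro exI[of _ 1] exI[of _ "\<bar>c\<bar>"]) auto

lemma tame_nth: "tame (\<lambda>z. z $ i)"
  unfolding tame_def tame_on_def
proof (intro exI[of _ 1] conjI allI impI)
  show "\<bar>z $ i\<bar> \<le> 1" if "norm z < 1" for z :: "real^2" using abs_nth_le_norm[of z i] that by linarith
  show "\<bar>y $ i - z $ i\<bar> \<le> 1 * norm (y - z)" for y z :: "real^2" using abs_nth_le_norm[of "y - z" i] by simp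
qed auto

lemma tame_add:
  assumes "tame f" "tame g"
  shows "tame (\<lambda>z. f z + g z)"
proof -
  obtain \<delta> M where t: "tame_on \<delta> M f" "tame_on \<delta> M g" using tame_common[OF assms] .
  have "tame_on \<delta> (2 * M) (\<lambda>z. f z + g z)"
    unfolding tame_on_def
  proof (intro conjI allI impI)
    show "\<bar>f z + g z\<bar> \<le> 2 * M" if "norm z < \<delta>" for z
    proof -
      have "\<bar>f z\<bar> \<le> M" "\<bar>g z\<bar> \<le> M" using t that by (auto simp: tame_on_def)
      then show ?thesis by linarith
    qed
    show "\<bar>f y + g y - (f z + g z)\<bar> \<le> 2 * M * norm (y - z)" if "norm z < \<delta>" "norm y < \<delta>" for y z
    proof -
      have "\<bar>f y - f z\<bar> \<le> M * norm (y - z)" "\<bar>g y - g z\<bar> \<le> M * norm (y - z)" using t that by (auto simp: tame_on_def)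
      then show ?thesis by linarith
    qed
    show "\<bar>f (z + p) + g (z + p) + (f (z - p) + g (z - p)) - 2 * (f z + g z)\<bar> \<le> 2 * M * (norm p)\<^sup>2"
      if "norm z < \<delta>" "norm (z + p) < \<delta>" "norm (z - p) < \<delta>" for z p
    proof -
      have "\<bar>f (z + p) + f (z - p) - 2 * f z\<bar> \<le> M * (norm p)\<^sup>2" "\<bar>g (z + p) + g (z - p) - 2 * g z\<bar> \<le> M * (norm p)\<^sup>2"
        using t that by (auto simp: tame_on_def)
      then have "\<bar>(f (z + p) + f (z - p) - 2 * f z) + (g (z + p) + g (z - p) - 2 * g z)\<bar> \<le> M * (norm p)\<^sup>2 + M * (norm p)\<^sup>2"
        by linarith
      also have "(f (z + p) + f (z - p) - 2 * f z) + (g (z + p) + g (z - p) - 2 * g z)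
        = f (z + p) + g (z + p) + (f (z - p) + g (z - p)) - 2 * (f z + g z)" by simp
      finally show ?thesis by simp
    qed
  qed (use t in \<open>auto simp: tame_on_def\<close>)
  then show ?thesis unfolding tame_def by blast
qed

lemma tame_mult:
  assumes "tame f" "tame g"
  shows "tame (\<lambda>z. f z * g z)"
proof -
  obtain \<delta> M where t: "tame_on \<delta> M f" "tame_on \<delta> M g" using tame_common[OF assms] .
  have M: "0 \<le> M" using t by (simp add: tame_on_def)
  have b: "\<bar>f z\<bar> \<le> M" "\<bar>g z\<bar> \<le> M" if "norm z < \<delta>" for z using t that by (auto simp: tame_on_def)
  have l: "\<bar>f y - f z\<bar> \<le> M * norm (y - z)" "\<bar>g y - g z\<bar> \<le> M * norm (y - z)" if "norm z < \<delta>" "norm y < \<delta>" for y z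
    using t that by (auto simp: tame_on_def)
  have "tame_on \<delta> (4 * M\<^sup>2) (\<lambda>z. f z * g z)"
    unfolding tame_on_def
  proof (intro conjI allI impI)
    show "0 < \<delta>" "0 \<le> 4 * M\<^sup>2" using t by (auto simp: tame_on_def)
    show "\<bar>f z * g z\<bar> \<le> 4 * M\<^sup>2" if "norm z < \<delta>" for z
    proof -
      have "\<bar>f z * g z\<bar> \<le> M * M" unfolding abs_mult using b[OF that] M by (intro mult_mono) auto
      moreover have "0 \<le> M * M" by simp
      ultimately show ?thesis unfolding power2_eq_square by linarith
    qed
    show "\<bar>f y * g y - f z * g z\<bar> \<le> 4 * M\<^sup>2 * norm (y - z)" if "norm z < \<delta>" "norm y < \<delta>" for y z
    proof -
      have "\<bar>(f y - f z) * g y\<bar> \<le> (M * norm (y - z)) * M" "\<bar>f z * (g y - g z)\<bar> \<le> M * (M * norm (y - z))"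
        unfolding abs_mult using b[OF that(1)] b[OF that(2)] l[OF that] M by (intro mult_mono; simp)+
      moreover have "f y * g y - f z * g z = (f y - f z) * g y + f z * (g y - g z)" by (simp add: algebra_simps)
      moreover have "0 \<le> M * M * norm (y - z)" by simp
      moreover have "4 * M\<^sup>2 * norm (y - z) = 4 * (M * M * norm (y - z))" "(M * norm (y - z)) * M = M * M * norm (y - z)"
        "M * (M * norm (y - z)) = M * M * norm (y - z)" by (simp_all add: power2_eq_square)
      ultimately show ?thesis by linarith
    qed
    show "\<bar>f (z + p) * g (z + p) + f (z - p) * g (z - p) - 2 * (f z * g z)\<bar> \<le> 4 * M\<^sup>2 * (norm p)\<^sup>2"
      if z: "norm z < \<delta>" "norm (z + p) < \<delta>" "norm (z - p) < \<delta>" for z p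
    proof -
      let ?fp = "f (z + p) - f z" and ?fm = "f (z - p) - f z" and ?gp = "g (z + p) - g z" and ?gm = "g (z - p) - g z"
      let ?X = "M * M * (norm p)\<^sup>2"
      \<comment> \<open>Discrete product rule: second differences of the factors, and products of
        first differences in place of the mixed term.\<close>
      have eq: "f (z + p) * g (z + p) + f (z - p) * g (z - p) - 2 * (f z * g z)
        = (f (z + p) + f (z - p) - 2 * f z) * g z + f z * (g (z + p) + g (z - p) - 2 * g z) + ?fp * ?gp + ?fm * ?gm"
        by (simp add: algebra_simps)
      have s: "\<bar>f (z + p) + f (z - p) - 2 * f z\<bar> \<le> M * (norm p)\<^sup>2" "\<bar>g (z + p) + g (z - p) - 2 * g z\<bar> \<le> M * (norm p)\<^sup>2"
        using t z by (auto simp: tame_on_def)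
      have 1: "\<bar>(f (z + p) + f (z - p) - 2 * f z) * g z\<bar> \<le> (M * (norm p)\<^sup>2) * M"
        unfolding abs_mult using s b[OF z(1)] M by (intro mult_mono; simp)
      have 2: "\<bar>f z * (g (z + p) + g (z - p) - 2 * g z)\<bar> \<le> M * (M * (norm p)\<^sup>2)"
        unfolding abs_mult using s b[OF z(1)] M by (intro mult_mono; simp)
      have d: "\<bar>?fp\<bar> \<le> M * norm p" "\<bar>?gp\<bar> \<le> M * norm p" "\<bar>?fm\<bar> \<le> M * norm p" "\<bar>?gm\<bar> \<le> M * norm p"
        using l[OF z(1,2)] l[OF z(1,3)] by simp_all
      have 3: "\<bar>?fp * ?gp\<bar> \<le> (M * norm p) * (M * norm p)" "\<bar>?fm * ?gm\<bar> \<le> (M * norm p) * (M * norm p)"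
        unfolding abs_mult using d M by (intro mult_mono; simp)+
      have e: "(M * (norm p)\<^sup>2) * M = ?X" "M * (M * (norm p)\<^sup>2) = ?X" "(M * norm p) * (M * norm p) = ?X"
         "4 * M\<^sup>2 * (norm p)\<^sup>2 = 4 * ?X" by (simp_all add: power2_eq_square)
      have tri: "\<bar>a\<bar> \<le> X \<Longrightarrow> \<bar>b\<bar> \<le> X \<Longrightarrow> \<bar>c\<bar> \<le> X \<Longrightarrow> \<bar>d\<bar> \<le> X \<Longrightarrow> \<bar>a + b + c + d\<bar> \<le> 4 * X" for a b c d X :: real
        by linarith
      show ?thesis unfolding eq e(4) by (rule tri) (use 1 2 3 in \<open>simp_all only: e\<close>)
    qed
  qed
  then show ?thesis unfolding tame_def by blast
qed

text \<open>\<Psi>(z - p) differs from the reflection of \<Psi>(z + p) in \<Psi>(z) by a second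
  difference of \<Psi>, of size O(|p|^2). The Lipschitz bound of \<open>f\<close> pays for this
  discrepancy, its second-difference bound for the symmetric triple.\<close>

lemma tame_compose:
  assumes f: "tame f" and p: "tame p1" "tame p2" "p1 0 = 0" "p2 0 = 0"
  shows "tame (\<lambda>z. f (vec2 (p1 z) (p2 z)))"
proof -
  obtain df B where f: "tame_on df B f" using f unfolding tame_def by blast
  obtain dp N where t: "tame_on dp N p1" "tame_on dp N p2" using tame_common[OF p(1,2)] .
  define N' where "N' = 2 * N + 1"
  have N: "0 \<le> N" "0 < dp" "0 < N'" using t by (auto simp: tame_on_def N'_def add_nonneg_pos)
  have B: "0 \<le> B" "0 < df" using f by (auto simp: tame_on_def)
  define \<Psi> where "\<Psi> = (\<lambda>z. vec2 (p1 z) (p2 z))"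
  have vd: "vec2 a b - vec2 c d = vec2 (a - c) (b - d)" "vec2 a b + vec2 c d = vec2 (a + c) (b + d)" for a b c d
    by (simp_all add: vec2_def algebra_simps)
  have lip: "norm (\<Psi> y - \<Psi> z) \<le> N' * norm (y - z)" if "norm z < dp" "norm y < dp" for y z
  proof -
    have "\<bar>p1 y - p1 z\<bar> \<le> N * norm (y - z)" "\<bar>p2 y - p2 z\<bar> \<le> N * norm (y - z)" using t that by (auto simp: tame_on_def)
    moreover have "N' * norm (y - z) = N * norm (y - z) + N * norm (y - z) + norm (y - z)" by (simp add: N'_def algebra_simps)
    ultimately show ?thesis unfolding \<Psi>_def vd using norm_vec2_le[of "p1 y - p1 z" "p2 y - p2 z"] norm_ge_zero[of "y - z"] by linarith
  qed
  have sd: "norm ((\<Psi> (z + p) - \<Psi> z) + (\<Psi> (z - p) - \<Psi> z)) \<le> N' * (norm p)\<^sup>2"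
    if "norm z < dp" "norm (z + p) < dp" "norm (z - p) < dp" for z p
  proof -
    have "\<bar>p1 (z + p) + p1 (z - p) - 2 * p1 z\<bar> \<le> N * (norm p)\<^sup>2" "\<bar>p2 (z + p) + p2 (z - p) - 2 * p2 z\<bar> \<le> N * (norm p)\<^sup>2"
      using t that by (auto simp: tame_on_def)
    moreover have "N' * (norm p)\<^sup>2 = N * (norm p)\<^sup>2 + N * (norm p)\<^sup>2 + (norm p)\<^sup>2" by (simp add: N'_def algebra_simps)
    moreover have eq: "(\<Psi> (z + p) - \<Psi> z) + (\<Psi> (z - p) - \<Psi> z)
       = vec2 (p1 (z + p) + p1 (z - p) - 2 * p1 z) (p2 (z + p) + p2 (z - p) - 2 * p2 z)"
      unfolding \<Psi>_def vd by (rule arg_cong2[of _ _ _ _ vec2]) simp_all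
    ultimately show ?thesis unfolding eq
      using norm_vec2_le[of "p1 (z + p) + p1 (z - p) - 2 * p1 z" "p2 (z + p) + p2 (z - p) - 2 * p2 z"] zero_le_power2[of "norm p"]
      by linarith
  qed
  \<comment> \<open>With |\<Psi>| < df/4 the reflected point has norm below 3 df/4, still in the
    domain where \<open>f\<close> is controlled.\<close>
  define \<delta> where "\<delta> = min dp (df / (4 * N'))"
  have \<delta>: "0 < \<delta>" "\<delta> \<le> dp" "\<delta> \<le> df / (4 * N')" using N B by (auto simp: \<delta>_def)
  have \<Psi>0: "\<Psi> 0 = 0" using p by (simp add: \<Psi>_def vec2_def)
  have small: "norm (\<Psi> z) < df / 4" if "norm z < \<delta>" for z
  proof -
    have "norm (\<Psi> z) \<le> N' * norm z" using lip[of 0 z] that \<delta> N \<Psi>0 by simp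
    also have "\<dots> < N' * (df / (4 * N'))" using that \<delta> N by (intro mult_strict_left_mono) auto
    finally show ?thesis using N by simp
  qed
  define M where "M = B + B * N' + (B * N'\<^sup>2 + B * N')"
  have BN: "0 \<le> B * N'" "0 \<le> B * N'\<^sup>2" using B N by simp_all
  have M: "0 \<le> M" "B \<le> M" "B * N' \<le> M" "B * N'\<^sup>2 + B * N' \<le> M" using B BN by (auto simp: M_def)
  have fl: "\<bar>f u - f v\<bar> \<le> B * norm (u - v)" if "norm u < df" "norm v < df" for u v using f that by (auto simp: tame_on_def)
  have "tame_on \<delta> M (\<lambda>z. f (\<Psi> z))"
    unfolding tame_on_def
  proof (intro conjI allI impI)
    show "\<bar>f (\<Psi> z)\<bar> \<le> M" if "norm z < \<delta>" for z
    proof -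
      have "\<bar>f (\<Psi> z)\<bar> \<le> B" using f small[OF that] B by (auto simp: tame_on_def)
      then show ?thesis using M by linarith
    qed
    show "\<bar>f (\<Psi> y) - f (\<Psi> z)\<bar> \<le> M * norm (y - z)" if "norm z < \<delta>" "norm y < \<delta>" for y z
    proof -
      have "\<bar>f (\<Psi> y) - f (\<Psi> z)\<bar> \<le> B * norm (\<Psi> y - \<Psi> z)" by (rule fl) (use small[OF that(1)] small[OF that(2)] B in linarith)+
      also have "\<dots> \<le> B * (N' * norm (y - z))" using lip[of z y] that \<delta> B by (intro mult_left_mono) auto
      also have "\<dots> = (B * N') * norm (y - z)" by simp
      also have "\<dots> \<le> M * norm (y - z)" using M(3) by (rule mult_right_mono) simp
      finally show ?thesis .
    qed
    show "\<bar>f (\<Psi> (z + p)) + f (\<Psi> (z - p)) - 2 * f (\<Psi> z)\<bar> \<le> M * (norm p)\<^sup>2"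
      if z: "norm z < \<delta>" "norm (z + p) < \<delta>" "norm (z - p) < \<delta>" for z p
    proof -
      define a where "a = \<Psi> (z + p) - \<Psi> z"
      have an: "norm a \<le> N' * norm p" using lip[of z "z + p"] z \<delta> by (simp add: a_def)
      have u: "norm (\<Psi> z) < df" "norm (\<Psi> z + a) < df" "norm (\<Psi> z - a) < df" "norm (\<Psi> (z - p)) < df"
        using small[OF z(1)] small[OF z(2)] small[OF z(3)] B
          norm_triangle_ineq4[of "\<Psi> z" a] norm_triangle_ineq4[of "\<Psi> (z + p)" "\<Psi> z"] by (auto simp: a_def)
      have "\<bar>f (\<Psi> z + a) + f (\<Psi> z - a) - 2 * f (\<Psi> z)\<bar> \<le> B * (norm a)\<^sup>2" using f u by (auto simp: tame_on_def)
      also have "\<dots> \<le> B * (N' * norm p)\<^sup>2" using an B by (intro mult_left_mono power_mono) auto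
      also have "\<dots> = (B * N'\<^sup>2) * (norm p)\<^sup>2" by (simp add: power_mult_distrib)
      finally have 1: "\<bar>f (\<Psi> z + a) + f (\<Psi> z - a) - 2 * f (\<Psi> z)\<bar> \<le> (B * N'\<^sup>2) * (norm p)\<^sup>2" .
      have "\<bar>f (\<Psi> (z - p)) - f (\<Psi> z - a)\<bar> \<le> B * norm (\<Psi> (z - p) - (\<Psi> z - a))" by (rule fl) (use u in auto)
      also have "\<Psi> (z - p) - (\<Psi> z - a) = (\<Psi> (z + p) - \<Psi> z) + (\<Psi> (z - p) - \<Psi> z)" by (simp add: a_def)
      also have "B * norm \<dots> \<le> B * (N' * (norm p)\<^sup>2)" using sd[of z p] z \<delta> B by (intro mult_left_mono) auto
      finally have 2: "\<bar>f (\<Psi> (z - p)) - f (\<Psi> z - a)\<bar> \<le> (B * N') * (norm p)\<^sup>2" by simp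
      have 3: "\<Psi> z + a = \<Psi> (z + p)" by (simp add: a_def)
      have "(B * N'\<^sup>2 + B * N') * (norm p)\<^sup>2 \<le> M * (norm p)\<^sup>2" using M(4) by (rule mult_right_mono) simp
      then show ?thesis using 1 2 unfolding 3 distrib_right by linarith
    qed
  qed (use \<delta> M in auto)
  then show ?thesis unfolding tame_def \<Psi>_def by blast
qed

lemma tame_cong:
  assumes "tame f" "\<forall>\<^sub>F z in nhds 0. g z = f z"
  shows "tame g"
proof -
  obtain \<delta> M where t: "tame_on \<delta> M f" using assms(1) unfolding tame_def by blast
  obtain d where d: "0 < d" "\<And>z. norm z < d \<Longrightarrow> g z = f z"
    using assms(2) unfolding eventually_nhds_metric by (auto simp: dist_norm)
  have "tame_on (min \<delta> d) M f" by (rule tame_on_mono[OF t]) (use t d in \<open>auto simp: tame_on_def\<close>)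
  then have "tame_on (min \<delta> d) M g" using d(2) by (simp add: tame_on_def)
  then show ?thesis unfolding tame_def by blast
qed

section \<open>Partial derivatives, jets and difference bounds of C^2 functions\<close>

lemma add_mem_ball_iff: "q + w \<in> ball q d \<longleftrightarrow> norm w < d" "q + w \<in> cball q d \<longleftrightarrow> norm w \<le> d"
  for q w :: "'b::real_normed_vector"
  by (simp_all add: dist_norm)

lemma vec2_eta: "vec2 (z$1) (z$2) = z"
  by (simp add: vec_eq_iff forall_2)

lemma partial_works:
  fixes f :: "real^2 \<Rightarrow> 'b::real_normed_vector"
  assumes "f differentiable (at q)"
  shows "(f has_derivative (\<lambda>v. (v$1) *\<^sub>R partial 1 f q + (v$2) *\<^sub>R partial 2 f q)) (at q)"
proof -
  have d: "(f has_derivative frechet_derivative f (at q)) (at q)"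
    using assms by (simp add: frechet_derivative_works)
  have l: "linear (frechet_derivative f (at q))" using d by (rule has_derivative_linear)
  have "frechet_derivative f (at q) v = (v$1) *\<^sub>R partial 1 f q + (v$2) *\<^sub>R partial 2 f q" for v
  proof -
    have "frechet_derivative f (at q) (vec2 (v$1) (v$2)) = (v$1) *\<^sub>R partial 1 f q + (v$2) *\<^sub>R partial 2 f q"
      unfolding vec2_def partial_def by (simp add: linear_add[OF l] linear_scale[OF l])
    then show ?thesis by (simp only: vec2_eta)
  qed
  then have "frechet_derivative f (at q) = (\<lambda>v. (v$1) *\<^sub>R partial 1 f q + (v$2) *\<^sub>R partial 2 f q)" by blast
  then show ?thesis using d by simp
qed

lemma partial_eqI:
  assumes "(f has_derivative f') (at q)"
  shows "partial i f q = f' (axis i 1)"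
  unfolding partial_def using frechet_derivative_at[OF assms] by simp

lemma partial_cong:
  assumes "open W" "q \<in> W" "\<And>y. y \<in> W \<Longrightarrow> f y = g y"
  shows "partial i f q = partial i g q"
proof -
  have "(f has_derivative D) (at q) \<longleftrightarrow> (g has_derivative D) (at q)" for D
    using has_derivative_transform_within_open[OF _ assms(1,2)] assms(3) by metis
  then show ?thesis unfolding partial_def frechet_derivative_def by simp
qed

lemma differentiable_cong_open:
  assumes "open W" "q \<in> W" "\<And>y. y \<in> W \<Longrightarrow> f y = g y" "f differentiable (at q)"
  shows "g differentiable (at q)"
  using assms unfolding differentiable_def by (meson has_derivative_transform_within_open)

lemma Ck_on_cong:
  assumes "open W" "\<And>y. y \<in> W \<Longrightarrow> f y = g y" "Ck_on k f W"
  shows "Ck_on k g W"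
  using assms(2,3)
proof (induction k arbitrary: f g)
  case 0
  then show ?case using continuous_on_cong[of W W f g] by simp
next
  case (Suc k)
  show ?case unfolding Ck_on.simps
  proof (intro conjI ballI allI)
    show "g differentiable (at q)" if "q \<in> W" for q
      using differentiable_cong_open[OF assms(1) that Suc.prems(1)] Suc.prems(2) that by auto
    show "Ck_on k (partial i g) W" for i
    proof (rule Suc.IH[of "partial i f"])
      show "partial i f y = partial i g y" if "y \<in> W" for y by (rule partial_cong[OF assms(1) that Suc.prems(1)])
    qed (use Suc.prems in simp)
  qed
qed

lemma partial_bounded_linear:
  assumes "bounded_linear L" "f differentiable (at q)"
  shows "partial i (\<lambda>q. L (f q)) q = L (partial i f q)"
proof -
  have d: "(f has_derivative frechet_derivative f (at q)) (at q)" using assms(2) by (simp add: frechet_derivative_works)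
  show ?thesis by (subst partial_eqI[OF bounded_linear.has_derivative[OF assms(1) d]]) (simp add: partial_def)
qed

lemma Ck_on_bounded_linear:
  assumes L: "bounded_linear L" and W: "open W" and "Ck_on k f W"
  shows "Ck_on k (\<lambda>q. L (f q)) W"
  using assms(3)
proof (induction k arbitrary: f)
  case 0
  then show ?case by (simp add: bounded_linear.continuous_on[OF L])
next
  case (Suc k)
  show ?case unfolding Ck_on.simps
  proof (intro conjI ballI allI)
    show "(\<lambda>q. L (f q)) differentiable (at q)" if "q \<in> W" for q
      using Suc.prems that bounded_linear.has_derivative[OF L] unfolding differentiable_def Ck_on.simps by blast
    show "Ck_on k (partial i (\<lambda>q. L (f q))) W" for i
    proof (rule Ck_on_cong[OF W])
      show "Ck_on k (\<lambda>q. L (partial i f q)) W" by (rule Suc.IH) (use Suc.prems in simp)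
      show "L (partial i f y) = partial i (\<lambda>q. L (f q)) y" if "y \<in> W" for y
        by (rule partial_bounded_linear[OF L, symmetric]) (use Suc.prems that in auto)
    qed
  qed
qed

lemma bounded_linear_mat_nth: "bounded_linear (\<lambda>m :: real^2^2. m $ i $ j)"
  by (rule bounded_linear_compose[OF bounded_linear_vec_nth bounded_linear_vec_nth])

lemma Ck_on_2D:
  assumes "Ck_on 2 f W"
  shows "q \<in> W \<Longrightarrow> f differentiable (at q)" "q \<in> W \<Longrightarrow> partial i f differentiable (at q)"
    "continuous_on W (partial i (partial j f))"
  using assms by (auto simp: numeral_2_eq_2)

lemma partial_linear_approx:
  fixes G :: "real^2 \<Rightarrow> real"
  assumes "G differentiable (at q)" "0 < \<epsilon>"
  shows "\<exists>\<delta>>0. \<forall>z. norm z < \<delta> \<longrightarrow> \<bar>G (q + z) - G q - (z$1 * partial 1 G q + z$2 * partial 2 G q)\<bar> \<le> \<epsilon> * norm z"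
proof -
  obtain \<delta> where \<delta>: "0 < \<delta>" "\<And>y. norm (y - q) < \<delta> \<Longrightarrow>
     norm (G y - G q - ((y - q)$1 *\<^sub>R partial 1 G q + (y - q)$2 *\<^sub>R partial 2 G q)) \<le> \<epsilon> * norm (y - q)"
    using partial_works[OF assms(1)] assms(2) unfolding has_derivative_at_alt by blast
  have "\<bar>G (q + z) - G q - (z$1 * partial 1 G q + z$2 * partial 2 G q)\<bar> \<le> \<epsilon> * norm z" if "norm z < \<delta>" for z
    using \<delta>(2)[of "q + z"] that by (simp del: vector_minus_component)
  then show ?thesis using \<delta>(1) by blast
qed

lemma axis_MVT:
  fixes \<phi> :: "real \<Rightarrow> real"
  assumes d: "\<And>t. \<bar>t\<bar> \<le> \<bar>b\<bar> \<Longrightarrow> (\<phi> has_real_derivative \<phi>' t) (at t)" and e: "\<And>t. \<bar>t\<bar> \<le> \<bar>b\<bar> \<Longrightarrow> \<bar>\<phi>' t\<bar> \<le> B"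
  shows "\<bar>\<phi> b - \<phi> 0\<bar> \<le> B * \<bar>b\<bar>"
proof -
  have "norm (\<phi> b - \<phi> 0) \<le> B * norm (b - 0)"
    by (rule field_differentiable_bound[of "{-\<bar>b\<bar>..\<bar>b\<bar>}" \<phi> \<phi>'])
      (use d e in \<open>auto intro: has_field_derivative_at_within\<close>)
  then show ?thesis by simp
qed

text \<open>From the origin go along the first axis to (a, 0), then along the second to (a, b). On
  each leg the expected polynomial is subtracted and the mean value estimate applied; the derivative
  of the difference is o(|z|) because the first partials are differentiable at \<open>q\<close>.
  This order of the legs produces the mixed coefficient as
  \<open>partial 1 (partial 2 f)\<close>.\<close>

lemma Ck_on_2_jet:
  fixes f :: "real^2 \<Rightarrow> real"
  assumes W: "open W" "q \<in> W" and C: "Ck_on 2 f W"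
  shows "jet (\<lambda>z. f (q + z)) (f q) (partial 1 f q) (partial 2 f q)
    (partial 1 (partial 1 f) q / 2) (partial 1 (partial 2 f) q) (partial 2 (partial 2 f) q / 2)"
  unfolding jet_def small2_def
proof safe
  fix \<epsilon> :: real assume \<epsilon>: "0 < \<epsilon>"
  then have \<epsilon>4: "0 < \<epsilon> / 4" by simp
  let ?G = "partial 2 f" and ?H = "partial 1 f"
  obtain d1 where d1: "0 < d1" "\<And>z. norm z < d1 \<Longrightarrow> \<bar>?G (q + z) - ?G q - (z$1 * partial 1 ?G q + z$2 * partial 2 ?G q)\<bar> \<le> \<epsilon> / 4 * norm z"
    using partial_linear_approx[OF Ck_on_2D(2)[OF C W(2)] \<epsilon>4] by blast
  obtain d2 where d2: "0 < d2" "\<And>z. norm z < d2 \<Longrightarrow> \<bar>?H (q + z) - ?H q - (z$1 * partial 1 ?H q + z$2 * partial 2 ?H q)\<bar> \<le> \<epsilon> / 4 * norm z"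
    using partial_linear_approx[OF Ck_on_2D(2)[OF C W(2)] \<epsilon>4] by blast
  obtain d3 where d3: "0 < d3" "ball q d3 \<subseteq> W" using W open_contains_ball by blast
  define d where "d = min d1 (min d2 d3)"
  have d: "0 < d" using d1 d2 d3 by (simp add: d_def)
  have fd: "((\<lambda>t. f (q + (z + t *\<^sub>R axis i 1))) has_real_derivative partial i f (q + (z + t *\<^sub>R axis i 1))) (at t)"
    if "norm (z + t *\<^sub>R axis i 1) < d" for z t i
  proof -
    have "q + (z + t *\<^sub>R axis i 1) \<in> W" by (rule subsetD[OF d3(2)]) (use that in \<open>simp add: d_def add_mem_ball_iff del: mem_ball\<close>)
    then have "(f has_derivative (\<lambda>v. (v$1) *\<^sub>R partial 1 f (q + (z + t *\<^sub>R axis i 1)) + (v$2) *\<^sub>R partial 2 f (q + (z + t *\<^sub>R axis i 1)))) (at (q + (z + t *\<^sub>R axis i 1)))"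
      by (rule partial_works[OF Ck_on_2D(1)[OF C]])
    moreover have "((\<lambda>t. q + (z + t *\<^sub>R axis i 1)) has_derivative (\<lambda>s. s *\<^sub>R axis i 1)) (at t)"
      by (auto intro!: derivative_eq_intros)
    ultimately have "((\<lambda>t. f (q + (z + t *\<^sub>R axis i 1))) has_derivative (\<lambda>s. s * partial i f (q + (z + t *\<^sub>R axis i 1)))) (at t)"
      using exhaust_2[of i]
      by - (rule has_derivative_eq_rhs, rule has_derivative_compose[where g = f and f = "\<lambda>t. q + (z + t *\<^sub>R axis i 1)"],
          assumption, assumption, auto simp: axis_def)
    then show ?thesis by (simp add: has_field_derivative_def mult.commute[of _ "partial _ _ _"] mult_commute_abs)
  qed
  have main: "\<bar>f (q + z) - (f q + ?H q * z$1 + ?G q * z$2 + (partial 1 ?H q / 2 * (z$1)\<^sup>2 + partial 1 ?G q * (z$1 * z$2) + partial 2 ?G q / 2 * (z$2)\<^sup>2))\<bar>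
      \<le> \<epsilon> * (norm z)\<^sup>2" if z: "norm z < d" for z
  proof -
    define a b where "a = z$1" and "b = z$2"
    have ab: "\<bar>a\<bar> \<le> norm z" "\<bar>b\<bar> \<le> norm z" by (simp_all add: a_def b_def abs_nth_le_norm)
    have nz: "norm (vec2 s t) \<le> norm z" if "\<bar>s\<bar> \<le> \<bar>a\<bar>" "\<bar>t\<bar> \<le> \<bar>b\<bar>" for s t
    proof -
      have "s\<^sup>2 \<le> a\<^sup>2" "t\<^sup>2 \<le> b\<^sup>2" using that by (auto simp: abs_le_square_iff)
      then have "(norm (vec2 s t))\<^sup>2 \<le> (norm z)\<^sup>2" by (simp add: norm_vec2 a_def b_def)
      then show ?thesis by (rule power2_le_imp_le) simp
    qed
    have v1: "vec2 0 0 + t *\<^sub>R axis 1 1 = vec2 t 0" and v2: "vec2 a 0 + t *\<^sub>R axis 2 1 = vec2 a t" for t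
      by (simp_all add: vec2_def)
    define \<phi> where "\<phi> = (\<lambda>t. f (q + (vec2 a 0 + t *\<^sub>R axis 2 1)) - (t * ?G q + t * a * partial 1 ?G q + t\<^sup>2 / 2 * partial 2 ?G q))"
    define \<psi> where "\<psi> = (\<lambda>t. f (q + (vec2 0 0 + t *\<^sub>R axis 1 1)) - (t * ?H q + t\<^sup>2 / 2 * partial 1 ?H q))"
    have 1: "\<bar>\<phi> b - \<phi> 0\<bar> \<le> (\<epsilon> / 4 * norm z) * \<bar>b\<bar>"
    proof (rule axis_MVT)
      fix t :: real assume t: "\<bar>t\<bar> \<le> \<bar>b\<bar>"
      have n: "norm (vec2 a t) \<le> norm z" using nz[of a t] t by simp
      show "(\<phi> has_real_derivative (?G (q + vec2 a t) - ?G q - (a * partial 1 ?G q + t * partial 2 ?G q))) (at t)"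
        unfolding \<phi>_def by (rule derivative_eq_intros fd refl | use n z in \<open>simp add: v2\<close>)+
      have "\<bar>?G (q + vec2 a t) - ?G q - (vec2 a t $ 1 * partial 1 ?G q + vec2 a t $ 2 * partial 2 ?G q)\<bar> \<le> \<epsilon> / 4 * norm (vec2 a t)"
        by (rule d1(2)) (use n z in \<open>simp add: d_def\<close>)
      also have "\<dots> \<le> \<epsilon> / 4 * norm z" using n \<epsilon> by (intro mult_left_mono) auto
      finally show "\<bar>?G (q + vec2 a t) - ?G q - (a * partial 1 ?G q + t * partial 2 ?G q)\<bar> \<le> \<epsilon> / 4 * norm z" by simp
    qed
    have 2: "\<bar>\<psi> a - \<psi> 0\<bar> \<le> (\<epsilon> / 4 * norm z) * \<bar>a\<bar>"
    proof (rule axis_MVT)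
      fix t :: real assume t: "\<bar>t\<bar> \<le> \<bar>a\<bar>"
      have n: "norm (vec2 t 0) \<le> norm z" using nz[of t 0] t by simp
      show "(\<psi> has_real_derivative (?H (q + vec2 t 0) - ?H q - t * partial 1 ?H q)) (at t)"
        unfolding \<psi>_def by (rule derivative_eq_intros fd refl | use n z in \<open>simp add: v1\<close>)+
      have "\<bar>?H (q + vec2 t 0) - ?H q - (vec2 t 0 $ 1 * partial 1 ?H q + vec2 t 0 $ 2 * partial 2 ?H q)\<bar> \<le> \<epsilon> / 4 * norm (vec2 t 0)"
        by (rule d2(2)) (use n z in \<open>simp add: d_def\<close>)
      also have "\<dots> \<le> \<epsilon> / 4 * norm z" using n \<epsilon> by (intro mult_left_mono) auto
      finally show "\<bar>?H (q + vec2 t 0) - ?H q - t * partial 1 ?H q\<bar> \<le> \<epsilon> / 4 * norm z" by simp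
    qed
    have 3: "(\<epsilon> / 4 * norm z) * \<bar>b\<bar> \<le> \<epsilon> / 4 * (norm z)\<^sup>2" "(\<epsilon> / 4 * norm z) * \<bar>a\<bar> \<le> \<epsilon> / 4 * (norm z)\<^sup>2"
      using mult_left_mono[OF ab(1), of "\<epsilon> / 4 * norm z"] mult_left_mono[OF ab(2), of "\<epsilon> / 4 * norm z"] \<epsilon>
      by (simp_all add: power2_eq_square mult.assoc)
    have e: "f (q + z) - (f q + ?H q * a + ?G q * b + (partial 1 ?H q / 2 * a\<^sup>2 + partial 1 ?G q * (a * b) + partial 2 ?G q / 2 * b\<^sup>2))
       = (\<phi> b - \<phi> 0) + (\<psi> a - \<psi> 0)"
    proof -
      have "vec2 a b = z" "vec2 0 0 = 0" by (simp_all add: a_def b_def vec2_eta, simp add: vec2_def)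
      then show ?thesis unfolding \<phi>_def \<psi>_def v1 v2 by (simp add: algebra_simps)
    qed
    have "\<bar>(\<phi> b - \<phi> 0) + (\<psi> a - \<psi> 0)\<bar> \<le> \<epsilon> / 4 * (norm z)\<^sup>2 + \<epsilon> / 4 * (norm z)\<^sup>2"
      by (rule order_trans[OF abs_triangle_ineq add_mono[OF order_trans[OF 1 3(1)] order_trans[OF 2 3(2)]]])
    also have "\<dots> = \<epsilon> / 2 * (norm z)\<^sup>2" by (simp add: field_simps)
    also have "\<dots> \<le> \<epsilon> * (norm z)\<^sup>2" using \<epsilon> by (intro mult_right_mono) auto
    finally show ?thesis unfolding a_def[symmetric] b_def[symmetric] e .
  qed
  show "\<forall>\<^sub>F z in nhds 0. \<bar>f (q + z) - (f q + ?H q * z$1 + ?G q * z$2 + (partial 1 ?H q / 2 * (z$1)\<^sup>2 + partial 1 ?G q * (z$1 * z$2) + partial 2 ?G q / 2 * (z$2)\<^sup>2))\<bar>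
      \<le> \<epsilon> * (norm z)\<^sup>2"
    unfolding eventually_nhds_metric using d main by (auto simp: dist_norm)
qed

lemma C1_lipschitz:
  fixes f :: "real^2 \<Rightarrow> real"
  assumes S: "convex S" "compact S" and d: "\<And>q. q \<in> S \<Longrightarrow> f differentiable (at q)" and c: "\<And>i. continuous_on S (partial i f)"
  shows "\<exists>B\<ge>0. \<forall>u\<in>S. \<forall>v\<in>S. \<bar>f u - f v\<bar> \<le> B * norm (u - v)"
proof -
  have "bounded (partial i f ` S)" for i by (intro compact_imp_bounded compact_continuous_image c S)
  then obtain B1 B2 where B: "\<And>q. q \<in> S \<Longrightarrow> \<bar>partial 1 f q\<bar> \<le> B1" "\<And>q. q \<in> S \<Longrightarrow> \<bar>partial 2 f q\<bar> \<le> B2"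
    unfolding bounded_iff by (metis image_eqI real_norm_def)
  define B where "B = \<bar>B1\<bar> + \<bar>B2\<bar>"
  have "\<bar>f u - f v\<bar> \<le> B * norm (u - v)" if uv: "u \<in> S" "v \<in> S" for u v
  proof -
    let ?D = "\<lambda>q w::real^2. (w$1) *\<^sub>R partial 1 f q + (w$2) *\<^sub>R partial 2 f q"
    have "norm (?D q w) \<le> B * norm w" if "q \<in> S" for q w
    proof -
      have "\<bar>w$1 * partial 1 f q\<bar> \<le> norm w * \<bar>B1\<bar>" "\<bar>w$2 * partial 2 f q\<bar> \<le> norm w * \<bar>B2\<bar>"
        unfolding abs_mult using B(1)[OF that] B(2)[OF that] by (intro mult_mono abs_nth_le_norm; simp)+
      moreover have "B * norm w = norm w * \<bar>B1\<bar> + norm w * \<bar>B2\<bar>" by (simp add: B_def algebra_simps)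
      ultimately show ?thesis
        using abs_triangle_ineq[of "w$1 * partial 1 f q" "w$2 * partial 2 f q"] by simp
    qed
    then have "onorm (?D q) \<le> B" if "q \<in> S" for q
      using that by (intro onorm_le)
    moreover have "(f has_derivative ?D q) (at q within S)" if "q \<in> S" for q
      by (rule has_derivative_at_withinI[OF partial_works[OF d[OF that]]])
    ultimately have "norm (f u - f v) \<le> B * norm (u - v)"
      by (intro differentiable_bound[where S = S and f' = ?D] S uv)
    then show ?thesis by simp
  qed
  moreover have "0 \<le> B" by (simp add: B_def)
  ultimately show ?thesis by blast
qed

text \<open>The second difference is the increment over [0, 1] of f(z + t p) + f(z - t p), whose
  derivative is \<open>p\<close> paired with the difference of the gradients at two points 2 t p
  apart. The gradient is Lipschitz on a closed ball because its partials are continuous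
  there.\<close>

lemma Ck_on_2_tame:
  fixes f :: "real^2 \<Rightarrow> real"
  assumes W: "open W" "q \<in> W" and C: "Ck_on 2 f W"
  shows "tame (\<lambda>z. f (q + z))"
proof -
  obtain \<delta> where \<delta>: "0 < \<delta>" "cball q \<delta> \<subseteq> W" using W open_contains_cball by blast
  have c1: "continuous_on (cball q \<delta>) (partial i f)" for i
    using Ck_on_2D(2)[OF C] \<delta>(2) by (meson continuous_at_imp_continuous_on differentiable_imp_continuous_within subsetD)
  obtain B0 where B0: "0 \<le> B0" "\<And>u v. u \<in> cball q \<delta> \<Longrightarrow> v \<in> cball q \<delta> \<Longrightarrow> \<bar>f u - f v\<bar> \<le> B0 * norm (u - v)"
    using C1_lipschitz[OF convex_cball compact_cball Ck_on_2D(1)[OF C] c1] \<delta>(2) by (metis subsetD)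
  have "\<exists>B\<ge>0. \<forall>u\<in>cball q \<delta>. \<forall>v\<in>cball q \<delta>. \<bar>partial i f u - partial i f v\<bar> \<le> B * norm (u - v)" for i
  proof (rule C1_lipschitz[OF convex_cball compact_cball])
    show "partial i f differentiable (at u)" if "u \<in> cball q \<delta>" for u
      using Ck_on_2D(2)[OF C] \<delta>(2) that by blast
    show "continuous_on (cball q \<delta>) (partial j (partial i f))" for j
      by (rule continuous_on_subset[OF Ck_on_2D(3)[OF C] \<delta>(2)])
  qed
  then obtain Bp where Bp: "\<And>i. 0 \<le> Bp i" "\<And>i u v. u \<in> cball q \<delta> \<Longrightarrow> v \<in> cball q \<delta> \<Longrightarrow> \<bar>partial i f u - partial i f v\<bar> \<le> Bp i * norm (u - v)"
    by metis
  define L where "L = Bp 1 + Bp 2"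
  have L: "0 \<le> L" using Bp(1) by (simp add: L_def)
  define M where "M = \<bar>f q\<bar> + B0 * \<delta> + B0 + 2 * L"
  have B\<delta>: "0 \<le> B0 * \<delta>" using B0 \<delta> by simp
  have M: "0 \<le> M" "\<bar>f q\<bar> + B0 * \<delta> \<le> M" "B0 \<le> M" "2 * L \<le> M" using B0 \<delta> L B\<delta> unfolding M_def by linarith+
  have "tame_on \<delta> M (\<lambda>z. f (q + z))"
    unfolding tame_on_def
  proof (intro conjI allI impI \<delta>(1) M(1))
    show "\<bar>f (q + z)\<bar> \<le> M" if "norm z < \<delta>" for z
    proof -
      have "\<bar>f (q + z) - f q\<bar> \<le> B0 * norm z" using B0(2)[of "q + z" q] that \<delta> by (simp add: dist_norm)
      moreover have "B0 * norm z \<le> B0 * \<delta>" using that B0 by (intro mult_left_mono) auto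
      ultimately show ?thesis using M(2) by linarith
    qed
    show "\<bar>f (q + y) - f (q + z)\<bar> \<le> M * norm (y - z)" if "norm z < \<delta>" "norm y < \<delta>" for y z
    proof -
      have "\<bar>f (q + y) - f (q + z)\<bar> \<le> B0 * norm (y - z)" using B0(2)[of "q + y" "q + z"] that \<delta> by (simp add: dist_norm)
      also have "\<dots> \<le> M * norm (y - z)" using M by (intro mult_right_mono) auto
      finally show ?thesis .
    qed
    show "\<bar>f (q + (z + p)) + f (q + (z - p)) - 2 * f (q + z)\<bar> \<le> M * (norm p)\<^sup>2"
      if z: "norm z < \<delta>" "norm (z + p) < \<delta>" "norm (z - p) < \<delta>" for z p
    proof -
      have seg: "q + z + t *\<^sub>R p \<in> cball q \<delta>" if "\<bar>t\<bar> \<le> 1" for t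
      proof -
        have "q + z + t *\<^sub>R p = ((1 + t) / 2) *\<^sub>R (q + (z + p)) + ((1 - t) / 2) *\<^sub>R (q + (z - p))"
          unfolding vec_eq_iff by (simp add: field_simps)
        moreover have "q + (z + p) \<in> cball q \<delta>" "q + (z - p) \<in> cball q \<delta>"
          unfolding add_mem_ball_iff using z by simp_all
        then have "((1 + t) / 2) *\<^sub>R (q + (z + p)) + ((1 - t) / 2) *\<^sub>R (q + (z - p)) \<in> cball q \<delta>"
          by (rule convexD[OF convex_cball]) (use that in \<open>auto simp: field_simps\<close>)
        ultimately show ?thesis by simp
      qed
      have fd: "((\<lambda>t. f (q + z + (s * t) *\<^sub>R p)) has_real_derivative
          s * (p$1 * partial 1 f (q + z + (s * t) *\<^sub>R p) + p$2 * partial 2 f (q + z + (s * t) *\<^sub>R p))) (at t)"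
        if "\<bar>s * t\<bar> \<le> 1" for s t
      proof -
        let ?y = "q + z + (s * t) *\<^sub>R p"
        have "?y \<in> W" using seg[OF that] \<delta>(2) by blast
        then have "(f has_derivative (\<lambda>v. (v$1) *\<^sub>R partial 1 f ?y + (v$2) *\<^sub>R partial 2 f ?y)) (at ?y)"
          by (rule partial_works[OF Ck_on_2D(1)[OF C]])
        moreover have "((\<lambda>t. q + z + (s * t) *\<^sub>R p) has_derivative (\<lambda>r. (s * r) *\<^sub>R p)) (at t)"
          by (auto intro!: derivative_eq_intros)
        ultimately have "((\<lambda>t. f (q + z + (s * t) *\<^sub>R p)) has_derivative
            (\<lambda>r. ((s * r) *\<^sub>R p)$1 *\<^sub>R partial 1 f ?y + ((s * r) *\<^sub>R p)$2 *\<^sub>R partial 2 f ?y)) (at t)"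
          by (intro has_derivative_compose[where g = f and f = "\<lambda>t. q + z + (s * t) *\<^sub>R p"])
        then show ?thesis unfolding has_field_derivative_def
          by (rule has_derivative_eq_rhs) (simp add: fun_eq_iff algebra_simps)
      qed
      define \<phi> where "\<phi> = (\<lambda>t. f (q + z + (1 * t) *\<^sub>R p) + f (q + z + ((-1) * t) *\<^sub>R p))"
      have "\<bar>\<phi> 1 - \<phi> 0\<bar> \<le> (2 * L * (norm p)\<^sup>2) * \<bar>1\<bar>"
      proof (rule axis_MVT[of 1 \<phi> "\<lambda>t. 1 * (p$1 * partial 1 f (q + z + (1 * t) *\<^sub>R p) + p$2 * partial 2 f (q + z + (1 * t) *\<^sub>R p))
            + (-1) * (p$1 * partial 1 f (q + z + ((-1) * t) *\<^sub>R p) + p$2 * partial 2 f (q + z + ((-1) * t) *\<^sub>R p))"])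
        fix t :: real assume "\<bar>t\<bar> \<le> \<bar>1\<bar>"
        then have t: "\<bar>1 * t\<bar> \<le> 1" "\<bar>(-1) * t\<bar> \<le> 1" by auto
        let ?u = "q + z + (1 * t) *\<^sub>R p" and ?v = "q + z + ((-1) * t) *\<^sub>R p"
        show "(\<phi> has_real_derivative (1 * (p$1 * partial 1 f ?u + p$2 * partial 2 f ?u) + (-1) * (p$1 * partial 1 f ?v + p$2 * partial 2 f ?v))) (at t)"
          unfolding \<phi>_def by (rule DERIV_add[OF fd[OF t(1)] fd[OF t(2)]])
        have nuv: "norm (?u - ?v) \<le> 2 * norm p"
        proof -
          have "?u - ?v = (2 * t) *\<^sub>R p" by (simp add: algebra_simps flip: scaleR_2)
          then have "norm (?u - ?v) = 2 * (\<bar>t\<bar> * norm p)" by (simp add: abs_mult)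
          moreover have "\<bar>t\<bar> * norm p \<le> 1 * norm p" using t by (intro mult_right_mono) auto
          ultimately show ?thesis by linarith
        qed
        have k: "\<bar>p$i * (partial i f ?u - partial i f ?v)\<bar> \<le> norm p * (Bp i * (2 * norm p))" for i
          unfolding abs_mult
          by (intro mult_mono abs_nth_le_norm order_trans[OF Bp(2)[OF seg[OF t(1)] seg[OF t(2)]]] mult_left_mono nuv Bp) auto
        have "1 * (p$1 * partial 1 f ?u + p$2 * partial 2 f ?u) + (-1) * (p$1 * partial 1 f ?v + p$2 * partial 2 f ?v)
          = p$1 * (partial 1 f ?u - partial 1 f ?v) + p$2 * (partial 2 f ?u - partial 2 f ?v)" by (simp add: algebra_simps)
        also have "\<bar>\<dots>\<bar> \<le> norm p * (Bp 1 * (2 * norm p)) + norm p * (Bp 2 * (2 * norm p))"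
          by (rule order_trans[OF abs_triangle_ineq add_mono[OF k k]])
        also have "\<dots> = 2 * L * (norm p)\<^sup>2" by (simp add: L_def power2_eq_square algebra_simps)
        finally show "\<bar>1 * (p$1 * partial 1 f ?u + p$2 * partial 2 f ?u) + (-1) * (p$1 * partial 1 f ?v + p$2 * partial 2 f ?v)\<bar> \<le> 2 * L * (norm p)\<^sup>2" .
      qed
      also have "\<phi> 1 - \<phi> 0 = f (q + (z + p)) + f (q + (z - p)) - 2 * f (q + z)" by (simp add: \<phi>_def algebra_simps)
      also have "(2 * L * (norm p)\<^sup>2) * \<bar>1\<bar> \<le> M * (norm p)\<^sup>2" using M(4) by (simp add: mult_right_mono)
      finally show ?thesis .
    qed
  qed
  then show ?thesis unfolding tame_def by blast
qed

section \<open>Curvature in terms of the derivatives of the metric\<close>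

lemma partial_mult:
  fixes f g :: "real^2 \<Rightarrow> real"
  assumes "f differentiable (at q)" "g differentiable (at q)"
  shows "partial i (\<lambda>y. f y * g y) q = partial i f q * g q + f q * partial i g q"
  using assms unfolding frechet_derivative_works
  by (subst partial_eqI[OF has_derivative_mult]) (auto simp: partial_def)

lemma partial_add:
  fixes f g :: "real^2 \<Rightarrow> real"
  assumes "f differentiable (at q)" "g differentiable (at q)"
  shows "partial i (\<lambda>y. f y + g y) q = partial i f q + partial i g q"
  using assms unfolding frechet_derivative_works
  by (subst partial_eqI[OF has_derivative_add]) (auto simp: partial_def)

lemma partial_diff:
  fixes f g :: "real^2 \<Rightarrow> real"
  assumes "f differentiable (at q)" "g differentiable (at q)"
  shows "partial i (\<lambda>y. f y - g y) q = partial i f q - partial i g q"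
  using assms unfolding frechet_derivative_works
  by (subst partial_eqI[OF has_derivative_diff]) (auto simp: partial_def)

text \<open>Lowering the index with \<open>h\<close> cancels \<open>matrix_inv\<close> and leaves
  the Christoffel symbols of the first kind.\<close>

lemma christoffel_lowered:
  fixes h :: "real^2 \<Rightarrow> real^2^2"
  assumes "det (h y) \<noteq> 0"
  shows "h y $ m $ 1 * christoffel h 1 i j y + h y $ m $ 2 * christoffel h 2 i j y
    = (partial i (\<lambda>y. h y $ j $ m) y + partial j (\<lambda>y. h y $ i $ m) y - partial m (\<lambda>y. h y $ i $ j) y) / 2"
proof -
  let ?S = "\<lambda>l. partial i (\<lambda>y. h y $ j $ l) y + partial j (\<lambda>y. h y $ i $ l) y - partial l (\<lambda>y. h y $ i $ j) y"
  have "h y ** matrix_inv (h y) = mat 1" 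
    using assms someI_ex[of "\<lambda>m. h y ** m = mat 1 \<and> m ** h y = mat 1"]
    by (simp add: matrix_inv_def invertible_def flip: invertible_det_nz)
  then have e: "h y $ m $ 1 * matrix_inv (h y) $ 1 $ l + h y $ m $ 2 * matrix_inv (h y) $ 2 $ l = (if m = l then 1 else 0)" for l
    by (auto simp: vec_eq_iff matrix_matrix_mult_def sum_2 mat_def)
  have "h y $ m $ 1 * christoffel h 1 i j y + h y $ m $ 2 * christoffel h 2 i j y
    = ((h y $ m $ 1 * matrix_inv (h y) $ 1 $ 1 + h y $ m $ 2 * matrix_inv (h y) $ 2 $ 1) * ?S 1
     + (h y $ m $ 1 * matrix_inv (h y) $ 1 $ 2 + h y $ m $ 2 * matrix_inv (h y) $ 2 $ 2) * ?S 2) / 2"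
    by (simp only: christoffel_def sum_2) (simp add: algebra_simps add_divide_distrib diff_divide_distrib)
  also have "\<dots> = ?S m / 2" unfolding e using exhaust_2[of m] by auto
  finally show ?thesis .
qed

text \<open>Differentiating the lowered identities, rather than the inverse matrix, expresses the
  derivatives of the symbols by second derivatives of \<open>h\<close> and products. What is
  quadratic then collapses to <\<Gamma>_12, \<Gamma>_12> - <\<Gamma>_11, \<Gamma>_22>; writing it
  with lowered symbols and the inverse metric produces the inner division by the
  determinant.\<close>

lemma coord_curvature_eq:
  fixes h :: "real^2 \<Rightarrow> real^2^2"
  assumes W: "open W" "q \<in> W" and C: "Ck_on 2 h W"
    and sym: "\<And>y. y \<in> W \<Longrightarrow> h y $ 2 $ 1 = h y $ 1 $ 2" and det: "\<And>y. y \<in> W \<Longrightarrow> det (h y) \<noteq> 0"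
    and abc: "a = h q $ 1 $ 1" "b = h q $ 1 $ 2" "c = h q $ 2 $ 2"
    and dabc: "a1 = partial 1 (\<lambda>y. h y $ 1 $ 1) q" "a2 = partial 2 (\<lambda>y. h y $ 1 $ 1) q"
      "b1 = partial 1 (\<lambda>y. h y $ 1 $ 2) q" "b2 = partial 2 (\<lambda>y. h y $ 1 $ 2) q"
      "c1 = partial 1 (\<lambda>y. h y $ 2 $ 2) q" "c2 = partial 2 (\<lambda>y. h y $ 2 $ 2) q"
  shows "coord_curvature h q * (a * c - b\<^sup>2) = partial 1 (partial 2 (\<lambda>y. h y $ 1 $ 2)) q
      - partial 2 (partial 2 (\<lambda>y. h y $ 1 $ 1)) q / 2 - partial 1 (partial 1 (\<lambda>y. h y $ 2 $ 2)) q / 2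
      + ((c * (a2 / 2)\<^sup>2 - 2 * b * (a2 / 2) * (c1 / 2) + a * (c1 / 2)\<^sup>2)
       - (c * (b2 - c1 / 2) * (a1 / 2) - b * ((b2 - c1 / 2) * (b1 - a2 / 2) + (c2 / 2) * (a1 / 2))
          + a * (c2 / 2) * (b1 - a2 / 2))) / (a * c - b\<^sup>2)"
proof -
  define g where "g = (\<lambda>i j y. h y $ i $ j)"
  define \<Gamma> where "\<Gamma> = christoffel h"
  define S where "S = (\<lambda>m i j y. partial i (g j m) y + partial j (g i m) y - partial m (g i j) y)"
  have gC: "Ck_on 2 (g i j) W" for i j
    unfolding g_def by (rule Ck_on_bounded_linear[OF bounded_linear_mat_nth W(1) C])
  have gd: "g i j differentiable (at y)" "partial k (g i j) differentiable (at y)" if "y \<in> W" for i j k y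
    using Ck_on_2D(1,2)[OF gC that] by auto
  have gs: "g 2 1 y = g 1 2 y" if "y \<in> W" for y using sym that by (simp add: g_def)
  have gs1: "partial i (g 2 1) y = partial i (g 1 2) y" if "y \<in> W" for y i
    by (rule partial_cong[OF W(1) that gs])
  have gs2: "partial k (partial i (g 2 1)) y = partial k (partial i (g 1 2)) y" if "y \<in> W" for y i k
    by (rule partial_cong[OF W(1) that gs1])
  have low: "g m 1 y * \<Gamma> 1 i j y + g m 2 y * \<Gamma> 2 i j y = S m i j y / 2" if "y \<in> W" for m i j y
    using christoffel_lowered[where h = h, OF det[OF that]] by (simp add: g_def \<Gamma>_def S_def)
  have D: "g 1 1 y * g 2 2 y - g 1 2 y * g 1 2 y \<noteq> 0" if "y \<in> W" for y
    using det[OF that] sym[OF that] by (simp add: det_2 g_def)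
  \<comment> \<open>Cramer's rule exhibits the symbols as quotients of differentiable
    functions.\<close>
  have \<Gamma>e: "\<Gamma> 1 i j y = (g 2 2 y * (S 1 i j y / 2) - g 1 2 y * (S 2 i j y / 2)) / (g 1 1 y * g 2 2 y - g 1 2 y * g 1 2 y)"
    "\<Gamma> 2 i j y = (g 1 1 y * (S 2 i j y / 2) - g 1 2 y * (S 1 i j y / 2)) / (g 1 1 y * g 2 2 y - g 1 2 y * g 1 2 y)"
    if y: "y \<in> W" for i j y
    unfolding low[OF y, symmetric] eq_divide_eq gs[OF y] using D[OF y] by (simp_all add: algebra_simps)
  have Sd: "S m i j differentiable (at y)" if "y \<in> W" for m i j y
    unfolding S_def by (intro differentiable_diff differentiable_add gd that)
  have Sp: "partial k (\<lambda>y. S m i j y / 2) y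
      = (partial k (partial i (g j m)) y + partial k (partial j (g i m)) y - partial k (partial m (g i j)) y) / 2"
    if y: "y \<in> W" for k m i j y
  proof -
    have "partial k (\<lambda>y. (1 / 2) * S m i j y) y = (1 / 2) * partial k (S m i j) y"
      by (rule partial_bounded_linear[OF bounded_linear_mult_right Sd[OF y]])
    moreover have "partial k (S m i j) y = partial k (partial i (g j m)) y + partial k (partial j (g i m)) y - partial k (partial m (g i j)) y"
      unfolding S_def by (subst partial_diff) (auto intro!: differentiable_add gd y partial_add)
    ultimately show ?thesis by simp
  qed
  have \<Gamma>d: "\<Gamma> 1 i j differentiable (at y)" "\<Gamma> 2 i j differentiable (at y)" if y: "y \<in> W" for i j y
    by (rule differentiable_cong_open[OF W(1) y \<Gamma>e(1)[symmetric]], assumption,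
        intro differentiable_divide differentiable_diff differentiable_mult gd Sd y D differentiable_const,
        auto intro: Sd y)
      (rule differentiable_cong_open[OF W(1) y \<Gamma>e(2)[symmetric]], assumption,
        intro differentiable_divide differentiable_diff differentiable_mult gd Sd y D differentiable_const,
        auto intro: Sd y)
  have dlow: "(partial k (g m 1) q * \<Gamma> 1 i j q + g m 1 q * partial k (\<Gamma> 1 i j) q)
      + (partial k (g m 2) q * \<Gamma> 2 i j q + g m 2 q * partial k (\<Gamma> 2 i j) q)
      = (partial k (partial i (g j m)) q + partial k (partial j (g i m)) q - partial k (partial m (g i j)) q) / 2" for k m i j
  proof -
    have "partial k (\<lambda>y. g m 1 y * \<Gamma> 1 i j y + g m 2 y * \<Gamma> 2 i j y) q = partial k (\<lambda>y. S m i j y / 2) q"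
      by (rule partial_cong[OF W low])
    then show ?thesis unfolding Sp[OF W(2)]
      by (subst (asm) partial_add) (auto simp: partial_mult gd[OF W(2)] \<Gamma>d[OF W(2)] intro!: differentiable_mult gd W \<Gamma>d)
  qed
  have abc': "g 1 1 q = a" "g 1 2 q = b" "g 2 1 q = b" "g 2 2 q = c" using abc sym[OF W(2)] by (simp_all add: g_def)
  have dabc': "partial 1 (g 1 1) q = a1" "partial 2 (g 1 1) q = a2" "partial 1 (g 1 2) q = b1" "partial 2 (g 1 2) q = b2"
    "partial 1 (g 2 2) q = c1" "partial 2 (g 2 2) q = c2" using dabc by (simp_all add: g_def)
  have D0: "a * c - b\<^sup>2 \<noteq> 0" using D[OF W(2)] by (simp add: abc' power2_eq_square)
  \<comment> \<open>A1, A2 are the components of \<Gamma>_22 and B1, B2 those of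
    \<Gamma>_12.\<close>
  define A1 A2 B1 B2 where "A1 = \<Gamma> 1 2 2 q" "A2 = \<Gamma> 2 2 2 q" "B1 = \<Gamma> 1 1 2 q" "B2 = \<Gamma> 2 1 2 q"
  note AB = A1_A2_B1_B2_def
  define P where "P = partial 1 (partial 2 (g 1 2)) q"
  define Q where "Q = partial 2 (partial 2 (g 1 1)) q"
  define R where "R = partial 1 (partial 1 (g 2 2)) q"
  have lows: "a * A1 + b * A2 = b2 - c1 / 2" "b * A1 + c * A2 = c2 / 2" "a * B1 + b * B2 = a2 / 2" "b * B1 + c * B2 = c1 / 2"
    "a * \<Gamma> 1 1 1 q + b * \<Gamma> 2 1 1 q = a1 / 2" "a * \<Gamma> 1 2 1 q + b * \<Gamma> 2 2 1 q = a2 / 2"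
    using low[OF W(2), of 1 2 2] low[OF W(2), of 2 2 2] low[OF W(2), of 1 1 2] low[OF W(2), of 2 1 2]
      low[OF W(2), of 1 1 1] low[OF W(2), of 1 2 1]
    unfolding S_def abc' gs1[OF W(2)] dabc' AB by simp_all
  have d1: "a * partial 1 (\<Gamma> 1 2 2) q + b * partial 1 (\<Gamma> 2 2 2) q = P - R / 2 - a1 * A1 - b1 * A2"
    using dlow[of 1 1 2 2] unfolding abc' gs2[OF W(2)] dabc' AB[symmetric] P_def R_def by (simp add: field_simps)
  have d2: "a * partial 2 (\<Gamma> 1 1 2) q + b * partial 2 (\<Gamma> 2 1 2) q = Q / 2 - a2 * B1 - b2 * B2"
    using dlow[of 2 1 1 2] unfolding abc' gs2[OF W(2)] dabc' AB[symmetric] Q_def by (simp add: field_simps)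
  have "coord_curvature h q * (a * c - b\<^sup>2) = (\<Sum>l\<in>UNIV. h q $ 1 $ l * riemann h l 1 2 2 q)"
    unfolding coord_curvature_def using D0 abc sym[OF W(2)] by (simp add: det_2 power2_eq_square)
  also have "\<dots> = a * riemann h 1 1 2 2 q + b * riemann h 2 1 2 2 q" by (simp add: sum_2 abc)
  also have "\<dots> = (a * partial 1 (\<Gamma> 1 2 2) q + b * partial 1 (\<Gamma> 2 2 2) q) - (a * partial 2 (\<Gamma> 1 1 2) q + b * partial 2 (\<Gamma> 2 1 2) q)
     + A1 * (a * \<Gamma> 1 1 1 q + b * \<Gamma> 2 1 1 q) + A2 * (a * B1 + b * B2)
     - B1 * (a * \<Gamma> 1 2 1 q + b * \<Gamma> 2 2 1 q) - B2 * (a * A1 + b * A2)"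
    unfolding riemann_def sum_2 \<Gamma>_def[symmetric] AB by (simp add: algebra_simps)
  also have "\<dots> = P - Q / 2 - R / 2 + (B1 * (a2 / 2) + B2 * (c1 / 2)) - (A1 * (a1 / 2) + A2 * (b1 - a2 / 2))"
    unfolding d1 d2 lows by (simp add: field_simps)
  also have "B1 * (a2 / 2) + B2 * (c1 / 2) = (c * (a2 / 2)\<^sup>2 - 2 * b * (a2 / 2) * (c1 / 2) + a * (c1 / 2)\<^sup>2) / (a * c - b\<^sup>2)"
    unfolding lows(3,4)[symmetric] eq_divide_eq using D0 by (simp add: algebra_simps power2_eq_square)
  also have "A1 * (a1 / 2) + A2 * (b1 - a2 / 2) = (c * (b2 - c1 / 2) * (a1 / 2) - b * ((b2 - c1 / 2) * (b1 - a2 / 2) + (c2 / 2) * (a1 / 2))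
          + a * (c2 / 2) * (b1 - a2 / 2)) / (a * c - b\<^sup>2)"
    unfolding lows(1,2)[symmetric] eq_divide_eq using D0
    by (simp add: algebra_simps power2_eq_square) (simp add: field_simps)
  finally show ?thesis by (simp add: P_def Q_def R_def g_def diff_divide_distrib)
qed

section \<open>Polynomial changes of coordinates and the normal form of the metric\<close>

definition mat2 :: "real \<Rightarrow> real \<Rightarrow> real \<Rightarrow> real \<Rightarrow> real^2^2" where
  "mat2 a b c d = (\<chi> i j. if i = 1 then if j = 1 then a else b else if j = 1 then c else d)"

lemma mat2_nth [simp]: "mat2 a b c d $ 1 $ 1 = a" "mat2 a b c d $ 1 $ 2 = b" "mat2 a b c d $ 2 $ 1 = c" "mat2 a b c d $ 2 $ 2 = d"
  by (simp_all add: mat2_def)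

lemma mat2_mult_vec: "mat2 a b c d *v v = vec2 (a * v$1 + b * v$2) (c * v$1 + d * v$2)"
  by (simp add: vec_eq_iff forall_2 matrix_vector_mult_def sum_2)

lemma continuous_on_mat2:
  assumes "continuous_on S a" "continuous_on S b" "continuous_on S c" "continuous_on S d"
  shows "continuous_on S (\<lambda>z. mat2 (a z) (b z) (c z) (d z))"
  unfolding mat2_def
proof (intro continuous_on_vec_lambda)
  show "continuous_on S (\<lambda>z. if i = 1 then if j = 1 then a z else b z else if j = 1 then c z else d z)" for i j :: 2
    using assms by (cases "i = 1"; cases "j = 1") simp_all
qed

lemma continuous_on_matrix_mult:
  fixes m n :: "'a::topological_space \<Rightarrow> real^2^2"
  assumes "continuous_on S m" "continuous_on S n"
  shows "continuous_on S (\<lambda>z. m z ** n z)"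
  unfolding matrix_matrix_mult_def by (intro continuous_intros assms)

lemma pullback_nth:
  fixes m :: "real^2^2"
  shows "(transpose J ** m ** J) $ i $ j = J$1$i * (m$1$1 * J$1$j + m$1$2 * J$2$j) + J$2$i * (m$2$1 * J$1$j + m$2$2 * J$2$j)"
  by (simp add: matrix_matrix_mult_def sum_2 transpose_def algebra_simps)

text \<open>The Jacobian matrix \<open>J\<close> is kept as an explicit function since the
  pulled-back metric is formed with it. Invertibility is asked at the origin, where the metric is
  expanded.\<close>

definition polymap :: "(real^2 \<Rightarrow> real^2) \<Rightarrow> (real^2 \<Rightarrow> real^2^2) \<Rightarrow> bool" where
  "polymap \<Phi> J \<longleftrightarrow> \<Phi> 0 = 0 \<and> det (J 0) \<noteq> 0 \<and> continuous_on UNIV J \<and> (\<forall>z. (\<Phi> has_derivative (\<lambda>v. J z *v v)) (at z))"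

lemma polymap_compose:
  assumes "polymap \<Phi> J" "polymap \<Psi> L"
  shows "polymap (\<lambda>z. \<Phi> (\<Psi> z)) (\<lambda>z. J (\<Psi> z) ** L z)"
  unfolding polymap_def
proof (intro conjI allI)
  have d: "(\<Psi> has_derivative (\<lambda>v. L z *v v)) (at z)" "(\<Phi> has_derivative (\<lambda>v. J z *v v)) (at z)" for z
    using assms by (auto simp: polymap_def)
  show "\<Phi> (\<Psi> 0) = 0" using assms by (simp add: polymap_def)
  show "det (J (\<Psi> 0) ** L 0) \<noteq> 0" using assms by (simp add: polymap_def det_mul)
  have "continuous_on UNIV \<Psi>" using d(1) by (intro has_derivative_continuous_on) (auto intro: has_derivative_at_withinI)
  then have "continuous_on UNIV (\<lambda>z. J (\<Psi> z))"
    using assms by (intro continuous_on_compose2[of UNIV J UNIV \<Psi>]) (auto simp: polymap_def)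
  then show "continuous_on UNIV (\<lambda>z. J (\<Psi> z) ** L z)"
    using assms by (intro continuous_on_matrix_mult) (auto simp: polymap_def)
  show "((\<lambda>z. \<Phi> (\<Psi> z)) has_derivative (\<lambda>v. (J (\<Psi> z) ** L z) *v v)) (at z)" for z
    using has_derivative_compose[OF d(1) d(2)] by (simp add: matrix_vector_mul_assoc)
qed

lemma polymapI:
  assumes d: "\<And>z. (p1 has_derivative (\<lambda>v. j11 z * v$1 + j12 z * v$2)) (at z)" "\<And>z. (p2 has_derivative (\<lambda>v. j21 z * v$1 + j22 z * v$2)) (at z)"
    and c: "continuous_on UNIV j11" "continuous_on UNIV j12" "continuous_on UNIV j21" "continuous_on UNIV j22"
    and z: "p1 0 = 0" "p2 0 = 0" "j11 0 * j22 0 - j12 0 * j21 0 \<noteq> 0"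
  shows "polymap (\<lambda>z. vec2 (p1 z) (p2 z)) (\<lambda>z. mat2 (j11 z) (j12 z) (j21 z) (j22 z))"
  unfolding polymap_def
proof (intro conjI allI continuous_on_mat2 c)
  show "((\<lambda>z. vec2 (p1 z) (p2 z)) has_derivative (\<lambda>v. mat2 (j11 z) (j12 z) (j21 z) (j22 z) *v v)) (at z)" for z
    unfolding mat2_mult_vec vec2_def
    by (intro has_derivative_add has_derivative_scaleR_left d)
qed (use z in \<open>simp_all add: vec2_def det_2\<close>)

definition tame_metric :: "(real^2 \<Rightarrow> real^2^2) \<Rightarrow> bool" where
  "tame_metric m \<longleftrightarrow> (\<forall>z. transpose (m z) = m z) \<and> (\<forall>i j. tame (\<lambda>z. m z $ i $ j))"

text \<open>The letters a, b, c belong to the entries E, F, G of the first fundamental form; the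
  indices 0 to 5 to the monomials 1, x, y, x^2, xy, y^2, so that the coefficients of x^2 and y^2 are
  half the second derivatives.\<close>

definition metric_jet :: "(real^2 \<Rightarrow> real^2^2) \<Rightarrow> real \<Rightarrow> real \<Rightarrow> real \<Rightarrow> real \<Rightarrow> real \<Rightarrow> real \<Rightarrow>
    real \<Rightarrow> real \<Rightarrow> real \<Rightarrow> real \<Rightarrow> real \<Rightarrow> real \<Rightarrow> real \<Rightarrow> real \<Rightarrow> real \<Rightarrow> real \<Rightarrow> real \<Rightarrow> real \<Rightarrow> bool" where
  "metric_jet m a0 a1 a2 a3 a4 a5 b0 b1 b2 b3 b4 b5 c0 c1 c2 c3 c4 c5 \<longleftrightarrow> tame_metric m \<and>
     jet (\<lambda>z. m z $ 1 $ 1) a0 a1 a2 a3 a4 a5 \<and> jet (\<lambda>z. m z $ 1 $ 2) b0 b1 b2 b3 b4 b5 \<and> jet (\<lambda>z. m z $ 2 $ 2) c0 c1 c2 c3 c4 c5"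

lemma transpose_sym_nth:
  fixes m :: "real^2^2"
  assumes "transpose m = m"
  shows "m $ 2 $ 1 = m $ 1 $ 2"
proof -
  have "transpose m $ 1 $ 2 = m $ 2 $ 1" by (simp add: transpose_def)
  then show ?thesis by (simp add: assms)
qed

lemma tame_pullback:
  assumes m: "tame_metric m" and p: "tame p1" "tame p2" "p1 0 = 0" "p2 0 = 0"
    and j: "tame j11" "tame j12" "tame j21" "tame j22"
  shows "tame_metric (\<lambda>z. transpose (mat2 (j11 z) (j12 z) (j21 z) (j22 z)) ** m (vec2 (p1 z) (p2 z)) ** mat2 (j11 z) (j12 z) (j21 z) (j22 z))"
  unfolding tame_metric_def
proof (intro conjI allI)
  show "transpose (transpose L ** m z ** L) = transpose L ** m z ** L" for z L
    using m by (simp add: tame_metric_def matrix_transpose_mul matrix_mul_assoc)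
  have j': "tame (\<lambda>z. mat2 (j11 z) (j12 z) (j21 z) (j22 z) $ i $ k)" for i k
    using exhaust_2[of i] exhaust_2[of k] j by auto
  have m': "tame (\<lambda>z. m (vec2 (p1 z) (p2 z)) $ i $ k)" for i k
    using m tame_compose[of "\<lambda>z. m z $ i $ k", OF _ p] by (simp add: tame_metric_def)
  show "tame (\<lambda>z. (transpose (mat2 (j11 z) (j12 z) (j21 z) (j22 z)) ** m (vec2 (p1 z) (p2 z)) ** mat2 (j11 z) (j12 z) (j21 z) (j22 z)) $ i $ k)" for i k
    unfolding pullback_nth by (intro tame_add tame_mult j' m')
qed

lemma metric_jet_pullback:
  assumes m: "metric_jet m a0 a1 a2 a3 a4 a5 b0 b1 b2 b3 b4 b5 c0 c1 c2 c3 c4 c5"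
    and p: "tame p1" "tame p2" "p1 0 = 0" "p2 0 = 0" and j: "tame j11" "tame j12" "tame j21" "tame j22"
    and E: "jet (\<lambda>z. j11 z * (m (vec2 (p1 z) (p2 z)) $ 1 $ 1 * j11 z + m (vec2 (p1 z) (p2 z)) $ 1 $ 2 * j21 z)
       + j21 z * (m (vec2 (p1 z) (p2 z)) $ 1 $ 2 * j11 z + m (vec2 (p1 z) (p2 z)) $ 2 $ 2 * j21 z)) e0 e1 e2 e3 e4 e5"
    and F: "jet (\<lambda>z. j11 z * (m (vec2 (p1 z) (p2 z)) $ 1 $ 1 * j12 z + m (vec2 (p1 z) (p2 z)) $ 1 $ 2 * j22 z)
       + j21 z * (m (vec2 (p1 z) (p2 z)) $ 1 $ 2 * j12 z + m (vec2 (p1 z) (p2 z)) $ 2 $ 2 * j22 z)) f0 f1 f2 f3 f4 f5"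
    and G: "jet (\<lambda>z. j12 z * (m (vec2 (p1 z) (p2 z)) $ 1 $ 1 * j12 z + m (vec2 (p1 z) (p2 z)) $ 1 $ 2 * j22 z)
       + j22 z * (m (vec2 (p1 z) (p2 z)) $ 1 $ 2 * j12 z + m (vec2 (p1 z) (p2 z)) $ 2 $ 2 * j22 z)) g0 g1 g2 g3 g4 g5"
  shows "metric_jet (\<lambda>z. transpose (mat2 (j11 z) (j12 z) (j21 z) (j22 z)) ** m (vec2 (p1 z) (p2 z)) ** mat2 (j11 z) (j12 z) (j21 z) (j22 z))
    e0 e1 e2 e3 e4 e5 f0 f1 f2 f3 f4 f5 g0 g1 g2 g3 g4 g5"
proof -
  have t: "tame_metric m" using m by (simp add: metric_jet_def)
  then have s: "m z $ 2 $ 1 = m z $ 1 $ 2" for z by (intro transpose_sym_nth) (simp add: tame_metric_def)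
  show ?thesis unfolding metric_jet_def pullback_nth s mat2_nth
    using tame_pullback[OF t p j] E F G by blast
qed

lemma jet_poly: "jet (\<lambda>z. c + l1 * z$1 + l2 * z$2 + (q1 * (z$1)\<^sup>2 + q2 * (z$1 * z$2) + q3 * (z$2)\<^sup>2)) c l1 l2 q1 q2 q3"
  by (simp add: jet_def small2_zero)

lemma tame_poly: "tame (\<lambda>z. c + l1 * z$1 + l2 * z$2 + (q1 * (z$1)\<^sup>2 + q2 * (z$1 * z$2) + q3 * (z$2)\<^sup>2))"
  unfolding power2_eq_square by (intro tame_add tame_mult tame_const tame_nth)

lemma has_derivative_nth: "((\<lambda>z::real^2. z $ i) has_derivative (\<lambda>v. v $ i)) (at z)"
  by (rule bounded_linear.has_derivative[OF bounded_linear_vec_nth has_derivative_ident])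

lemma has_derivative_poly:
  "((\<lambda>z::real^2. c + l1 * z$1 + l2 * z$2 + (q1 * (z$1)\<^sup>2 + q2 * (z$1 * z$2) + q3 * (z$2)\<^sup>2)) has_derivative
     (\<lambda>v. (l1 + 2 * q1 * z$1 + q2 * z$2) * v$1 + (l2 + q2 * z$1 + 2 * q3 * z$2) * v$2)) (at z)"
proof -
  note n = has_derivative_nth[of _ z]
  note d = has_derivative_add[OF has_derivative_add[OF has_derivative_add[OF has_derivative_const[of c]
      has_derivative_mult_right[OF n, of l1 1]] has_derivative_mult_right[OF n, of l2 2]]
    has_derivative_add[OF has_derivative_add[OF has_derivative_mult_right[OF has_derivative_mult[OF n n], of q1 1 1]
      has_derivative_mult_right[OF has_derivative_mult[OF n n], of q2 1 2]] has_derivative_mult_right[OF has_derivative_mult[OF n n], of q3 2 2]]]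
  show ?thesis unfolding power2_eq_square
    by (rule has_derivative_eq_rhs[OF d]) (simp add: fun_eq_iff algebra_simps)
qed

text \<open>How the quadratic part of the curvature formula transforms under (x, y) -> (s x + t y, w
  y). The letters x and u stand for half the derivatives of E and G, and y for the derivatives of
  F.\<close>

lemma linear_curvature_identity:
  fixes s t w x1 x2 y1 y2 u1 u2 :: real
  shows "((s\<^sup>2 * (x1 * t + x2 * w))\<^sup>2 + (t\<^sup>2 * (x1 * s) + t * w * (y1 * s) + w\<^sup>2 * (u1 * s))\<^sup>2)
     - ((s * (t * (2 * (x1 * t + x2 * w)) + w * (y1 * t + y2 * w)) - (t\<^sup>2 * (x1 * s) + t * w * (y1 * s) + w\<^sup>2 * (u1 * s))) * (s\<^sup>2 * (x1 * s))
        + (t\<^sup>2 * (x1 * t + x2 * w) + t * w * (y1 * t + y2 * w) + w\<^sup>2 * (u1 * t + u2 * w))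
          * (s * (t * (2 * (x1 * s)) + w * (y1 * s)) - s\<^sup>2 * (x1 * t + x2 * w)))
    = (s\<^sup>2 * w\<^sup>2 * (s\<^sup>2 + t\<^sup>2) * x2\<^sup>2 + 2 * (t * s\<^sup>2 * w ^ 3) * x2 * u1 + s\<^sup>2 * w ^ 4 * u1\<^sup>2)
       - (s\<^sup>2 * w\<^sup>2 * (s\<^sup>2 + t\<^sup>2) * (y2 - u1) * x1 + (t * s\<^sup>2 * w ^ 3) * ((y2 - u1) * (y1 - x2) + u2 * x1)
          + s\<^sup>2 * w ^ 4 * u2 * (y1 - x2))"
  by (simp add: algebra_simps power2_eq_square power3_eq_cube power4_eq_xxxx)

text \<open>A diagonal entry of J^T m J to second order when m and J are the identity at 0; (p, r)
  is the first column of J. Exchanging X with Z and passing to the second column gives the other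
  diagonal entry.\<close>

lemma jet_congruence_diagonal:
  assumes "jet X 1 a1 a2 a3 a4 a5" "jet Y 0 b1 b2 b3 b4 b5" "jet Z 1 c1 c2 c3 c4 c5"
    and "jet p 1 p1 p2 p3 p4 p5" "jet r 0 r1 r2 r3 r4 r5"
  shows "jet (\<lambda>z. p z * (X z * p z + Y z * r z) + r z * (Y z * p z + Z z * r z)) 1 (a1 + 2 * p1) (a2 + 2 * p2)
    (a3 + 2 * p3 + p1 * p1 + 2 * a1 * p1 + 2 * b1 * r1 + r1 * r1)
    (a4 + 2 * p4 + 2 * p1 * p2 + 2 * (a1 * p2 + a2 * p1) + 2 * (b1 * r2 + b2 * r1) + 2 * r1 * r2)
    (a5 + 2 * p5 + p2 * p2 + 2 * a2 * p2 + 2 * b2 * r2 + r2 * r2)"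
proof -
  have 1: "jet (\<lambda>z. X z * p z + Y z * r z) 1 (a1 + p1) (a2 + p2) (a3 + a1 * p1 + p3 + b1 * r1)
      (a4 + a1 * p2 + a2 * p1 + p4 + (b1 * r2 + b2 * r1)) (a5 + a2 * p2 + p5 + b2 * r2)"
    by (rule jet_eq[OF jet_add[OF jet_mult[OF assms(1,4)] jet_mult[OF assms(2,5)]]]) simp_all
  have 2: "jet (\<lambda>z. Y z * p z + Z z * r z) 0 (b1 + r1) (b2 + r2) (b3 + b1 * p1 + r3 + c1 * r1)
      (b4 + b1 * p2 + b2 * p1 + r4 + (c1 * r2 + c2 * r1)) (b5 + b2 * p2 + r5 + c2 * r2)"
    by (rule jet_eq[OF jet_add[OF jet_mult[OF assms(2,4)] jet_mult[OF assms(3,5)]]]) simp_all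
  show ?thesis
    by (rule jet_eq[OF jet_add[OF jet_mult[OF assms(4) 1] jet_mult[OF assms(5) 2]]]) (simp_all add: algebra_simps)
qed

lemma jet_congruence_off_diagonal:
  assumes "jet X 1 a1 a2 a3 a4 a5" "jet Y 0 b1 b2 b3 b4 b5" "jet Z 1 c1 c2 c3 c4 c5"
    and "jet p 1 p1 p2 p3 p4 p5" "jet r 0 r1 r2 r3 r4 r5" "jet s 0 s1 s2 s3 s4 s5" "jet t 1 t1 t2 t3 t4 t5"
  shows "jet (\<lambda>z. p z * (X z * s z + Y z * t z) + r z * (Y z * s z + Z z * t z)) 0 (b1 + s1 + r1) (b2 + s2 + r2)
    (s3 + p1 * s1 + a1 * s1 + b3 + b1 * (p1 + t1) + r3 + r1 * t1 + r1 * c1)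
    (s4 + (p1 * s2 + p2 * s1) + (a1 * s2 + a2 * s1) + b4 + (b1 * (p2 + t2) + b2 * (p1 + t1)) + r4 + (r1 * t2 + r2 * t1) + (r1 * c2 + r2 * c1))
    (s5 + p2 * s2 + a2 * s2 + b5 + b2 * (p2 + t2) + r5 + r2 * t2 + r2 * c2)"
proof -
  have 1: "jet (\<lambda>z. X z * s z + Y z * t z) 0 (s1 + b1) (s2 + b2) (s3 + a1 * s1 + b3 + b1 * t1)
      (s4 + (a1 * s2 + a2 * s1) + b4 + (b1 * t2 + b2 * t1)) (s5 + a2 * s2 + b5 + b2 * t2)"
    by (rule jet_eq[OF jet_add[OF jet_mult[OF assms(1,6)] jet_mult[OF assms(2,7)]]]) simp_all
  have 2: "jet (\<lambda>z. Y z * s z + Z z * t z) 1 (c1 + t1) (c2 + t2) (c3 + c1 * t1 + t3 + b1 * s1)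
      (c4 + (c1 * t2 + c2 * t1) + t4 + (b1 * s2 + b2 * s1)) (c5 + c2 * t2 + t5 + b2 * s2)"
    by (rule jet_eq[OF jet_add[OF jet_mult[OF assms(2,6)] jet_mult[OF assms(3,7)]]]) simp_all
  show ?thesis
    by (rule jet_eq[OF jet_add[OF jet_mult[OF assms(4) 1] jet_mult[OF assms(5) 2]]]) (simp_all add: algebra_simps)
qed

lemma jet_congruence_const:
  assumes "jet X x0 x1 x2 x3 x4 x5" "jet Y y0 y1 y2 y3 y4 y5" "jet Z z0 z1 z2 z3 z4 z5"
  shows "jet (\<lambda>z. p * (X z * s + Y z * t) + r * (Y z * s + Z z * t)) (p * (x0 * s + y0 * t) + r * (y0 * s + z0 * t))
    (p * (x1 * s + y1 * t) + r * (y1 * s + z1 * t)) (p * (x2 * s + y2 * t) + r * (y2 * s + z2 * t)) (p * (x3 * s + y3 * t) + r * (y3 * s + z3 * t))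
    (p * (x4 * s + y4 * t) + r * (y4 * s + z4 * t)) (p * (x5 * s + y5 * t) + r * (y5 * s + z5 * t))"
proof -
  have k: "jet (\<lambda>z. f z * k) (a0 * k) (a1 * k) (a2 * k) (a3 * k) (a4 * k) (a5 * k)" if "jet f a0 a1 a2 a3 a4 a5" for f a0 a1 a2 a3 a4 a5 k
    using jet_cmult[OF that, of k] by (simp only: mult.commute)
  show ?thesis by (intro jet_add jet_cmult k assms)
qed

text \<open>Gram-Schmidt at the origin: the columns (s, 0) and (t, w) are orthonormal for the metric
  there. The second-order part of the curvature expression is multiplied by s^2 w^2; its quadratic
  part follows \<open>linear_curvature_identity\<close>.\<close>

lemma linear_normalization:
  assumes m: "metric_jet m a0 a1 a2 a3 a4 a5 b0 b1 b2 b3 b4 b5 c0 c1 c2 c3 c4 c5"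
    and s: "s \<noteq> 0" "w \<noteq> 0" "s\<^sup>2 * a0 = 1" "t * a0 + w * b0 = 0" "t\<^sup>2 * a0 + 2 * t * w * b0 + w\<^sup>2 * c0 = 1"
  shows "\<exists>\<Phi> J E1 E2 E3 E4 E5 F1 F2 F3 F4 F5 G1 G2 G3 G4 G5. polymap \<Phi> J \<and>
     metric_jet (\<lambda>z. transpose (J z) ** m (\<Phi> z) ** J z) 1 E1 E2 E3 E4 E5 0 F1 F2 F3 F4 F5 1 G1 G2 G3 G4 G5 \<and>
     F4 - E5 - G3 + ((E2 / 2)\<^sup>2 + (G1 / 2)\<^sup>2) - ((F2 - G1 / 2) * (E1 / 2) + (G2 / 2) * (F1 - E2 / 2))
     = s\<^sup>2 * w\<^sup>2 * (b4 - a5 - c3) + (s\<^sup>2 * w\<^sup>2 * (s\<^sup>2 + t\<^sup>2) * (a2 / 2)\<^sup>2 + 2 * (t * s\<^sup>2 * w ^ 3) * (a2 / 2) * (c1 / 2) + s\<^sup>2 * w ^ 4 * (c1 / 2)\<^sup>2)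
       - (s\<^sup>2 * w\<^sup>2 * (s\<^sup>2 + t\<^sup>2) * (b2 - c1 / 2) * (a1 / 2) + (t * s\<^sup>2 * w ^ 3) * ((b2 - c1 / 2) * (b1 - a2 / 2) + (c2 / 2) * (a1 / 2))
          + s\<^sup>2 * w ^ 4 * (c2 / 2) * (b1 - a2 / 2))"
proof -
  define p1 where "p1 = (\<lambda>z::real^2. 0 + s * z$1 + t * z$2 + (0 * (z$1)\<^sup>2 + 0 * (z$1 * z$2) + 0 * (z$2)\<^sup>2))"
  define p2 where "p2 = (\<lambda>z::real^2. 0 + 0 * z$1 + w * z$2 + (0 * (z$1)\<^sup>2 + 0 * (z$1 * z$2) + 0 * (z$2)\<^sup>2))"
  have p: "jet p1 0 s t 0 0 0" "jet p2 0 0 w 0 0 0" unfolding p1_def p2_def by (rule jet_poly)+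
  have tp: "tame p1" "tame p2" unfolding p1_def p2_def by (rule tame_poly)+
  have z: "p1 0 = 0" "p2 0 = 0" by (simp_all add: p1_def p2_def)
  note M = jet_compose[OF _ p]
  have m3: "jet (\<lambda>z. m z $ 1 $ 1) a0 a1 a2 a3 a4 a5" "jet (\<lambda>z. m z $ 1 $ 2) b0 b1 b2 b3 b4 b5" "jet (\<lambda>z. m z $ 2 $ 2) c0 c1 c2 c3 c4 c5"
    using m by (auto simp: metric_jet_def)
  have M1: "jet (\<lambda>z. m (vec2 (p1 z) (p2 z)) $ 1 $ 1) a0 (a1 * s) (a1 * t + a2 * w) (a3 * s\<^sup>2) (2 * a3 * s * t + a4 * s * w) (a3 * t\<^sup>2 + a4 * (t * w) + a5 * w\<^sup>2)"
    by (rule jet_eq[OF M[OF m3(1)]]) simp_all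
  have M2: "jet (\<lambda>z. m (vec2 (p1 z) (p2 z)) $ 1 $ 2) b0 (b1 * s) (b1 * t + b2 * w) (b3 * s\<^sup>2) (2 * b3 * s * t + b4 * s * w) (b3 * t\<^sup>2 + b4 * (t * w) + b5 * w\<^sup>2)"
    by (rule jet_eq[OF M[OF m3(2)]]) simp_all
  have M3: "jet (\<lambda>z. m (vec2 (p1 z) (p2 z)) $ 2 $ 2) c0 (c1 * s) (c1 * t + c2 * w) (c3 * s\<^sup>2) (2 * c3 * s * t + c4 * s * w) (c3 * t\<^sup>2 + c4 * (t * w) + c5 * w\<^sup>2)"
    by (rule jet_eq[OF M[OF m3(3)]]) simp_all
  note C = jet_congruence_const[OF M1 M2 M3]
  have 0: "s * (a0 * s) = 1" "a0 * t + b0 * w = 0" using s(3,4) by (simp_all add: power2_eq_square algebra_simps)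
  have "t * (a0 * t + b0 * w) + w * (b0 * t + c0 * w) = 1"
    using s(5) by (simp add: power2_eq_square algebra_simps)
  then have 1: "w * (b0 * t + c0 * w) = 1" by (simp add: 0)
  have pm: "polymap (\<lambda>z. vec2 (p1 z) (p2 z)) (\<lambda>z. mat2 s t 0 w)"
  proof (rule polymapI)
    show "(p1 has_derivative (\<lambda>v. s * v$1 + t * v$2)) (at z)" for z
      unfolding p1_def by (rule has_derivative_eq_rhs[OF has_derivative_poly]) (simp add: fun_eq_iff)
    show "(p2 has_derivative (\<lambda>v. 0 * v$1 + w * v$2)) (at z)" for z
      unfolding p2_def by (rule has_derivative_eq_rhs[OF has_derivative_poly]) (simp add: fun_eq_iff)
  qed (use s z in simp_all)
  have mj: "metric_jet (\<lambda>z. transpose (mat2 s t 0 w) ** m (vec2 (p1 z) (p2 z)) ** mat2 s t 0 w)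
    1 (s\<^sup>2 * (a1 * s)) (s\<^sup>2 * (a1 * t + a2 * w)) (s\<^sup>2 * (a3 * s\<^sup>2)) (s\<^sup>2 * (2 * a3 * s * t + a4 * s * w)) (s\<^sup>2 * (a3 * t\<^sup>2 + a4 * (t * w) + a5 * w\<^sup>2))
    0 (s * (t * (a1 * s) + w * (b1 * s))) (s * (t * (a1 * t + a2 * w) + w * (b1 * t + b2 * w)))
      (s * (t * (a3 * s\<^sup>2) + w * (b3 * s\<^sup>2))) (s * (t * (2 * a3 * s * t + a4 * s * w) + w * (2 * b3 * s * t + b4 * s * w)))
      (s * (t * (a3 * t\<^sup>2 + a4 * (t * w) + a5 * w\<^sup>2) + w * (b3 * t\<^sup>2 + b4 * (t * w) + b5 * w\<^sup>2)))
    1 (t\<^sup>2 * (a1 * s) + 2 * t * w * (b1 * s) + w\<^sup>2 * (c1 * s))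
      (t\<^sup>2 * (a1 * t + a2 * w) + 2 * t * w * (b1 * t + b2 * w) + w\<^sup>2 * (c1 * t + c2 * w))
      (t\<^sup>2 * (a3 * s\<^sup>2) + 2 * t * w * (b3 * s\<^sup>2) + w\<^sup>2 * (c3 * s\<^sup>2))
      (t\<^sup>2 * (2 * a3 * s * t + a4 * s * w) + 2 * t * w * (2 * b3 * s * t + b4 * s * w) + w\<^sup>2 * (2 * c3 * s * t + c4 * s * w))
      (t\<^sup>2 * (a3 * t\<^sup>2 + a4 * (t * w) + a5 * w\<^sup>2) + 2 * t * w * (b3 * t\<^sup>2 + b4 * (t * w) + b5 * w\<^sup>2) + w\<^sup>2 * (c3 * t\<^sup>2 + c4 * (t * w) + c5 * w\<^sup>2))"
  proof (rule metric_jet_pullback[OF m tp z tame_const tame_const tame_const tame_const])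
  qed (rule jet_eq[OF C], (simp add: 0 1 power2_eq_square; fail),
      (simp add: power2_eq_square algebra_simps; fail), (simp add: power2_eq_square algebra_simps; fail), (simp add: power2_eq_square algebra_simps; fail), (simp add: power2_eq_square algebra_simps; fail), (simp add: power2_eq_square algebra_simps; fail))+
  have h: "s\<^sup>2 * (a1 * s) / 2 = s\<^sup>2 * (a1 / 2 * s)" "s\<^sup>2 * (a1 * t + a2 * w) / 2 = s\<^sup>2 * (a1 / 2 * t + a2 / 2 * w)"
    "(t\<^sup>2 * (a1 * s) + 2 * t * w * (b1 * s) + w\<^sup>2 * (c1 * s)) / 2 = t\<^sup>2 * (a1 / 2 * s) + t * w * (b1 * s) + w\<^sup>2 * (c1 / 2 * s)"
    "(t\<^sup>2 * (a1 * t + a2 * w) + 2 * t * w * (b1 * t + b2 * w) + w\<^sup>2 * (c1 * t + c2 * w)) / 2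
       = t\<^sup>2 * (a1 / 2 * t + a2 / 2 * w) + t * w * (b1 * t + b2 * w) + w\<^sup>2 * (c1 / 2 * t + c2 / 2 * w)"
    by (simp_all add: add_divide_distrib distrib_left)
  have h': "s * (t * (a1 * s) + w * (b1 * s)) = s * (t * (2 * (a1 / 2 * s)) + w * (b1 * s))"
    "s * (t * (a1 * t + a2 * w) + w * (b1 * t + b2 * w)) = s * (t * (2 * (a1 / 2 * t + a2 / 2 * w)) + w * (b1 * t + b2 * w))"
    by (simp_all add: distrib_left)
  have q: "s * (t * (2 * a3 * s * t + a4 * s * w) + w * (2 * b3 * s * t + b4 * s * w)) - s\<^sup>2 * (a3 * t\<^sup>2 + a4 * (t * w) + a5 * w\<^sup>2)
     - (t\<^sup>2 * (a3 * s\<^sup>2) + 2 * t * w * (b3 * s\<^sup>2) + w\<^sup>2 * (c3 * s\<^sup>2)) = s\<^sup>2 * w\<^sup>2 * (b4 - a5 - c3)"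
    by (simp add: algebra_simps power2_eq_square)
  note id = linear_curvature_identity[of s "a1 / 2" t "a2 / 2" w b1 "c1 / 2" b2 "c2 / 2"]
  have comb: "P + Q - R = P' + S - T" if "P = P'" "Q - R = S - T" for P P' Q R S T :: real using that by simp
  show ?thesis
  proof (intro exI conjI, rule pm, rule mj, rule comb[OF q])
  qed (unfold h, unfold h', rule id)
qed

text \<open>The substitution with components z^k - (1/2) \<Gamma>^k_ij z^i z^j removes the first
  derivatives of the metric. The parameters encode the symbols at 0: \<Gamma>_11 = 2 C, \<Gamma>_12
  = B, \<Gamma>_22 = 2 A. The combination f2 - e3 - g1 afterwards carries the whole curvature
  expression.\<close>

lemma quadratic_normalization:
  assumes m: "metric_jet m 1 (4 * C1) (2 * B1) E3 E4 E5 0 (2 * C2 + B1) (2 * A1 + B2) F3 F4 F5 1 (2 * B2) (4 * A2) G3 G4 G5"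
  shows "\<exists>\<Phi> J e1 e2 e3 f1 f2 f3 g1 g2 g3. polymap \<Phi> J \<and>
     metric_jet (\<lambda>z. transpose (J z) ** m (\<Phi> z) ** J z) 1 0 0 e1 e2 e3 0 0 0 f1 f2 f3 1 0 0 g1 g2 g3 \<and>
     f2 - e3 - g1 = F4 - E5 - G3 + (B1\<^sup>2 + B2\<^sup>2) - 4 * (A1 * C1 + A2 * C2)"
proof -
  define p1 where "p1 = (\<lambda>z::real^2. 0 + 1 * z$1 + 0 * z$2 + (- C1 * (z$1)\<^sup>2 + - B1 * (z$1 * z$2) + - A1 * (z$2)\<^sup>2))"
  define p2 where "p2 = (\<lambda>z::real^2. 0 + 0 * z$1 + 1 * z$2 + (- C2 * (z$1)\<^sup>2 + - B2 * (z$1 * z$2) + - A2 * (z$2)\<^sup>2))"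
  define j11 where "j11 = (\<lambda>z::real^2. 1 + - (2 * C1) * z$1 + - B1 * z$2 + (0 * (z$1)\<^sup>2 + 0 * (z$1 * z$2) + 0 * (z$2)\<^sup>2))"
  define j12 where "j12 = (\<lambda>z::real^2. 0 + - B1 * z$1 + - (2 * A1) * z$2 + (0 * (z$1)\<^sup>2 + 0 * (z$1 * z$2) + 0 * (z$2)\<^sup>2))"
  define j21 where "j21 = (\<lambda>z::real^2. 0 + - (2 * C2) * z$1 + - B2 * z$2 + (0 * (z$1)\<^sup>2 + 0 * (z$1 * z$2) + 0 * (z$2)\<^sup>2))"
  define j22 where "j22 = (\<lambda>z::real^2. 1 + - B2 * z$1 + - (2 * A2) * z$2 + (0 * (z$1)\<^sup>2 + 0 * (z$1 * z$2) + 0 * (z$2)\<^sup>2))"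
  note defs = p1_def p2_def j11_def j12_def j21_def j22_def
  have p: "jet p1 0 1 0 (- C1) (- B1) (- A1)" "jet p2 0 0 1 (- C2) (- B2) (- A2)"
    and j: "jet j11 1 (- (2 * C1)) (- B1) 0 0 0" "jet j12 0 (- B1) (- (2 * A1)) 0 0 0"
      "jet j21 0 (- (2 * C2)) (- B2) 0 0 0" "jet j22 1 (- B2) (- (2 * A2)) 0 0 0"
    unfolding defs by (rule jet_poly)+
  have tp: "tame p1" "tame p2" and tj: "tame j11" "tame j12" "tame j21" "tame j22" unfolding defs by (rule tame_poly)+
  have z: "p1 0 = 0" "p2 0 = 0" by (simp_all add: defs)
  note M = jet_compose[OF _ p]
  have m3: "jet (\<lambda>z. m z $ 1 $ 1) 1 (4 * C1) (2 * B1) E3 E4 E5" "jet (\<lambda>z. m z $ 1 $ 2) 0 (2 * C2 + B1) (2 * A1 + B2) F3 F4 F5" "jet (\<lambda>z. m z $ 2 $ 2) 1 (2 * B2) (4 * A2) G3 G4 G5"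
    using m by (auto simp: metric_jet_def)
  note M1 = M[OF m3(1)] and M2 = M[OF m3(2)] and M3 = M[OF m3(3)]
  note E = jet_congruence_diagonal[OF M1 M2 M3 j(1) j(3)] and F = jet_congruence_off_diagonal[OF M1 M2 M3 j(1) j(3) j(2) j(4)]
    and G = jet_congruence_diagonal[OF M3 M2 M1 j(4) j(2)]
  have c: "continuous_on UNIV j11" "continuous_on UNIV j12" "continuous_on UNIV j21" "continuous_on UNIV j22"
    unfolding defs by (intro continuous_intros)+
  have pm: "polymap (\<lambda>z. vec2 (p1 z) (p2 z)) (\<lambda>z. mat2 (j11 z) (j12 z) (j21 z) (j22 z))"
  proof (rule polymapI)
    show "(p1 has_derivative (\<lambda>v. j11 z * v$1 + j12 z * v$2)) (at z)" for z
      unfolding defs by (rule has_derivative_eq_rhs[OF has_derivative_poly]) (simp add: fun_eq_iff algebra_simps)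
    show "(p2 has_derivative (\<lambda>v. j21 z * v$1 + j22 z * v$2)) (at z)" for z
      unfolding defs by (rule has_derivative_eq_rhs[OF has_derivative_poly]) (simp add: fun_eq_iff algebra_simps)
    show "j11 0 * j22 0 - j12 0 * j21 0 \<noteq> 0" by (simp add: j11_def j12_def j21_def j22_def)
  qed (rule c z)+
  note mj = metric_jet_pullback[OF m tp z tj]
  \<comment> \<open>The second diagonal entry is the first with the axes exchanged; this puts it
    into the shape of \<open>G\<close>.\<close>
  have comm: "j12 z * (x * j12 z + y * j22 z) + j22 z * (y * j12 z + u * j22 z) = j22 z * (u * j22 z + y * j12 z) + j12 z * (y * j22 z + x * j12 z)" for x y u z
    by (simp add: algebra_simps)
  show ?thesis
    apply (intro exI conjI, rule pm, rule mj)
       apply (rule jet_eq[OF E]; (rule refl)?; simp)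
      apply (rule jet_eq[OF F]; (rule refl)?; simp)
     apply (unfold comm)
     apply (rule jet_eq[OF G]; (rule refl)?; simp)
    apply (simp add: algebra_simps power2_eq_square)
    done
qed

text \<open>Eight cubic coefficients face nine second-order coefficients of the metric. The cubic
  terms add 2 u3 + 2 v2 to f2, 2 u3 to e3 and 2 v2 to g1, so f2 - e3 - g1 is invariant. With this
  invariant equal to K, eight conditions are solved and the ninth, the coefficient K/3 of xy,
  follows.\<close>

lemma cubic_normalization:
  assumes m: "metric_jet m 1 0 0 e1 e2 e3 0 0 0 f1 f2 f3 1 0 0 g1 g2 g3" and K: "f2 - e3 - g1 = K"
  shows "\<exists>\<Phi> J. polymap \<Phi> J \<and>
     metric_jet (\<lambda>z. transpose (J z) ** m (\<Phi> z) ** J z) 1 0 0 0 0 (- K / 3) 0 0 0 0 (K / 3) 0 1 0 0 (- K / 3) 0 0"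
proof -
  \<comment> \<open>Solutions of e1 + 6 u1 = 0, e2 + 4 u2 = 0, e3 + 2 u3 = -K/3, likewise for the
    g's; the off-diagonal entry adds f1 + u2 + 3 v1 = 0 and f3 + v3 + 3 u4 = 0.\<close>
  define u1 u2 u3 where "u1 = - e1 / 6" and "u2 = - e2 / 4" and "u3 = - (K / 3 + e3) / 2"
  define v2 v3 v4 where "v2 = - (K / 3 + g1) / 2" and "v3 = - g2 / 4" and "v4 = - g3 / 6"
  define u4 v1 where "u4 = - (f3 + v3) / 3" and "v1 = - (f1 + u2) / 3"
  note uv = u1_def u2_def u3_def v2_def v3_def v4_def u4_def v1_def
  define p1 where "p1 = (\<lambda>z::real^2. z$1 + (z$1 * (0 + 0 * z$1 + 0 * z$2 + (u1 * (z$1)\<^sup>2 + u2 * (z$1 * z$2) + u3 * (z$2)\<^sup>2))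
     + z$2 * (0 + 0 * z$1 + 0 * z$2 + (0 * (z$1)\<^sup>2 + 0 * (z$1 * z$2) + u4 * (z$2)\<^sup>2))))"
  define p2 where "p2 = (\<lambda>z::real^2. z$2 + (z$1 * (0 + 0 * z$1 + 0 * z$2 + (v1 * (z$1)\<^sup>2 + v2 * (z$1 * z$2) + v3 * (z$2)\<^sup>2))
     + z$2 * (0 + 0 * z$1 + 0 * z$2 + (0 * (z$1)\<^sup>2 + 0 * (z$1 * z$2) + v4 * (z$2)\<^sup>2))))"
  define j11 where "j11 = (\<lambda>z::real^2. 1 + 0 * z$1 + 0 * z$2 + (3 * u1 * (z$1)\<^sup>2 + 2 * u2 * (z$1 * z$2) + u3 * (z$2)\<^sup>2))"
  define j12 where "j12 = (\<lambda>z::real^2. 0 + 0 * z$1 + 0 * z$2 + (u2 * (z$1)\<^sup>2 + 2 * u3 * (z$1 * z$2) + 3 * u4 * (z$2)\<^sup>2))"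
  define j21 where "j21 = (\<lambda>z::real^2. 0 + 0 * z$1 + 0 * z$2 + (3 * v1 * (z$1)\<^sup>2 + 2 * v2 * (z$1 * z$2) + v3 * (z$2)\<^sup>2))"
  define j22 where "j22 = (\<lambda>z::real^2. 1 + 0 * z$1 + 0 * z$2 + (v2 * (z$1)\<^sup>2 + 2 * v3 * (z$1 * z$2) + 3 * v4 * (z$2)\<^sup>2))"
  note defs = p1_def p2_def j11_def j12_def j21_def j22_def
  have "jet p1 0 1 0 0 0 0"
    unfolding p1_def by (rule jet_eq, rule jet_add[OF jet_fst jet_add[OF jet_mult[OF jet_fst jet_poly] jet_mult[OF jet_snd jet_poly]]]; simp)
  moreover have "jet p2 0 0 1 0 0 0"
    unfolding p2_def by (rule jet_eq, rule jet_add[OF jet_snd jet_add[OF jet_mult[OF jet_fst jet_poly] jet_mult[OF jet_snd jet_poly]]]; simp)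
  ultimately have p: "jet p1 0 1 0 0 0 0" "jet p2 0 0 1 0 0 0" by blast+
  have j: "jet j11 1 0 0 (3 * u1) (2 * u2) u3" "jet j12 0 0 0 u2 (2 * u3) (3 * u4)"
      "jet j21 0 0 0 (3 * v1) (2 * v2) v3" "jet j22 1 0 0 v2 (2 * v3) (3 * v4)"
    unfolding j11_def j12_def j21_def j22_def by (rule jet_poly)+
  have tj: "tame j11" "tame j12" "tame j21" "tame j22" unfolding j11_def j12_def j21_def j22_def by (rule tame_poly)+
  have tp: "tame p1" "tame p2" unfolding p1_def p2_def by (intro tame_add tame_nth tame_mult[OF tame_nth tame_poly])+
  have z: "p1 0 = 0" "p2 0 = 0" by (simp_all add: defs)
  note M = jet_compose[OF _ p]
  have m3: "jet (\<lambda>z. m z $ 1 $ 1) 1 0 0 e1 e2 e3" "jet (\<lambda>z. m z $ 1 $ 2) 0 0 0 f1 f2 f3" "jet (\<lambda>z. m z $ 2 $ 2) 1 0 0 g1 g2 g3"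
    using m by (auto simp: metric_jet_def)
  note M1 = M[OF m3(1)] and M2 = M[OF m3(2)] and M3 = M[OF m3(3)]
  note E = jet_congruence_diagonal[OF M1 M2 M3 j(1) j(3)] and F = jet_congruence_off_diagonal[OF M1 M2 M3 j(1) j(3) j(2) j(4)]
    and G = jet_congruence_diagonal[OF M3 M2 M1 j(4) j(2)]
  have c: "continuous_on UNIV j11" "continuous_on UNIV j12" "continuous_on UNIV j21" "continuous_on UNIV j22"
    unfolding defs by (intro continuous_intros)+
  have pm: "polymap (\<lambda>z. vec2 (p1 z) (p2 z)) (\<lambda>z. mat2 (j11 z) (j12 z) (j21 z) (j22 z))"
  proof (rule polymapI)
    note n = has_derivative_nth and q = has_derivative_poly
    show "(p1 has_derivative (\<lambda>v. j11 z * v$1 + j12 z * v$2)) (at z)" for z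
      unfolding defs
      by (rule has_derivative_eq_rhs[OF has_derivative_add[OF n has_derivative_add[OF has_derivative_mult[OF n q] has_derivative_mult[OF n q]]]])
        (simp add: fun_eq_iff algebra_simps power2_eq_square)
    show "(p2 has_derivative (\<lambda>v. j21 z * v$1 + j22 z * v$2)) (at z)" for z
      unfolding defs
      by (rule has_derivative_eq_rhs[OF has_derivative_add[OF n has_derivative_add[OF has_derivative_mult[OF n q] has_derivative_mult[OF n q]]]])
        (simp add: fun_eq_iff algebra_simps power2_eq_square)
    show "j11 0 * j22 0 - j12 0 * j21 0 \<noteq> 0" by (simp add: j11_def j12_def j21_def j22_def)
  qed (rule c z)+
  note mj = metric_jet_pullback[OF m tp z tj]
  have comm: "j12 z * (x * j12 z + y * j22 z) + j22 z * (y * j12 z + u * j22 z) = j22 z * (u * j22 z + y * j12 z) + j12 z * (y * j22 z + x * j12 z)" for x y u z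
    by (simp add: algebra_simps)
  show ?thesis
    apply (intro exI conjI, rule pm, rule mj)
      apply (rule jet_eq[OF E]; simp add: uv field_simps)
     apply (rule jet_eq[OF F]; simp add: uv K[symmetric] field_simps)
    apply (unfold comm)
    apply (rule jet_eq[OF G]; simp add: uv field_simps)
    done
qed

text \<open>Composes the linear, quadratic and cubic changes. The factors s, t, w yield the entries
  of the inverse of the metric at 0, namely s^2 + t^2 = c0/D, t w = -b0/D and w^2 = a0/D, which
  identifies the expression tracked through the changes with K.\<close>

lemma normal_coordinates:
  assumes m: "metric_jet m a0 a1 a2 a3 a4 a5 b0 b1 b2 b3 b4 b5 c0 c1 c2 c3 c4 c5"
    and pos: "0 < a0" "0 < a0 * c0 - b0\<^sup>2"
    and K: "K * (a0 * c0 - b0\<^sup>2) = b4 - a5 - c3 + ((c0 * (a2 / 2)\<^sup>2 - 2 * b0 * (a2 / 2) * (c1 / 2) + a0 * (c1 / 2)\<^sup>2)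
       - (c0 * (b2 - c1 / 2) * (a1 / 2) - b0 * ((b2 - c1 / 2) * (b1 - a2 / 2) + (c2 / 2) * (a1 / 2))
          + a0 * (c2 / 2) * (b1 - a2 / 2))) / (a0 * c0 - b0\<^sup>2)"
  obtains \<Phi> J where "polymap \<Phi> J"
    "metric_jet (\<lambda>z. transpose (J z) ** m (\<Phi> z) ** J z) 1 0 0 0 0 (- K / 3) 0 0 0 0 (K / 3) 0 1 0 0 (- K / 3) 0 0"
proof -
  define D where "D = a0 * c0 - b0\<^sup>2"
  define s where "s = 1 / sqrt a0"
  define w where "w = sqrt a0 / sqrt D"
  define t where "t = - w * b0 / a0"
  have D: "0 < D" using pos by (simp add: D_def)
  have s2: "s\<^sup>2 = 1 / a0" using pos by (simp add: s_def power_divide)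
  have w2: "w\<^sup>2 = a0 / D" using pos D by (simp add: w_def power_divide)
  have ne: "s \<noteq> 0" "w \<noteq> 0" using pos D by (auto simp: s_def w_def)
  have s1: "s\<^sup>2 * a0 = 1" using pos by (simp add: s2)
  have t1: "t * a0 + w * b0 = 0" using pos by (simp add: t_def)
  have t2: "t\<^sup>2 = w\<^sup>2 * b0\<^sup>2 / a0\<^sup>2" by (simp add: t_def power_mult_distrib power_divide)
  have "t\<^sup>2 * a0 + 2 * t * w * b0 + w\<^sup>2 * c0 = w\<^sup>2 * (D / a0)"
    unfolding t2 using pos by (simp add: t_def D_def field_simps power2_eq_square)
  also have "\<dots> = 1" using pos D by (simp add: w2)
  finally have r3: "t\<^sup>2 * a0 + 2 * t * w * b0 + w\<^sup>2 * c0 = 1" .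
  have sw: "s\<^sup>2 * w\<^sup>2 = 1 / D" using pos by (simp add: s2 w2)
  have q: "s\<^sup>2 * w ^ 4 = a0 / D\<^sup>2"
  proof -
    have "s\<^sup>2 * w ^ 4 = (s\<^sup>2 * w\<^sup>2) * w\<^sup>2" by (simp add: power2_eq_square power4_eq_xxxx)
    then show ?thesis unfolding sw unfolding w2 by (simp add: power2_eq_square)
  qed
  have q': "t * s\<^sup>2 * w ^ 3 = - b0 / D\<^sup>2"
  proof -
    have "t * s\<^sup>2 * w ^ 3 = (s\<^sup>2 * w\<^sup>2) * (t * w)" by (simp add: power2_eq_square power3_eq_cube)
    also have "t * w = - (w\<^sup>2 * b0 / a0)" by (simp add: t_def power2_eq_square)
    finally show ?thesis unfolding sw unfolding w2 using pos by (simp add: power2_eq_square)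
  qed
  have q'': "s\<^sup>2 * w\<^sup>2 * (s\<^sup>2 + t\<^sup>2) = c0 / D\<^sup>2"
  proof -
    have "s\<^sup>2 + t\<^sup>2 = 1 / a0 + b0\<^sup>2 / (a0 * D)" unfolding t2 w2 s2 using pos by (simp add: power2_eq_square)
    also have "\<dots> = c0 / D" using pos D by (simp add: D_def field_simps)
    finally show ?thesis unfolding sw using D by (simp add: power2_eq_square)
  qed
  obtain \<Phi>0 J0 E1 E2 E3 E4 E5 F1 F2 F3 F4 F5 G1 G2 G3 G4 G5 where 0: "polymap \<Phi>0 J0"
     "metric_jet (\<lambda>z. transpose (J0 z) ** m (\<Phi>0 z) ** J0 z) 1 E1 E2 E3 E4 E5 0 F1 F2 F3 F4 F5 1 G1 G2 G3 G4 G5"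
     "F4 - E5 - G3 + ((E2 / 2)\<^sup>2 + (G1 / 2)\<^sup>2) - ((F2 - G1 / 2) * (E1 / 2) + (G2 / 2) * (F1 - E2 / 2))
     = s\<^sup>2 * w\<^sup>2 * (b4 - a5 - c3) + (s\<^sup>2 * w\<^sup>2 * (s\<^sup>2 + t\<^sup>2) * (a2 / 2)\<^sup>2 + 2 * (t * s\<^sup>2 * w ^ 3) * (a2 / 2) * (c1 / 2) + s\<^sup>2 * w ^ 4 * (c1 / 2)\<^sup>2)
       - (s\<^sup>2 * w\<^sup>2 * (s\<^sup>2 + t\<^sup>2) * (b2 - c1 / 2) * (a1 / 2) + (t * s\<^sup>2 * w ^ 3) * ((b2 - c1 / 2) * (b1 - a2 / 2) + (c2 / 2) * (a1 / 2))
          + s\<^sup>2 * w ^ 4 * (c2 / 2) * (b1 - a2 / 2))"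
    using linear_normalization[OF m ne s1 t1 r3] by - (elim exE conjE, rule that)
  let ?R = "(c0 * (a2 / 2)\<^sup>2 - 2 * b0 * (a2 / 2) * (c1 / 2) + a0 * (c1 / 2)\<^sup>2)
       - (c0 * (b2 - c1 / 2) * (a1 / 2) - b0 * ((b2 - c1 / 2) * (b1 - a2 / 2) + (c2 / 2) * (a1 / 2))
          + a0 * (c2 / 2) * (b1 - a2 / 2))"
  have "K * D = b4 - a5 - c3 + ?R / D" using K by (simp only: D_def)
  then have "K = (b4 - a5 - c3 + ?R / D) / D" using D by (metis nonzero_eq_divide_eq less_irrefl)
  also have "\<dots> = 1 / D * (b4 - a5 - c3) + ?R / D\<^sup>2" by (simp add: add_divide_distrib power2_eq_square)
  also have "\<dots> = F4 - E5 - G3 + ((E2 / 2)\<^sup>2 + (G1 / 2)\<^sup>2) - ((F2 - G1 / 2) * (E1 / 2) + (G2 / 2) * (F1 - E2 / 2))"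
    unfolding 0(3) q q' q'' unfolding sw by (simp add: diff_divide_distrib add_divide_distrib ac_simps)
  finally have K': "F4 - E5 - G3 + ((E2 / 2)\<^sup>2 + (G1 / 2)\<^sup>2) - ((F2 - G1 / 2) * (E1 / 2) + (G2 / 2) * (F1 - E2 / 2)) = K" by simp
  \<comment> \<open>Presents the first-order coefficients through the parameters A, B, C of
    \<open>quadratic_normalization\<close>, read off from the Christoffel symbols at 0.\<close>
  have r: "4 * (E1 / 4) = E1" "2 * (E2 / 2) = E2" "2 * ((F1 - E2 / 2) / 2) + E2 / 2 = F1" "2 * ((F2 - G1 / 2) / 2) + G1 / 2 = F2"
    "2 * (G1 / 2) = G1" "4 * (G2 / 4) = G2"
    by (simp_all add: diff_divide_distrib)
  have m0: "metric_jet (\<lambda>z. transpose (J0 z) ** m (\<Phi>0 z) ** J0 z) 1 (4 * (E1 / 4)) (2 * (E2 / 2)) E3 E4 E5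
      0 (2 * ((F1 - E2 / 2) / 2) + E2 / 2) (2 * ((F2 - G1 / 2) / 2) + G1 / 2) F3 F4 F5 1 (2 * (G1 / 2)) (4 * (G2 / 4)) G3 G4 G5"
    unfolding r by (rule 0(2))
  have K'': "F4 - E5 - G3 + ((E2 / 2)\<^sup>2 + (G1 / 2)\<^sup>2) - 4 * ((F2 - G1 / 2) / 2 * (E1 / 4) + G2 / 4 * ((F1 - E2 / 2) / 2)) = K"
    unfolding K'[symmetric] by (simp add: field_simps)
  obtain \<Phi>1 J1 e1 e2 e3 f1 f2 f3 g1 g2 g3 where 1: "polymap \<Phi>1 J1"
     "metric_jet (\<lambda>z. transpose (J1 z) ** (transpose (J0 (\<Phi>1 z)) ** m (\<Phi>0 (\<Phi>1 z)) ** J0 (\<Phi>1 z)) ** J1 z) 1 0 0 e1 e2 e3 0 0 0 f1 f2 f3 1 0 0 g1 g2 g3"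
     "f2 - e3 - g1 = K"
    using quadratic_normalization[OF m0] unfolding K'' by - (elim exE conjE, rule that)
  obtain \<Phi>2 J2 where 2: "polymap \<Phi>2 J2"
     "metric_jet (\<lambda>z. transpose (J2 z) ** (transpose (J1 (\<Phi>2 z)) ** (transpose (J0 (\<Phi>1 (\<Phi>2 z))) ** m (\<Phi>0 (\<Phi>1 (\<Phi>2 z))) ** J0 (\<Phi>1 (\<Phi>2 z))) ** J1 (\<Phi>2 z)) ** J2 z)
        1 0 0 0 0 (- K / 3) 0 0 0 0 (K / 3) 0 1 0 0 (- K / 3) 0 0"
    using cubic_normalization[OF 1(2,3)] by - (elim exE conjE, rule that)
  show thesis
  proof (rule that)
    show "polymap (\<lambda>z. \<Phi>0 (\<Phi>1 (\<Phi>2 z))) (\<lambda>z. J0 (\<Phi>1 (\<Phi>2 z)) ** (J1 (\<Phi>2 z) ** J2 z))"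
      using polymap_compose[OF 0(1) polymap_compose[OF 1(1) 2(1)]] .
    show "metric_jet (\<lambda>z. transpose (J0 (\<Phi>1 (\<Phi>2 z)) ** (J1 (\<Phi>2 z) ** J2 z)) ** m (\<Phi>0 (\<Phi>1 (\<Phi>2 z))) ** (J0 (\<Phi>1 (\<Phi>2 z)) ** (J1 (\<Phi>2 z) ** J2 z)))
        1 0 0 0 0 (- K / 3) 0 0 0 0 (K / 3) 0 1 0 0 (- K / 3) 0 0"
      using 2(2) by (simp add: matrix_transpose_mul matrix_mul_assoc)
  qed
qed

section \<open>From the normal form to the estimates on a disc\<close>

lemma qf_diff: "qf m v w - qf n v w = qf (m - n) v w" and qf_sum: "qf m v w + qf n v w = qf (m + n) v w"
  and qf_scale: "k * qf m v w = qf (k *\<^sub>R m) v w"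
  by (simp_all add: qf_eq algebra_simps)

lemma qf_bound:
  assumes "\<And>i j. \<bar>m $ i $ j\<bar> \<le> B"
  shows "\<bar>qf m v w\<bar> \<le> 4 * B * norm v * norm w"
proof -
  have B: "0 \<le> B" using assms[of 1 1] by simp
  have k: "\<bar>m$i$j * v$i * w$j\<bar> \<le> B * norm v * norm w" for i j
    unfolding abs_mult using assms[of i j] B by (intro mult_mono abs_nth_le_norm) auto
  have "\<bar>qf m v w\<bar> \<le> \<bar>m$1$1 * v$1 * w$1\<bar> + \<bar>m$1$2 * v$1 * w$2\<bar> + \<bar>m$2$1 * v$2 * w$1\<bar> + \<bar>m$2$2 * v$2 * w$2\<bar>"
    unfolding qf_eq by linarith
  also have "\<dots> \<le> B * norm v * norm w + B * norm v * norm w + B * norm v * norm w + B * norm v * norm w"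
    by (intro add_mono k)
  finally show ?thesis by simp
qed

text \<open>The prescribed quadratic part is exactly |v|^2 - K/3 (q \<times> v)^2, and a form with
  entries at most B is bounded by 4 B |v| |w|; this turns entrywise errors into the bounds of the
  locale. Every sufficiently small radius is allowed because the disc is later shrunk to fit the
  chart.\<close>

lemma metric_jet_normal:
  assumes m: "metric_jet m 1 0 0 0 0 (- K / 3) 0 0 0 0 (K / 3) 0 1 0 0 (- K / 3) 0 0"
  shows "\<exists>r M. 0 < r \<and> (\<forall>r0. 0 < r0 \<longrightarrow> r0 \<le> r \<longrightarrow> metric_normal m r0 M K)"
proof -
  have sym: "m z $ 2 $ 1 = m z $ 1 $ 2" and t: "tame (\<lambda>z. m z $ i $ j)" for z i j
    using m by (auto simp: metric_jet_def tame_metric_def intro!: transpose_sym_nth)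
  obtain \<delta>1 M1 where t1: "tame_on \<delta>1 M1 (\<lambda>z. m z $ 1 $ 1)" "tame_on \<delta>1 M1 (\<lambda>z. m z $ 1 $ 2)" using tame_common[OF t t] .
  obtain \<delta>2 M2 where t2: "tame_on \<delta>2 M2 (\<lambda>z. m z $ 2 $ 2)" using t unfolding tame_def by blast
  define \<delta> N where "\<delta> = min \<delta>1 \<delta>2" and "N = max M1 M2"
  have d: "0 < \<delta>" using t1 t2 by (auto simp: tame_on_def \<delta>_def)
  have "tame_on \<delta> N (\<lambda>z. m z $ 1 $ 1)" "tame_on \<delta> N (\<lambda>z. m z $ 1 $ 2)" "tame_on \<delta> N (\<lambda>z. m z $ 2 $ 2)"
    using t1 t2 d by (auto simp: \<delta>_def N_def intro: tame_on_mono)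
  then have T: "tame_on \<delta> N (\<lambda>z. m z $ i $ j)" for i j
    using exhaust_2[of i] exhaust_2[of j] by (auto simp: sym)
  have N: "0 \<le> N" using T by (simp add: tame_on_def)
  have jets: "jet (\<lambda>z. m z $ 1 $ 1) 1 0 0 0 0 (- K / 3)" "jet (\<lambda>z. m z $ 1 $ 2) 0 0 0 0 (K / 3) 0" "jet (\<lambda>z. m z $ 2 $ 2) 1 0 0 (- K / 3) 0 0"
    using m by (auto simp: metric_jet_def)
  have normal: "\<exists>\<delta>>0. \<forall>q v. norm q < \<delta> \<longrightarrow>
     \<bar>qf (m q) v v - ((norm v)\<^sup>2 - K / 3 * (cross2 q v)\<^sup>2)\<bar> \<le> \<epsilon> * (norm q)\<^sup>2 * (norm v)\<^sup>2" if \<epsilon>: "0 < \<epsilon>" for \<epsilon>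
  proof -
    have e4: "0 < \<epsilon> / 4" using \<epsilon> by simp
    have "\<forall>\<^sub>F z in nhds 0. \<bar>m z $ 1 $ 1 - (1 + - K / 3 * (z$2)\<^sup>2)\<bar> \<le> \<epsilon> / 4 * (norm z)\<^sup>2 \<and> \<bar>m z $ 1 $ 2 - K / 3 * (z$1 * z$2)\<bar> \<le> \<epsilon> / 4 * (norm z)\<^sup>2
      \<and> \<bar>m z $ 2 $ 2 - (1 + - K / 3 * (z$1)\<^sup>2)\<bar> \<le> \<epsilon> / 4 * (norm z)\<^sup>2"
      using jets(1)[unfolded jet_def small2_def, rule_format, OF e4] jets(2)[unfolded jet_def small2_def, rule_format, OF e4]
        jets(3)[unfolded jet_def small2_def, rule_format, OF e4] by eventually_elim simp
    then obtain \<rho> where \<rho>: "0 < \<rho>" "\<And>z. norm z < \<rho> \<Longrightarrow> \<bar>m z $ 1 $ 1 - (1 + - K / 3 * (z$2)\<^sup>2)\<bar> \<le> \<epsilon> / 4 * (norm z)\<^sup>2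
      \<and> \<bar>m z $ 1 $ 2 - K / 3 * (z$1 * z$2)\<bar> \<le> \<epsilon> / 4 * (norm z)\<^sup>2 \<and> \<bar>m z $ 2 $ 2 - (1 + - K / 3 * (z$1)\<^sup>2)\<bar> \<le> \<epsilon> / 4 * (norm z)\<^sup>2"
      unfolding eventually_nhds_metric by (auto simp: dist_norm)
    show ?thesis
    proof (intro exI[of _ \<rho>] conjI allI impI \<rho>(1))
      fix q v :: "real^2" assume q: "norm q < \<rho>"
      let ?n = "mat2 (1 + - K / 3 * (q$2)\<^sup>2) (K / 3 * (q$1 * q$2)) (K / 3 * (q$1 * q$2)) (1 + - K / 3 * (q$1)\<^sup>2)"
      have "(norm v)\<^sup>2 - K / 3 * (cross2 q v)\<^sup>2 = qf ?n v v"
        unfolding norm_vec2 cross2_def qf_eq mat2_nth by (simp add: field_simps power2_eq_square)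
      moreover have "\<bar>qf (m q - ?n) v v\<bar> \<le> 4 * (\<epsilon> / 4 * (norm q)\<^sup>2) * norm v * norm v"
      proof (rule qf_bound)
        show "\<bar>(m q - ?n) $ i $ j\<bar> \<le> \<epsilon> / 4 * (norm q)\<^sup>2" for i j
          using \<rho>(2)[OF q] exhaust_2[of i] exhaust_2[of j] sym[of q] by auto
      qed
      ultimately show "\<bar>qf (m q) v v - ((norm v)\<^sup>2 - K / 3 * (cross2 q v)\<^sup>2)\<bar> \<le> \<epsilon> * (norm q)\<^sup>2 * (norm v)\<^sup>2"
        unfolding qf_diff[symmetric] by (simp add: power2_eq_square mult.assoc)
    qed
  qed
  obtain \<delta>' where \<delta>': "0 < \<delta>'" "\<And>q v. norm q < \<delta>' \<Longrightarrow> \<bar>qf (m q) v v - ((norm v)\<^sup>2 - K / 3 * (cross2 q v)\<^sup>2)\<bar> \<le> 1 * (norm q)\<^sup>2 * (norm v)\<^sup>2"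
    using normal[OF zero_less_one] by blast
  \<comment> \<open>For |q| \<le> 1/(2k) \<le> 1 the deviation k |q|^2 from the Euclidean form is at
    most 1/2, which gives both ellipticity bounds.\<close>
  define k where "k = \<bar>K\<bar> / 3 + 1"
  have k: "1 \<le> k" by (simp add: k_def)
  define r where "r = min \<delta> (min \<delta>' (1 / (2 * k)))"
  have r: "0 < r" "r \<le> \<delta>" "r \<le> \<delta>'" "r \<le> 1 / (2 * k)" using d \<delta>' k by (auto simp: r_def)
  have near: "\<bar>qf (m q) v v - (norm v)\<^sup>2\<bar> \<le> (norm v)\<^sup>2 / 2" if q: "norm q < r" for q v
  proof -
    have c: "(cross2 q v)\<^sup>2 \<le> (norm q)\<^sup>2 * (norm v)\<^sup>2" using inner_cross2[of q v] zero_le_power2[of "q \<bullet> v"] by linarith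
    have "\<bar>K / 3 * (cross2 q v)\<^sup>2\<bar> = \<bar>K\<bar> / 3 * (cross2 q v)\<^sup>2" by (simp add: abs_mult)
    also have "\<dots> \<le> \<bar>K\<bar> / 3 * ((norm q)\<^sup>2 * (norm v)\<^sup>2)" by (rule mult_left_mono[OF c]) simp
    finally have "\<bar>qf (m q) v v - (norm v)\<^sup>2\<bar> \<le> 1 * (norm q)\<^sup>2 * (norm v)\<^sup>2 + \<bar>K\<bar> / 3 * ((norm q)\<^sup>2 * (norm v)\<^sup>2)"
      using \<delta>'(2)[of q v] q r by linarith
    also have "\<dots> = k * (norm q)\<^sup>2 * (norm v)\<^sup>2" by (simp add: k_def algebra_simps)
    also have "\<dots> \<le> (1 / 2) * (norm v)\<^sup>2"
    proof (rule mult_right_mono)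
      have l: "norm q \<le> 1 / (2 * k)" using q r by linarith
      have "1 / (2 * k) \<le> 1" using k by simp
      then have "norm q \<le> 1" using l by linarith
      then have "norm q * norm q \<le> norm q * 1" by (intro mult_left_mono) auto
      then have "(norm q)\<^sup>2 \<le> 1 / (2 * k)" using l by (simp add: power2_eq_square)
      then have "k * (norm q)\<^sup>2 \<le> k * (1 / (2 * k))" using k by (intro mult_left_mono) auto
      then show "k * (norm q)\<^sup>2 \<le> 1 / 2" using k by simp
    qed simp
    finally show ?thesis by simp
  qed
  have "metric_normal m r0 (4 * N) K" if r0: "0 < r0" "r0 \<le> r" for r0
  proof (unfold_locales)
    show "0 < r0" "0 \<le> 4 * N" using r0 N by auto
    show "qf (m q) v w = qf (m q) w v" for q v w unfolding qf_eq sym by simp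
    show "continuous_on (ball 0 r0) m"
    proof -
      have "continuous_on (ball 0 r0) (\<lambda>z. m z $ i $ j)" for i j
        unfolding continuous_on_iff
      proof safe
        fix z :: "real^2" and e :: real assume z: "z \<in> ball 0 r0" and e: "0 < e"
        show "\<exists>d>0. \<forall>y\<in>ball 0 r0. dist y z < d \<longrightarrow> dist (m y $ i $ j) (m z $ i $ j) < e"
        proof (intro exI[of _ "e / (N + 1)"] conjI ballI impI)
          show "0 < e / (N + 1)" using e N by simp
          fix y assume y: "y \<in> ball 0 r0" and "dist y z < e / (N + 1)"
          then have "norm (y - z) * (N + 1) < e" using N by (simp add: dist_norm pos_less_divide_eq)
          moreover have "\<bar>m y $ i $ j - m z $ i $ j\<bar> \<le> N * norm (y - z)" using T[of i j] y z r r0 by (auto simp: tame_on_def)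
          ultimately show "dist (m y $ i $ j) (m z $ i $ j) < e" by (simp add: dist_real_def algebra_simps add_nonneg_pos) (smt (verit) norm_ge_zero)
        qed
      qed
      then have "continuous_on (ball 0 r0) (\<lambda>z. \<chi> i j. m z $ i $ j)" by (intro continuous_on_vec_lambda)
      then show ?thesis by simp
    qed
    have near': "\<bar>qf (m q) v v - (norm v)\<^sup>2\<bar> \<le> (norm v)\<^sup>2 / 2" if "q \<in> ball 0 r0" for q v
      by (rule near) (use that r0 in simp)
    show "(norm v)\<^sup>2 / 2 \<le> qf (m q) v v" if "q \<in> ball 0 r0" for q v
      using near'[OF that, of v] unfolding abs_le_iff by linarith
    show "qf (m q) v v \<le> 2 * (norm v)\<^sup>2" if "q \<in> ball 0 r0" for q v
      using near'[OF that, of v] zero_le_power2[of "norm v"] unfolding abs_le_iff by linarith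
    show "\<bar>qf (m q) v w - qf (m q') v w\<bar> \<le> 4 * N * norm (q - q') * norm v * norm w" if "q \<in> ball 0 r0" "q' \<in> ball 0 r0" for q q' v w
    proof -
      have "\<bar>(m q - m q') $ i $ j\<bar> \<le> N * norm (q - q')" for i j
        using T[of i j] that r r0 by (auto simp: tame_on_def)
      from qf_bound[OF this, of v w] show ?thesis unfolding qf_diff by (simp add: mult.assoc)
    qed
    show "\<bar>qf (m (q + p)) v v + qf (m (q - p)) v v - 2 * qf (m q) v v\<bar> \<le> 4 * N * (norm p)\<^sup>2 * (norm v)\<^sup>2"
      if "q \<in> ball 0 r0" "q + p \<in> ball 0 r0" "q - p \<in> ball 0 r0" for q p v
    proof -
      have "\<bar>(m (q + p) + m (q - p) - 2 *\<^sub>R m q) $ i $ j\<bar> \<le> N * (norm p)\<^sup>2" for i j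
        using T[of i j] that r r0 by (auto simp: tame_on_def)
      from qf_bound[OF this, of v v] show ?thesis
        unfolding qf_sum qf_scale qf_diff by (simp add: mult.assoc power2_eq_square[of "norm v"])
    qed
    show "\<exists>\<delta>>0. \<forall>q v. norm q < \<delta> \<longrightarrow>
     \<bar>qf (m q) v v - ((norm v)\<^sup>2 - K / 3 * (cross2 q v)\<^sup>2)\<bar> \<le> \<epsilon> * (norm q)\<^sup>2 * (norm v)\<^sup>2" if "0 < \<epsilon>" for \<epsilon>
      by (rule normal[OF that])
  qed
  then show ?thesis using r(1) by blast
qed

section \<open>The normal form on the surface, conformal charts, and the conclusion\<close>

lemma small2_cong:
  assumes "small2 e" "\<forall>\<^sub>F z in nhds 0. f z = e z"
  shows "small2 f"
  unfolding small2_def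
proof safe
  fix \<epsilon> :: real assume "0 < \<epsilon>"
  then have "\<forall>\<^sub>F z in nhds 0. \<bar>e z\<bar> \<le> \<epsilon> * (norm z)\<^sup>2" using assms(1) unfolding small2_def by blast
  then show "\<forall>\<^sub>F z in nhds 0. \<bar>f z\<bar> \<le> \<epsilon> * (norm z)\<^sup>2" using assms(2) by eventually_elim simp
qed

lemma jet_cong:
  assumes "jet f c l1 l2 q1 q2 q3" "\<forall>\<^sub>F z in nhds 0. g z = f z"
  shows "jet g c l1 l2 q1 q2 q3"
  unfolding jet_def by (rule small2_cong[OF assms(1)[unfolded jet_def]]) (use assms(2) in eventually_elim, simp)

lemma posdef_2:
  fixes m :: "real^2^2"
  assumes "transpose m = m" "\<And>v. v \<noteq> 0 \<Longrightarrow> 0 < v \<bullet> (m *v v)"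
  shows "0 < m$1$1" "0 < m$1$1 * m$2$2 - (m$1$2)\<^sup>2"
proof -
  have s: "m$2$1 = m$1$2" by (rule transpose_sym_nth[OF assms(1)])
  have z: "vec2 a b = 0 \<longleftrightarrow> a = 0 \<and> b = 0" for a b by (simp add: vec_eq_iff forall_2)
  have "vec2 1 0 \<noteq> 0" by (simp add: z)
  from assms(2)[OF this] show 1: "0 < m$1$1" by (simp add: qf_def[symmetric] qf_eq)
  have "vec2 (- m$1$2) (m$1$1) \<noteq> 0" using 1 by (simp add: z)
  from assms(2)[OF this] have "0 < m$1$1 * (m$1$1 * m$2$2 - (m$1$2)\<^sup>2)"
    by (simp add: qf_def[symmetric] qf_eq s algebra_simps power2_eq_square)
  then show "0 < m$1$1 * m$2$2 - (m$1$2)\<^sup>2" using 1 by (simp add: zero_less_mult_iff)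
qed

text \<open>Outside the coordinate domain the metric is completed by the identity matrix, so that it
  is symmetric everywhere; the germ at 0, hence the jet, is unaffected.\<close>

lemma C2_metric_jet:
  fixes h :: "real^2 \<Rightarrow> real^2^2"
  assumes W: "open W" "q \<in> W" and C: "Ck_on 2 h W" and sym: "\<And>y. y \<in> W \<Longrightarrow> transpose (h y) = h y"
  shows "metric_jet (\<lambda>z. if q + z \<in> W then h (q + z) else mat 1)
    (h q $ 1 $ 1) (partial 1 (\<lambda>y. h y $ 1 $ 1) q) (partial 2 (\<lambda>y. h y $ 1 $ 1) q)
      (partial 1 (partial 1 (\<lambda>y. h y $ 1 $ 1)) q / 2) (partial 1 (partial 2 (\<lambda>y. h y $ 1 $ 1)) q) (partial 2 (partial 2 (\<lambda>y. h y $ 1 $ 1)) q / 2)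
    (h q $ 1 $ 2) (partial 1 (\<lambda>y. h y $ 1 $ 2) q) (partial 2 (\<lambda>y. h y $ 1 $ 2) q)
      (partial 1 (partial 1 (\<lambda>y. h y $ 1 $ 2)) q / 2) (partial 1 (partial 2 (\<lambda>y. h y $ 1 $ 2)) q) (partial 2 (partial 2 (\<lambda>y. h y $ 1 $ 2)) q / 2)
    (h q $ 2 $ 2) (partial 1 (\<lambda>y. h y $ 2 $ 2) q) (partial 2 (\<lambda>y. h y $ 2 $ 2) q)
      (partial 1 (partial 1 (\<lambda>y. h y $ 2 $ 2)) q / 2) (partial 1 (partial 2 (\<lambda>y. h y $ 2 $ 2)) q) (partial 2 (partial 2 (\<lambda>y. h y $ 2 $ 2)) q / 2)"
proof -
  let ?m = "\<lambda>z. if q + z \<in> W then h (q + z) else mat 1"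
  have ev: "\<forall>\<^sub>F z in nhds 0. ?m z $ i $ j = h (q + z) $ i $ j" for i j
  proof -
    obtain d where "0 < d" "ball q d \<subseteq> W" using W open_contains_ball by blast
    then have "q + z \<in> W" if "norm z < d" for z using that add_mem_ball_iff(1)[of q z d] by blast
    then show ?thesis unfolding eventually_nhds_metric using \<open>0 < d\<close> by (auto simp: dist_norm)
  qed
  have Cij: "Ck_on 2 (\<lambda>y. h y $ i $ j) W" for i j by (rule Ck_on_bounded_linear[OF bounded_linear_mat_nth W(1) C])
  have "tame (\<lambda>z. ?m z $ i $ j)" for i j by (rule tame_cong[OF Ck_on_2_tame[OF W Cij] ev])
  moreover have "transpose (?m z) = ?m z" for z using sym by (simp add: transpose_mat)
  ultimately show ?thesis unfolding metric_jet_def tame_metric_def using jet_cong[OF Ck_on_2_jet[OF W Cij] ev] by blast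
qed

text \<open>The derivatives of \<open>u\<close> are obtained from those of the metric, as u is half
  the logarithm of a diagonal entry. With E = G = e^{2u} and F = 0, the squares of first derivatives
  of u in the quadratic part cancel those from the second derivatives of e^{2u}, and only the
  Laplacian survives.\<close>

lemma conformal_curvature:
  fixes u :: "real^2 \<Rightarrow> real"
  assumes W: "open W" "q \<in> W" and C: "Ck_on 2 h W" and h: "\<And>y. y \<in> W \<Longrightarrow> h y = mat (exp (2 * u y))"
  shows "coord_curvature h q = - exp (- 2 * u q) * laplacian u q"
proof -
  define \<phi> where "\<phi> = (\<lambda>y. exp (2 * u y))"
  have \<phi>pos: "0 < \<phi> y" for y by (simp add: \<phi>_def)
  have e: "h y $ 1 $ 1 = \<phi> y" "h y $ 1 $ 2 = 0" "h y $ 2 $ 1 = 0" "h y $ 2 $ 2 = \<phi> y" if "y \<in> W" for y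
    using h[OF that] by (simp_all add: \<phi>_def mat_def)
  have C\<phi>: "Ck_on 2 \<phi> W"
    by (rule Ck_on_cong[OF W(1) e(1) Ck_on_bounded_linear[OF bounded_linear_mat_nth W(1) C]])
  have \<phi>d: "\<phi> differentiable (at y)" "partial i \<phi> differentiable (at y)" if "y \<in> W" for y i
    using Ck_on_2D(1,2)[OF C\<phi> that] by auto
  have ud: "(u has_derivative (\<lambda>v. frechet_derivative \<phi> (at y) v / \<phi> y / 2)) (at y)" if y: "y \<in> W" for y
  proof -
    have "(\<phi> has_derivative frechet_derivative \<phi> (at y)) (at y)" using \<phi>d(1)[OF y] by (simp add: frechet_derivative_works)
    from has_derivative_ln[OF \<phi>pos this]
    have "((\<lambda>y. ln (\<phi> y)) has_derivative (\<lambda>v. frechet_derivative \<phi> (at y) v * inverse (\<phi> y))) (at y)" .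
    from has_derivative_mult_right[OF this, of "1 / 2"]
    have "((\<lambda>y. (1 / 2) * ln (\<phi> y)) has_derivative (\<lambda>v. (1 / 2) * (frechet_derivative \<phi> (at y) v * inverse (\<phi> y)))) (at y)" .
    moreover have "(\<lambda>y. (1 / 2) * ln (\<phi> y)) = u" by (simp add: \<phi>_def)
    ultimately show ?thesis by (simp add: field_simps)
  qed
  have up: "partial i u y = partial i \<phi> y / \<phi> y / 2" if "y \<in> W" for y i
    using partial_eqI[OF ud[OF that]] by (simp add: partial_def)
  have upd: "partial i u differentiable (at y)" if y: "y \<in> W" for y i
  proof (rule differentiable_cong_open[OF W(1) y])
    show "partial i \<phi> y / \<phi> y / 2 = partial i u y" if "y \<in> W" for y using up[OF that] by simp
    show "(\<lambda>y. partial i \<phi> y / \<phi> y / 2) differentiable (at y)"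
      using \<phi>pos[of y] by (intro differentiable_divide \<phi>d y differentiable_const) auto
  qed
  have p\<phi>: "partial i \<phi> y = 2 * (\<phi> y * partial i u y)" if "y \<in> W" for y i
    using up[OF that] \<phi>pos[of y] by simp
  have pp\<phi>: "partial i (partial i \<phi>) q = 4 * \<phi> q * (partial i u q)\<^sup>2 + 2 * \<phi> q * partial i (partial i u) q" for i
  proof -
    have "partial i (partial i \<phi>) q = partial i (\<lambda>y. 2 * (\<phi> y * partial i u y)) q"
      by (rule partial_cong[OF W p\<phi>])
    also have "\<dots> = 2 * partial i (\<lambda>y. \<phi> y * partial i u y) q"
      by (rule partial_bounded_linear[OF bounded_linear_mult_right]) (intro differentiable_mult \<phi>d upd W)
    also have "\<dots> = 2 * (partial i \<phi> q * partial i u q + \<phi> q * partial i (partial i u) q)"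
      by (simp add: partial_mult \<phi>d upd W)
    finally show ?thesis using p\<phi>[OF W(2)] by (simp add: algebra_simps power2_eq_square)
  qed
  have c1: "partial i (\<lambda>y. h y $ 1 $ 1) y = partial i \<phi> y" "partial i (\<lambda>y. h y $ 2 $ 2) y = partial i \<phi> y"
    "partial i (\<lambda>y. h y $ 1 $ 2) y = 0" if y: "y \<in> W" for i y
  proof -
    show "partial i (\<lambda>y. h y $ 1 $ 1) y = partial i \<phi> y" by (rule partial_cong[OF W(1) y e(1)])
    show "partial i (\<lambda>y. h y $ 2 $ 2) y = partial i \<phi> y" by (rule partial_cong[OF W(1) y e(4)])
    have "partial i (\<lambda>y. h y $ 1 $ 2) y = partial i (\<lambda>y. 0) y" by (rule partial_cong[OF W(1) y e(2)])
    then show "partial i (\<lambda>y. h y $ 1 $ 2) y = 0" by (simp add: partial_eqI[OF has_derivative_const])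
  qed
  have c2: "partial 2 (partial 2 (\<lambda>y. h y $ 1 $ 1)) q = partial 2 (partial 2 \<phi>) q"
    "partial 1 (partial 1 (\<lambda>y. h y $ 2 $ 2)) q = partial 1 (partial 1 \<phi>) q" "partial 1 (partial 2 (\<lambda>y. h y $ 1 $ 2)) q = 0"
  proof -
    show "partial 2 (partial 2 (\<lambda>y. h y $ 1 $ 1)) q = partial 2 (partial 2 \<phi>) q" by (rule partial_cong[OF W c1(1)])
    show "partial 1 (partial 1 (\<lambda>y. h y $ 2 $ 2)) q = partial 1 (partial 1 \<phi>) q" by (rule partial_cong[OF W c1(2)])
    have "partial 1 (partial 2 (\<lambda>y. h y $ 1 $ 2)) q = partial 1 (\<lambda>y. 0) q" by (rule partial_cong[OF W c1(3)])
    then show "partial 1 (partial 2 (\<lambda>y. h y $ 1 $ 2)) q = 0" by (simp add: partial_eqI[OF has_derivative_const])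
  qed
  have det: "det (h y) \<noteq> 0" if "y \<in> W" for y using e[OF that] \<phi>pos[of y] by (simp add: det_2)
  have sym: "h y $ 2 $ 1 = h y $ 1 $ 2" if "y \<in> W" for y using e[OF that] by simp
  define f where "f = \<phi> q"
  have f: "0 < f" by (simp add: f_def \<phi>pos)
  define a b where "a = partial 1 u q" and "b = partial 2 u q"
  have p: "partial 1 \<phi> q = 2 * (f * a)" "partial 2 \<phi> q = 2 * (f * b)" using p\<phi>[OF W(2)] by (simp_all add: f_def a_def b_def)
  have "coord_curvature h q * (f * f - 0\<^sup>2) = 0 - partial 2 (partial 2 \<phi>) q / 2 - partial 1 (partial 1 \<phi>) q / 2
      + ((f * (2 * (f * b) / 2)\<^sup>2 - 2 * 0 * (2 * (f * b) / 2) * (2 * (f * a) / 2) + f * (2 * (f * a) / 2)\<^sup>2)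
       - (f * (0 - 2 * (f * a) / 2) * (2 * (f * a) / 2) - 0 * ((0 - 2 * (f * a) / 2) * (0 - 2 * (f * b) / 2) + (2 * (f * b) / 2) * (2 * (f * a) / 2))
          + f * (2 * (f * b) / 2) * (0 - 2 * (f * b) / 2))) / (f * f - 0\<^sup>2)"
    using coord_curvature_eq[OF W C sym det refl refl refl refl refl refl refl refl refl]
    unfolding e[OF W(2)] c1[OF W(2)] c2 p f_def[symmetric] by simp
  then have "(f * f) * (coord_curvature h q * (f * f)) = (f * f) * (- (partial 2 (partial 2 \<phi>) q + partial 1 (partial 1 \<phi>) q) / 2 + 2 * f * (a\<^sup>2 + b\<^sup>2))"
    using f by (simp add: field_simps power2_eq_square)
  then have "coord_curvature h q * (f * f) = - (partial 2 (partial 2 \<phi>) q + partial 1 (partial 1 \<phi>) q) / 2 + 2 * f * (a\<^sup>2 + b\<^sup>2)"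
    using f by (metis mult_left_cancel mult_eq_0_iff less_irrefl)
  also have "\<dots> = - f * laplacian u q"
    unfolding pp\<phi> by (simp add: laplacian_def sum_2 f_def[symmetric] a_def[symmetric] b_def[symmetric] field_simps)
  finally have "f * (f * coord_curvature h q + laplacian u q) = 0" by (simp add: algebra_simps)
  then have k: "f * coord_curvature h q = - laplacian u q" using f by (simp add: add_eq_0_iff)
  have "coord_curvature h q = f * coord_curvature h q / f" using f by simp
  also have "\<dots> = - laplacian u q / f" by (simp only: k)
  also have "\<dots> = - exp (- 2 * u q) * laplacian u q" by (simp add: f_def \<phi>_def exp_minus field_simps)
  finally show ?thesis .
qed

lemma polymap_inj:
  assumes "polymap \<Phi> J"
  obtains r where "0 < r" "inj_on \<Phi> (ball 0 r)"
proof (rule has_derivative_locally_injective[of 0 UNIV "inv2 (J 0)" "\<lambda>z v. J z *v v" \<Phi>])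
  have d: "det (J 0) \<noteq> 0" and c: "continuous_on UNIV J" using assms by (auto simp: polymap_def)
  show "bounded_linear (inv2 (J 0))" by (simp add: linear_inv2 linear_conv_bounded_linear[symmetric])
  show "inv2 (J 0) \<circ> matrix_vector_mult (J 0) = id" by (simp add: fun_eq_iff inv2_left[OF d])
  show "(\<Phi> has_derivative matrix_vector_mult (J z)) (at z)" for z using assms by (simp add: polymap_def)
  fix e :: real assume e: "0 < e"
  define \<phi> where "\<phi> = (\<lambda>z. \<Sum>i\<in>UNIV. \<Sum>j\<in>UNIV. \<bar>(J z - J 0) $ i $ j\<bar>)"
  have "continuous_on UNIV \<phi>" unfolding \<phi>_def by (intro continuous_intros c)
  then obtain d where d: "0 < d" "\<And>z. dist z 0 < d \<Longrightarrow> dist (\<phi> z) (\<phi> 0) < e"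
    using e unfolding continuous_on_iff by (meson UNIV_I)
  have "onorm (\<lambda>v. J z *v v - J 0 *v v) < e" if "dist 0 z < d" for z
  proof -
    have "(\<lambda>v. J z *v v - J 0 *v v) = matrix_vector_mult (J z - J 0)"
      by (simp add: fun_eq_iff vec_eq_iff matrix_vector_mult_def sum_2 algebra_simps)
    then have "onorm (\<lambda>v. J z *v v - J 0 *v v) = onorm (matrix_vector_mult (J z - J 0))" by simp
    also have "\<dots> \<le> \<phi> z" unfolding \<phi>_def by (rule onorm_le_matrix_component_sum)
    also have "\<phi> z < e"
    proof -
      have "\<bar>\<phi> z - \<phi> 0\<bar> < e" using d(2)[of z] that by (simp only: dist_real_def dist_commute)
      moreover have "\<phi> 0 = 0" by (simp add: \<phi>_def)
      ultimately show ?thesis by simp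
    qed
    finally show ?thesis .
  qed
  then show "\<exists>d>0. \<forall>z. dist 0 z < d \<longrightarrow> onorm (\<lambda>v. J z *v v - J 0 *v v) < e" using d(1) by blast
qed (use that in auto)

lemma frechet_matrix:
  assumes "f differentiable (at (q :: real^2))"
  shows "((f :: real^2 \<Rightarrow> real^2) has_derivative matrix_vector_mult (matrix (frechet_derivative f (at q)))) (at q)"
proof -
  have "(\<lambda>v. matrix (frechet_derivative f (at q)) *v v) = (\<lambda>v. (v$1) *\<^sub>R partial 1 f q + (v$2) *\<^sub>R partial 2 f q)"
    by (simp add: fun_eq_iff vec_eq_iff matrix_def matrix_vector_mult_def sum_2 partial_def mult.commute)
  then show ?thesis using partial_works[OF assms] by simp
qed

text \<open>The coordinates of \<open>c\<close> are translated to \<open>x\<close>, composed with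
  the normal form map, and restricted to a disc on which the map is injective and stays where the
  metric is C^2; invariance of domain supplies the inverse. Jacobian matrices into the other charts
  come from the transition maps, and the transformation law of the metric becomes the law of the
  locale.\<close>

lemma normal_coordinates_surface:
  assumes S: "smooth_surface A" and R: "riemannian_metric A G" and C2: "C2_near A G x" and c: "c \<in> A" "x \<in> dom_of c"
  obtains h r0 M U \<zeta> \<pi> J r1 where "surface_normal h r0 M A G x c U \<zeta> \<pi> J (gauss_curvature G c x) r1"
proof -
  obtain V where V: "open V" "x \<in> V" "Ck_on 2 (G c \<circ> param c) (coord c ` (dom_of c \<inter> V))"
    using C2 c unfolding C2_near_def by blast
  have ch: "is_chart d" if "d \<in> A" for d using S that by (simp add: smooth_surface_def)
  have oc: "open (dom_of c)" "open (coord c ` dom_of c)" and hc: "homeomorphism (dom_of c) (coord c ` dom_of c) (coord c) (param c)"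
    using ch[OF c(1)] by (auto simp: is_chart_def)
  have pc: "param c (coord c p) = p" if "p \<in> dom_of c" for p using hc that by (simp add: homeomorphism_def)
  have op: "open (coord c ` (dom_of c \<inter> D))" if "open D" for D
  proof -
    have "openin (top_of_set (coord c ` dom_of c)) (coord c ` (dom_of c \<inter> D))"
      by (rule homeomorphism_imp_open_map[OF hc]) (use that in blast)
    then show ?thesis using openin_open_eq[OF oc(2)] by blast
  qed
  define W q hh where "W = coord c ` (dom_of c \<inter> V)" and "q = coord c x" and "hh = G c \<circ> param c"
  have W: "open W" "q \<in> W" using op[OF V(1)] V(2) c(2) by (auto simp: W_def q_def)
  have Wp: "param c y \<in> dom_of c" "coord c (param c y) = y" if "y \<in> W" for y using that pc by (auto simp: W_def)
  have CW: "Ck_on 2 hh W" using V(3) by (simp add: W_def hh_def)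
  have Rc: "\<forall>p\<in>dom_of c. transpose (G c p) = G c p \<and> (\<forall>v. v \<noteq> 0 \<longrightarrow> v \<bullet> (G c p *v v) > 0)"
    using R c(1) unfolding riemannian_metric_def by blast
  have tr: "transpose (hh y) = hh y" and pd: "v \<noteq> 0 \<Longrightarrow> 0 < v \<bullet> (hh y *v v)" if "y \<in> W" for y v
    using Rc Wp(1)[OF that] by (simp_all add: hh_def)
  have sy: "hh y $ 2 $ 1 = hh y $ 1 $ 2" if "y \<in> W" for y by (rule transpose_sym_nth[OF tr[OF that]])
  have D: "0 < hh y $ 1 $ 1" "0 < hh y $ 1 $ 1 * hh y $ 2 $ 2 - (hh y $ 1 $ 2)\<^sup>2" if "y \<in> W" for y
    using posdef_2[OF tr[OF that] pd[OF that]] by blast+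
  have det: "det (hh y) \<noteq> 0" if "y \<in> W" for y using D(2)[OF that] sy[OF that] by (simp add: det_2 power2_eq_square)
  define K where "K = gauss_curvature G c x"
  have K: "K = coord_curvature hh q" by (simp add: K_def gauss_curvature_def hh_def q_def)
  define m where "m = (\<lambda>z. if q + z \<in> W then hh (q + z) else mat 1)"
  note mj = C2_metric_jet[OF W CW tr, folded m_def]
  note curv = coord_curvature_eq[OF W CW sy det refl refl refl refl refl refl refl refl refl, folded K]
  obtain \<Phi> L where \<Phi>: "polymap \<Phi> L"
    "metric_jet (\<lambda>z. transpose (L z) ** m (\<Phi> z) ** L z) 1 0 0 0 0 (- K / 3) 0 0 0 0 (K / 3) 0 1 0 0 (- K / 3) 0 0"
    by (rule normal_coordinates[OF mj D[OF W(2)] curv])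
  define h where "h = (\<lambda>z. transpose (L z) ** m (\<Phi> z) ** L z)"
  obtain rn M where rn: "0 < rn" "\<And>r0. 0 < r0 \<Longrightarrow> r0 \<le> rn \<Longrightarrow> metric_normal h r0 M K"
    using metric_jet_normal[OF \<Phi>(2), folded h_def] by blast
  obtain ri where ri: "0 < ri" "inj_on \<Phi> (ball 0 ri)" by (rule polymap_inj[OF \<Phi>(1)])
  have L: "continuous_on UNIV L" and \<Phi>d: "\<And>z. (\<Phi> has_derivative matrix_vector_mult (L z)) (at z)" and \<Phi>0: "\<Phi> 0 = 0"
    using \<Phi>(1) by (auto simp: polymap_def)
  define \<Psi> where "\<Psi> = (\<lambda>z. q + \<Phi> z)"
  have \<Psi>d: "(\<Psi> has_derivative matrix_vector_mult (L z)) (at z)" for z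
    unfolding \<Psi>_def using has_derivative_add[OF has_derivative_const \<Phi>d] by simp
  have \<Psi>c: "continuous_on UNIV \<Psi>"
    using \<Psi>d by (intro has_derivative_continuous_on) (auto intro: has_derivative_at_withinI)
  have "open (\<Psi> -` W)" "0 \<in> \<Psi> -` W" using open_vimage[OF W(1) \<Psi>c] W(2) by (auto simp: \<Psi>_def \<Phi>0)
  then obtain rw where rw: "0 < rw" "ball 0 rw \<subseteq> \<Psi> -` W" using open_contains_ball by blast
  \<comment> \<open>Three limits: the estimates for \<open>h\<close>, injectivity of the coordinate
    change, and its image staying in \<open>W\<close>.\<close>
  define r0 where "r0 = min rn (min ri rw)"
  have r0: "0 < r0" "r0 \<le> rn" "r0 \<le> ri" "r0 \<le> rw" using rn ri rw by (auto simp: r0_def)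
  have \<Psi>W: "\<Psi> z \<in> W" if "z \<in> ball 0 r0" for z using that rw r0 by (auto simp: subset_iff)
  define B where "B = ball (0::real^2) r0"
  have "inj_on \<Phi> B" by (rule inj_on_subset[OF ri(2)]) (use r0 in \<open>auto simp: B_def\<close>)
  then have inj: "inj_on \<Psi> B" unfolding \<Psi>_def inj_on_def by simp
  have cB: "continuous_on B \<Psi>" by (rule continuous_on_subset[OF \<Psi>c]) simp
  obtain g where g: "homeomorphism B (\<Psi> ` B) \<Psi> g"
    by (rule invariance_of_domain_homeomorphism[OF _ cB _ inj]) (auto simp: B_def)
  have oB: "open (\<Psi> ` B)" by (rule invariance_of_domain[OF cB _ inj]) (simp add: B_def)
  have sB: "\<Psi> ` B \<subseteq> W" using \<Psi>W by (auto simp: B_def)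
  define U where "U = param c ` \<Psi> ` B"
  have Wc: "W \<subseteq> coord c ` dom_of c" by (auto simp: W_def)
  have h2: "homeomorphism (\<Psi> ` B) U (param c) (coord c)"
    by (rule homeomorphism_of_subsets[OF homeomorphism_symD[OF hc], of _ "{}"]) (use sB Wc in \<open>auto simp: U_def\<close>)
  have hom: "homeomorphism U B (g \<circ> coord c) (param c \<circ> \<Psi>)"
    by (rule homeomorphism_symD[OF homeomorphism_compose[OF g h2]])
  have "openin (top_of_set (dom_of c)) U" unfolding U_def
    by (rule homeomorphism_imp_open_map[OF homeomorphism_symD[OF hc]]) (use oB sB Wc in \<open>auto simp: openin_open\<close>)
  then have oU: "open U" using openin_open_eq[OF oc(1)] by blast
  have Uc: "U \<subseteq> dom_of c" using sB Wp(1) by (auto simp: U_def)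
  define \<pi> where "\<pi> = param c \<circ> \<Psi>"
  define J where "J = (\<lambda>d z. transition_jacobian c d (\<pi> z) ** L z)"
  have \<pi>c: "\<pi> z \<in> dom_of c" "coord c (\<pi> z) = \<Psi> z" if "z \<in> ball 0 r0" for z
    using Wp[OF \<Psi>W[OF that]] by (auto simp: \<pi>_def)
  have Ck: "Ck_on 1 (coord d \<circ> param c) (coord c ` (dom_of c \<inter> dom_of d))" if "d \<in> A" for d
    using S c(1) that unfolding smooth_surface_def by blast
  have Td: "(coord d \<circ> param c) differentiable (at y)" "continuous_on (coord c ` (dom_of c \<inter> dom_of d)) (partial i (coord d \<circ> param c))"
    if "d \<in> A" "y \<in> coord c ` (dom_of c \<inter> dom_of d)" for d y i
    using Ck[OF that(1)] that(2) unfolding One_nat_def Ck_on.simps by blast+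
  have \<Psi>in: "\<Psi> z \<in> coord c ` (dom_of c \<inter> dom_of d)" if "z \<in> ball 0 r0" "\<pi> z \<in> dom_of d" for d z
    using imageI[of "\<pi> z" "dom_of c \<inter> dom_of d" "coord c"] \<pi>c[OF that(1)] that(2) by simp
  have MN: "metric_normal h r0 M K" by (rule rn(2)) (use r0 in auto)
  interpret metric_normal h r0 M K by (rule MN)
  have SC: "surface_chart h r0 M A G x c U (g \<circ> coord c) \<pi> J"
  proof (unfold_locales)
    show "is_chart d" if "d \<in> A" for d by (rule ch[OF that])
    show "c \<in> A" "U \<subseteq> dom_of c" "open U" using c Uc oU by auto
    show "homeomorphism U (ball 0 r0) (g \<circ> coord c) \<pi>" using hom by (simp add: B_def \<pi>_def)
    show "\<pi> 0 = x" using pc[OF c(2)] by (simp add: \<pi>_def \<Psi>_def \<Phi>0 q_def)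
    show "((coord d \<circ> \<pi>) has_derivative matrix_vector_mult (J d z)) (at z)" if d: "d \<in> A" "z \<in> ball 0 r0" "\<pi> z \<in> dom_of d" for d z
    proof -
      have "((coord d \<circ> param c) has_derivative matrix_vector_mult (transition_jacobian c d (\<pi> z))) (at (\<Psi> z))"
        unfolding transition_jacobian_def \<pi>c(2)[OF d(2)] by (rule frechet_matrix[OF Td(1)[OF d(1) \<Psi>in[OF d(2,3)]]])
      note D = diff_chain_at[OF \<Psi>d this]
      have e: "coord d \<circ> \<pi> = (coord d \<circ> param c) \<circ> \<Psi>" "matrix_vector_mult (J d z) = matrix_vector_mult (transition_jacobian c d (\<pi> z)) \<circ> matrix_vector_mult (L z)"
        by (simp_all add: \<pi>_def fun_eq_iff J_def matrix_vector_mul_assoc)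
      show ?thesis unfolding e by (rule D)
    qed
    show "continuous_on {z \<in> ball 0 r0. \<pi> z \<in> dom_of d} (J d)" if d: "d \<in> A" for d
    proof -
      let ?S = "{z \<in> ball 0 r0. \<pi> z \<in> dom_of d}"
      have "continuous_on ?S (\<lambda>z. partial j (coord d \<circ> param c) (\<Psi> z))" for j
      proof (cases "?S = {}")
        case False
        then obtain z where "z \<in> ?S" by blast
        then have "continuous_on (coord c ` (dom_of c \<inter> dom_of d)) (partial j (coord d \<circ> param c))"
          using Td(2)[OF d \<Psi>in] by blast
        then show ?thesis by (rule continuous_on_compose2[OF _ continuous_on_subset[OF \<Psi>c subset_UNIV]]) (use \<Psi>in in blast)
      qed (simp only: continuous_on_empty)
      then have "continuous_on ?S (\<lambda>z. \<chi> i j. partial j (coord d \<circ> param c) (\<Psi> z) $ i)"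
        by (intro continuous_on_vec_lambda continuous_on_component)
      then have "continuous_on ?S (\<lambda>z. transition_jacobian c d (\<pi> z))"
        by (rule continuous_on_eq) (auto simp: transition_jacobian_def matrix_def partial_def \<pi>c(2))
      then show ?thesis unfolding J_def by (rule continuous_on_matrix_mult) (rule continuous_on_subset[OF L], simp)
    qed
    show "h z = transpose (J d z) ** G d (\<pi> z) ** J d z" if d: "d \<in> A" "z \<in> ball 0 r0" "\<pi> z \<in> dom_of d" for d z
    proof -
      have "m (\<Phi> z) = G c (\<pi> z)" using \<Psi>W[OF d(2)] by (simp add: m_def hh_def \<Psi>_def \<pi>_def)
      also have "\<dots> = transpose (transition_jacobian c d (\<pi> z)) ** G d (\<pi> z) ** transition_jacobian c d (\<pi> z)"
        by (rule R[unfolded riemannian_metric_def, THEN conjunct2, rule_format, OF c(1) d(1)]) (use d(3) \<pi>c(1)[OF d(2)] in blast)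
      finally show ?thesis by (simp add: h_def J_def matrix_transpose_mul matrix_mul_assoc)
    qed
  qed
  \<comment> \<open>As r1 \<le> 1, the required M (4 r1^2 + 8 r1) is at most 12 M r1, and the last
    entry makes this at most 1.\<close>
  define r1 where "r1 = min 1 (min (r0 / 8) (1 / (12 * M + 1)))"
  have M0: "0 < 12 * M + 1" using M by linarith
  have r1: "0 < r1" "r1 \<le> 1" "8 * r1 \<le> r0" "r1 \<le> 1 / (12 * M + 1)" using r0 M0 by (auto simp: r1_def)
  have "M * (4 * r1\<^sup>2 + 8 * r1) \<le> 1"
  proof -
    have "r1 * r1 \<le> 1 * r1" using r1 by (intro mult_right_mono) auto
    then have "M * (4 * r1\<^sup>2 + 8 * r1) \<le> M * (12 * r1)" using M by (intro mult_left_mono) (auto simp: power2_eq_square)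
    moreover have "(12 * M + 1) * r1 \<le> 1" using r1(4) M0 by (simp add: pos_le_divide_eq mult.commute)
    moreover have "M * (12 * r1) = (12 * M + 1) * r1 - r1" by (simp add: algebra_simps)
    ultimately show ?thesis using r1(1) by linarith
  qed
  then have "surface_normal h r0 M A G x c U (g \<circ> coord c) \<pi> J K r1"
    using r1 by (intro surface_normal.intro SC MN surface_normal_axioms.intro)
  then show thesis unfolding K_def by (rule that)
qed

lemma surface_expansions:
  assumes "smooth_surface A" "riemannian_metric A G" "C2_near A G x" "c \<in> A" "x \<in> dom_of c" and K: "K = gauss_curvature G c x"
  shows "\<exists>\<rho>. \<rho> \<in> o[at_right 0](\<lambda>r. r ^ 2) \<and>
        (\<forall>\<^sub>F r in at_right 0. perimeter A G x r = 2 * pi * r * (1 - K / 6 * r ^ 2 + \<rho> r))"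
    and "(\<lambda>r. delta_per A G x r - K / 6 * r ^ 3) \<in> o[at_right 0](\<lambda>r. r ^ 3)"
    and "\<exists>\<rho>. \<rho> \<in> o[at_right 0](\<lambda>r. r ^ 2) \<and>
        (\<forall>\<^sub>F r in at_right 0. ball_area A G x r = pi * r ^ 2 * (1 - K / 12 * r ^ 2 + \<rho> r))"
    and "(\<lambda>r. delta_area A G x r - K / 24 * r ^ 3) \<in> o[at_right 0](\<lambda>r. r ^ 3)"
proof -
  obtain h r0 M U \<zeta> \<pi> J r1 where sn: "surface_normal h r0 M A G x c U \<zeta> \<pi> J K r1"
    using normal_coordinates_surface[OF assms(1-5)] unfolding K by blast
  note ge = gauge_expansions[OF surface_normal.perimeter_approx[OF sn] surface_normal.ball_area_approx[OF sn]]
  show "\<exists>\<rho>. \<rho> \<in> o[at_right 0](\<lambda>r. r ^ 2) \<and>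
        (\<forall>\<^sub>F r in at_right 0. perimeter A G x r = 2 * pi * r * (1 - K / 6 * r ^ 2 + \<rho> r))" by (rule ge(1))
  show "(\<lambda>r. delta_per A G x r - K / 6 * r ^ 3) \<in> o[at_right 0](\<lambda>r. r ^ 3)"
    unfolding delta_per_def radius_per_def by (rule ge(2))
  show "\<exists>\<rho>. \<rho> \<in> o[at_right 0](\<lambda>r. r ^ 2) \<and>
        (\<forall>\<^sub>F r in at_right 0. ball_area A G x r = pi * r ^ 2 * (1 - K / 12 * r ^ 2 + \<rho> r))" by (rule ge(3))
  show "(\<lambda>r. delta_area A G x r - K / 24 * r ^ 3) \<in> o[at_right 0](\<lambda>r. r ^ 3)"
    unfolding delta_area_def radius_area_def by (rule ge(4))
qed

lemma gauss_curvature_conformal: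
  assumes S: "smooth_surface A" and C2: "C2_near A G x" and d: "d \<in> A" "x \<in> dom_of d" "conformal_chart G d u"
  shows "gauss_curvature G d x = - exp (- 2 * u (coord d x)) * laplacian u (coord d x)"
proof -
  obtain V where V: "open V" "x \<in> V" "Ck_on 2 (G d \<circ> param d) (coord d ` (dom_of d \<inter> V))"
    using C2 d unfolding C2_near_def by blast
  have oc: "open (coord d ` dom_of d)" and hc: "homeomorphism (dom_of d) (coord d ` dom_of d) (coord d) (param d)"
    using S d(1) by (auto simp: smooth_surface_def is_chart_def)
  have pc: "param d (coord d p) = p" if "p \<in> dom_of d" for p using hc that by (simp add: homeomorphism_def)
  have "openin (top_of_set (coord d ` dom_of d)) (coord d ` (dom_of d \<inter> V))"
    by (rule homeomorphism_imp_open_map[OF hc]) (use V(1) in blast)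
  then have o: "open (coord d ` (dom_of d \<inter> V))" using openin_open_eq[OF oc] by blast
  show ?thesis unfolding gauss_curvature_def
  proof (rule conformal_curvature[OF o _ V(3)])
    show "coord d x \<in> coord d ` (dom_of d \<inter> V)" using V d by blast
    show "(G d \<circ> param d) y = mat (exp (2 * u y))" if "y \<in> coord d ` (dom_of d \<inter> V)" for y
      using that d(3) pc by (auto simp: conformal_chart_def)
  qed
qed

theorem theorem4p1:
  fixes A :: "'a::{t2_space, second_countable_topology} chart set"
    and G :: "'a metric" and x :: 'a and c :: "'a chart" and K :: real
  assumes "smooth_surface A"
    and "riemannian_metric A G"
    and "C2_near A G x"
    and "c \<in> A" and "x \<in> dom_of c"
    and "K = gauss_curvature G c x"
  shows
    "(\<exists>\<rho>. \<rho> \<in> o[at_right 0](\<lambda>r. r ^ 2) \<and>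
        (\<forall>\<^sub>F r in at_right 0. perimeter A G x r = 2 * pi * r * (1 - K / 6 * r ^ 2 + \<rho> r))) \<and>
     (\<lambda>r. delta_per A G x r - K / 6 * r ^ 3) \<in> o[at_right 0](\<lambda>r. r ^ 3) \<and>
     (\<exists>\<rho>. \<rho> \<in> o[at_right 0](\<lambda>r. r ^ 2) \<and>
        (\<forall>\<^sub>F r in at_right 0. ball_area A G x r = pi * r ^ 2 * (1 - K / 12 * r ^ 2 + \<rho> r))) \<and>
     (\<lambda>r. delta_area A G x r - K / 24 * r ^ 3) \<in> o[at_right 0](\<lambda>r. r ^ 3) \<and>
     (\<forall>d u. d \<in> A \<and> x \<in> dom_of d \<and> conformal_chart G d u \<longrightarrow>
        (\<lambda>r. delta_per A G x r - (- exp (- 2 * u (coord d x)) / 6 * laplacian u (coord d x) * r ^ 3))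
            \<in> o[at_right 0](\<lambda>r. r ^ 3) \<and>
        (\<lambda>r. delta_area A G x r - (- exp (- 2 * u (coord d x)) / 24 * laplacian u (coord d x) * r ^ 3))
            \<in> o[at_right 0](\<lambda>r. r ^ 3))"
proof (intro conjI allI impI)
  show "\<exists>\<rho>. \<rho> \<in> o[at_right 0](\<lambda>r. r ^ 2) \<and>
        (\<forall>\<^sub>F r in at_right 0. perimeter A G x r = 2 * pi * r * (1 - K / 6 * r ^ 2 + \<rho> r))"
    by (rule surface_expansions(1)[OF assms])
  show "(\<lambda>r. delta_per A G x r - K / 6 * r ^ 3) \<in> o[at_right 0](\<lambda>r. r ^ 3)"
    by (rule surface_expansions(2)[OF assms])
  show "\<exists>\<rho>. \<rho> \<in> o[at_right 0](\<lambda>r. r ^ 2) \<and>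
        (\<forall>\<^sub>F r in at_right 0. ball_area A G x r = pi * r ^ 2 * (1 - K / 12 * r ^ 2 + \<rho> r))"
    by (rule surface_expansions(3)[OF assms])
  show "(\<lambda>r. delta_area A G x r - K / 24 * r ^ 3) \<in> o[at_right 0](\<lambda>r. r ^ 3)"
    by (rule surface_expansions(4)[OF assms])
  fix d u assume "d \<in> A \<and> x \<in> dom_of d \<and> conformal_chart G d u"
  then have d: "d \<in> A" "x \<in> dom_of d" "conformal_chart G d u" by auto
  \<comment> \<open>The expansions hold with the curvature computed in any chart around
    \<open>x\<close>; they are instantiated with the conformal chart \<open>d\<close>
    itself.\<close>
  note k = gauss_curvature_conformal[OF assms(1,3) d, symmetric]
  note e = surface_expansions[OF assms(1-3) d(1,2) k]
  show "(\<lambda>r. delta_per A G x r - (- exp (- 2 * u (coord d x)) / 6 * laplacian u (coord d x) * r ^ 3))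
            \<in> o[at_right 0](\<lambda>r. r ^ 3)"
    using e(2) by simp
  show "(\<lambda>r. delta_area A G x r - (- exp (- 2 * u (coord d x)) / 24 * laplacian u (coord d x) * r ^ 3))
            \<in> o[at_right 0](\<lambda>r. r ^ 3)"
    using e(4) by simp
qed

end
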